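(* For every quantum spin network $(\Gamma,\gamma)$, every complex root of unity $\zeta$ and every natural number $r$, there exists $C>0$ (which depends on $\Gamma$, $\gamma$ and $r$) such that $$\left|\langle\!\langle\Gamma,n\gamma\rangle\!\rangle^{(r)}(\zeta)\right|\le C^n$$ for all $n\in\mathbb{N}$.
   Context: Quantum spin networks. A knotted ribbon graph is a framed graph $\Gamma$ embedded in $S^3$, with vertices of arbitrary valency, together with a cyclic ordering of the edges around each vertex; only integer framings are allowed, so that thickening $\Gamma$ (vertices to disks, edges to bands) gives an orientable surface. Multiple edges and loops are allowed, $\Gamma$ may be disconnected, and knots and links (graphs without vertices) are included. A local projector at a vertex $v$ whose incident half-edges, in cyclic order, are colored $(c_1,\dots,c_d)$ is a planar way to connect, by disjoint arcs in a disk, the $c_1+\dots+c_d$ points placed on the boundary of the disk ($c_i$ consecutive points for the $i$-th half-edge), with no U-turns (no arc joins two points of the same half-edge). A quantum spin network is a pair $(\Gamma,\gamma)$, where $\Gamma$ is a knotted ribbon graph and $\gamma=(\gamma_E,\gamma_V)$ consists of a coloring $\gamma_E$ of the edges of $\Gamma$ by natural numbers and a choice $\gamma_V$ of a local projector at each vertex. It is admissible if at every vertex the projector $\gamma_V(v)$ matches the labels given by $\gamma_E$. (At a trivalent vertex the projector is determined by the three colors $a,b,c$, and it exists iff $a+b+c$ is even and the triangle inequalities hold.) For $n\in\mathbb{N}$, $n\gamma$ denotes the pair obtained by multiplying all edge colors by $n$ and replacing each arc of each local projector by $n$ parallel arcs. Evaluation. Let $A^4=q$, $[n]=\frac{A^{2n}-A^{-2n}}{A^2-A^{-2}}$,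 $[n]!=\prod_{k=1}^n[k]$. The Kauffman bracket of framed links is given by: a crossing equals $A$ times its $A$-smoothing plus $A^{-1}$ times its other smoothing (standard convention), and a disjoint unknotted circle contributes the factor $-[2]$. The Penrose evaluation $\langle\Gamma,\gamma\rangle^P$ is $0$ if $(\Gamma,\gamma)$ is not admissible. Otherwise thicken vertices to disks and edges to untwisted bands following the ribbon structure, replace each vertex $v$ by the arcs of $\gamma_V(v)$, replace each edge colored $b$ by $A^{b(b-1)}\sum_{\sigma\in S_b}A^{-3\ell(\sigma)}\beta_\sigma$ (where $\ell(\sigma)$ is the length of $\sigma$ and $\beta_\sigma$ is the negative permutation braid of $\sigma$, strands oriented downwards; this is $[b]!$ times the Jones-Wenzl idempotent), and evaluate the resulting linear combination of framed links by the Kauffman bracket. The standard evaluation is $\langle\Gamma,\gamma\rangle=\frac{1}{[\mathcal I]!}\langle\Gamma,\gamma\rangle^P$, with $[\mathcal I]!=\prod_v[\gamma_V(v)]!$, where for a projector $p$, $[p]!$ is the product, over pairs of edges (half-edges) at the vertex, of $[m]!$, $m$ being the number of arcs of $p$ connecting the pair. A knot component colored $a$ is interpreted by first subdividing it with a vertex (whose third edge is colored $0$), so that the $0$-framed unknot colored $a$ has value $(-1)^a[a+1]$. Modified evaluation. There is a $\mathbb{Z}/4\mathbb{Z}$-valued quadratic form $Q(\gamma)$ in the labels (depending on $\Gamma$) such that, with $\mathbb{Z}/4\mathbb{Z}$ identified with $\{0,1,2,3\}$, $\langle\Gamma,\gamma\rangle(q)=q^{Q(\gamma)/4}\langle\!\langle\Gamma,\gamma\rangle\!\rangle(q)$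 with $\langle\!\langle\Gamma,\gamma\rangle\!\rangle(q)\in\mathbb{Z}[q^{\pm1}]$; this defines $\langle\!\langle\Gamma,\gamma\rangle\!\rangle$. For $f\in\mathbb{Z}[q^{\pm1}]$, $f^{(r)}(q)=\frac{d^r}{dq^r}f(q)$, and $f^{(r)}(\zeta)$ is its value at $q=\zeta$. *)

theory Defs
  imports
    "HOL-Analysis.Analysis"
    "HOL-Library.Poly_Mapping"
    "HOL-Combinatorics.Permutations"
begin

section \<open>Framed links and the Kauffman bracket\<close>

text \<open>
  Links and graphs in the three-sphere are given by planar diagrams with the blackboard framing.
  A diagram is read from bottom to top; an entry \<open>(k, p)\<close> is a horizontal slice in which the
  elementary piece \<open>p\<close> has exactly \<open>k\<close> vertical strands to its left.  \<open>Cup\<close> creates two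
  neighbouring strands (a local minimum), \<open>Cap\<close> joins two neighbouring strands (a local maximum).
  At a crossing \<open>Pos\<close> the strand going from the lower left to the upper right is on top, at \<open>Neg\<close> it
  is the other strand; thus, when both strands are oriented downwards (or both upwards), \<open>Pos\<close> is
  a positive and \<open>Neg\<close> a negative crossing.
\<close>

datatype elem = Cup | Cap | Pos | Neg

type_synonym link_diagram = "(nat \<times> elem) list"

definition qint :: "complex \<Rightarrow> nat \<Rightarrow> complex" where
  "qint A n = (A powi (2 * int n) - A powi (- 2 * int n)) / (A powi 2 - A powi (- 2))"

definition qfact :: "complex \<Rightarrow> nat \<Rightarrow> complex" where
  "qfact A n = (\<Prod>k = 1..n. qint A k)"

definition insert_at :: "nat \<Rightarrow> 'a list \<Rightarrow> 'a list \<Rightarrow> 'a list" where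
  "insert_at k ys xs = take k xs @ ys @ drop k xs"

definition remove_two :: "nat \<Rightarrow> 'a list \<Rightarrow> 'a list" where
  "remove_two k xs = take k xs @ drop (k + 2) xs"

definition swap_two :: "nat \<Rightarrow> 'a list \<Rightarrow> 'a list" where
  "swap_two k xs = take k xs @ [xs ! (k + 1), xs ! k] @ drop (k + 2) xs"

primrec elem_weight :: "elem \<Rightarrow> nat" where
  "elem_weight Cup = 1"
| "elem_weight Cap = 1"
| "elem_weight Pos = 3"
| "elem_weight Neg = 3"

text \<open>
  In \<open>bracket A m w D\<close> the list \<open>w\<close> describes the part of the diagram below \<open>D\<close>, whose crossings
  have been smoothed already: two of its open ends carry the same label iff they are joined
  below \<open>D\<close>; labels \<open>\<ge> m\<close> are unused.  A cap joining two ends with the same label closes a circle,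
  which contributes the factor \<open>-[2]\<close>.  The \<open>A\<close>-smoothing connects the two regions swept out when
  the overstrand is rotated counterclockwise; it is the vertical smoothing for \<open>Pos\<close> and the
  horizontal one (a cap followed by a cup) for \<open>Neg\<close>.  The bracket of a link diagram \<open>D\<close> is
  \<open>bracket A 0 [] D\<close>.
\<close>

function bracket :: "complex \<Rightarrow> nat \<Rightarrow> nat list \<Rightarrow> link_diagram \<Rightarrow> complex" where
  "bracket A m w [] = 1"
| "bracket A m w ((k, Cup) # D) = bracket A (Suc m) (insert_at k [m, m] w) D"
| "bracket A m w ((k, Cap) # D) =
     (if w ! k = w ! (k + 1) then - qint A 2 * bracket A m (remove_two k w) D
      else bracket A m
        (map (\<lambda>x. if x = w ! k then w ! (k + 1) else x) (remove_two k w)) D)"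
| "bracket A m w ((k, Pos) # D) =
     A * bracket A m w D + inverse A * bracket A m w ((k, Cap) # (k, Cup) # D)"
| "bracket A m w ((k, Neg) # D) =
     A * bracket A m w ((k, Cap) # (k, Cup) # D) + inverse A * bracket A m w D"
  by pat_completeness auto
termination
  by (relation "Wellfounded.measure (\<lambda>(A, m, w, D). \<Sum>(k, p)\<leftarrow>D. elem_weight p)") auto

section \<open>Knotted ribbon graphs\<close>

text \<open>
  A knotted ribbon graph is given by a diagram as above in which also vertices occur:
  \<open>Vertex d\<close> is a disk lying flat in the plane with \<open>d\<close> half-edges, all of them leaving upwards.
  The cyclic order at the vertex is the one of the plane.  Up to isotopy every knotted ribbon graph
  with integer framings has such a diagram: lay all vertex disks face up and turn them so that all
  half-edges leave upwards; the framing is realized by curls.  Conversely, every such diagram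
  describes a knotted ribbon graph.
\<close>

datatype piece = Elem elem | Vertex nat

type_synonym diagram = "(nat \<times> piece) list"

text \<open>
  The strands starting at a slice receive labels: one label for the two legs of a cup, and one label
  for each half-edge of a vertex.  A label is kept while its strand runs upwards, also through
  crossings; \<open>level D s\<close> lists the labels of the strands between slices \<open>s - 1\<close> and \<open>s\<close> from left to
  right.
\<close>

fun births :: "piece \<Rightarrow> nat" where
  "births (Elem Cup) = 1"
| "births (Vertex d) = d"
| "births _ = 0"

definition first_label :: "diagram \<Rightarrow> nat \<Rightarrow> nat" where
  "first_label D s = (\<Sum>t<s. births (snd (D ! t)))"

fun apply_piece :: "nat \<Rightarrow> nat \<times> piece \<Rightarrow> nat list \<Rightarrow> nat list" where
  "apply_piece m (k, Elem Cup) w = insert_at k [m, m] w"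
| "apply_piece m (k, Elem Cap) w = remove_two k w"
| "apply_piece m (k, Elem Pos) w = swap_two k w"
| "apply_piece m (k, Elem Neg) w = swap_two k w"
| "apply_piece m (k, Vertex d) w = insert_at k [m..<m + d] w"

primrec level :: "diagram \<Rightarrow> nat \<Rightarrow> nat list" where
  "level D 0 = []"
| "level D (Suc s) = apply_piece (first_label D s) (D ! s) (level D s)"

fun inputs :: "piece \<Rightarrow> nat" where
  "inputs (Elem Cup) = 0"
| "inputs (Elem _) = 2"
| "inputs (Vertex d) = 0"

definition knotted_ribbon_graph :: "diagram \<Rightarrow> bool" where
  "knotted_ribbon_graph D \<longleftrightarrow>
     (\<forall>s<length D. fst (D ! s) + inputs (snd (D ! s)) \<le> length (level D s)) \<and>
     level D (length D) = []"

text \<open>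
  An edge (or knot component) is represented by the set of the labels occurring along it, that is,
  by an equivalence class of labels under the relation of being joined by a cap.
\<close>

definition labels :: "diagram \<Rightarrow> nat set" where
  "labels D = {..<first_label D (length D)}"

definition cap_rel :: "diagram \<Rightarrow> (nat \<times> nat) set" where
  "cap_rel D = {(level D s ! k, level D s ! (k + 1)) | s k. s < length D \<and> D ! s = (k, Elem Cap)}"

definition edge_at :: "diagram \<Rightarrow> nat \<Rightarrow> nat set" where
  "edge_at D x = {y. (x, y) \<in> (cap_rel D \<union> (cap_rel D)\<inverse>)\<^sup>*}"

definition edges :: "diagram \<Rightarrow> nat set set" where
  "edges D = edge_at D ` labels D"

text \<open>Vertices are identified with the positions of their slices.\<close>

definition vertices :: "diagram \<Rightarrow> nat set" where
  "vertices D = {v. v < length D \<and> (\<exists>k d. D ! v = (k, Vertex d))}"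

definition half_edges :: "diagram \<Rightarrow> nat \<Rightarrow> nat list" where
  "half_edges D v = [first_label D v..<first_label D v + births (snd (D ! v))]"

definition knots :: "diagram \<Rightarrow> nat set set" where
  "knots D = {e \<in> edges D. \<forall>v \<in> vertices D. e \<inter> set (half_edges D v) = {}}"

section \<open>Local projectors and quantum spin networks\<close>

text \<open>
  The boundary points of the disk are \<open>0, 1, \<dots>\<close> from left to right, the first \<open>legs p ! 0\<close> of them
  belonging to the first half-edge, and so on.  Up to isotopy, disjoint arcs in the disk are given
  by a noncrossing perfect matching; an arc is the pair of its left and its right end point.
\<close>

record projector =
  legs :: "nat list"
  arcs :: "(nat \<times> nat) set"

definition leg_points :: "projector \<Rightarrow> nat \<Rightarrow> nat set" where
  "leg_points p h = {sum_list (take h (legs p))..<sum_list (take (Suc h) (legs p))}"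

definition local_projector :: "projector \<Rightarrow> bool" where
  "local_projector p \<longleftrightarrow>
     (\<forall>(i, j) \<in> arcs p. i < j \<and> j < sum_list (legs p)) \<and>
     (\<forall>x<sum_list (legs p). \<exists>!a. a \<in> arcs p \<and> (x = fst a \<or> x = snd a)) \<and>
     (\<forall>(i, j) \<in> arcs p. \<forall>(k, l) \<in> arcs p. \<not> (i < k \<and> k < j \<and> j < l)) \<and>
     (\<forall>(i, j) \<in> arcs p. \<forall>h<length (legs p). \<not> (i \<in> leg_points p h \<and> j \<in> leg_points p h))"

definition arcs_between :: "projector \<Rightarrow> nat \<Rightarrow> nat \<Rightarrow> nat" where
  "arcs_between p g h = card {(i, j) \<in> arcs p. i \<in> leg_points p g \<and> j \<in> leg_points p h}"

definition projector_fact :: "complex \<Rightarrow> projector \<Rightarrow> complex" where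
  "projector_fact A p = (\<Prod>h<length (legs p). \<Prod>g<h. qfact A (arcs_between p g h))"

definition scale_projector :: "nat \<Rightarrow> projector \<Rightarrow> projector" where
  "scale_projector n p =
     \<lparr>legs = map (\<lambda>c. n * c) (legs p),
      arcs = {(n * i + t, n * j + (n - Suc t)) | i j t. (i, j) \<in> arcs p \<and> t < n}\<rparr>"

text \<open>The pair \<open>(\<gamma>\<^sub>E, \<gamma>\<^sub>V)\<close>; only its values on the edges and vertices of the graph matter.\<close>

type_synonym coloring = "(nat set \<Rightarrow> nat) \<times> (nat \<Rightarrow> projector)"

definition quantum_spin_network :: "diagram \<Rightarrow> coloring \<Rightarrow> bool" where
  "quantum_spin_network D \<gamma> \<longleftrightarrow>
     knotted_ribbon_graph D \<and>
     (\<forall>v \<in> vertices D. local_projector (snd \<gamma> v) \<and>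
        length (legs (snd \<gamma> v)) = length (half_edges D v))"

definition admissible :: "diagram \<Rightarrow> coloring \<Rightarrow> bool" where
  "admissible D \<gamma> \<longleftrightarrow>
     (\<forall>v \<in> vertices D. legs (snd \<gamma> v) = map (\<lambda>x. fst \<gamma> (edge_at D x)) (half_edges D v))"

definition scale_coloring :: "nat \<Rightarrow> coloring \<Rightarrow> coloring" where
  "scale_coloring n \<gamma> = (\<lambda>e. n * fst \<gamma> e, \<lambda>v. scale_projector n (snd \<gamma> v))"

section \<open>Evaluations\<close>

definition perm_length :: "nat \<Rightarrow> (nat \<Rightarrow> nat) \<Rightarrow> nat" where
  "perm_length b \<sigma> = card {(i, j). i < j \<and> j < b \<and> \<sigma> j < \<sigma> i}"

text \<open>
  A reduced word for \<open>\<sigma>\<close>: in turn, each strand \<open>j = 0, 1, \<dots>, b - 1\<close> is moved to the left past those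
  strands \<open>i < j\<close> with \<open>\<sigma> i > \<sigma> j\<close>, which at that moment are its immediate left neighbours.
\<close>

definition perm_braid :: "nat \<Rightarrow> (nat \<Rightarrow> nat) \<Rightarrow> nat list" where
  "perm_braid b \<sigma> = concat (map (\<lambda>j. rev [j - card {i. i < j \<and> \<sigma> j < \<sigma> i}..<j]) [0..<b])"

text \<open>
  The link diagram obtained from a graph diagram by replacing each strand of color \<open>c\<close> by \<open>c\<close> parallel
  strands, each vertex by the arcs of its projector, and by inserting on each edge \<open>e\<close> once the
  negative permutation braid of \<open>\<sigma> e\<close>.  It is inserted at the beginning of the strand with the least
  label of \<open>e\<close>.
\<close>

definition label_color :: "diagram \<Rightarrow> coloring \<Rightarrow> nat \<Rightarrow> nat" where
  "label_color D \<gamma> x = fst \<gamma> (edge_at D x)"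

definition edge_braid ::
    "diagram \<Rightarrow> coloring \<Rightarrow> (nat set \<Rightarrow> nat \<Rightarrow> nat) \<Rightarrow> nat \<Rightarrow> nat \<Rightarrow> link_diagram" where
  "edge_braid D \<gamma> \<sigma> x q =
     (if x = Min (edge_at D x)
      then map (\<lambda>i. (q + i, Neg)) (perm_braid (label_color D \<gamma> x) (\<sigma> (edge_at D x)))
      else [])"

definition cable_crossing :: "elem \<Rightarrow> nat \<Rightarrow> nat \<Rightarrow> nat \<Rightarrow> link_diagram" where
  "cable_crossing p q a b =
     concat (map (\<lambda>i. map (\<lambda>j. (q + i + j, p)) [0..<b]) (rev [0..<a]))"

text \<open>
  Inserting the cups of a noncrossing matching in the order of their left end points, each cup
  has to be put exactly at the position of its left end point.
\<close>

definition projector_cups :: "projector \<Rightarrow> nat \<Rightarrow> link_diagram" where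
  "projector_cups p q = map (\<lambda>i. (q + i, Cup)) (sorted_list_of_set (fst ` arcs p))"

definition cable_slice ::
    "diagram \<Rightarrow> coloring \<Rightarrow> (nat set \<Rightarrow> nat \<Rightarrow> nat) \<Rightarrow> nat \<Rightarrow> link_diagram" where
  "cable_slice D \<gamma> \<sigma> s =
     (let (k, p) = D ! s; w = level D s; m = first_label D s; c = label_color D \<gamma>;
          q = sum_list (map c (take k w))
      in case p of
           Elem Cup \<Rightarrow> map (\<lambda>i. (q + i, Cup)) [0..<c m] @ edge_braid D \<gamma> \<sigma> m q
         | Elem Cap \<Rightarrow> map (\<lambda>i. (q + i, Cap)) (rev [0..<c (w ! k)])
         | Elem Pos \<Rightarrow> cable_crossing Pos q (c (w ! k)) (c (w ! (k + 1)))
         | Elem Neg \<Rightarrow> cable_crossing Neg q (c (w ! k)) (c (w ! (k + 1)))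
         | Vertex d \<Rightarrow> projector_cups (snd \<gamma> s) q @
             concat (map (\<lambda>j. edge_braid D \<gamma> \<sigma> (m + j) (q + (\<Sum>i<j. c (m + i)))) [0..<d]))"

definition cable :: "diagram \<Rightarrow> coloring \<Rightarrow> (nat set \<Rightarrow> nat \<Rightarrow> nat) \<Rightarrow> link_diagram" where
  "cable D \<gamma> \<sigma> = concat (map (cable_slice D \<gamma> \<sigma>) [0..<length D])"

definition edge_perms :: "diagram \<Rightarrow> coloring \<Rightarrow> (nat set \<Rightarrow> nat \<Rightarrow> nat) set" where
  "edge_perms D \<gamma> = (\<Pi>\<^sub>E e \<in> edges D. {\<pi>. \<pi> permutes {..<fst \<gamma> e}})"

definition penrose_eval :: "diagram \<Rightarrow> coloring \<Rightarrow> complex \<Rightarrow> complex" where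
  "penrose_eval D \<gamma> A =
     (if admissible D \<gamma> then
        (\<Sum>\<sigma> \<in> edge_perms D \<gamma>.
           (\<Prod>e \<in> edges D. A ^ (fst \<gamma> e * (fst \<gamma> e - 1)) *
              A powi (- 3 * int (perm_length (fst \<gamma> e) (\<sigma> e)))) *
           bracket A 0 [] (cable D \<gamma> \<sigma>))
      else 0)"

text \<open>
  A knot component of color \<open>a\<close> is subdivided by a vertex.  This does not change the cabled links;
  the projector at the new vertex consists of \<open>a\<close> arcs connecting its two half-edges of color \<open>a\<close>
  (the third one has color \<open>0\<close>), hence the factor \<open>[a]!\<close>.
\<close>

definition network_fact :: "diagram \<Rightarrow> coloring \<Rightarrow> complex \<Rightarrow> complex" where
  "network_fact D \<gamma> A =
     (\<Prod>v \<in> vertices D. projector_fact A (snd \<gamma> v)) * (\<Prod>e \<in> knots D. qfact A (fst \<gamma> e))"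

definition standard_eval :: "diagram \<Rightarrow> coloring \<Rightarrow> complex \<Rightarrow> complex" where
  "standard_eval D \<gamma> A = penrose_eval D \<gamma> A / network_fact D \<gamma> A"

text \<open>
  The ring of integer Laurent polynomials in \<open>q\<close> is \<^typ>\<open>int \<Rightarrow>\<^sub>0 int\<close>, the monoid algebra of the additive
  group of integers.  Rational functions of \<open>A\<close> are compared through their values at the nonzero
  complex numbers which are not roots of unity; there all quantum integers of positive index are
  defined and nonzero.
\<close>

definition laurent_eval :: "(int \<Rightarrow>\<^sub>0 int) \<Rightarrow> complex \<Rightarrow> complex" where
  "laurent_eval f q = (\<Sum>k \<in> Poly_Mapping.keys f. of_int (Poly_Mapping.lookup f k) * q powi k)"

definition root_of_unity :: "complex \<Rightarrow> bool" where
  "root_of_unity \<zeta> \<longleftrightarrow> (\<exists>m>0. \<zeta> ^ m = 1)"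

text \<open>
  \<open>modified_eval D \<gamma>\<close> is the integer Laurent polynomial \<open>f\<close> in \<open>q = A^4\<close> for which the standard
  evaluation is \<open>q^(Q/4) f(q) = A^Q f(A^4)\<close> with \<open>Q \<in> {0, 1, 2, 3}\<close>.  If the standard
  evaluation is nonzero, comparing the exponents of \<open>A\<close> modulo 4 shows that it determines both \<open>Q\<close>
  and \<open>f\<close>, so \<open>Q\<close> is necessarily the value of the quadratic form at \<open>\<gamma>\<close>; otherwise \<open>f = 0\<close>
  whatever the value of \<open>Q\<close>.
\<close>

definition modified_eval :: "diagram \<Rightarrow> coloring \<Rightarrow> (int \<Rightarrow>\<^sub>0 int)" where
  "modified_eval D \<gamma> = (THE f. \<exists>Q \<in> {0, 1, 2, 3::nat}. \<forall>A. A \<noteq> 0 \<and> \<not> root_of_unity A \<longrightarrow>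
     standard_eval D \<gamma> A = A ^ Q * laurent_eval f (A ^ 4))"

end

theory Submission
  imports
    Defs
    "HOL-Complex_Analysis.Complex_Analysis"
    "HOL-Computational_Algebra.Computational_Algebra"
begin

text \<open>
  In the spin model of the Kauffman bracket a link diagram acts on vectors indexed by words in two
  letters.  The symmetrizers of the edges are idempotents which slide along strands and through
  crossings, caps and cups, so that they may be inserted wherever a strand starts.  Symmetric vectors
  only depend on numbers of letters, and the evaluation becomes a sum, with exponentially many terms
  in \<open>n\<close>, of products of coefficients of cabled crossings and, at each vertex, of Gaussian binomial
  coefficients, one for each bundle of parallel arcs.  A single term is not a Laurent polynomial, but
  after normalization its square is one: it is a product of coefficients of crossings, of their
  transposes and of quantum multinomial coefficients, all of which are at most exponential in \<open>n\<close> for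
  \<open>A\<close> on the unit circle.  For this each edge has to contribute \<open>[b]!\<close> once for each of its two ends.
  Hence the evaluation is an integer Laurent polynomial in \<open>A\<close> (these form an integrally closed ring) of
  quadratic degree, bounded exponentially on the unit circle, and so are its coefficients.  Finally the
  substitution \<open>A \<mapsto> \<i> A\<close> multiplies the evaluation by a fourth root of unity, so that all exponents
  of \<open>A\<close> are congruent modulo 4.
\<close>

text \<open>Estimating the defining sum term by term fails twice: an edge of color \<open>b\<close>
  is a sum over b! braids, and the factorials in the denominators vanish at roots of unity and are
  arbitrarily small nearby. Working with letter counts removes the first obstacle. The second is the
  reason for squares. The symmetric vector with a given count, paired with itself, gives a Gaussian
  binomial, and a coefficient of a crossing differs from the transposed one exactly by a ratio of
  such binomials. So the square of a coefficient times this ratio is coefficient times transposed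
  coefficient, without denominators, and the ratios telescope along the diagram. The standard
  evaluation retains one factor [b]! for each edge that is not a knot; in the square this becomes
  one copy for each end, which is what the vertices need to form multinomials. All these identities
  hold only away from roots of unity, so no estimate is made at the root of unity itself: the
  coefficients are means over points of the unit circle that are not roots of unity, and since the
  degree is quadratic, a derivative of fixed order costs only a polynomial factor.\<close>

definition generic :: "complex => bool" where
 "generic A \<longleftrightarrow> A ~= 0 & \<not> root_of_unity A"

lemma generic_nz [simp]: "generic A ==> A ~= 0"
 by (simp add: generic_def)

lemma generic_power_neq_1: "generic A ==> n > 0 ==> A^n ~= 1"
 unfolding generic_def root_of_unity_def by blast

lemma generic_denominator:
 assumes "generic A" "n > 0"
 shows "A^n-inverse A^n ~= 0"
proof
 assume "A^n-inverse A^n=0"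
 hence "A^n*A^n=1"
  using assms(1) by (metis right_minus_eq generic_nz power_not_zero power_inverse right_inverse)
 hence "A^(n+n)=1" by (simp add: power_add)
 with generic_power_neq_1[OF assms(1), of "n+n"] assms(2) show False by simp
qed

section \<open>Quantum integers and factorials away from roots of unity\<close>

lemma qint_alt: "qint A n=(A^(2 * n)-inverse A^(2 * n))/(A^2-inverse A^2)"
proof -
 have "A powi (- 2 * int n)=inverse A^(2 * n)"
  by (metis mult_minus_left of_nat_mult of_nat_numeral power_int_minus power_int_of_nat power_inverse)
 moreover have "A powi (2 * int n)=A^(2 * n)"
  by (simp add: power_int_def nat_mult_distrib)
 moreover have "A powi 2=A^2" "A powi (- 2)=inverse A^2"
  by (simp_all add: power_int_def power_inverse)
 ultimately show ?thesis unfolding qint_def by simp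
qed

lemma qint_0 [simp]: "qint A 0=0"
 by (simp add: qint_alt)

lemma qint_1: "generic A ==> qint A 1=1"
 using generic_denominator[of A 2] by (simp add: qint_alt)

lemma qint_powers: "qint A n=((A^2)^n-(inverse A^2)^n)/(A^2-inverse A^2)"
 by (simp add: qint_alt power_mult)

lemma qint_Suc:
 assumes "generic A"
 shows "qint A (Suc n)=A^(2 * n)+inverse A^2 * qint A n"
proof -
 have "(X^Suc n-Y^Suc n)/(X-Y)=X^n+Y*((X^n-Y^n)/(X-Y))"
  if "X-Y ~= 0" for X Y :: complex
  using that by (simp add: field_simps)
 from this[OF generic_denominator[OF assms, of 2]] show ?thesis
  by (simp add: qint_powers power_mult)
qed

text \<open>The addition rule for quantum integers, in the unsymmetric normalization in which it
  meets the Pascal recursion of \<open>gauss\<close>.\<close>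

lemma qint_add:
 assumes "generic A"
 shows "A^(2 * l) * qint A (k+l)=qint A k+A^(2*(k+l)) * qint A l"
proof -
 have "X^l*(X^(k+l)-Y^(k+l))=X^k-Y^k+X^(k+l)*(X^l-Y^l)"
  if "X*Y=1" for X Y :: complex
 proof -
  have "X^l*Y^l=1" using that by (simp flip: power_mult_distrib)
  hence "X^(k+l)*Y^l=X^k" "X^l*Y^(k+l)=Y^k"
   by (simp_all add: power_add mult.left_commute mult.assoc)
  thus ?thesis by (simp add: algebra_simps)
 qed
 hence "(A^2)^l*((A^2)^(k+l)-(inverse A^2)^(k+l)) =
  (A^2)^k-(inverse A^2)^k+(A^2)^(k+l)*((A^2)^l-(inverse A^2)^l)"
  using assms by (simp flip: power_mult_distrib)
 thus ?thesis
  unfolding qint_powers power_mult by (metis add_divide_distrib times_divide_eq_right)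
qed

lemma qint_2: "generic A ==> qint A 2=A^2+inverse A^2"
 using qint_Suc[of A 1] qint_1[of A] by (simp add: numeral_2_eq_2)

lemma qint_nz: "generic A ==> n > 0 ==> qint A n ~= 0"
 using generic_denominator[of A 2] generic_denominator[of A "2 * n"] by (simp add: qint_alt)

lemma qfact_0 [simp]: "qfact A 0=1"
 by (simp add: qfact_def)

lemma qfact_Suc: "qfact A (Suc n)=qint A (Suc n) * qfact A n"
 by (simp add: qfact_def prod.nat_ivl_Suc')

lemma qfact_nz: "generic A ==> qfact A n ~= 0"
 by (induction n) (auto simp: qfact_Suc qint_nz)

section \<open>Words in two letters\<close>

definition words :: "nat => bool list set" where
 "words n={ep. length ep=n}"

lemma in_words [simp]: "ep \<in> words n \<longleftrightarrow> length ep=n"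
 by (simp add: words_def)

lemma finite_words [simp]: "finite (words n)"
 using finite_lists_length_eq[of "UNIV :: bool set" n] by (simp add: words_def)

lemma words_0 [simp]: "words 0={[]}"
 by (auto simp: words_def)

lemma words_Suc: "words (Suc n)=(#) True ` words n \<union> (#) False ` words n"
 by (auto simp: words_def length_Suc_conv image_iff)

lemma sum_words_Suc:
 fixes f :: "bool list => 'a::comm_monoid_add"
 shows "(\<Sum>ep\<in>words (Suc n). f ep)=(\<Sum>ep\<in>words n. f (True#ep))+(\<Sum>ep\<in>words n. f (False#ep))"
 unfolding words_Suc by (subst sum.union_disjoint) (auto simp: sum.reindex)

lemma sum_words_add:
 fixes f :: "bool list => 'a::comm_monoid_add"
 shows "(\<Sum>ep\<in>words (m+n). f ep)=(\<Sum>al\<in>words m. \<Sum>bt\<in>words n. f (al@bt))"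
 by (induction m arbitrary: f) (simp_all add: sum_words_Suc)

lemma card_words: "card (words n)=2^n"
 using card_lists_length_eq[of "UNIV :: bool set" n] by (simp add: words_def)

primrec cnt :: "bool list => nat" where
 "cnt []=0"
| "cnt (a#ep)=(if a then 1 else 0) + cnt ep"

text \<open>The inversion number, with \<open>True\<close> sorted before
  \<open>False\<close>.\<close>

primrec invs :: "bool list => nat" where
 "invs []=0"
| "invs (a#ep)=(if a then 0 else cnt ep)+invs ep"

text \<open>What nested arcs show at their other ends: nesting reverses the order, and each arc
  joins opposite letters.\<close>

definition flip :: "bool list => bool list" where
 "flip ep=rev (map Not ep)"

lemma cnt_append [simp]: "cnt (al@bt)=cnt al + cnt bt"
 by (induction al) auto

lemma cnt_le: "cnt ep <= length ep"
 by (induction ep) auto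

lemma invs_append: "invs (al@bt)=invs al+invs bt+(length al - cnt al) * cnt bt"
proof (induction al)
 case (Cons a al)
 have "length (a#al) - cnt (a#al)=(if a then 0 else 1)+(length al - cnt al)"
  using cnt_le[of al] by auto
 thus ?case using Cons by (simp add: add_mult_distrib)
qed simp

lemma invs_le: "invs ep <= length ep * length ep"
proof (induction ep)
 case (Cons a ep)
 show ?case using Cons cnt_le[of ep] by auto
qed simp

lemma length_flip [simp]: "length (flip ep)=length ep"
 by (simp add: flip_def)

lemma flip_flip [simp]: "flip (flip ep)=ep"
 by (simp add: flip_def rev_map o_def)

lemma flip_eq_iff: "al=flip bt \<longleftrightarrow> flip al=bt"
 by auto

lemma flip_Nil [simp]: "flip []=[]"
 by (simp add: flip_def)

lemma flip_Cons: "flip (a#ep)=flip ep@[\<not> a]"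
 by (simp add: flip_def)

lemma cnt_flip: "cnt (flip ep)=length ep - cnt ep"
proof (induction ep)
 case (Cons a ep)
 show ?case using Cons cnt_le[of ep] by (auto simp: flip_Cons Suc_diff_le)
qed simp

lemma invs_flip: "invs (flip ep)=invs ep"
proof (induction ep)
 case (Cons a ep)
 show ?case using Cons cnt_le[of ep] by (auto simp: flip_Cons invs_append cnt_flip)
qed simp

lemma bij_flip: "bij_betw flip (words n) (words n)"
 by (rule bij_betw_byWitness[where f' = flip]) auto

lemma sum_words_flip:
 fixes f :: "bool list => 'a::comm_monoid_add"
 shows "(\<Sum>ep\<in>words n. f (flip ep))=(\<Sum>ep\<in>words n. f ep)"
 using sum.reindex_bij_betw[OF bij_flip, of f n] by simp

lemma sum_words_cnt:
 fixes f :: "bool list => 'a::comm_monoid_add"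
 shows "(\<Sum>ep\<in>words n. f ep)=(\<Sum>k\<le>n. \<Sum>ep\<in>{ep\<in>words n. cnt ep=k}. f ep)"
proof -
 have "cnt ` words n \<subseteq> {..n}" using cnt_le by auto
 from sum.group[OF finite_words finite_atMost this, of f] show ?thesis by simp
qed

text \<open>Up to a power of \<open>A\<close> this is the Gaussian binomial coefficient, see \<open>gauss_qfact\<close>.\<close>

definition gauss :: "complex => nat => nat => complex" where
 "gauss A b k=(\<Sum>ep\<in>{ep\<in>words b. cnt ep=k}. A^(4 * invs ep))"

lemma gauss_if: "gauss A b k=(\<Sum>ep\<in>words b. if cnt ep=k then A^(4 * invs ep) else 0)"
 unfolding gauss_def by (rule sum.inter_filter) simp

lemma gauss_0 [simp]: "gauss A b 0=1"
 by (induction b) (simp_all add: gauss_if sum_words_Suc cong: if_cong)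

lemma gauss_gt: "k > b ==> gauss A b k=0"
 unfolding gauss_if using cnt_le by (intro sum.neutral) (metis in_words not_le)

lemma gauss_Suc: "gauss A (Suc b) (Suc k)=gauss A b k+A^(4*Suc k) * gauss A b (Suc k)"
proof -
 have "(\<Sum>ep\<in>words b. if cnt (False#ep)=Suc k then A^(4 * invs (False#ep)) else 0) =
  A^(4*Suc k) * gauss A b (Suc k)"
  unfolding gauss_if sum_distrib_left
  by (intro sum.cong) (auto simp: power_add algebra_simps)
 moreover have "(\<Sum>ep\<in>words b. if cnt (True#ep)=Suc k then A^(4 * invs (True#ep)) else 0) =
  gauss A b k" unfolding gauss_if by (intro sum.cong) auto
 ultimately show ?thesis unfolding gauss_if[of A "Suc b"] sum_words_Suc by simp
qed

text \<open>\<open>flip\<close> is a bijection of the words that preserves \<open>invs\<close> and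
  complements \<open>cnt\<close>.\<close>

lemma gauss_flip: "k <= b ==> gauss A b (b-k)=gauss A b k"
proof -
 assume k: "k <= b"
 have "gauss A b (b-k)=(\<Sum>ep\<in>words b. if cnt (flip ep)=b-k then A^(4 * invs (flip ep)) else 0)"
  unfolding gauss_if by (subst sum_words_flip[symmetric]) simp
 also have "\<dots>=gauss A b k"
  unfolding gauss_if
 proof (intro sum.cong refl)
  fix ep assume "ep \<in> words b"
  with cnt_le[of ep] k have "cnt (flip ep)=b-k \<longleftrightarrow> cnt ep=k" by (auto simp: cnt_flip)
  thus "(if cnt (flip ep)=b-k then A^(4 * invs (flip ep)) else 0) =
    (if cnt ep=k then A^(4 * invs ep) else 0)" by (simp add: invs_flip)
 qed
 finally show ?thesis .
qed

text \<open>Both sides obey the same Pascal recursion; on the right this is \<open>qint_add\<close>.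
  The form without division is the one used to trade Gaussian binomials for factorials.\<close>

lemma gauss_qfact:
 assumes "generic A"
 shows "gauss A (k+l) k * qfact A k * qfact A l=A^(2 * k * l) * qfact A (k+l)"
proof (induction "k+l" arbitrary: k l)
 case 0
 thus ?case by simp
next
 case (Suc n)
 show ?case
 proof (cases k)
  case 0 thus ?thesis by simp
 next
  case (Suc k')
  note k = this
  show ?thesis
  proof (cases l)
   case 0
   have "gauss A k k=1" for k
    by (induction k) (simp_all add: gauss_Suc gauss_gt)
   with 0 show ?thesis by simp
  next
   case (Suc l')
   have n: "n=k'+l" "n=k+l'" using Suc.hyps(2) k Suc by auto
   have "gauss A (k+l) k * qfact A k * qfact A l =
     (gauss A (k'+l) k' * qfact A k' * qfact A l) * qint A k +
     A^(4 * k)*(gauss A (k+l') k * qfact A k * qfact A l') * qint A l"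
    by (simp add: k Suc gauss_Suc qfact_Suc algebra_simps)
   also have "\<dots>=qfact A n*(A^(2 * k' * l) * qint A k+A^(4 * k+2 * k * l') * qint A l)"
    using Suc.hyps(1)[OF n(1)] Suc.hyps(1)[OF n(2)] n by (simp add: power_add algebra_simps)
   also have "A^(2 * k' * l) * qint A k+A^(4 * k+2 * k * l') * qint A l =
     A^(2 * k * l) * qint A (k+l)"
   proof -
    have e: "4 * k+2 * k * l' = 2 * k * l+2 * k" "2 * k * l=2 * k' * l+2 * l"
     "2 * k * l+2 * k=2 * k' * l+2*(k+l)"
     by (simp_all add: Suc k algebra_simps)
    have "A^(2 * k' * l) * qint A k+A^(2 * k' * l+2*(k+l)) * qint A l =
     A^(2 * k' * l)*(A^(2 * l) * qint A (k+l))"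
     unfolding qint_add[OF assms] by (simp add: power_add algebra_simps)
    thus ?thesis unfolding e(1) e(3) unfolding e(2) by (simp add: power_add mult.assoc)
   qed
   also have "qfact A n*(A^(2 * k * l) * qint A (k+l))=A^(2 * k * l) * qfact A (k+l)"
    using Suc.hyps(2) by (metis mult.left_commute mult.commute qfact_Suc)
   finally show ?thesis .
  qed
 qed
qed

lemma gauss_nz: "generic A ==> k <= b ==> gauss A b k ~= 0"
 using gauss_qfact[of A k "b-k"] qfact_nz[of A b] by auto

lemma gauss_eq:
 assumes "generic A" "k <= b"
 shows "gauss A b k=A^(2 * k*(b-k)) * qfact A b/(qfact A k * qfact A (b-k))"
 using gauss_qfact[of A k "b-k"] qfact_nz[of A] assms by (simp add: field_simps)

section \<open>The spin state model of the Kauffman bracket\<close>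

type_synonym vec = "bool list => complex"

text \<open>The kernel takes the letters at the upper ends first and those at the lower ends second;
  the operator carries vectors on the lower level to vectors on the upper level. Words that are too
  short get 0, so that support on a single length is preserved.\<close>

definition op :: "nat => nat => nat => (bool list => bool list => complex) => vec => vec" where
 "op k m n K v ep=(if k+n <= length ep
   then \<Sum>bt\<in>words m. K (take n (drop k ep)) bt * v (take k ep@bt@drop (k+n) ep) else 0)"

lemma op_app:
 "length al=k ==> length ga=n ==>
  op k m n K v (al@ga@et)=(\<Sum>bt\<in>words m. K ga bt * v (al@bt@et))"
 by (simp add: op_def)

lemma op_short: "length ep<k+n ==> op k m n K v ep=0"
 by (simp add: op_def)

lemma split3:
 assumes "k+n <= length ep"
 obtains al ga et where "ep=al@ga@et" "length al=k" "length ga=n"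
proof
 show "ep=take k ep@take n (drop k ep)@drop (k+n) ep"
  by (metis add.commute append_take_drop_id drop_drop)
qed (use assms in auto)

lemma split5:
 assumes "k+n+d+n' <= length ep"
 obtains al ga dl ga' et where "ep=al@ga@dl@ga'@et" "length al=k" "length ga=n"
  "length dl=d" "length ga' = n'"
proof -
 obtain al ga et where 1: "ep=al@ga@et" "length al=k" "length ga=n"
  using split3[of k n ep] assms by auto
 hence "d+n' <= length et" using assms by auto
 then obtain dl ga' et' where "et=dl@ga'@et'" "length dl=d" "length ga' = n'"
  by (rule split3)
 with 1 that show ?thesis by blast
qed

text \<open>Operators on disjoint groups of strands commute; the right one is renumbered because the
  left one changes the number of strands from \<open>m\<close> to \<open>n\<close>.\<close>

lemma op_op_far:
 "op k m n K (op (k+m+d) m' n' K' v) = op (k+n+d) m' n' K' (op k m n K v)"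
proof
 fix ep :: "bool list"
 show "op k m n K (op (k+m+d) m' n' K' v) ep = op (k+n+d) m' n' K' (op k m n K v) ep"
 proof (cases "k+n+d+n' <= length ep")
  case True
  then obtain al ga dl ga' et where e: "ep=al@ga@dl@ga'@et" "length al=k" "length ga=n"
   "length dl=d" "length ga' = n'" by (rule split5)
  have 1: "op (k+m+d) m' n' K' v (al@bt@dl@ga'@et) =
   (\<Sum>bt'\<in>words m'. K' ga' bt' * v (al@bt@dl@bt'@et))" if "bt \<in> words m" for bt
   using op_app[of "al@bt@dl" "k+m+d" ga' n' m' K' v et] e that by simp
  have 2: "op k m n K v (al@ga@dl@bt'@et) =
   (\<Sum>bt\<in>words m. K ga bt * v (al@bt@dl@bt'@et))" for bt'
   using op_app[of al k ga n m K v "dl@bt'@et"] e by simp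
  have "op k m n K (op (k+m+d) m' n' K' v) ep =
   (\<Sum>bt\<in>words m. K ga bt*(\<Sum>bt'\<in>words m'. K' ga' bt' * v (al@bt@dl@bt'@et)))"
   using op_app[of al k ga n m K _ "dl@ga'@et"] e 1 by simp
  also have "\<dots>=(\<Sum>bt'\<in>words m'. K' ga' bt'*(\<Sum>bt\<in>words m. K ga bt * v (al@bt@dl@bt'@et)))"
   unfolding sum_distrib_left by (subst sum.swap) (simp add: mult.left_commute)
  also have "\<dots> = op (k+n+d) m' n' K' (op k m n K v) ep"
   using op_app[of "al@ga@dl" "k+n+d" ga' n' m' K' _ et] e 2 by simp
  finally show ?thesis .
 next
  case False
  have "op k m n K (op (k+m+d) m' n' K' v) ep=0"
  proof (cases "k+n <= length ep")
   case True
   with False show ?thesis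
    unfolding op_def[of k m n] by (intro if_P[THEN trans] sum.neutral ballI) (auto simp: op_short)
  qed (simp add: op_def)
  moreover have "op (k+n+d) m' n' K' (op k m n K v) ep=0"
   using False by (simp add: op_short)
  ultimately show ?thesis by simp
 qed
qed

text \<open>Vectors are functions on words of all lengths; this places one in the
  \<open>n\<close>-th tensor power.\<close>

definition supp :: "nat => vec => bool" where
 "supp n v \<longleftrightarrow> (\<forall>ep. length ep ~= n --> v ep=0)"

lemma suppD: "supp n v ==> length ep ~= n ==> v ep=0"
 by (simp add: supp_def)

lemma supp_eqI:
 assumes "supp n u" "supp n v" "!!ep. length ep=n ==> u ep=v ep"
 shows "u=v"
proof
 fix ep show "u ep=v ep" using assms by (cases "length ep=n") (auto simp: supp_def)
qed

lemma supp_op: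
 assumes "supp N v" "k+m <= N" "N' = N-m+n"
 shows "supp N' (op k m n K v)"
 unfolding supp_def op_def using assms
 by (auto intro!: sum.neutral suppD[OF assms(1)])

lemma op_sum: "op k m n K (%ep. \<Sum>i\<in>I. c i * v i ep) ep=(\<Sum>i\<in>I. c i * op k m n K (v i) ep)"
proof (cases "k+n <= length ep")
 case True
 thus ?thesis
  unfolding op_def by (simp add: sum_distrib_left) (subst sum.swap, simp add: mult.left_commute)
qed (simp add: op_def)

lemma op_cong:
 "(!!ep'. length ep'+n=length ep+m ==> u ep' = v ep') ==> op k m n K u ep = op k m n K v ep"
 unfolding op_def by (auto intro!: sum.cong)

section \<open>The operators of link diagrams\<close>

fun n_in :: "elem => nat" where
 "n_in Cup=0" | "n_in Cap=2" | "n_in Pos=2" | "n_in Neg=2"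

fun n_out :: "elem => nat" where
 "n_out Cup=2" | "n_out Cap=0" | "n_out Pos=2" | "n_out Neg=2"

text \<open>Kauffman's solution has off-diagonal entries \<i> A and - \<i> / A for cup and cap
  alike. Here the cup is multiplied by \<i> A and the cap divided by it, which changes neither
  circles nor zigzags and leaves only integer Laurent monomials.\<close>

definition cupw :: "complex => bool => bool => complex" where
 "cupw A a b=(if a=b then 0 else if a then-(A^2) else 1)"

definition capw :: "complex => bool => bool => complex" where
 "capw A a b=(if a=b then 0 else if a then 1 else-(inverse A^2))"

fun ekernel :: "complex => elem => bool list => bool list => complex" where
 "ekernel A Cup ga bt=cupw A (ga!0) (ga!1)"
| "ekernel A Cap ga bt=capw A (bt!0) (bt!1)"
| "ekernel A Pos ga bt=(if ga=bt then A else 0) +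
   inverse A*(cupw A (ga!0) (ga!1) * capw A (bt!0) (bt!1))"
| "ekernel A Neg ga bt=A*(cupw A (ga!0) (ga!1) * capw A (bt!0) (bt!1)) +
   (if ga=bt then inverse A else 0)"

definition elem_op :: "complex => nat => elem => vec => vec" where
 "elem_op A k p = op k (n_in p) (n_out p) (ekernel A p)"

fun run :: "complex => link_diagram => vec => vec" where
 "run A [] v=v"
| "run A ((k, p)#D) v=run A D (elem_op A k p v)"

fun valid :: "nat => link_diagram => nat => bool" where
 "valid n [] m \<longleftrightarrow> n=m"
| "valid n ((k, p)#D) m \<longleftrightarrow> k+n_in p <= n & valid (n-n_in p+n_out p) D m"

definition shift :: "nat => link_diagram => link_diagram" where
 "shift q D=map (%(k, p). (q+k, p)) D"

lemma shift_simps [simp]: "shift q []=[]" "shift q ((k, p)#D)=(q+k, p)#shift q D"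
 "shift q (D@D')=shift q D@shift q D'"
 by (simp_all add: shift_def)

lemma shift_0 [simp]: "shift 0 D=D"
 by (simp add: shift_def)

lemma shift_shift: "shift q (shift q' D)=shift (q+q') D"
 by (auto simp: shift_def)

lemma run_append: "run A (D@D') v=run A D' (run A D v)"
 by (induction A D v rule: run.induct) auto

lemma valid_append: "valid n (D@D') m \<longleftrightarrow> (\<exists>l. valid n D l & valid l D' m)"
 by (induction n D m rule: valid.induct) auto

lemma valid_shift:
 assumes "valid n D m" "q+n <= N" "M=N-n+m"
 shows "valid N (shift q D) M"
 using assms
proof (induction n D m arbitrary: N rule: valid.induct)
 case (2 n k p D m)
 have "valid (N-n_in p+n_out p) (shift q D) M"
  by (rule 2(1)) (use 2 in auto)
 with 2 show ?case by simp
qed simp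

lemma supp_run: "supp n v ==> valid n D m ==> supp m (run A D v)"
proof (induction n D m arbitrary: v rule: valid.induct)
 case (2 n k p D m)
 have "supp (n-n_in p+n_out p) (elem_op A k p v)"
  unfolding elem_op_def by (rule supp_op[of n]) (use 2 in auto)
 from 2(1)[OF this] 2(3) show ?case unfolding valid.simps run.simps by blast
qed simp

lemma run_sum: "run A D (%ep. \<Sum>i\<in>I. c i * v i ep) ep=(\<Sum>i\<in>I. c i * run A D (v i) ep)"
proof (induction D arbitrary: v ep)
 case (Cons x D)
 obtain k p where x: "x=(k, p)" by (cases x)
 have "elem_op A k p (%ep. \<Sum>i\<in>I. c i * v i ep)=(%ep. \<Sum>i\<in>I. c i * elem_op A k p (v i) ep)"
  unfolding elem_op_def by (rule ext) (rule op_sum)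
 thus ?case using Cons[of "%i. elem_op A k p (v i)"] x by simp
qed simp

lemma run_scale: "run A D (%ep. c * v ep) ep=c * run A D v ep"
 using run_sum[where I = "{()}" and c = "%_. c" and v = "%_. v"] by simp

lemma run_add: "run A D (%ep. c * u ep+d * v ep) ep=c * run A D u ep+d * run A D v ep"
 using run_sum[where I = "UNIV :: bool set" and c = "%b. if b then c else d" and
  v = "%b. if b then u else v"]
 by (simp add: UNIV_bool add.commute)

lemma run_cong:
 "valid n D m ==> length ep=m ==> (!!ep'. length ep' = n ==> u ep' = v ep') ==> run A D u ep=run A D v ep"
proof (induction n D m arbitrary: u v rule: valid.induct)
 case (2 n k p D m)
 show ?case unfolding run.simps
  by (rule 2(1)) (use 2 in \<open>auto simp: elem_op_def intro!: op_cong\<close>)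
qed simp

lemma run_local:
 assumes "valid n D m" "length al=q" "length ga=m"
 shows "run A (shift q D) v (al@ga@et)=run A D (%\<mu>. v (al@\<mu>@et)) ga"
 using assms
proof (induction n D m arbitrary: v rule: valid.induct)
 case (2 n k p D m)
 let ?n = "n-n_in p+n_out p"
 have "run A (shift q ((k, p)#D)) v (al@ga@et) =
  run A D (%\<mu>. elem_op A (q+k) p v (al@\<mu>@et)) ga"
  using 2(1)[of "elem_op A (q+k) p v"] 2(2-) unfolding valid.simps shift_simps run.simps by blast
 also have "\<dots>=run A D (elem_op A k p (%\<mu>. v (al@\<mu>@et))) ga"
 proof (rule run_cong)
  show "valid ?n D m" "length ga=m" using 2 by auto
  fix \<mu> :: "bool list" assume "length \<mu> = ?n"
  thus "elem_op A (q+k) p v (al@\<mu>@et)=elem_op A k p (%\<mu>. v (al@\<mu>@et)) \<mu>"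
   using 2 by (auto simp: elem_op_def op_def intro!: sum.cong)
 qed
 finally show ?case by simp
qed simp

lemma run_local_0:
 "valid n D m ==> length ga=m ==> run A D v (ga@et)=run A D (%\<mu>. v (\<mu>@et)) ga"
 using run_local[of n D m "[]" 0 ga A v et] by simp

lemma run_op_left:
 assumes "valid n D m" "k+b+d=q" "supp N v" "q+n <= N"
 shows "run A (shift q D) (op k b b K v) = op k b b K (run A (shift q D) v)"
proof (rule supp_eqI)
 let ?M = "N-n+m"
 have V: "valid N (shift q D) ?M" using assms by (intro valid_shift) auto
 show "supp ?M (run A (shift q D) (op k b b K v))"
  using assms by (intro supp_run[OF _ V] supp_op[of N]) auto
 show "supp ?M (op k b b K (run A (shift q D) v))"
  using assms by (intro supp_op[of ?M] supp_run[OF _ V]) auto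
 fix ep :: "bool list" assume "length ep = ?M"
 hence "k+b+d+m <= length ep" using assms by simp
 then obtain al ga dl ga' et where e: "ep=al@ga@dl@ga'@et" "length al=k" "length ga=b"
   "length dl=d" "length ga' = m" by (rule split5)
 have r: "run A (shift q D) w (al@bt@dl@ga'@et)=run A D (%\<mu>. w (al@bt@dl@\<mu>@et)) ga'"
  if "length bt=b" for w bt
  using run_local[OF assms(1), of "al@bt@dl" q ga' A w et] e assms(2) that by simp
 have "run A (shift q D) (op k b b K v) ep =
  run A D (%\<mu>. \<Sum>bt\<in>words b. K ga bt * v (al@bt@dl@\<mu>@et)) ga'"
  using e r[of ga] by (simp add: op_app)
 also have "\<dots>=(\<Sum>bt\<in>words b. K ga bt * run A (shift q D) v (al@bt@dl@ga'@et))"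
  unfolding run_sum by (intro sum.cong) (simp_all add: r)
 also have "\<dots> = op k b b K (run A (shift q D) v) ep"
  using e by (simp add: op_app)
 finally show "run A (shift q D) (op k b b K v) ep = op k b b K (run A (shift q D) v) ep" .
qed

lemma run_op_right:
 assumes "valid n D m" "supp N v" "q+n+d+b <= N"
 shows "run A (shift q D) (op (q+n+d) b b K v) = op (q+m+d) b b K (run A (shift q D) v)"
proof (rule supp_eqI)
 let ?M = "N-n+m"
 have V: "valid N (shift q D) ?M" using assms by (intro valid_shift) auto
 show "supp ?M (run A (shift q D) (op (q+n+d) b b K v))"
  using assms by (intro supp_run[OF _ V] supp_op[of N]) auto
 show "supp ?M (op (q+m+d) b b K (run A (shift q D) v))"
  using assms by (intro supp_op[of ?M] supp_run[OF _ V]) auto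
 fix ep :: "bool list" assume "length ep = ?M"
 hence "q+m+d+b <= length ep" using assms by simp
 then obtain al ga dl ga' et where e: "ep=al@ga@dl@ga'@et" "length al=q" "length ga=m"
   "length dl=d" "length ga' = b" by (rule split5)
 have o: "op (q+l+d) b b K w (al@\<mu>@dl@ga'@et) =
   (\<Sum>bt\<in>words b. K ga' bt * w (al@\<mu>@dl@bt@et))" if "length \<mu>=l" for w \<mu> l
  using op_app[of "al@\<mu>@dl" "q+l+d" ga' b b K w et] e that by simp
 have r: "run A (shift q D) w (al@ga@\<zeta>)=run A D (%\<mu>. w (al@\<mu>@\<zeta>)) ga" for w \<zeta>
  by (rule run_local[OF assms(1)]) (use e in auto)
 have "run A (shift q D) (op (q+n+d) b b K v) ep =
  run A D (%\<mu>. op (q+n+d) b b K v (al@\<mu>@dl@ga'@et)) ga"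
  using e r by simp
 also have "\<dots>=run A D (%\<mu>. \<Sum>bt\<in>words b. K ga' bt * v (al@\<mu>@dl@bt@et)) ga"
  by (rule run_cong[OF assms(1)]) (use e o in auto)
 also have "\<dots>=(\<Sum>bt\<in>words b. K ga' bt * run A (shift q D) v (al@ga@dl@bt@et))"
  unfolding run_sum by (simp add: r)
 also have "\<dots> = op (q+m+d) b b K (run A (shift q D) v) ep"
  using e o by simp
 finally show "run A (shift q D) (op (q+n+d) b b K v) ep = op (q+m+d) b b K (run A (shift q D) v) ep" .
qed

section \<open>The state model computes the Kauffman bracket\<close>

definition unit_vec :: vec where
 "unit_vec ep=(if ep=[] then 1 else 0)"

lemma supp_unit [simp]: "supp 0 unit_vec"
 by (simp add: supp_def unit_vec_def)

lemma words_2: "(\<Sum>bt\<in>words 2. f bt)=f [True, True]+f [True, False]+f [False, True]+f [False, False]"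
 for f :: "bool list => complex"
 by (simp add: numeral_2_eq_2 sum_words_Suc add.assoc)

lemma elem_op_Cup:
 "length al=k ==> elem_op A k Cup v (al@a#b#et)=cupw A a b * v (al@et)"
 using op_app[of al k "[a, b]" 2 0 "ekernel A Cup" v et] by (simp add: elem_op_def)

lemma elem_op_Cap:
 "length al=k ==> elem_op A k Cap v (al@et) =
   v (al@True#False#et)-inverse A^2 * v (al@False#True#et)"
 using op_app[of al k "[]" 0 2 "ekernel A Cap" v et]
 by (simp add: elem_op_def words_2 capw_def)

lemma elem_op_Pos:
 "length al=k ==> elem_op A k Pos v (al@a#b#et)=A * v (al@a#b#et) +
   inverse A*(cupw A a b*(v (al@True#False#et)-inverse A^2 * v (al@False#True#et)))"
 using op_app[of al k "[a, b]" 2 2 "ekernel A Pos" v et]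
 by (cases a; cases b) (simp_all add: elem_op_def words_2 capw_def algebra_simps)

lemma elem_op_Neg:
 "length al=k ==> elem_op A k Neg v (al@a#b#et)=inverse A * v (al@a#b#et) +
   A*(cupw A a b*(v (al@True#False#et)-inverse A^2 * v (al@False#True#et)))"
 using op_app[of al k "[a, b]" 2 2 "ekernel A Neg" v et]
 by (cases a; cases b) (simp_all add: elem_op_def words_2 capw_def algebra_simps)

lemma supp_elem_op:
 assumes "supp N v" "k+n_in p <= N" "N' = N-n_in p+n_out p"
 shows "supp N' (elem_op A k p v)"
 unfolding elem_op_def using assms by (rule supp_op)

lemma split_len:
 assumes "k <= length ep" obtains al et where "ep=al@et" "length al=k"
 by (rule that[of "take k ep" "drop k ep"]) (use assms in auto)

lemma cap_cup_same:
 assumes "A ~= 0" "supp N v" "k <= N"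
 shows "elem_op A k Cap (elem_op A k Cup v)=(%ep. - (A^2+inverse A^2) * v ep)"
proof (rule supp_eqI)
 show "supp N (elem_op A k Cap (elem_op A k Cup v))"
  using assms by (intro supp_elem_op[OF supp_elem_op[OF assms(2), of _ _ "N+2"]]) auto
 show "supp N (%ep. - (A^2+inverse A^2) * v ep)" using assms by (simp add: supp_def)
 fix ep :: "bool list" assume "length ep=N"
 then obtain al et where "ep=al@et" "length al=k" using split_len[of k ep] assms by auto
 thus "elem_op A k Cap (elem_op A k Cup v) ep = - (A^2+inverse A^2) * v ep"
  by (simp add: elem_op_Cap elem_op_Cup cupw_def algebra_simps)
qed

text \<open>A zigzag is straight because \<open>cupw\<close> and \<open>capw\<close>, read as 2 by 2
  matrices, are inverse to each other.\<close>

lemma cap_cup_right: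
 assumes "A ~= 0" "supp N v" "k<N"
 shows "elem_op A (Suc k) Cap (elem_op A k Cup v)=v"
proof (rule supp_eqI)
 show "supp N (elem_op A (Suc k) Cap (elem_op A k Cup v))"
  using assms by (intro supp_elem_op[OF supp_elem_op[OF assms(2), of _ _ "N+2"]]) auto
 show "supp N v" by fact
 fix ep :: "bool list" assume "length ep=N"
 then obtain al et' where "ep=al@et'" "length al=k" using split_len[of k ep] assms by auto
 moreover obtain a et where "et' = a#et" using calculation \<open>length ep = N\<close> assms by (cases et') auto
 moreover have "elem_op A (Suc k) Cap u (al@a#et) =
  u (al@a#True#False#et)-inverse A^2 * u (al@a#False#True#et)" for u
  using elem_op_Cap[of "al@[a]" "Suc k" A u et] calculation by simp
 moreover have "inverse A^2*A^2=1" using assms(1) by (simp add: field_simps)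
 ultimately show "elem_op A (Suc k) Cap (elem_op A k Cup v) ep=v ep"
  by (cases a) (simp_all add: elem_op_Cup cupw_def flip: mult.assoc)
qed

lemma cap_cup_left:
 assumes "A ~= 0" "supp N v" "k<N"
 shows "elem_op A k Cap (elem_op A (Suc k) Cup v)=v"
proof (rule supp_eqI)
 show "supp N (elem_op A k Cap (elem_op A (Suc k) Cup v))"
  using assms by (intro supp_elem_op[OF supp_elem_op[OF assms(2), of _ _ "N+2"]]) auto
 show "supp N v" by fact
 fix ep :: "bool list" assume "length ep=N"
 then obtain al et' where "ep=al@et'" "length al=k" using split_len[of k ep] assms by auto
 moreover obtain a et where "et' = a#et" using calculation \<open>length ep = N\<close> assms by (cases et') auto
 ultimately show "elem_op A k Cap (elem_op A (Suc k) Cup v) ep=v ep"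
  using elem_op_Cup[of "al@[True]" "Suc k" A v _ _ et] elem_op_Cup[of "al@[False]" "Suc k" A v _ _ et] assms
  by (cases a) (simp_all add: elem_op_Cap cupw_def field_simps)
qed

lemma cap_cup_far_right:
 "elem_op A (k+2+d) Cap (elem_op A k Cup v)=elem_op A k Cup (elem_op A (k+d) Cap v)"
 using op_op_far[of k 0 2 "ekernel A Cup" d 2 0 "ekernel A Cap" v] by (simp add: elem_op_def)

lemma cap_cup_far_left:
 "elem_op A k Cap (elem_op A (k+2+d) Cup v)=elem_op A (k+d) Cup (elem_op A k Cap v)"
 using op_op_far[of k 2 0 "ekernel A Cap" d 0 2 "ekernel A Cup" v] by (simp add: elem_op_def)

text \<open>\<open>pairing A w v\<close>: the vector \<open>v\<close> of a planar system of arcs whose end points, labelled by \<open>w\<close>,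
 have equal labels iff they are joined.\<close>

inductive pairing :: "complex => nat list => vec => bool" for A where
 pairing_Nil: "pairing A [] unit_vec"
| pairing_cup: "pairing A (u@t) v ==> x \<notin> set (u@t) ==>
  pairing A (u@[x, x]@t) (elem_op A (length u) Cup v)"

lemma pairing_supp: "pairing A w v ==> supp (length w) v"
 by (induction rule: pairing.induct) (auto intro!: supp_elem_op)

lemma pairing_map:
 "pairing A w v ==> inj_on f (set w) ==> pairing A (map f w) v"
proof (induction rule: pairing.induct)
 case (pairing_cup u t v x)
 have "pairing A (map f u@map f t) v"
  using pairing_cup.IH pairing_cup.prems by (auto simp: inj_on_Un)
 moreover have "f x \<notin> set (map f u@map f t)"
  using pairing_cup.hyps(2) pairing_cup.prems by (auto simp: inj_on_def)
 ultimately have "pairing A (map f u@[f x, f x]@map f t) (elem_op A (length (map f u)) Cup v)"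
  by (rule pairing.pairing_cup)
 thus ?case by simp
qed (auto intro: pairing.intros)

text \<open>Compare the cap with the last cup of the derivation: it closes this cup to a circle,
  straightens it from one of the two sides, or misses it. In the last case cap and cup commute and
  the induction hypothesis applies to the remaining arcs.\<close>

lemma pairing_cap:
 assumes "pairing A w v" "w=u@[a, b]@t" "generic A"
 shows "if a=b then \<exists>v'. pairing A (u@t) v' \<and>
   elem_op A (length u) Cap v=(%ep. - (A^2+inverse A^2) * v' ep)
  else pairing A (map (%y. if y=a then b else y) (u@t)) (elem_op A (length u) Cap v)"
 using assms(1,2)
proof (induction arbitrary: u a b t rule: pairing.induct)
 case (pairing_cup u' t' v x)
 have A: "A ~= 0" using assms(3) by simp
 have sv: "supp (length (u'@t')) v" using pairing_cup.hyps(1) by (rule pairing_supp)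
 let ?f = "%y. if y=a then b else y"
 consider "length u=length u'" | "length u=Suc (length u')" | "length u' = Suc (length u)"
  | "length u >= length u'+2" | "length u' >= length u+2" by linarith
 thus ?case
 proof cases
  case 1
  hence "u=u'" "a=x" "b=x" "t=t'" using pairing_cup.prems by auto
  with cap_cup_same[OF A sv, of "length u"] pairing_cup.hyps(1) show ?thesis by auto
 next
  case 2
  hence e: "u=u'@[x]" "a=x" "t' = b#t"
   using pairing_cup.prems
   by (auto simp: append_eq_append_conv2 append_eq_Cons_conv Cons_eq_append_conv)
  have "a ~= b" using e pairing_cup.hyps(2) by auto
  moreover have "map ?f (u@t)=u'@t'"
   using e pairing_cup.hyps(2) by (auto intro!: map_idI)
  moreover have "elem_op A (length u) Cap (elem_op A (length u') Cup v)=v"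
   using cap_cup_right[OF A sv] e by simp
  ultimately show ?thesis using pairing_cup.hyps(1) by simp
 next
  case 3
  hence e: "u' = u@[a]" "b=x" "t=x#t'"
   using pairing_cup.prems
   by (auto simp: append_eq_append_conv2 append_eq_Cons_conv Cons_eq_append_conv)
  have "a ~= b" using e pairing_cup.hyps(2) by auto
  moreover have "map ?f (u@t)=map ?f (u'@t')"
   using e pairing_cup.hyps(2) by auto
  \<comment> \<open>\<open>b\<close> is the fresh label of the removed cup, so renaming
    \<open>a\<close> to it is injective on the labels that remain.\<close>
  moreover have "inj_on ?f (set (u'@t'))"
   using e pairing_cup.hyps(2) by (auto simp: inj_on_def)
  moreover have "elem_op A (length u) Cap (elem_op A (length u') Cup v)=v"
   using cap_cup_left[OF A sv] e by simp
  ultimately show ?thesis using pairing_map[OF pairing_cup.hyps(1), of ?f] by simp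
 next
  case 4
  define m where "m=drop (length u'+2) u"
  have "u=u'@[x, x]@m" "t' = m@[a, b]@t"
  proof -
   have "take (length u'+2) (u'@[x, x]@t')=take (length u'+2) u"
    using pairing_cup.prems 4 by simp
   hence "u'@[x, x]=take (length u'+2) u" by simp
   thus 1: "u=u'@[x, x]@m"
    unfolding m_def by (metis append.assoc append_take_drop_id)
   thus "t' = m@[a, b]@t" using pairing_cup.prems by simp
  qed
  note e = this
  have IH: "if a=b then \<exists>v'. pairing A ((u'@m)@t) v' \<and>
    elem_op A (length (u'@m)) Cap v=(%ep. - (A^2+inverse A^2) * v' ep)
   else pairing A (map ?f ((u'@m)@t)) (elem_op A (length (u'@m)) Cap v)"
   by (rule pairing_cup.IH) (use e in simp)
  have c: "elem_op A (length u) Cap (elem_op A (length u') Cup v) =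
   elem_op A (length u') Cup (elem_op A (length (u'@m)) Cap v)"
   using cap_cup_far_right[of A "length u'" "length m" v] e by simp
  show ?thesis
  proof (cases "a=b")
   case True
   with IH obtain v' where v': "pairing A (u'@m@t) v'"
    "elem_op A (length (u'@m)) Cap v=(%ep. - (A^2+inverse A^2) * v' ep)" by auto
   have "pairing A (u'@[x, x]@m@t) (elem_op A (length u') Cup v')"
    using v'(1) pairing_cup.hyps(2) e by (intro pairing.pairing_cup) auto
   moreover have "elem_op A (length u) Cap (elem_op A (length u') Cup v) =
    (%ep. - (A^2+inverse A^2) * elem_op A (length u') Cup v' ep)"
    unfolding c v'(2) using run_scale[of A "[(length u', Cup)]"] by auto
   ultimately show ?thesis using True e by auto
  next
   case False
   have "x ~= a" "x ~= b" using e pairing_cup.hyps(2) by auto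
   have "pairing A (map ?f u'@[x, x]@map ?f (m@t))
    (elem_op A (length (map ?f u')) Cup (elem_op A (length (u'@m)) Cap v))"
    using IH False pairing_cup.hyps(2) e by (intro pairing.pairing_cup) auto
   thus ?thesis using False e \<open>x ~= a\<close> unfolding c by simp
  qed
 next
  case 5
  define m where "m=drop (length u+2) u'"
  have "u' = u@[a, b]@m" "t=m@[x, x]@t'"
  proof -
   have "take (length u+2) (u@[a, b]@t)=take (length u+2) u'"
    unfolding pairing_cup.prems[symmetric] using 5 by simp
   hence "u@[a, b]=take (length u+2) u'" by simp
   thus 1: "u' = u@[a, b]@m"
    unfolding m_def by (metis append.assoc append_take_drop_id)
   thus "t=m@[x, x]@t'" using pairing_cup.prems by simp
  qed
  note e = this
  have IH: "if a=b then \<exists>v'. pairing A (u@(m@t')) v' \<and>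
    elem_op A (length u) Cap v=(%ep. - (A^2+inverse A^2) * v' ep)
   else pairing A (map ?f (u@(m@t'))) (elem_op A (length u) Cap v)"
   by (rule pairing_cup.IH) (use e in simp)
  have c: "elem_op A (length u) Cap (elem_op A (length u') Cup v) =
   elem_op A (length (u@m)) Cup (elem_op A (length u) Cap v)"
   using cap_cup_far_left[of A "length u" "length m" v] e by simp
  show ?thesis
  proof (cases "a=b")
   case True
   with IH obtain v' where v': "pairing A ((u@m)@t') v'"
    "elem_op A (length u) Cap v=(%ep. - (A^2+inverse A^2) * v' ep)" by auto
   have "pairing A ((u@m)@[x, x]@t') (elem_op A (length (u@m)) Cup v')"
    using v'(1) pairing_cup.hyps(2) e by (intro pairing.pairing_cup) auto
   moreover have "elem_op A (length u) Cap (elem_op A (length u') Cup v) =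
    (%ep. - (A^2+inverse A^2) * elem_op A (length (u@m)) Cup v' ep)"
    unfolding c v'(2) using run_scale[of A "[(length (u@m), Cup)]"] by auto
   ultimately show ?thesis using True e by auto
  next
   case False
   have "x ~= a" "x ~= b" using e pairing_cup.hyps(2) by auto
   have "pairing A (map ?f (u@m)@[x, x]@map ?f t')
    (elem_op A (length (map ?f (u@m))) Cup (elem_op A (length u) Cap v))"
    using IH False pairing_cup.hyps(2) e by (intro pairing.pairing_cup) auto
   thus ?thesis using False e \<open>x ~= a\<close> unfolding c by simp
  qed
 qed
qed simp

lemma split_at:
 assumes "k+2 <= length w"
 shows "w=take k w@[w!k, w!(k+1)]@drop (k+2) w"
proof -
 have "drop k w=w!k#w!(k+1)#drop (k+2) w"
  using assms by (simp add: Cons_nth_drop_Suc)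
 thus ?thesis by (metis append_Cons append_Nil append_take_drop_id)
qed

lemma run_Pos:
 assumes "supp N v" "k+2 <= N"
 shows "elem_op A k Pos v=(%ep. A * v ep+inverse A * run A [(k, Cap), (k, Cup)] v ep)"
proof (rule supp_eqI)
 have s: "supp N (run A [(k, Cap), (k, Cup)] v)"
  using assms by (intro supp_run[of N v]) auto
 show "supp N (elem_op A k Pos v)" using assms by (auto intro: supp_elem_op)
 show "supp N (%ep. A * v ep+inverse A * run A [(k, Cap), (k, Cup)] v ep)"
  using s assms by (simp add: supp_def)
 fix ep :: "bool list" assume "length ep=N"
 hence "ep=take k ep@[ep!k, ep!(k+1)]@drop (k+2) ep" "length (take k ep)=k"
  using assms split_at[of k ep] by auto
 then obtain al a b et where "ep=al@a#b#et" "length al=k" by (metis append_Cons append_Nil)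
 thus "elem_op A k Pos v ep=A * v ep+inverse A * run A [(k, Cap), (k, Cup)] v ep"
  by (simp add: elem_op_Pos elem_op_Cup elem_op_Cap)
qed

lemma run_Neg:
 assumes "supp N v" "k+2 <= N"
 shows "elem_op A k Neg v=(%ep. A * run A [(k, Cap), (k, Cup)] v ep+inverse A * v ep)"
proof (rule supp_eqI)
 have s: "supp N (run A [(k, Cap), (k, Cup)] v)"
  using assms by (intro supp_run[of N v]) auto
 show "supp N (elem_op A k Neg v)" using assms by (auto intro: supp_elem_op)
 show "supp N (%ep. A * run A [(k, Cap), (k, Cup)] v ep+inverse A * v ep)"
  using s assms by (simp add: supp_def)
 fix ep :: "bool list" assume "length ep=N"
 hence "ep=take k ep@[ep!k, ep!(k+1)]@drop (k+2) ep" "length (take k ep)=k"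
  using assms split_at[of k ep] by auto
 then obtain al a b et where "ep=al@a#b#et" "length al=k" by (metis append_Cons append_Nil)
 thus "elem_op A k Neg v ep=A * run A [(k, Cap), (k, Cup)] v ep+inverse A * v ep"
  by (simp add: elem_op_Neg elem_op_Cup elem_op_Cap)
qed

text \<open>Induction along the recursion of \<open>bracket\<close>: the part already smoothed,
  described there by the labels \<open>w\<close>, is here the vector \<open>v\<close>. Caps act on
  both alike by \<open>pairing_cap\<close>, and the crossing operators are by construction the
  combinations of the two smoothings.\<close>

lemma bracket_run_aux:
 "generic A ==> pairing A w v ==> \<forall>x\<in>set w. x<m ==> valid (length w) D 0 ==> bracket A m w D=run A D v []"
proof (induction A m w D arbitrary: v rule: bracket.induct)
 case (1 A m w)
 thus ?case by (auto elim: pairing.cases simp: unit_vec_def)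
next
 case (2 A m w k D)
 have "pairing A (take k w@[m, m]@drop k w) (elem_op A (length (take k w)) Cup v)"
  by (rule pairing_cup) (use 2 in \<open>auto dest: in_set_takeD in_set_dropD\<close>)
 hence "pairing A (insert_at k [m, m] w) (elem_op A k Cup v)"
  using 2 by (simp add: insert_at_def min_absorb2)
 moreover have "length (insert_at k [m, m] w)=length w+2"
  using 2 by (simp add: insert_at_def)
 moreover have "\<forall>x\<in>set (insert_at k [m, m] w). x<Suc m"
  using 2 by (auto simp: insert_at_def less_SucI dest!: in_set_takeD in_set_dropD)
 ultimately show ?case using 2 by simp
next
 case (3 A m w k D)
 note A = "3.prems"(1)
 have k: "k+2 <= length w" using 3 by simp
 have V: "valid (length w-2) D 0" using 3 by simp
 have l: "length (take k w)=k" using k by simp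
 note c = pairing_cap[OF "3.prems"(2) split_at[OF k] A]
 have lt: "w!k<m" "w!(k+1)<m" using 3 k by auto
 have ms: "\<forall>x\<in>set (remove_two k w). x<m"
  using 3 by (auto simp: remove_two_def dest!: in_set_takeD in_set_dropD)
 show ?case
 proof (cases "w!k=w!(k+1)")
  case True
  with c l obtain v' where v': "pairing A (remove_two k w) v'"
   "elem_op A k Cap v=(%ep. - (A^2+inverse A^2) * v' ep)"
   by (auto simp: remove_two_def)
  have "bracket A m (remove_two k w) D=run A D v' []"
   by (rule 3(1)[OF True A v'(1) ms]) (use V k in \<open>simp add: remove_two_def\<close>)
  thus ?thesis
   using True v'(2) run_scale[of A D "- (A^2+inverse A^2)" v' "[]"] A
   by (simp add: qint_2)
 next
  case False
  with c l have "pairing A (map (%y. if y=w!k then w!(k+1) else y) (remove_two k w))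
    (elem_op A k Cap v)"
   by (simp add: remove_two_def)
  hence "bracket A m (map (%y. if y=w!k then w!(k+1) else y) (remove_two k w)) D =
    run A D (elem_op A k Cap v) []"
   by (intro 3(2)[OF False A]) (use V k ms lt in \<open>auto simp: remove_two_def\<close>)
  thus ?thesis using False by simp
 qed
next
 case (4 A m w k D)
 have k: "k+2 <= length w" using 4 by simp
 note s = pairing_supp[OF "4.prems"(2)]
 have e: "length w-2+2=length w" using k by linarith
 have "valid (length w) D 0"
  using "4.prems"(4) unfolding valid.simps n_in.simps n_out.simps e by blast
 hence "bracket A m w D=run A D v []" by (intro "4.IH"(1) "4.prems")
 moreover have "bracket A m w ((k, Cap)#(k, Cup)#D)=run A ((k, Cap)#(k, Cup)#D) v []"
  by (rule 4(2)) (use "4.prems" k in auto)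
 ultimately show ?case
  using run_add[of A D A v "inverse A" "run A [(k, Cap), (k, Cup)] v" "[]"] run_Pos[OF s k, of A]
  by simp
next
 case (5 A m w k D)
 have k: "k+2 <= length w" using 5 by simp
 note s = pairing_supp[OF "5.prems"(2)]
 have e: "length w-2+2=length w" using k by linarith
 have "valid (length w) D 0"
  using "5.prems"(4) unfolding valid.simps n_in.simps n_out.simps e by blast
 hence "bracket A m w D=run A D v []" by (intro "5.IH"(2) "5.prems")
 moreover have "bracket A m w ((k, Cap)#(k, Cup)#D)=run A ((k, Cap)#(k, Cup)#D) v []"
  by (rule 5(1)) (use "5.prems" k in auto)
 ultimately show ?case
  using run_add[of A D A "run A [(k, Cap), (k, Cup)] v" "inverse A" v "[]"] run_Neg[OF s k, of A]
  by simp
qed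

lemma bracket_run:
 "generic A ==> valid 0 D 0 ==> bracket A 0 [] D=run A D unit_vec []"
 by (rule bracket_run_aux[OF _ pairing_Nil]) auto

section \<open>The symmetrizer of an edge\<close>

text \<open>The Lehmer code: how many earlier strands the strand \<open>j\<close> has to pass in
  \<open>perm_braid\<close>.\<close>

definition code :: "(nat => nat) => nat => nat" where
 "code sm j=card {i. i<j & sm j<sm i}"

lemma code_le: "code sm j <= j"
 unfolding code_def using card_mono[of "{..<j}" "{i. i<j & sm j<sm i}"] by auto

lemma sum_words_snoc:
 fixes f :: "bool list => 'a::comm_monoid_add"
 shows "(\<Sum>ep\<in>words (Suc n). f ep)=(\<Sum>ep\<in>words n. f (ep@[True]))+(\<Sum>ep\<in>words n. f (ep@[False]))"
proof -
 have "(\<Sum>ep\<in>words (n+1). f ep)=(\<Sum>al\<in>words n. \<Sum>bt\<in>words (Suc 0). f (al@bt))"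
  unfolding sum_words_add by simp
 thus ?thesis unfolding sum_words_Suc[of _ 0] by (simp add: sum.distrib)
qed

lemma perm_length_code: "perm_length b sm=(\<Sum>j<b. code sm j)"
proof -
 have "{(i, j). i<j & j<b & sm j<sm i}=prod.swap ` (SIGMA j:{..<b}. {i. i<j & sm j<sm i})"
  by auto
 hence "perm_length b sm=card (SIGMA j:{..<b}. {i. i<j & sm j<sm i})"
  unfolding perm_length_def by (simp add: card_image)
 thus ?thesis by (simp add: code_def)
qed

text \<open>By induction on \<open>j\<close> the code determines the relative order of the first
  \<open>j\<close> values: exactly \<open>code sm j\<close> earlier values exceed the value at
  \<open>j\<close>, and \<open>crit\<close> reads off from this number on which side of a given
  earlier value it lies. The order of all values determines a permutation.\<close>

lemma code_inj:
 assumes "sm permutes {..<b}" "ta permutes {..<b}" "!!j. j<b ==> code sm j=code ta j"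
 shows "sm=ta"
proof -
 have inj: "sm i=sm j \<longleftrightarrow> i=j" "ta i=ta j \<longleftrightarrow> i=j" for i j
  using assms(1,2)[THEN permutes_inj] by (auto dest: injD)
 have crit: "rh j<rh i \<longleftrightarrow> card {i'. i' < j & \<not> rh i' < rh i} <= code rh j"
  if "i<j" "inj rh" for rh :: "nat => nat" and i j
 proof
  assume "rh j<rh i"
  thus "card {i'. i' < j & \<not> rh i' < rh i} <= code rh j"
   unfolding code_def by (intro card_mono) auto
 next
  assume le: "card {i'. i' < j & \<not> rh i' < rh i} <= code rh j"
  show "rh j<rh i"
  proof (rule ccontr)
   assume "\<not> rh j<rh i"
   moreover have "rh j ~= rh i" using that by (auto dest: injD)
   ultimately have "{i'. i' < j & rh j<rh i'} \<subset> {i'. i' < j & \<not> rh i' < rh i}"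
    using that(1) by (auto intro!: psubsetI)
   hence "code rh j<card {i'. i' < j & \<not> rh i' < rh i}"
    unfolding code_def by (intro psubset_card_mono) auto
   with le show False by simp
  qed
 qed
 have ord: "j <= b ==> \<forall>i<j. \<forall>i'<j. sm i<sm i' \<longleftrightarrow> ta i<ta i'" for j
 proof (induction j)
  case (Suc j)
  have *: "sm j<sm i \<longleftrightarrow> ta j<ta i" if "i<j" for i
  proof -
   have "{i'. i' < j & \<not> sm i' < sm i}={i'. i' < j & \<not> ta i' < ta i}"
    using Suc that by auto
   thus ?thesis
    using crit[OF that permutes_inj[OF assms(1)]] crit[OF that permutes_inj[OF assms(2)]]
     assms(3)[of j] Suc.prems by simp
  qed
  have **: "sm i<sm j \<longleftrightarrow> ta i<ta j" if "i<j" for i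
   using *[OF that] inj[of i j] that by (metis linorder_neqE_nat less_asym less_irrefl)
  show ?case using Suc * ** by (auto simp: less_Suc_eq)
 qed simp
 have rank: "rh i=card {i'. i' < b & rh i' < rh i}" if "rh permutes {..<b}" "i<b" for rh i
 proof -
  have lt: "rh i<b" using permutes_in_image[OF that(1), of i] that(2) by simp
  have "rh ` {i'. i' < b & rh i' < rh i}={..<rh i}"
  proof (intro equalityI subsetI)
   fix y assume y: "y \<in> {..<rh i}"
   hence "y \<in> rh ` {..<b}" using permutes_image[OF that(1)] lt by auto
   with y show "y \<in> rh ` {i'. i' < b & rh i' < rh i}" by auto
  qed auto
  thus ?thesis using card_image[of rh "{i'. i' < b & rh i' < rh i}"]
   permutes_inj[OF that(1)] by (simp add: inj_on_subset)
 qed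
 show ?thesis
 proof
  fix i
  show "sm i=ta i"
  proof (cases "i<b")
   case True
   have "{i'. i' < b & sm i' < sm i}={i'. i' < b & ta i' < ta i}"
    using ord[of b] True by auto
   thus ?thesis using rank[OF assms(1) True] rank[OF assms(2) True] by simp
  next
   case False
   thus ?thesis using assms(1,2) by (auto simp: permutes_def)
  qed
 qed
qed

text \<open>Surjectivity needs no construction: both sides have b! elements.\<close>

lemma bij_code:
 "bij_betw (%sm. restrict (code sm) {..<b}) {sm. sm permutes {..<b}} (\<Pi>\<^sub>E j\<in>{..<b}. {..j})"
proof -
 let ?f = "%sm. restrict (code sm) {..<b}"
 have inj: "inj_on ?f {sm. sm permutes {..<b}}"
 proof (rule inj_onI)
  fix sm ta assume *: "sm \<in> {sm. sm permutes {..<b}}" "ta \<in> {sm. sm permutes {..<b}}" "?f sm = ?f ta"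
  have "code sm j=code ta j" if "j<b" for j
   using fun_cong[OF *(3), of j] that by simp
  with * show "sm=ta" by (intro code_inj) auto
 qed
 have sub: "?f ` {sm. sm permutes {..<b}} \<subseteq> (\<Pi>\<^sub>E j\<in>{..<b}. {..j})"
  using code_le by (auto simp: PiE_iff extensional_def split: if_splits)
 have "card (\<Pi>\<^sub>E j\<in>{..<b}. {..j})=fact b"
  by (subst card_PiE) (simp_all add: fact_prod_Suc atLeast0LessThan)
 moreover have "card (?f ` {sm. sm permutes {..<b}})=fact b"
  using card_image[OF inj] card_permutations[of "{..<b}" b] by simp
 ultimately have "?f ` {sm. sm permutes {..<b}}=(\<Pi>\<^sub>E j\<in>{..<b}. {..j})"
  by (intro card_subset_eq sub finite_PiE) auto
 with inj show ?thesis by (simp add: bij_betw_def)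
qed

definition negs :: "nat list => link_diagram" where
 "negs w=map (%i. (i, Neg)) w"

lemma negs_simps [simp]: "negs []=[]" "negs (i#w)=(i, Neg)#negs w" "negs (w@w')=negs w@negs w'"
 by (simp_all add: negs_def)

lemma valid_negs: "(!!i. i \<in> set w ==> i+2 <= n) ==> valid n (negs w) n"
proof (induction w)
 case (Cons i w)
 have "n-2+2=n" using Cons.prems[of i] by simp
 thus ?case using Cons by (simp del: add_2_eq_Suc')
qed simp

definition code_word :: "nat => (nat => nat) => nat list" where
 "code_word b t=concat (map (%j. rev [j-t j..<j]) [0..<b])"

lemma code_word_Suc: "code_word (Suc b) t=code_word b t@rev [b-t b..<b]"
 by (simp add: code_word_def)

lemma code_word_cong: "(!!j. j<b ==> t j=t' j) ==> code_word b t=code_word b t'"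
 unfolding code_word_def by (intro arg_cong[where f = concat] map_cong) auto

lemma perm_braid_code: "perm_braid b sm=code_word b (code sm)"
 by (simp add: perm_braid_def code_word_def code_def)

lemma set_code_word: "i \<in> set (code_word b t) ==> i+2 <= b"
 by (auto simp: code_word_def)

lemma valid_code_word: "valid b (negs (code_word b t)) b"
 using set_code_word by (intro valid_negs) auto

text \<open>A sum over minimal coset representatives of the permutations of \<open>b\<close> strands
  in those of \<open>b + 1\<close> strands: the last strand moves left past \<open>t\<close>
  others.\<close>

definition insertion :: "complex => nat => vec => vec" where
 "insertion A b ps ep=(\<Sum>t\<le>b. (inverse A^3)^t * run A (negs (rev [b-t..<b])) ps ep)"

primrec symmetrizer :: "complex => nat => vec => vec" where
 "symmetrizer A 0 ps=ps"
| "symmetrizer A (Suc b) ps=insertion A b (symmetrizer A b ps)"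

text \<open>Multiplying out the recursion; the summation index of the last \<open>insertion\<close>
  becomes the last entry of the code.\<close>

lemma symmetrizer_codes:
 "symmetrizer A b ps ep=(\<Sum>t\<in>(\<Pi>\<^sub>E j\<in>{..<b}. {..j}).
   (inverse A^3)^(\<Sum>j<b. t j) * run A (negs (code_word b t)) ps ep)"
proof (induction b arbitrary: ep)
 case 0
 thus ?case by (simp add: code_word_def)
next
 case (Suc b)
 let ?P = "%b. \<Pi>\<^sub>E j\<in>{..<b}. {..j::nat}"
 have inj: "inj_on (%(y, g). g(b := y)) ({..b} \<times> ?P b)"
  using inj_combinator[of b "{..<b}" "%j. {..j}"] by simp
 have P: "?P (Suc b)=(%(y, g). g(b := y)) ` ({..b} \<times> ?P b)"
  unfolding lessThan_Suc by (rule PiE_insert_eq)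
 have "symmetrizer A (Suc b) ps ep=(\<Sum>y\<le>b. (inverse A^3)^y * run A (negs (rev [b-y..<b]))
   (%ep. \<Sum>t\<in>?P b. (inverse A^3)^(\<Sum>j<b. t j) * run A (negs (code_word b t)) ps ep) ep)"
  unfolding symmetrizer.simps insertion_def Suc[abs_def] ..
 also have "\<dots>=(\<Sum>(y, t)\<in>{..b} \<times> ?P b. (inverse A^3)^(y+(\<Sum>j<b. t j)) *
   run A (negs (code_word b t@rev [b-y..<b])) ps ep)"
  unfolding run_sum sum_distrib_left
  by (simp add: sum.cartesian_product run_append power_add mult.assoc)
 also have "\<dots>=(\<Sum>t\<in>?P (Suc b). (inverse A^3)^(\<Sum>j<Suc b. t j) *
   run A (negs (code_word (Suc b) t)) ps ep)"
  unfolding P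
 proof (subst sum.reindex[OF inj], intro sum.cong refl, clarify)
  fix y t assume "t \<in> ?P b"
  have "code_word b (t(b := y))=code_word b t" by (rule code_word_cong) auto
  moreover have "(\<Sum>j<b. (t(b := y)) j)=(\<Sum>j<b. t j)" by (intro sum.cong) auto
  ultimately show "(inverse A^3)^(y+(\<Sum>j<b. t j)) * run A (negs (code_word b t@rev [b-y..<b])) ps ep =
   ((%t. (inverse A^3)^(\<Sum>j<Suc b. t j) * run A (negs (code_word (Suc b) t)) ps ep) \<circ>
    (%(y, g). g(b := y))) (y, t)"
   by (simp add: code_word_Suc add.commute)
 qed
 finally show ?case .
qed

lemma symmetrizer_perms:
 "(\<Sum>sm | sm permutes {..<b}. (inverse A^3)^perm_length b sm * run A (negs (perm_braid b sm)) ps ep) =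
   symmetrizer A b ps ep"
 unfolding symmetrizer_codes sum.reindex_bij_betw[OF bij_code, symmetric]
proof (intro sum.cong refl)
 fix sm
 have "code_word b (restrict (code sm) {..<b})=code_word b (code sm)"
  by (rule code_word_cong) auto
 thus "(inverse A^3)^perm_length b sm * run A (negs (perm_braid b sm)) ps ep =
  (inverse A^3)^(\<Sum>j<b. restrict (code sm) {..<b} j) *
   run A (negs (code_word b (restrict (code sm) {..<b}))) ps ep"
  by (simp add: perm_length_code perm_braid_code)
qed

text \<open>All summands except that for \<open>t = 0\<close> begin with the crossing of the last
  two strands, which is split off.\<close>

lemma insertion_Suc:
 "insertion A (Suc b) ps ep=ps ep+inverse A^3 * insertion A b (elem_op A b Neg ps) ep"
proof -
 have "rev [Suc b-Suc t..<Suc b]=b#rev [b-t..<b]" for t by simp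
 thus ?thesis
  unfolding insertion_def sum.atMost_Suc_shift by (simp add: sum_distrib_left mult.assoc)
qed

lemma insertion_local:
 assumes "length ga=Suc b"
 shows "insertion A b ps (ga@et)=insertion A b (%\<mu>. ps (\<mu>@et)) ga"
 unfolding insertion_def
proof (intro sum.cong refl arg_cong2[where f = "(*)"] run_local_0)
 show "valid (Suc b) (negs (rev [b-t..<b])) (Suc b)" for t by (rule valid_negs) auto
qed (use assms in auto)

lemma symmetrizer_local:
 assumes "length ga=b"
 shows "symmetrizer A b ps (ga@et)=symmetrizer A b (%\<mu>. ps (\<mu>@et)) ga"
 unfolding symmetrizer_codes
 using run_local_0[OF valid_code_word assms] by (intro sum.cong refl) simp

text \<open>The symmetric vectors \<open>A ^ (2 * invs ga)\<close> of \<open>b\<close> strands span together with one more letter the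
 domain; the result is symmetric in all \<open>b + 1\<close> strands.\<close>

lemma insertion_symmetric:
 assumes A: "generic A"
  and ps: "!!ga x. length ga=b ==> ps (ga@[x])=A^(2 * invs ga) * y (cnt ga) x"
  and ga: "length ga=Suc b"
 shows "insertion A b ps ga=A^(2 * invs ga) *
  (inverse A^(2 * b) * qint A (cnt ga) * y (cnt ga-1) True +
   inverse A^(2 * b+2 * cnt ga) * qint A (Suc b - cnt ga) * y (cnt ga) False)"
 using ps ga
proof (induction b arbitrary: ps y ga)
 case 0
 then obtain x where "ga=[x]" by (auto simp: length_Suc_conv)
 with 0 show ?case using 0(1)[of "[]" x] A qint_1 by (cases x) (auto simp: insertion_def)
next
 case (Suc b)
 obtain ga' x where ga: "ga=ga'@[x]" "length ga' = Suc b"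
  using Suc.prems(2) by (cases ga rule: rev_cases) auto
 have nz: "A ~= 0" using A by simp
 define k where "k=cnt ga'"
 have k: "k <= Suc b" using cnt_le[of ga'] ga by (simp add: k_def)
 define B where "B=inverse A"
 have AB: "A*B=1" using nz by (simp add: B_def)
 \<comment> \<open>With the last letter \<open>x\<close> kept fixed, crossing the last two strands
   gives a vector on the other \<open>b + 1\<close> strands that again has the assumed form, with
   these coefficients. So the induction hypothesis applies to it.\<close>
 define y' where "y' j z=(if x then if z then B*A^(2*(b-j)) * y (Suc j) True
    else A*A^(2*(b-j)) * y (Suc j) False
   else if z then (B-A^3)*A^(2*(b-j)) * y (Suc j) False+A * y j True
    else B * y j False)" for j z
 have e: "elem_op A b Neg ps ((dl@[z])@[x])=A^(2 * invs dl) * y' (cnt dl) z" if "length dl=b" for dl z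
 proof -
  define E where "E=A^(2 * invs dl)"
  define X where "X=A^(2*(b - cnt dl))"
  have v: "ps (dl@[u, v])=E*(if u then X * y (Suc (cnt dl)) v else y (cnt dl) v)" for u v
   using Suc.prems(1)[of "dl@[u]" v] that by (simp add: invs_append power_add E_def X_def)
  have "elem_op A b Neg ps (dl@[z, x])=B * ps (dl@[z, x]) +
    A*(cupw A z x * (ps (dl@[True, False])-B^2 * ps (dl@[False, True])))"
   using elem_op_Neg[OF that, of A ps z x "[]"] by (simp add: B_def)
  also have "\<dots>=E * y' (cnt dl) z"
   unfolding v y'_def X_def[symmetric] using AB by (cases x; cases z; simp add: cupw_def; algebra)
  finally show ?thesis by (simp add: E_def)
 qed
 have "insertion A (Suc b) ps ga=ps ga+inverse A^3 *
   insertion A b (%\<mu>. elem_op A b Neg ps (\<mu>@[x])) ga'"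
  using insertion_local[OF ga(2)] by (simp add: insertion_Suc ga)
 also have "insertion A b (%\<mu>. elem_op A b Neg ps (\<mu>@[x])) ga' = A^(2 * invs ga') *
  (inverse A^(2 * b) * qint A k * y' (k-1) True +
   inverse A^(2 * b+2 * k) * qint A (Suc b-k) * y' k False)"
  unfolding k_def by (rule Suc.IH) (use e ga in auto)
 also have "ps ga=A^(2 * invs ga') * y k x"
  using Suc.prems(1)[of ga' x] ga by (simp add: k_def)
 finally have l: "insertion A (Suc b) ps ga=A^(2 * invs ga')*(y k x+B^3 *
  (B^(2 * b) * qint A k * y' (k-1) True+B^(2 * b+2 * k) * qint A (Suc b-k) * y' k False))"
  by (simp add: algebra_simps B_def)
 define m where "m=Suc b-k"
 have b: "Suc b=k+m" using k by (simp add: m_def)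
 define X where "X=A^(2 * m)"
 define K where "K=A^(2 * k)"
 define R where "R=B^(2 * b)"
 define S where "S=B^(2 * k)"
 have "R*B^2=B^(2*(k+m))"
  by (simp add: R_def b[symmetric] power2_eq_square)
 moreover have "X*K=A^(2*(k+m))"
  by (simp add: X_def K_def power_add distrib_left mult.commute)
 moreover have "A^(2*(k+m))*B^(2*(k+m))=1"
  using AB by (simp flip: power_mult_distrib)
 ultimately have "(X*K)*(R*B^2)=1" by simp
 hence h: "X * R*B^2*K=1" by algebra
 have qk: "(A^2-B^2) * qint A k=K-S"
  using generic_denominator[OF A, of 2] by (simp add: qint_alt K_def S_def B_def)
 have f: "inverse A^(2*Suc b)=R*B^2" "B^(2 * b+2 * k)=R*S"
  "inverse A^(2*Suc b+2 * k)=R*B^2*S" "inverse A^(2*Suc b+2*Suc k)=R*B^2*(S*B^2)"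
  by (simp_all add: R_def S_def B_def[symmetric] power_add power2_eq_square)
 show ?case
 proof (cases x)
  case True
  have i: "invs ga=invs ga'+m" "cnt ga=Suc k" "Suc (Suc b)-Suc k=m"
   using ga True by (simp_all add: invs_append k_def m_def)
  \<comment> \<open>For \<open>m = 0\<close> the truncated difference \<open>b - k\<close> in
    \<open>y'\<close> is wrong, but then the factor \<open>qint A m\<close> vanishes.\<close>
  have 1: "qint A m * y' k False=qint A m*(X*B * y (Suc k) False)"
  proof (cases m)
   case (Suc m')
   hence "b-k=m'" using b by simp
   hence "y' k False=A*A^(2 * m') * y (Suc k) False" using True by (simp add: y'_def)
   moreover have "X=A^2*A^(2 * m')" by (simp add: X_def Suc power2_eq_square)
   moreover have "A*Z*Y=A^2*Z*B*Y" for Z Y using AB by algebra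
   ultimately show ?thesis by simp
  qed simp
  have 2: "qint A k * y' (k-1) True=qint A k*(B*X * y k True)"
   using b by (cases k) (simp_all add: y'_def True X_def)
  have e: "y k True+B^3*(R*(qint A k*(B*X * y k True))+R*S*(qint A m*(X*B * y (Suc k) False))) =
   X*(R*B^2*(K+B^2 * qint A k) * y k True+R*B^2*(S*B^2) * qint A m * y (Suc k) False)"
   using h by algebra
  have "insertion A (Suc b) ps ga=A^(2 * invs ga')*(y k True+B^3 *
    (R*(qint A k * y' (k-1) True)+R*S*(qint A m * y' k False)))"
   unfolding l f(2) m_def[symmetric] R_def[symmetric] using True by (simp add: mult.assoc)
  also have "\<dots>=A^(2 * invs ga')*X*(R*B^2 * qint A (Suc k) * y k True +
    R*B^2*(S*B^2) * qint A m * y (Suc k) False)"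
   unfolding 1 2 e qint_Suc[OF A, of k, folded K_def B_def] by (simp only: mult.assoc)
  finally show ?thesis
   unfolding i(2,3) f diff_Suc_1 unfolding i(1) distrib_left power_add X_def .
 next
  case False
  have i: "invs ga=invs ga'" "cnt ga=k" "Suc (Suc b)-k=Suc m"
   using ga False k by (simp_all add: invs_append k_def m_def)
  have 1: "qint A m * y' k False=qint A m*(B * y k False)"
   using False by (simp add: y'_def)
  have 2: "qint A k * y' (k-1) True=qint A k*((B-A^3)*X * y k False+A * y (k-1) True)"
   using b by (cases k) (simp_all add: y'_def False X_def)
  have e: "y k False+B^3*(R*(qint A k*((B-A^3)*X * y k False+A * y (k-1) True)) +
    R*S*(qint A m*(B * y k False))) =
   R*B^2 * qint A k * y (k-1) True+R*B^2*S*(X+B^2 * qint A m) * y k False"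
   using h qk AB by algebra
  have "insertion A (Suc b) ps ga=A^(2 * invs ga')*(y k False+B^3 *
    (R*(qint A k * y' (k-1) True)+R*S*(qint A m * y' k False)))"
   unfolding l f(2) m_def[symmetric] R_def[symmetric] using False by (simp add: mult.assoc)
  also have "\<dots>=A^(2 * invs ga')*(R*B^2 * qint A k * y (k-1) True +
    R*B^2*S * qint A (Suc m) * y k False)"
   unfolding 1 2 e qint_Suc[OF A, of m, folded X_def B_def] by (simp only: mult.assoc)
  finally show ?thesis
   unfolding i f .
 qed
qed

text \<open>The matrix of the Jones-Wenzl idempotent: on each letter count, the orthogonal
  projection onto the symmetric vector \<open>A^(2 * invs ga)\<close> for the bilinear pairing,
  whose pairing with itself is \<open>gauss\<close>.\<close>

definition sym_kernel :: "complex => nat => bool list => bool list => complex" where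
 "sym_kernel A b ga bt =
   (if cnt ga=cnt bt then A^(2 * invs ga+2 * invs bt)/gauss A b (cnt ga) else 0)"

lemma gauss_ratio_True:
 assumes "generic A" "k <= b"
 shows "qint A (Suc k)/gauss A b k=A^(2*(b-k)) * qint A (Suc b)/gauss A (Suc b) (Suc k)"
proof -
 have e: "2*Suc k*(b-k)=2 * k*(b-k)+2*(b-k)" by simp
 show ?thesis
  using assms qfact_nz[of A] qint_nz[OF assms(1)]
  unfolding gauss_eq[OF assms] gauss_eq[OF assms(1), of "Suc k" "Suc b", unfolded diff_Suc_Suc, OF Suc_leI, OF le_imp_less_Suc, OF assms(2)]
  unfolding qfact_Suc e power_add by (simp add: field_simps)
qed

lemma gauss_ratio_False:
 assumes "generic A" "k <= b"
 shows "qint A (Suc b-k)/gauss A b k=A^(2 * k) * qint A (Suc b)/gauss A (Suc b) k"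
proof -
 have e: "2 * k*(Suc (b-k))=2 * k*(b-k)+2 * k" "Suc b-k=Suc (b-k)"
  using assms by (simp_all add: Suc_diff_le)
 have k: "k <= Suc b" using assms by simp
 show ?thesis
  using assms qfact_nz[of A] qint_nz[OF assms(1)]
  unfolding gauss_eq[OF assms] gauss_eq[OF assms(1) k] e(2)
  unfolding qfact_Suc e(1) power_add by (simp add: field_simps)
qed

text \<open>By induction the symmetrizer of \<open>b\<close> strands yields symmetric vectors, so
  \<open>insertion_symmetric\<close> describes the effect of the next strand. Its two terms match
  the words ending in \<open>True\<close> and in \<open>False\<close>, after rewriting ratios of
  neighbouring Gaussian binomials.\<close>

lemma symmetrizer_kernel:
 assumes A: "generic A" and "length ga=b"
 shows "A^(b*(b-1)) * symmetrizer A b u ga=qfact A b*(\<Sum>bt\<in>words b. sym_kernel A b ga bt * u bt)"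
 using assms(2)
proof (induction b arbitrary: u ga)
 case 0
 thus ?case by (simp add: sym_kernel_def)
next
 case (Suc b)
 have nz: "A ~= 0" using A by simp
 define M where "M x k=(\<Sum>bt\<in>words b. (if cnt bt=k then A^(2 * invs bt) else 0) * u (bt@[x]))" for x k
 define y where "y k x=inverse A^(b*(b-1))*(qfact A b/gauss A b k*M x k)" for k x
 have sy: "symmetrizer A b u (dl@[x])=A^(2 * invs dl) * y (cnt dl) x" if "length dl=b" for dl x
 proof -
  have "A^(b*(b-1)) * symmetrizer A b u (dl@[x]) =
   qfact A b*(\<Sum>bt\<in>words b. sym_kernel A b dl bt * u (bt@[x]))"
   unfolding symmetrizer_local[OF that] by (rule Suc.IH[OF that])
  also have "(\<Sum>bt\<in>words b. sym_kernel A b dl bt * u (bt@[x])) =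
   A^(2 * invs dl)/gauss A b (cnt dl)*M x (cnt dl)"
   unfolding M_def sum_distrib_left
   by (intro sum.cong refl) (auto simp: sym_kernel_def power_add)
  finally have "inverse A^(b*(b-1))*(A^(b*(b-1)) * symmetrizer A b u (dl@[x])) =
    A^(2 * invs dl) * y (cnt dl) x"
   by (simp add: y_def)
  thus ?thesis using nz by (simp add: power_inverse flip: mult.assoc)
 qed
 define k where "k=cnt ga"
 have k: "k <= Suc b" using cnt_le[of ga] Suc.prems by (simp add: k_def)
 have "symmetrizer A (Suc b) u ga=A^(2 * invs ga) *
  (inverse A^(2 * b) * qint A k * y (k-1) True +
   inverse A^(2 * b+2 * k) * qint A (Suc b-k) * y k False)"
  using insertion_symmetric[OF A sy Suc.prems] by (simp add: k_def)
 also have "A^(Suc b*(Suc b-1))*\<dots>=A^(2 * invs ga) *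
  (qfact A b*(qint A k/gauss A b (k-1)*M True (k-1)) +
   inverse A^(2 * k)*(qfact A b*(qint A (Suc b-k)/gauss A b k*M False k)))"
 proof -
  have "Suc b*(Suc b-1)=b*(b-1)+2 * b" by (cases b) (simp_all add: algebra_simps)
  moreover have "A^(b*(b-1)) * inverse A^(b*(b-1))=1" "A^(2 * b) * inverse A^(2 * b)=1"
   using nz by (simp_all add: power_inverse)
  moreover have "(p * p')*(E*(q' * f1*(q*(h/d1*M1))+q' * r * f2*(q*(h/d2*M2)))) =
    E*(h*(f1/d1*M1)+r*(h*(f2/d2*M2)))"
   if "p * q=1" "p' * q' = 1" for p p' q q' E f1 f2 M1 M2 d1 d2 h r :: complex
  proof -
   have "(p * p')*(E*(q' * f1*(q*(h * e1*M1))+q' * r * f2*(q*(h * e2*M2)))) =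
    E*(h*(f1 * e1*M1)+r*(h*(f2 * e2*M2)))" for e1 e2 using that by algebra
   thus ?thesis unfolding divide_inverse .
  qed
  ultimately show ?thesis unfolding y_def power_add by (simp only: power_add)
 qed
 also have "qfact A b*(qint A k/gauss A b (k-1)*M True (k-1)) =
  qfact A (Suc b)/gauss A (Suc b) k*(\<Sum>bt\<in>words b. (if Suc (cnt bt)=k then A^(2 * invs (bt@[True])) else 0) * u (bt@[True]))"
 proof (cases k)
  case 0 thus ?thesis by simp
 next
  case (Suc k')
  have "(\<Sum>bt\<in>words b. (if Suc (cnt bt)=k then A^(2 * invs (bt@[True])) else 0) * u (bt@[True])) =
   A^(2*(b-k'))*M True k'"
   unfolding M_def sum_distrib_left
   by (intro sum.cong refl) (auto simp: invs_append Suc power_add)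
  thus ?thesis
   using gauss_ratio_True[OF A, of k' b] k Suc by (simp add: qfact_Suc)
 qed
 also have "inverse A^(2 * k)*(qfact A b*(qint A (Suc b-k)/gauss A b k*M False k)) =
  qfact A (Suc b)/gauss A (Suc b) k*(\<Sum>bt\<in>words b. (if cnt bt=k then A^(2 * invs (bt@[False])) else 0) * u (bt@[False]))"
 proof (cases "k <= b")
  case True
  have "(\<Sum>bt\<in>words b. (if cnt bt=k then A^(2 * invs (bt@[False])) else 0) * u (bt@[False]))=M False k"
   unfolding M_def by (intro sum.cong refl) (simp add: invs_append)
  thus ?thesis
   unfolding gauss_ratio_False[OF A True] using nz by (simp add: qfact_Suc power_inverse)
 next
  case False
  hence "cnt bt ~= k" if "bt \<in> words b" for bt using cnt_le[of bt] that by auto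
  thus ?thesis using False k by (simp add: M_def)
 qed
 also have "A^(2 * invs ga)*(qfact A (Suc b)/gauss A (Suc b) k * p+qfact A (Suc b)/gauss A (Suc b) k * q) =
   qfact A (Suc b)*(A^(2 * invs ga)/gauss A (Suc b) k*(p+q))" for p q
  by (simp add: algebra_simps add_divide_distrib)
 also have "(\<Sum>bt\<in>words b. (if Suc (cnt bt)=k then A^(2 * invs (bt@[True])) else 0) * u (bt@[True])) +
   (\<Sum>bt\<in>words b. (if cnt bt=k then A^(2 * invs (bt@[False])) else 0) * u (bt@[False])) =
   (\<Sum>bt\<in>words (Suc b). (if cnt bt=k then A^(2 * invs bt) else 0) * u bt)"
  unfolding sum_words_snoc by simp
 also have "A^(2 * invs ga)/gauss A (Suc b) k*\<dots>=(\<Sum>bt\<in>words (Suc b). sym_kernel A (Suc b) ga bt * u bt)"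
  unfolding sum_distrib_left by (intro sum.cong refl) (auto simp: sym_kernel_def k_def power_add)
 finally show ?case .
qed

lemma symmetrizer_perms_kernel:
 assumes "generic A" "length ga=b"
 shows "(\<Sum>sm | sm permutes {..<b}. A^(b*(b-1))*A powi (- 3 * int (perm_length b sm)) *
   run A (negs (perm_braid b sm)) u ga)=qfact A b*(\<Sum>bt\<in>words b. sym_kernel A b ga bt * u bt)"
proof -
 have "A powi (- 3 * int l)=(inverse A^3)^l" for l
 proof -
  have "A powi (- (int (3 * l)))=inverse (A^(3 * l))" by (simp only: power_int_minus power_int_of_nat)
  thus ?thesis by (simp add: power_mult power_inverse)
 qed
 thus ?thesis
  unfolding symmetrizer_kernel[OF assms, symmetric] symmetrizer_perms[symmetric]
  by (simp add: sum_distrib_left mult.assoc)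
qed

definition sym_op :: "complex => nat => nat => vec => vec" where
 "sym_op A q b = op q b b (sym_kernel A b)"

lemma sym_op_app:
 "length al=q ==> length ga=b ==>
  sym_op A q b v (al@ga@et)=(\<Sum>bt\<in>words b. sym_kernel A b ga bt * v (al@bt@et))"
 by (simp add: sym_op_def op_app)

lemma supp_sym_op: "supp N v ==> q+b <= N ==> supp N (sym_op A q b v)"
 unfolding sym_op_def by (rule supp_op) auto

lemma sym_kernel_commute: "sym_kernel A b ga bt=sym_kernel A b bt ga"
 by (simp add: sym_kernel_def add.commute)

lemma sym_kernel_flip:
 assumes "length ga=b" "length bt=b"
 shows "sym_kernel A b (flip ga) (flip bt)=sym_kernel A b ga bt"
proof -
 have "cnt (flip ga)=cnt (flip bt) \<longleftrightarrow> cnt ga=cnt bt"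
  using cnt_le[of ga] cnt_le[of bt] assms by (auto simp: cnt_flip)
 moreover have "gauss A b (cnt (flip ga))=gauss A b (cnt ga)"
  using gauss_flip[of "cnt ga" b] cnt_le[of ga] assms by (simp add: cnt_flip)
 ultimately show ?thesis by (simp add: sym_kernel_def invs_flip)
qed

text \<open>The sum over words of a given count is the Gaussian binomial in the denominator of the
  kernel.\<close>

lemma sym_kernel_fixes:
 assumes A: "generic A" and ga: "length ga=b"
 shows "(\<Sum>bt\<in>words b. sym_kernel A b ga bt*(A^(2 * invs bt) * y (cnt bt)))=A^(2 * invs ga) * y (cnt ga)"
proof -
 have "(\<Sum>bt\<in>words b. sym_kernel A b ga bt*(A^(2 * invs bt) * y (cnt bt))) =
  A^(2 * invs ga) * y (cnt ga)/gauss A b (cnt ga) * gauss A b (cnt ga)"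
  unfolding gauss_if[of A b "cnt ga"] sum_distrib_left
 proof (intro sum.cong refl)
  fix bt :: "bool list"
  have "A^(4 * invs bt)=A^(2 * invs bt)*A^(2 * invs bt)" by (simp flip: power_add)
  thus "sym_kernel A b ga bt*(A^(2 * invs bt) * y (cnt bt)) =
   A^(2 * invs ga) * y (cnt ga)/(\<Sum>ep\<in>words b. if cnt ep=cnt ga then A^(4 * invs ep) else 0) *
   (if cnt bt=cnt ga then A^(4 * invs bt) else 0)"
   by (simp add: sym_kernel_def power_add gauss_if)
 qed
 also have "\<dots>=A^(2 * invs ga) * y (cnt ga)"
  using gauss_nz[OF A, of "cnt ga" b] cnt_le[of ga] ga by simp
 finally show ?thesis .
qed

lemma sym_op_idem:
 assumes A: "generic A" and v: "supp N v" "q+b <= N"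
 shows "sym_op A q b (sym_op A q b v)=sym_op A q b v"
proof (rule supp_eqI)
 show "supp N (sym_op A q b (sym_op A q b v))" "supp N (sym_op A q b v)"
  using v by (auto intro!: supp_sym_op)
 fix ep :: "bool list" assume "length ep=N"
 then obtain al ga et where e: "ep=al@ga@et" "length al=q" "length ga=b"
  using split3[of q b ep] v by auto
 define y where "y k=(\<Sum>bt\<in>words b. (if k=cnt bt then A^(2 * invs bt)/gauss A b k else 0) * v (al@bt@et))" for k
 have 1: "sym_op A q b v (al@dl@et)=A^(2 * invs dl) * y (cnt dl)" if "length dl=b" for dl
  unfolding sym_op_app[OF e(2) that] y_def sum_distrib_left
  by (intro sum.cong refl) (simp add: sym_kernel_def power_add)
 have "sym_op A q b (sym_op A q b v) ep=(\<Sum>bt\<in>words b. sym_kernel A b ga bt*(A^(2 * invs bt) * y (cnt bt)))"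
  unfolding e(1) sym_op_app[OF e(2,3)] by (intro sum.cong refl) (simp add: 1)
 also have "\<dots>=sym_op A q b v ep"
  using sym_kernel_fixes[OF A e(3)] 1[OF e(3)] e by simp
 finally show "sym_op A q b (sym_op A q b v) ep=sym_op A q b v ep" .
qed

lemma sym_op_commute_aux:
 "q+b <= q' ==> sym_op A q b (sym_op A q' b' v)=sym_op A q' b' (sym_op A q b v)"
 unfolding sym_op_def using op_op_far[of q b b _ "q'-q-b" b' b' _ v] by simp

lemma sym_op_commute:
 "q+b <= q' \<or> q'+b' <= q ==> sym_op A q b (sym_op A q' b' v)=sym_op A q' b' (sym_op A q b v)"
 using sym_op_commute_aux[of q b q' A b' v] sym_op_commute_aux[of q' b' q A b v] by auto

text \<open>Back from the projector to braids: what slides through all braids slides through the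
  projector, and the sum over permutations in the Penrose evaluation is recognized as a
  projector.\<close>

lemma sym_op_perms:
 assumes A: "generic A" and ep: "q+b <= length ep"
 shows "qfact A b * sym_op A q b v ep=(\<Sum>sm | sm permutes {..<b}.
   (A^(b*(b-1))*A powi (- 3 * int (perm_length b sm))) * run A (shift q (negs (perm_braid b sm))) v ep)"
proof -
 obtain al ga et where e: "ep=al@ga@et" "length al=q" "length ga=b"
  using split3[OF ep] by auto
 have "run A (shift q (negs (perm_braid b sm))) v ep =
  run A (negs (perm_braid b sm)) (%\<mu>. v (al@\<mu>@et)) ga" for sm
  unfolding e(1) perm_braid_code by (rule run_local[OF valid_code_word]) (use e in auto)
 thus ?thesis
  using symmetrizer_perms_kernel[OF A e(3), of "%\<mu>. v (al@\<mu>@et)"] e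
  by (simp add: sym_op_app)
qed

lemma run_sym_op_left:
 assumes "valid n D m" "k+b <= q" "supp N v" "q+n <= N"
 shows "run A (shift q D) (sym_op A k b v)=sym_op A k b (run A (shift q D) v)"
 unfolding sym_op_def using assms by (intro run_op_left[where d = "q-k-b"]) auto

lemma run_sym_op_right:
 assumes "valid n D m" "supp N v" "q+n <= k" "k+b <= N"
 shows "run A (shift q D) (sym_op A k b v)=sym_op A (k-n+m) b (run A (shift q D) v)"
 unfolding sym_op_def using run_op_right[OF assms(1,2), of q "k-q-n" b A "sym_kernel A b"] assms
 by (simp add: algebra_simps)

section \<open>Cabled local minima and maxima\<close>

definition cups :: "nat => link_diagram" where
 "cups c=map (%i. (i, Cup)) [0..<c]"

definition caps :: "nat => link_diagram" where
 "caps c=map (%i. (i, Cap)) (rev [0..<c])"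

lemma cups_Suc: "cups (Suc c)=cups c@[(c, Cup)]"
 by (simp add: cups_def)

lemma caps_Suc: "caps (Suc c)=(c, Cap) # caps c"
 by (simp add: caps_def)

lemma valid_cups: "valid 0 (cups c) (c + c)"
proof (induction c)
 case (Suc c)
 thus ?case by (auto simp: cups_Suc valid_append)
qed (simp add: cups_def)

lemma valid_caps: "valid (c + c) (caps c) 0"
proof (induction c)
 case (Suc c)
 thus ?case by (auto simp: caps_Suc)
qed (simp add: caps_def)

lemma flip_snoc: "flip (al@[x])=(\<not> x)#flip al"
 by (simp add: flip_def)

lemma run_cups_0:
 "length al=c ==> length bt=c ==>
  run A (cups c) u (al@bt)=(if bt=flip al then (- (A^2)) ^ cnt al * u [] else 0)"
proof (induction c arbitrary: al bt)
 case (Suc c)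
 obtain al' x where a: "al=al'@[x]" "length al' = c" using Suc.prems(1) by (cases al rule: rev_cases) auto
 obtain y bt' where b: "bt=y#bt'" "length bt' = c" using Suc.prems(2) by (cases bt) auto
 show ?case
  using Suc.IH[OF a(2) b(2)] by (auto simp: a b cups_Suc run_append elem_op_Cup cupw_def flip_snoc)
qed (simp add: cups_def)

lemma run_caps_0:
 "run A (caps c) u []=(\<Sum>al\<in>words c. (- (inverse A^2))^(c - cnt al) * u (al@flip al))"
proof (induction c arbitrary: u)
 case (Suc c)
 have "run A (caps (Suc c)) u [] =
  (\<Sum>al\<in>words c. (- (inverse A^2))^(c - cnt al) * elem_op A c Cap u (al@flip al))"
  by (simp add: caps_Suc Suc)
 also have "\<dots>=(\<Sum>al\<in>words c. \<Sum>bt\<in>words 1. (- (inverse A^2))^(Suc c - cnt (al@bt)) *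
   u ((al@bt)@flip (al@bt)))"
 proof (intro sum.cong refl)
  fix al assume "al \<in> words c"
  hence "length al=c" "Suc c - cnt al=Suc (c - cnt al)" using cnt_le[of al] by auto
  thus "(- (inverse A^2))^(c - cnt al) * elem_op A c Cap u (al@flip al) =
   (\<Sum>bt\<in>words 1. (- (inverse A^2))^(Suc c - cnt (al@bt)) * u ((al@bt)@flip (al@bt)))"
   by (simp add: elem_op_Cap sum_words_Suc flip_snoc algebra_simps)
 qed
 also have "\<dots>=(\<Sum>al\<in>words (Suc c). (- (inverse A^2))^(Suc c - cnt al) * u (al@flip al))"
  using sum_words_add[of "%al. (- (inverse A^2))^(Suc c - cnt al) * u (al@flip al)" c 1] by simp
 finally show ?case .
qed (simp add: caps_def)

lemma run_cups:
 assumes "length al=q" "length ga1=c" "length ga2=c"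
 shows "run A (shift q (cups c)) v (al@ga1@ga2@et) =
  (if ga2=flip ga1 then (- (A^2)) ^ cnt ga1 * v (al@et) else 0)"
 using run_local[OF valid_cups[of c] assms(1), of "ga1@ga2" A v et] run_cups_0[OF assms(2,3), of A] assms by simp

lemma run_caps:
 assumes "length al=q"
 shows "run A (shift q (caps c)) v (al@et) =
  (\<Sum>ga\<in>words c. (- (inverse A^2))^(c - cnt ga) * v (al@ga@flip ga@et))"
 using run_local[OF valid_caps[of c] assms, of "[]" A v et] by (simp add: run_caps_0)

text \<open>Nested arcs carry \<open>ga\<close> on one side and \<open>flip ga\<close> on the other,
  with a weight that depends on \<open>cnt ga\<close> only, and the kernel is invariant under
  \<open>flip\<close>. Thus a symmetrizer may be moved around a local minimum.\<close>

lemma sym_op_cups: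
 assumes v: "supp N v" "q <= N"
 shows "sym_op A q c (run A (shift q (cups c)) v)=sym_op A (q + c) c (run A (shift q (cups c)) v)"
proof (rule supp_eqI)
 have s: "supp (N+2 * c) (run A (shift q (cups c)) v)"
  by (rule supp_run[OF v(1) valid_shift[OF valid_cups]]) (use v in auto)
 show "supp (N+2 * c) (sym_op A q c (run A (shift q (cups c)) v))"
  "supp (N+2 * c) (sym_op A (q + c) c (run A (shift q (cups c)) v))"
  using s v by (auto intro!: supp_sym_op)
 fix ep :: "bool list" assume "length ep=N+2 * c"
 hence "q + c+0 + c <= length ep" using v by simp
 then obtain al ga1 dl ga2 et where e': "ep=al@ga1@dl@ga2@et" "length al=q" "length ga1=c"
  "length dl=0" "length ga2=c" by (rule split5)
 hence e: "ep=al@ga1@ga2@et" by simp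
 let ?w = "v (al@et)"
 have "sym_op A q c (run A (shift q (cups c)) v) ep=(\<Sum>bt\<in>words c.
   if bt=flip ga2 then sym_kernel A c ga1 bt*((- (A^2)) ^ cnt bt * ?w) else 0)"
  using e' by (auto simp: e sym_op_app run_cups flip_eq_iff intro!: sum.cong)
 also have "\<dots>=sym_kernel A c ga1 (flip ga2)*((- (A^2)) ^ cnt (flip ga2) * ?w)"
  using e' by simp
 also have "\<dots>=sym_kernel A c ga2 (flip ga1)*((- (A^2)) ^ cnt ga1 * ?w)"
 proof -
  have "sym_kernel A c ga1 (flip ga2)=sym_kernel A c ga2 (flip ga1)"
   using sym_kernel_flip[of "flip ga1" c ga2 A] e' sym_kernel_commute[of A c ga2 "flip ga1"] by simp
  moreover have "sym_kernel A c ga1 (flip ga2)=0" if "cnt (flip ga2) ~= cnt ga1"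
   using that by (simp add: sym_kernel_def)
  ultimately show ?thesis by (cases "cnt (flip ga2)=cnt ga1") auto
 qed
 also have "\<dots>=(\<Sum>bt\<in>words c. if bt=flip ga1 then sym_kernel A c ga2 bt*((- (A^2)) ^ cnt ga1 * ?w) else 0)"
  using e' by simp
 also have "\<dots>=(\<Sum>bt\<in>words c. sym_kernel A c ga2 bt * run A (shift q (cups c)) v (al@ga1@bt@et))"
  using e' by (intro sum.cong) (auto simp: run_cups)
 also have "\<dots>=sym_op A (q + c) c (run A (shift q (cups c)) v) ep"
  using e' sym_op_app[of "al@ga1" "q + c" ga2 c A "run A (shift q (cups c)) v" et]
  by (simp add: e)
 finally show "sym_op A q c (run A (shift q (cups c)) v) ep =
  sym_op A (q + c) c (run A (shift q (cups c)) v) ep" .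
qed

lemma sym_op_caps:
 assumes v: "supp N v" "q+2 * c <= N"
 shows "run A (shift q (caps c)) (sym_op A q c v)=run A (shift q (caps c)) (sym_op A (q + c) c v)"
proof (rule supp_eqI)
 have V: "valid N (shift q (caps c)) (N-2 * c)"
  by (rule valid_shift[OF valid_caps]) (use v in auto)
 show "supp (N-2 * c) (run A (shift q (caps c)) (sym_op A q c v))"
  "supp (N-2 * c) (run A (shift q (caps c)) (sym_op A (q + c) c v))"
  using v by (auto intro!: supp_run[OF _ V] supp_sym_op)
 fix ep :: "bool list" assume "length ep=N-2 * c"
 hence "q <= length ep" using v by simp
 then obtain al et where e: "ep=al@et" "length al=q" by (rule split_len)
 let ?w = "%ga. (- (inverse A^2))^(c - cnt ga)"
 have 1: "sym_op A q c v (al@ga@flip ga@et)=(\<Sum>bt\<in>words c. sym_kernel A c ga bt * v (al@bt@flip ga@et))"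
  if "length ga=c" for ga using sym_op_app[OF e(2) that] by simp
 have 2: "sym_op A (q + c) c v (al@ga@flip ga@et) =
   (\<Sum>bt\<in>words c. sym_kernel A c ga bt * v (al@ga@flip bt@et))" if "length ga=c" for ga
 proof -
  have "sym_op A (q + c) c v (al@ga@flip ga@et) =
   (\<Sum>bt\<in>words c. sym_kernel A c (flip ga) bt * v (al@ga@bt@et))"
   using sym_op_app[of "al@ga" "q + c" "flip ga" c A v et] e that by simp
  also have "\<dots>=(\<Sum>bt\<in>words c. sym_kernel A c (flip ga) (flip bt) * v (al@ga@flip bt@et))"
   by (rule sum_words_flip[symmetric])
  finally show ?thesis using that by (simp add: sym_kernel_flip)
 qed
 have "run A (shift q (caps c)) (sym_op A q c v) ep =
  (\<Sum>ga\<in>words c. \<Sum>bt\<in>words c. ?w ga*(sym_kernel A c ga bt * v (al@bt@flip ga@et)))"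
  unfolding e(1) run_caps[OF e(2)] by (intro sum.cong refl) (simp add: 1 sum_distrib_left)
 also have "\<dots>=(\<Sum>ga\<in>words c. \<Sum>bt\<in>words c. ?w bt*(sym_kernel A c ga bt * v (al@ga@flip bt@et)))"
  by (subst sum.swap) (simp add: sym_kernel_commute)
 also have "\<dots>=(\<Sum>ga\<in>words c. \<Sum>bt\<in>words c. ?w ga*(sym_kernel A c ga bt * v (al@ga@flip bt@et)))"
  by (intro sum.cong refl) (simp add: sym_kernel_def)
 also have "\<dots>=run A (shift q (caps c)) (sym_op A (q + c) c v) ep"
  unfolding e(1) run_caps[OF e(2)] by (intro sum.cong refl) (simp add: 2 sum_distrib_left)
 finally show "run A (shift q (caps c)) (sym_op A q c v) ep =
  run A (shift q (caps c)) (sym_op A (q + c) c v) ep" .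
qed

section \<open>Cabled crossings\<close>

lemma elem_op_far:
 assumes "k+2 <= l" "p \<in> {Pos, Neg}" "p' \<in> {Pos, Neg}"
 shows "elem_op A k p (elem_op A l p' v)=elem_op A l p' (elem_op A k p v)"
proof -
 obtain d where l: "l=k+2+d" using assms(1) le_Suc_ex by blast
 have "n_in p=2" "n_out p=2" "n_in p' = 2" "n_out p' = 2" using assms by auto
 thus ?thesis
  using op_op_far[of k 2 2 "ekernel A p" d 2 2 "ekernel A p'" v] by (simp only: elem_op_def l)
qed

lemma elem_op_short: "length ep<k+n_out p ==> elem_op A k p v ep=0"
 by (simp add: elem_op_def op_short)

lemma crossing_values:
 assumes "length al=k" "A ~= 0"
 shows "elem_op A k Pos v (al@True#True#et)=A * v (al@True#True#et)"
  "elem_op A k Pos v (al@False#False#et)=A * v (al@False#False#et)"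
  "elem_op A k Pos v (al@True#False#et)=inverse A * v (al@False#True#et)"
  "elem_op A k Pos v (al@False#True#et) =
   inverse A * v (al@True#False#et)+(A-inverse A^3) * v (al@False#True#et)"
  "elem_op A k Neg v (al@True#True#et)=inverse A * v (al@True#True#et)"
  "elem_op A k Neg v (al@False#False#et)=inverse A * v (al@False#False#et)"
  "elem_op A k Neg v (al@True#False#et) =
   (inverse A-A^3) * v (al@True#False#et)+A * v (al@False#True#et)"
  "elem_op A k Neg v (al@False#True#et)=A * v (al@True#False#et)"
proof -
 define B where "B=inverse A"
 have AB: "A*B=1" using assms by (simp add: B_def)
 note e = elem_op_Pos[OF assms(1), of A v, folded B_def] elem_op_Neg[OF assms(1), of A v, folded B_def]
 show "elem_op A k Pos v (al@True#True#et)=A * v (al@True#True#et)"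
  "elem_op A k Pos v (al@False#False#et)=A * v (al@False#False#et)"
  "elem_op A k Neg v (al@True#True#et)=inverse A * v (al@True#True#et)"
  "elem_op A k Neg v (al@False#False#et)=inverse A * v (al@False#False#et)"
  by (simp_all add: e cupw_def B_def)
 show "elem_op A k Pos v (al@True#False#et)=inverse A * v (al@False#True#et)"
  unfolding e B_def[symmetric] cupw_def using AB by simp algebra
 show "elem_op A k Pos v (al@False#True#et) =
   inverse A * v (al@True#False#et)+(A-inverse A^3) * v (al@False#True#et)"
  unfolding e B_def[symmetric] cupw_def by (simp add: algebra_simps power2_eq_square power3_eq_cube)
 show "elem_op A k Neg v (al@True#False#et) =
   (inverse A-A^3) * v (al@True#False#et)+A * v (al@False#True#et)"
  unfolding e B_def[symmetric] cupw_def using AB by simp algebra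
 show "elem_op A k Neg v (al@False#True#et)=A * v (al@True#False#et)"
  unfolding e B_def[symmetric] cupw_def using AB by simp algebra
qed

text \<open>The third Reidemeister move for a strand crossing two others by \<open>p\<close>,
  checked on the eight words of three letters. For the crossing of these two others
  \<open>Neg\<close> suffices, since symmetrizers are built from negative braids.\<close>

lemma yang_baxter:
 assumes A: "A ~= 0" and p: "p \<in> {Pos, Neg}"
 shows "elem_op A (Suc i) p (elem_op A i p (elem_op A (Suc i) Neg v)) =
  elem_op A i Neg (elem_op A (Suc i) p (elem_op A i p v))"
proof
 fix ep :: "bool list"
 show "elem_op A (Suc i) p (elem_op A i p (elem_op A (Suc i) Neg v)) ep =
  elem_op A i Neg (elem_op A (Suc i) p (elem_op A i p v)) ep"
 proof (cases "i+3 <= length ep")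
  case True
  then obtain al ga et where e: "ep=al@ga@et" "length al=i" "length ga=3" by (rule split3)
  then obtain x y z where g: "ga=[x, y, z]" by (auto simp: numeral_3_eq_3 length_Suc_conv)
  define B where "B=inverse A"
  have AB: "A*B=1" using A by (simp add: B_def)
  note r = crossing_values[OF e(2) A, folded B_def]
  have r': "elem_op A (Suc i) p' u (al @ c#\<zeta>)=elem_op A (Suc i) p' u ((al@[c])@\<zeta>)" for p' u c \<zeta>
   by simp
  have r'': "length (al@[c])=Suc i" for c using e by simp
  note s = crossing_values[OF r'' A, folded B_def, unfolded append.assoc append_Cons append_Nil]
  consider "p=Pos" | "p=Neg" using p by auto
  thus ?thesis
  proof cases
   case 1
   show ?thesis
    unfolding e(1) g 1 append_Cons append_Nil using AB
    by (cases x rule: bool.exhaust; cases y rule: bool.exhaust; cases z rule: bool.exhaust;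
      simp only: r s; (algebra | simp add: algebra_simps))
  next
   case 2
   show ?thesis
    unfolding e(1) g 2 append_Cons append_Nil using AB
    by (cases x rule: bool.exhaust; cases y rule: bool.exhaust; cases z rule: bool.exhaust;
      simp only: r s; (algebra | simp add: algebra_simps))
  qed
 next
  case False
  hence "elem_op A (Suc i) p u ep=0" for u using p by (auto intro!: elem_op_short)
  moreover have "elem_op A i Neg (elem_op A (Suc i) p u) ep=0" for u
   unfolding elem_op_def[of A i] op_def[of i]
   using False p by (auto intro!: sum.neutral elem_op_short)
  ultimately show ?thesis by simp
 qed
qed

definition pass :: "elem => nat => link_diagram" where
 "pass p b=map (%j. (j, p)) [0..<b]"

definition pass_left :: "elem => nat => link_diagram" where
 "pass_left p a=map (%i. (i, p)) (rev [0..<a])"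

definition cross :: "elem => nat => nat => link_diagram" where
 "cross p a b=concat (map (%i. shift i (pass p b)) (rev [0..<a]))"

text \<open>The same grid of crossings as in \<open>cross\<close>, ordered by the strands that move
  left. Reversing \<open>cross\<close> leads to this order.\<close>

definition cross_left :: "elem => nat => nat => link_diagram" where
 "cross_left p a b=concat (map (%j. shift j (pass_left p a)) [0..<b])"

lemma cable_crossing_cross: "cable_crossing p q a b=shift q (cross p a b)"
 by (simp add: cable_crossing_def cross_def pass_def shift_def map_concat o_def add.assoc)

lemma cross_0 [simp]: "cross p 0 b=[]"
 by (simp add: cross_def)

lemma cross_Suc: "cross p (Suc a) b=shift a (pass p b) @ cross p a b"
 by (simp add: cross_def)

lemma valid_crossings:
 "(!!k p. (k, p) \<in> set D ==> p \<in> {Pos, Neg} & k+2 <= n) ==> valid n D n"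
proof (induction D)
 case (Cons x D)
 obtain k p where x: "x=(k, p)" by (cases x)
 have "n-n_in p+n_out p=n" "n_in p=2" using Cons.prems[of k p] x by auto
 moreover have "k+2 <= n" using Cons.prems[of k p] x by auto
 moreover have "valid n D n" by (rule Cons.IH) (use Cons.prems in auto)
 ultimately show ?case by (simp only: x valid.simps)
qed simp

lemma valid_pass: "p \<in> {Pos, Neg} ==> valid (Suc b) (pass p b) (Suc b)"
 by (rule valid_crossings) (auto simp: pass_def)

lemma set_cross: "(k, p') \<in> set (cross p a b) ==> p' = p & k+2 <= a+b"
 by (auto simp: cross_def pass_def shift_def)

lemma valid_cross: "p \<in> {Pos, Neg} ==> valid (a+b) (cross p a b) (a+b)"
 by (rule valid_crossings) (use set_cross in blast)

lemma run_elem_far: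
 assumes "!!k p. (k, p) \<in> set D ==> p \<in> {Pos, Neg} & (k+2 <= l \<or> l+2 <= k)" "p' \<in> {Pos, Neg}"
 shows "run A D (elem_op A l p' v)=elem_op A l p' (run A D v)"
 using assms(1)
proof (induction D arbitrary: v)
 case (Cons x D)
 obtain k p where x: "x=(k, p)" by (cases x)
 have "elem_op A k p (elem_op A l p' v)=elem_op A l p' (elem_op A k p v)"
  using Cons.prems[of k p] x elem_op_far[of k l p p' A v] elem_op_far[of l k p' p A v] assms(2) by auto
 moreover have "run A D (elem_op A l p' u)=elem_op A l p' (run A D u)" for u
  by (rule Cons.IH) (use Cons.prems in auto)
 ultimately show ?case by (simp add: x)
qed simp

text \<open>The moving strand commutes with the given crossing except at two of its own crossings,
  and there \<open>yang_baxter\<close> applies.\<close>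

lemma pass_Neg:
 assumes "A ~= 0" "p \<in> {Pos, Neg}" "i+2 <= b"
 shows "run A (shift q (pass p b)) (elem_op A (q+Suc i) Neg v) =
  elem_op A (q+i) Neg (run A (shift q (pass p b)) v)"
proof -
 define P1 where "P1=shift q (map (%j. (j, p)) [0..<i])"
 define P2 where "P2=shift q (map (%j. (j, p)) [i+2..<b])"
 have "[0..<b]=[0..<i]@[i, Suc i]@[i+2..<b]"
  using assms(3) upt_add_eq_append[of 0 i "b-i"] by (simp add: upt_conv_Cons)
 hence P: "shift q (pass p b)=P1@[(q+i, p), (q+Suc i, p)]@P2"
  by (simp add: pass_def P1_def P2_def)
 have 1: "run A P1 (elem_op A (q+Suc i) Neg v)=elem_op A (q+Suc i) Neg (run A P1 v)"
  by (rule run_elem_far) (use assms in \<open>auto simp: P1_def shift_def\<close>)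
 have 2: "run A P2 (elem_op A (q+i) Neg u)=elem_op A (q+i) Neg (run A P2 u)" for u
  by (rule run_elem_far) (use assms in \<open>auto simp: P2_def shift_def\<close>)
 show ?thesis
  unfolding P run_append 1 using yang_baxter[OF assms(1,2), of "q+i" "run A P1 v"]
  by (simp add: 2)
qed

lemma pass_negs:
 assumes "A ~= 0" "p \<in> {Pos, Neg}" "!!i. i \<in> set w ==> i+2 <= b"
 shows "run A (shift q (pass p b)) (run A (shift (q+1) (negs w)) v) =
  run A (shift q (negs w)) (run A (shift q (pass p b)) v)"
 using assms(3)
proof (induction w arbitrary: v)
 case (Cons i w)
 thus ?case using pass_Neg[OF assms(1,2), of i b q v] by simp
qed simp

text \<open>By \<open>sym_op_perms\<close> the projector, multiplied by the nonzero [b]!, is a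
  combination of negative braids, and \<open>pass_negs\<close> moves the strand through each of
  them.\<close>

lemma pass_sym_op:
 assumes A: "generic A" and p: "p \<in> {Pos, Neg}" and v: "supp N v" "q+Suc b <= N"
 shows "run A (shift q (pass p b)) (sym_op A (q+1) b v)=sym_op A q b (run A (shift q (pass p b)) v)"
proof (rule supp_eqI)
 have V: "valid N (shift q (pass p b)) N"
  by (rule valid_shift[OF valid_pass[OF p]]) (use v in auto)
 show "supp N (run A (shift q (pass p b)) (sym_op A (q+1) b v))"
  "supp N (sym_op A q b (run A (shift q (pass p b)) v))"
  using v by (auto intro!: supp_sym_op supp_run[OF _ V])
 fix ep :: "bool list" assume l: "length ep=N"
 let ?c = "%sm. A^(b*(b-1))*A powi (- 3 * int (perm_length b sm))"
 let ?S = "{sm. sm permutes {..<b}}"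
 have "qfact A b * run A (shift q (pass p b)) (sym_op A (q+1) b v) ep =
  run A (shift q (pass p b)) (%ep. qfact A b * sym_op A (q+1) b v ep) ep"
  by (rule run_scale[symmetric])
 also have "\<dots>=run A (shift q (pass p b))
   (%ep. \<Sum>sm\<in>?S. ?c sm * run A (shift (q+1) (negs (perm_braid b sm))) v ep) ep"
  by (rule run_cong[OF V l], rule sym_op_perms[OF A]) (use v in auto)
 also have "\<dots>=(\<Sum>sm\<in>?S. ?c sm * run A (shift q (negs (perm_braid b sm))) (run A (shift q (pass p b)) v) ep)"
  unfolding run_sum
 proof (intro sum.cong refl)
  fix sm
  have "run A (shift q (pass p b)) (run A (shift (q+1) (negs (perm_braid b sm))) v) =
   run A (shift q (negs (perm_braid b sm))) (run A (shift q (pass p b)) v)"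
   by (rule pass_negs) (use A p set_code_word in \<open>auto simp: perm_braid_code\<close>)
  thus "?c sm * run A (shift q (pass p b)) (run A (shift (q+1) (negs (perm_braid b sm))) v) ep =
   ?c sm * run A (shift q (negs (perm_braid b sm))) (run A (shift q (pass p b)) v) ep" by simp
 qed
 also have "\<dots>=qfact A b * sym_op A q b (run A (shift q (pass p b)) v) ep"
  using sym_op_perms[OF A, of q b ep] l v by simp
 finally show "run A (shift q (pass p b)) (sym_op A (q+1) b v) ep =
  sym_op A q b (run A (shift q (pass p b)) v) ep"
  using qfact_nz[OF A] by simp
qed

lemma cross_sym_op_right:
 assumes A: "generic A" and p: "p \<in> {Pos, Neg}" and v: "supp N v" "q+a+b <= N"
 shows "run A (shift q (cross p a b)) (sym_op A (q+a) b v)=sym_op A q b (run A (shift q (cross p a b)) v)"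
 using v
proof (induction a arbitrary: v)
 case (Suc a)
 have "supp N (run A (shift (q+a) (pass p b)) v)"
  by (rule supp_run[OF Suc.prems(1) valid_shift[OF valid_pass[OF p]]]) (use Suc.prems in auto)
 thus ?case
  using pass_sym_op[OF A p Suc.prems(1), of "q+a" b] Suc
  by (simp add: cross_Suc run_append shift_shift)
qed simp

lemma run_crossing_swap:
 assumes "!!k p. (k, p) \<in> set D ==> p \<in> {Pos, Neg} & k+2 <= l" "p' \<in> {Pos, Neg}"
 shows "run A ((l, p')#D) v=run A (D@[(l, p')]) v"
 using run_elem_far[of D l p' A v] assms by (auto simp: run_append)

lemma cross_left_Suc:
 assumes p: "p \<in> {Pos, Neg}"
 shows "run A (shift a (pass p b) @ cross_left p a b) v=run A (cross_left p (Suc a) b) v"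
proof (induction b arbitrary: v)
 case 0
 thus ?case by (simp add: pass_def cross_left_def)
next
 case (Suc b)
 have 1: "pass p (Suc b)=pass p b@[(b, p)]" by (simp add: pass_def)
 have 2: "cross_left p c (Suc b)=cross_left p c b@shift b (pass_left p c)" for c
  by (simp add: cross_left_def)
 have 3: "pass_left p (Suc a)=(a, p)#pass_left p a" by (simp add: pass_left_def)
 have 4: "run A ((a+b, p) # cross_left p a b) u=run A (cross_left p a b@[(a+b, p)]) u" for u
  by (rule run_crossing_swap) (use p in \<open>auto simp: cross_left_def pass_left_def shift_def\<close>)
 have "run A (shift a (pass p (Suc b)) @ cross_left p a (Suc b)) v =
  run A (shift b (pass_left p a)) (run A ((a+b, p) # cross_left p a b) (run A (shift a (pass p b)) v))"
  by (simp add: 1 2 run_append)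
 also have "\<dots>=run A ((a+b, p)#shift b (pass_left p a)) (run A (shift a (pass p b) @ cross_left p a b) v)"
  unfolding 4 by (simp add: run_append)
 also have "\<dots>=run A (cross_left p (Suc a) (Suc b)) v"
  unfolding Suc 2 3 by (simp add: run_append add.commute)
 finally show ?case .
qed

text \<open>A grid of crossings may be performed by rows or by columns, since the crossings that
  change their order are far apart.\<close>

lemma run_cross_left:
 assumes p: "p \<in> {Pos, Neg}"
 shows "run A (cross p a b) v=run A (cross_left p a b) v"
proof (induction a arbitrary: v)
 case 0
 have "cross_left p 0 b=[]" by (auto simp: cross_left_def pass_left_def)
 thus ?case by simp
next
 case (Suc a)
 thus ?case
  using cross_left_Suc[OF p, of A a b v] by (simp add: cross_Suc run_append)
qed

lemma rev_cross: "rev (cross p a b)=cross_left p b a"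
 by (simp add: cross_def cross_left_def pass_def pass_left_def shift_def rev_concat rev_map o_def)

lemma run_rev_cross: "p \<in> {Pos, Neg} ==> run A (rev (cross p a b)) v=run A (cross p b a) v"
 by (simp add: rev_cross run_cross_left)

section \<open>Transposes with respect to the bilinear pairing\<close>

definition pair :: "nat => vec => vec => complex" where
 "pair n u v=(\<Sum>ep\<in>words n. u ep * v ep)"

lemma pair_op:
 assumes "k+m <= n" and K: "!!ga bt. length ga=m ==> length bt=m ==> K ga bt=K bt ga"
 shows "pair n u (op k m m K v)=pair n (op k m m K u) v"
proof -
 define d where "d=n-k-m"
 have n: "n=k+(m+d)" using assms(1) by (simp add: d_def)
 have swap: "(\<Sum>ga\<in>words m. \<Sum>bt\<in>words m. K ga bt*(u (al@ga@et) * v (al@bt@et))) =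
   (\<Sum>ga\<in>words m. \<Sum>bt\<in>words m. K ga bt*(u (al@bt@et) * v (al@ga@et)))" for al et
  by (subst sum.swap) (intro sum.cong refl, simp add: K)
 have "pair n u (op k m m K v) =
  (\<Sum>al\<in>words k. \<Sum>ga\<in>words m. \<Sum>et\<in>words d. \<Sum>bt\<in>words m. K ga bt*(u (al@ga@et) * v (al@bt@et)))"
  unfolding pair_def n sum_words_add
  by (intro sum.cong refl) (simp add: op_app sum_distrib_left mult.left_commute)
 also have "\<dots>=(\<Sum>al\<in>words k. \<Sum>et\<in>words d. \<Sum>ga\<in>words m. \<Sum>bt\<in>words m. K ga bt*(u (al@ga@et) * v (al@bt@et)))"
  by (intro sum.cong refl sum.swap)
 also have "\<dots>=(\<Sum>al\<in>words k. \<Sum>et\<in>words d. \<Sum>ga\<in>words m. \<Sum>bt\<in>words m. K ga bt*(u (al@bt@et) * v (al@ga@et)))"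
  unfolding swap ..
 also have "\<dots>=(\<Sum>al\<in>words k. \<Sum>ga\<in>words m. \<Sum>et\<in>words d. \<Sum>bt\<in>words m. K ga bt*(u (al@bt@et) * v (al@ga@et)))"
  by (intro sum.cong refl sum.swap)
 also have "\<dots>=pair n (op k m m K u) v"
  unfolding pair_def n sum_words_add
  by (intro sum.cong refl) (simp add: op_app sum_distrib_right mult.assoc)
 finally show ?thesis .
qed

text \<open>\<open>cupw\<close> is - A^2 times \<open>capw\<close>, so the cap followed by the cup
  has a symmetric matrix.\<close>

lemma ekernel_commute:
 assumes "A ~= 0" "p \<in> {Pos, Neg}" "length ga=2" "length bt=2"
 shows "ekernel A p ga bt=ekernel A p bt ga"
proof -
 obtain a b c d where "ga=[a, b]" "bt=[c, d]" using assms by (auto simp: numeral_2_eq_2 length_Suc_conv)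
 moreover have "A^2 * inverse A^2=1" using assms by (simp add: power_inverse)
 ultimately show ?thesis using assms
  by (cases a; cases b; cases c; cases d) (auto simp: cupw_def capw_def)
qed

lemma pair_run:
 assumes "A ~= 0" "!!k p. (k, p) \<in> set D ==> p \<in> {Pos, Neg} & k+2 <= n"
 shows "pair n u (run A D v)=pair n (run A (rev D) u) v"
 using assms(2)
proof (induction D arbitrary: v)
 case (Cons x D)
 obtain k p where x: "x=(k, p)" by (cases x)
 have p: "p \<in> {Pos, Neg}" "k+2 <= n" using Cons.prems[of k p] x by auto
 have "pair n w (elem_op A k p v)=pair n (elem_op A k p w) v" for w
  using pair_op[of k 2 n "ekernel A p" w v] ekernel_commute[OF assms(1) p(1)] p by (auto simp: elem_op_def)
 moreover have "pair n u (run A D w)=pair n (run A (rev D) u) w" for w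
  by (rule Cons.IH) (use Cons.prems in auto)
 ultimately show ?case by (simp add: x run_append)
qed simp

lemma pair_sym_op: "q+b <= n ==> pair n u (sym_op A q b v)=pair n (sym_op A q b u) v"
 unfolding sym_op_def by (rule pair_op) (auto intro: sym_kernel_commute)

lemma pair_unit:
 assumes "length ep=n"
 shows "pair n (%bt. if bt=ep then 1 else 0) v=v ep"
proof -
 have "pair n (%bt. if bt=ep then 1 else 0) v=(\<Sum>bt\<in>words n. if bt=ep then v bt else 0)"
  unfolding pair_def by (intro sum.cong) auto
 thus ?thesis using assms by simp
qed

lemma rev_shift: "rev (shift q D)=shift q (rev D)"
 by (simp add: shift_def rev_map)

lemma run_shift_cong:
 assumes "!!v. run A D v=run A D' v" "valid n D n" "valid n D' n" "supp N v" "q+n <= N"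
 shows "run A (shift q D) v=run A (shift q D') v"
proof (rule supp_eqI)
 show "supp N (run A (shift q D) v)" "supp N (run A (shift q D') v)"
  using assms by (auto intro!: supp_run[OF assms(4)] valid_shift)
 fix ep :: "bool list" assume "length ep=N"
 then obtain al ga et where "ep=al@ga@et" "length al=q" "length ga=n"
  using split3[of q n ep] assms by auto
 thus "run A (shift q D) v ep=run A (shift q D') v ep"
  using run_local[OF assms(2), of al q ga A v et] run_local[OF assms(3), of al q ga A v et] assms(1) by simp
qed

text \<open>The transpose of the cabled crossing of \<open>a\<close> and \<open>b\<close> strands is that of \<open>b\<close> and \<open>a\<close> strands,
 so this is the transpose of \<open>cross_sym_op_right\<close>.\<close>

lemma cross_sym_op_left:
 assumes A: "generic A" and p: "p \<in> {Pos, Neg}" and v: "supp N v" "q+a+b <= N"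
 shows "run A (shift q (cross p a b)) (sym_op A q a v)=sym_op A (q+b) a (run A (shift q (cross p a b)) v)"
proof (rule supp_eqI)
 have V: "valid N (shift q (cross p a b)) N"
  by (rule valid_shift[OF valid_cross[OF p]]) (use v in auto)
 show "supp N (run A (shift q (cross p a b)) (sym_op A q a v))"
  "supp N (sym_op A (q+b) a (run A (shift q (cross p a b)) v))"
  using v by (auto intro!: supp_sym_op supp_run[OF _ V])
 fix ep :: "bool list" assume l: "length ep=N"
 \<comment> \<open>Pairing with this unit vector reads off the entry at \<open>ep\<close>; the
   operators are moved to it as transposes, where \<open>cross_sym_op_right\<close> is
   available.\<close>
 define u :: vec where "u=(%bt. if bt=ep then 1 else 0)"
 have u: "supp N u" using l by (auto simp: supp_def u_def)
 have nz: "A ~= 0" using A by simp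
 have D: "p' \<in> {Pos, Neg} & k+2 <= N" if "(k, p') \<in> set (shift q (cross p a' b'))" "a'+b' = a+b" for k p' a' b'
  using that p v(2) by (auto simp: shift_def dest!: set_cross)
 have rev: "run A (rev (shift q (cross p a b))) w=run A (shift q (cross p b a)) w" if "supp N w" for w
  unfolding rev_shift
 proof (rule run_shift_cong[OF _ _ _ that])
  show "run A (rev (cross p a b)) v=run A (cross p b a) v" for v by (rule run_rev_cross[OF p])
  show "valid (a+b) (rev (cross p a b)) (a+b)"
   by (rule valid_crossings) (use p set_cross in fastforce)
  show "valid (a+b) (cross p b a) (a+b)"
   using valid_cross[OF p, of b a] by (simp add: add.commute)
 qed (use v in auto)
 have "run A (shift q (cross p a b)) (sym_op A q a v) ep=pair N u (run A (shift q (cross p a b)) (sym_op A q a v))"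
  unfolding u_def by (simp add: pair_unit[OF l])
 also have "\<dots>=pair N (sym_op A q a (run A (shift q (cross p b a)) u)) v"
  using pair_run[OF nz D] pair_sym_op[of q a N] v rev[OF u] by simp
 also have "sym_op A q a (run A (shift q (cross p b a)) u)=run A (shift q (cross p b a)) (sym_op A (q+b) a u)"
  by (rule cross_sym_op_right[OF A p u, symmetric]) (use v in auto)
 also have "pair N \<dots> v=pair N (sym_op A (q+b) a u) (run A (shift q (cross p a b)) v)"
  using pair_run[OF nz D] rev[OF supp_sym_op[OF u, of "q+b" a A]] v by simp
 also have "\<dots>=pair N u (sym_op A (q+b) a (run A (shift q (cross p a b)) v))"
  using v by (intro pair_sym_op[symmetric]) auto
 also have "\<dots>=sym_op A (q+b) a (run A (shift q (cross p a b)) v) ep"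
  unfolding u_def by (simp add: pair_unit[OF l])
 finally show "run A (shift q (cross p a b)) (sym_op A q a v) ep =
  sym_op A (q+b) a (run A (shift q (cross p a b)) v) ep" .
qed

section \<open>Integer Laurent polynomials as functions\<close>

definition ipoly :: "int poly => complex => complex" where
 "ipoly p A=poly (map_poly of_int p) A"

lemma ipoly_0 [simp]: "ipoly 0 A=0"
 by (simp add: ipoly_def)

lemma ipoly_pCons [simp]: "ipoly (pCons a p) A = of_int a+A * ipoly p A"
 by (simp add: ipoly_def map_poly_pCons)

lemma ipoly_add [simp]: "ipoly (p+q) A=ipoly p A+ipoly q A"
 by (induction p q rule: poly_induct2) (simp_all add: algebra_simps)

lemma ipoly_uminus [simp]: "ipoly (- p) A = - ipoly p A"
 by (induction p) simp_all

lemma ipoly_diff [simp]: "ipoly (p-q) A=ipoly p A-ipoly q A"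
 using ipoly_add[of p "- q" A] by simp

lemma ipoly_smult [simp]: "ipoly (smult c p) A = of_int c * ipoly p A"
 by (induction p) (simp_all add: algebra_simps)

lemma ipoly_mult [simp]: "ipoly (p * q) A=ipoly p A * ipoly q A"
 by (induction p) (simp_all add: algebra_simps)

lemma ipoly_1 [simp]: "ipoly 1 A=1"
 using ipoly_pCons[of 1 0 A] by (simp add: one_pCons)

lemma ipoly_power [simp]: "ipoly (p^n) A=ipoly p A^n"
 by (induction n) simp_all

lemma ipoly_monom [simp]: "ipoly (monom 1 n) A=A^n"
 by (induction n) (simp_all add: monom_0 monom_Suc)

lemma generic_of_nat: "n >= 2 ==> generic (of_nat n)"
proof -
 assume n: "n >= 2"
 have "(of_nat n :: complex)^m ~= 1" if "m > 0" for m
 proof -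
  have "n^m ~= 1" using n that by simp
  thus ?thesis by (metis of_nat_eq_1_iff of_nat_power)
 qed
 thus ?thesis using n by (auto simp: generic_def root_of_unity_def)
qed

text \<open>The integers from 2 on are infinitely many points that are not roots of unity.\<close>

lemma ipoly_eqI:
 assumes "!!A. generic A ==> ipoly p A=ipoly q A"
 shows "p=q"
proof -
 let ?r = "map_poly of_int (p-q) :: complex poly"
 have "of_nat ` {2..} \<subseteq> {A. poly ?r A=0}"
  using assms generic_of_nat by (auto simp flip: ipoly_def)
 moreover have "infinite (of_nat ` {2::nat..} :: complex set)"
  by (subst finite_image_iff) (auto simp: inj_on_def infinite_Ici)
 ultimately have "infinite {A. poly ?r A=0}" by (metis finite_subset)
 hence "?r=0" using poly_roots_finite by blast
 hence "p-q=0" by (simp add: map_poly_eq_0_iff)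
 thus ?thesis by simp
qed

text \<open>\<open>laurent d B h\<close>: away from roots of unity \<open>h\<close> is an integer Laurent polynomial in \<open>A\<close> with
 exponents in \<open>{-d..d}\<close>, and it is bounded by \<open>B\<close> on the unit circle.\<close>

definition laurent :: "nat => real => (complex => complex) => bool" where
 "laurent d B h \<longleftrightarrow> (\<exists>p. degree p <= 2 * d & (\<forall>A. generic A --> A^d * h A=ipoly p A)) \<and>
   (\<forall>A. generic A & norm A=1 --> norm (h A) <= B)"

lemma laurent_cong: "(!!A. generic A ==> f A=g A) ==> laurent d B f \<longleftrightarrow> laurent d B g"
 by (auto simp: laurent_def)

lemma laurent_mono: "laurent d B h ==> d <= d' ==> B <= B' ==> laurent d' B' h"
proof -
 assume *: "laurent d B h" "d <= d'" "B <= B'"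
 then obtain p where p: "degree p <= 2 * d" "!!A. generic A ==> A^d * h A=ipoly p A"
  by (auto simp: laurent_def)
 have "degree (monom 1 (d'-d) * p) <= 2 * d'"
  using degree_mult_le[of "monom 1 (d'-d)" p] p(1) *(2) by (simp add: degree_monom_eq)
 moreover have "A^d' * h A=ipoly (monom 1 (d'-d) * p) A" if "generic A" for A
  unfolding ipoly_mult ipoly_monom p(2)[OF that, symmetric]
  using *(2) by (simp add: mult.assoc[symmetric] power_add[symmetric])
 moreover have "norm (h A) <= B'" if "generic A" "norm A=1" for A
  using *(1,3) that by (force simp: laurent_def)
 ultimately show ?thesis unfolding laurent_def by blast
qed

lemma laurent_add: "laurent d B f ==> laurent d C g ==> laurent d (B+C) (%A. f A+g A)"
proof -
 assume *: "laurent d B f" "laurent d C g"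
 obtain p where p: "degree p <= 2 * d" "!!A. generic A ==> A^d * f A=ipoly p A"
  using *(1) by (auto simp: laurent_def)
 obtain q where q: "degree q <= 2 * d" "!!A. generic A ==> A^d * g A=ipoly q A"
  using *(2) by (auto simp: laurent_def)
 have "degree (p+q) <= 2 * d" using p q by (intro degree_add_le)
 moreover have "A^d*(f A+g A)=ipoly (p+q) A" if "generic A" for A
  using p(2)[OF that] q(2)[OF that] by (simp add: algebra_simps)
 moreover have "norm (f A+g A) <= B+C" if "generic A" "norm A=1" for A
  using * that by (intro norm_triangle_mono) (auto simp: laurent_def)
 ultimately show ?thesis unfolding laurent_def by blast
qed

lemma laurent_mult: "laurent d B f ==> laurent e C g ==> laurent (d+e) (B*C) (%A. f A * g A)"
proof -
 assume *: "laurent d B f" "laurent e C g"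
 obtain p where p: "degree p <= 2 * d" "!!A. generic A ==> A^d * f A=ipoly p A"
  using *(1) by (auto simp: laurent_def)
 obtain q where q: "degree q <= 2 * e" "!!A. generic A ==> A^e * g A=ipoly q A"
  using *(2) by (auto simp: laurent_def)
 have "degree (p * q) <= 2*(d+e)" using degree_mult_le[of p q] p q by simp
 moreover have "A^(d+e)*(f A * g A)=ipoly (p * q) A" if "generic A" for A
  using p(2)[OF that, symmetric] q(2)[OF that, symmetric] by (simp add: power_add)
 moreover have "norm (f A * g A) <= B*C" if "generic A" "norm A=1" for A
 proof -
  have "norm (f A) <= B" "norm (g A) <= C" using * that by (auto simp: laurent_def)
  moreover from this(1) have "0 <= B" using norm_ge_zero order_trans by blast
  ultimately show ?thesis unfolding norm_mult by (intro mult_mono) auto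
 qed
 ultimately show ?thesis unfolding laurent_def by blast
qed

lemma laurent_0: "B >= 0 ==> laurent d B (%A. 0)"
 unfolding laurent_def by (auto intro!: exI[of _ 0])

lemma laurent_1: "laurent 0 1 (%A. 1)"
 unfolding laurent_def by (auto intro!: exI[of _ 1])

lemma laurent_uminus: "laurent d B f ==> laurent d B (%A. - f A)"
proof -
 assume *: "laurent d B f"
 obtain p where p: "degree p <= 2 * d" "!!A. generic A ==> A^d * f A=ipoly p A"
  using * by (auto simp: laurent_def)
 hence "degree (- p) <= 2 * d" "!!A. generic A ==> A^d * - f A=ipoly (- p) A" by auto
 thus ?thesis using * unfolding laurent_def norm_minus_cancel by blast
qed

lemma laurent_power: "laurent k 1 (%A. A^k)"
 unfolding laurent_def
 by (auto intro!: exI[of _ "monom 1 (2 * k)"] simp: degree_monom_eq norm_power mult_2 power_add)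

lemma laurent_inverse_power: "laurent k 1 (%A. inverse A^k)"
 unfolding laurent_def
 by (auto intro!: exI[of _ 1] simp: norm_power norm_inverse power_inverse)

lemma laurent_sum:
 "finite I ==> (!!i. i \<in> I ==> laurent d (B i) (f i)) ==> laurent d (sum B I) (%A. \<Sum>i\<in>I. f i A)"
 by (induction rule: finite_induct) (auto intro: laurent_0 laurent_add)

lemma laurent_prod:
 "finite I ==> (!!i. i \<in> I ==> laurent (d i) (B i) (f i)) ==>
  laurent (sum d I) (prod B I) (%A. \<Prod>i\<in>I. f i A)"
 by (induction rule: finite_induct) (auto intro: laurent_1 laurent_mult)

definition laurent_fun :: "(complex => complex) => bool" where
 "laurent_fun h \<longleftrightarrow> (\<exists>d B. laurent d B h)"

lemma laurent_fun_mult: "laurent_fun f ==> laurent_fun g ==> laurent_fun (%A. f A * g A)"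
 unfolding laurent_fun_def using laurent_mult by blast

lemma laurent_fun_add: "laurent_fun f ==> laurent_fun g ==> laurent_fun (%A. f A+g A)"
proof -
 assume "laurent_fun f" "laurent_fun g"
 then obtain d B e C where *: "laurent d B f" "laurent e C g" by (auto simp: laurent_fun_def)
 have "laurent (max d e) B f" "laurent (max d e) C g"
  by (rule laurent_mono[OF *(1)], simp, simp, rule laurent_mono[OF *(2)], simp, simp)
 thus ?thesis unfolding laurent_fun_def using laurent_add by blast
qed

lemma laurent_fun_1: "laurent_fun (%A. 1)"
 using laurent_1 by (auto simp: laurent_fun_def)

lemma laurent_fun_prod:
 "finite I ==> (!!i. i \<in> I ==> laurent_fun (f i)) ==> laurent_fun (%A. \<Prod>i\<in>I. f i A)"
 by (induction rule: finite_induct) (auto intro: laurent_fun_1 laurent_fun_mult)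

lemma laurent_fun_qint: "laurent_fun (%A. qint A n)"
proof (induction n)
 case 0
 thus ?case using laurent_0[of 0 0] by (auto simp: laurent_fun_def)
next
 case (Suc n)
 have "laurent_fun (%A. A^(2 * n)+inverse A^2 * qint A n)"
  using laurent_power laurent_inverse_power
  by (intro laurent_fun_add laurent_fun_mult Suc) (auto simp: laurent_fun_def)
 moreover have "laurent d B (%A. A^(2 * n)+inverse A^2 * qint A n)=laurent d B (%A. qint A (Suc n))" for d B
  by (rule laurent_cong) (simp add: qint_Suc)
 ultimately show ?case by (simp add: laurent_fun_def)
qed

lemma laurent_fun_qfact: "laurent_fun (%A. qfact A n)"
 unfolding qfact_def by (intro laurent_fun_prod laurent_fun_qint) simp

text \<open>The ring of integer Laurent polynomials is integrally closed.\<close>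

lemma laurent_sqrt:
 assumes "laurent_fun P" "laurent_fun Q" "!!A. generic A ==> Q A ~= 0" "B >= 0"
  and "laurent (2 * d) (B^2) (%A. (P A/Q A)^2)"
 shows "laurent d B (%A. P A/Q A)"
proof -
 obtain a1 a2 B1 B2 where *: "laurent a1 B1 P" "laurent a2 B2 Q"
  using assms(1,2) by (auto simp: laurent_fun_def)
 have "laurent (max a1 a2) B1 P" "laurent (max a1 a2) B2 Q"
  by (rule laurent_mono[OF *(1)], simp, simp, rule laurent_mono[OF *(2)], simp, simp)
 then obtain p q where p: "!!A. generic A ==> A^max a1 a2*P A=ipoly p A"
  and q: "!!A. generic A ==> A^max a1 a2*Q A=ipoly q A"
  by (auto simp: laurent_def)
 obtain g where g: "degree g <= 2*(2 * d)" "!!A. generic A ==> A^(2 * d)*(P A/Q A)^2=ipoly g A"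
  using assms(5) by (auto simp: laurent_def)
 have q0: "ipoly q A ~= 0" if "generic A" for A
  using q[OF that, symmetric] assms(3)[OF that] that by simp
 have quot: "P A/Q A=ipoly p A/ipoly q A" if "generic A" for A
  using p[OF that, symmetric] q[OF that, symmetric] that by simp
 have eq: "(monom 1 d * p)^2=q^2 * g"
 proof (rule ipoly_eqI)
  fix A assume A: "generic A"
  have "A^(2 * d)*(ipoly p A/ipoly q A)^2=ipoly g A"
   using g(2)[OF A] quot[OF A] by simp
  thus "ipoly ((monom 1 d * p)^2) A=ipoly (q^2 * g) A"
   using q0[OF A] by (simp add: power_divide power_mult_distrib field_simps power_mult[symmetric] mult.commute)
 qed
 have "q^2 dvd (monom 1 d * p)^2" unfolding eq by simp
 \<comment> \<open>Integer polynomials form a factorial ring, so divisibility of squares gives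
   divisibility.\<close>
 hence "q dvd monom 1 d * p" by simp
 then obtain r where r: "monom 1 d * p=q * r" by blast
 have "q ~= 0" using q0[OF generic_of_nat[of 2]] by auto
 hence "r^2=g" using eq unfolding r by (simp add: power_mult_distrib)
 hence "degree r <= 2 * d" using g(1) by (cases "r=0") (auto simp: degree_power_eq)
 moreover have "A^d*(P A/Q A)=ipoly r A" if "generic A" for A
 proof -
  have "A^d * ipoly p A=ipoly q A * ipoly r A"
   using arg_cong[OF r, of "%x. ipoly x A"] by simp
  hence "A^d*(ipoly p A/ipoly q A)=ipoly r A" using q0[OF that] by simp
  thus ?thesis by (simp add: quot[OF that])
 qed
 moreover have "norm (P A/Q A) <= B" if "generic A" "norm A=1" for A
 proof -
  have "norm (P A/Q A)^2 <= B^2"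
   using assms(5) that by (auto simp: laurent_def norm_power)
  thus ?thesis using assms(4) by (rule power2_le_imp_le)
 qed
 ultimately show ?thesis unfolding laurent_def by blast
qed

text \<open>Integral closedness concerns elements of the fraction field, so for each term one has to
  keep record that it lies there.\<close>

definition rational_fun :: "(complex => complex) => bool" where
 "rational_fun h \<longleftrightarrow> (\<exists>P Q. laurent_fun P & laurent_fun Q & (\<forall>A. generic A --> Q A ~= 0 & h A=P A/Q A))"

lemma rational_fun_cong: "(!!A. generic A ==> f A=g A) ==> rational_fun f \<longleftrightarrow> rational_fun g"
 by (auto simp: rational_fun_def)

lemma rational_fun_mult: "rational_fun f ==> rational_fun g ==> rational_fun (%A. f A * g A)"
proof -
 assume "rational_fun f" "rational_fun g"
 then obtain P Q P' Q' where "laurent_fun P" "laurent_fun Q" "!!A. generic A ==> Q A ~= 0 & f A=P A/Q A"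
  "laurent_fun P'" "laurent_fun Q'" "!!A. generic A ==> Q' A ~= 0 & g A=P' A/Q' A"
  unfolding rational_fun_def by blast
 thus ?thesis unfolding rational_fun_def
  by (intro exI[of _ "%A. P A*P' A"] exI[of _ "%A. Q A*Q' A"]) (auto intro: laurent_fun_mult)
qed

lemma rational_fun_divide:
 "rational_fun f ==> laurent_fun g ==> (!!A. generic A ==> g A ~= 0) ==> rational_fun (%A. f A/g A)"
proof -
 assume *: "rational_fun f" "laurent_fun g" "!!A. generic A ==> g A ~= 0"
 have "rational_fun (%A. 1/g A)"
  unfolding rational_fun_def using * laurent_fun_1 by (intro exI[of _ "%A. 1"] exI[of _ g]) auto
 from rational_fun_mult[OF *(1) this] show ?thesis by simp
qed

lemma rational_fun_laurent: "laurent_fun f ==> rational_fun f"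
 unfolding rational_fun_def using laurent_fun_1 by (intro exI[of _ f] exI[of _ "%A. 1"]) auto

lemma laurent_sqrt_rational:
 assumes "rational_fun h" "B >= 0" "laurent (2 * d) (B^2) (%A. h A^2)"
 shows "laurent d B h"
proof -
 obtain P Q where PQ: "laurent_fun P" "laurent_fun Q" "!!A. generic A ==> Q A ~= 0 & h A=P A/Q A"
  using assms(1) unfolding rational_fun_def by blast
 have "laurent (2 * d) (B^2) (%A. (P A/Q A)^2)"
  using assms(3) PQ(3) laurent_cong[of "%A. h A^2" "%A. (P A/Q A)^2"] by auto
 hence "laurent d B (%A. P A/Q A)" using PQ assms(2) by (intro laurent_sqrt) auto
 thus ?thesis using PQ(3) laurent_cong[of h "%A. P A/Q A"] by auto
qed

text \<open>\<open>h\<close> is a sum of rational functions \<open>T\<close> such that \<open>T\<^sup>2 Y\<close> is a Laurent polynomial bounded by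
 \<open>B\<^sub>T\<^sup>2\<close> on the unit circle, where the \<open>B\<^sub>T\<close> add up to \<open>B\<close>.\<close>

inductive sqrt_sum :: "(complex => complex) => nat => real => (complex => complex) => bool" for Y d where
 sqrt_sum_single: "rational_fun h ==> B >= 0 ==> laurent (2 * d) (B^2) (%A. h A^2*Y A) ==> sqrt_sum Y d B h"
| sqrt_sum_add: "sqrt_sum Y d B f ==> sqrt_sum Y d C g ==> (!!A. generic A ==> h A=f A+g A) ==>
  sqrt_sum Y d (B+C) h"

lemma sqrt_sum_cong:
 "sqrt_sum Y d B f ==> (!!A. generic A ==> g A=f A) ==> sqrt_sum Y d B g"
proof (induction arbitrary: g rule: sqrt_sum.induct)
 case (sqrt_sum_single h B)
 show ?case
 proof (rule sqrt_sum.sqrt_sum_single)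
  show "rational_fun g" using sqrt_sum_single rational_fun_cong[of g h] by simp
  show "laurent (2 * d) (B^2) (%A. g A^2*Y A)"
   using sqrt_sum_single laurent_cong[of "%A. g A^2*Y A" "%A. h A^2*Y A"] by simp
 qed fact
next
 case (sqrt_sum_add B f C g h)
 thus ?case by (intro sqrt_sum.sqrt_sum_add[OF sqrt_sum_add.hyps(1,2)]) auto
qed

lemma sqrt_sum_mono:
 "sqrt_sum Y d B h ==> d <= d' ==> sqrt_sum Y d' B h"
proof (induction rule: sqrt_sum.induct)
 case (sqrt_sum_single h B)
 show ?case
  by (intro sqrt_sum.sqrt_sum_single sqrt_sum_single.hyps laurent_mono[OF sqrt_sum_single.hyps(3)])
   (use sqrt_sum_single in auto)
next
 case (sqrt_sum_add B f C g h)
 thus ?case by (intro sqrt_sum.sqrt_sum_add[of _ _ B f C g]) auto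
qed

lemma sqrt_sum_0: "B >= 0 ==> sqrt_sum Y d B (%A. 0)"
 using laurent_0[of 0 0] by (intro sqrt_sum_single rational_fun_laurent) (auto simp: laurent_fun_def intro: laurent_0)

lemma sqrt_sum_mono2:
 assumes "sqrt_sum Y d B h" "d <= d'" "B <= B'"
 shows "sqrt_sum Y d' B' h"
 using sqrt_sum_add[OF sqrt_sum_mono[OF assms(1,2)] sqrt_sum_0[of "B'-B"], of h] assms(3) by simp

lemma sqrt_sum_sum:
 "finite I ==> (!!i. i \<in> I ==> sqrt_sum Y d (B i) (f i)) ==> sqrt_sum Y d (sum B I) (%A. \<Sum>i\<in>I. f i A)"
 by (induction rule: finite_induct) (auto intro: sqrt_sum_0 sqrt_sum_add)

text \<open>The normalization passes from \<open>Y\<close> to \<open>Y * R\<close>, while the bound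
  grows by the square root of a bound for \<open>W A^2 * R A\<close>. Only this product has to be a
  Laurent polynomial, not \<open>W\<close> or \<open>R\<close> alone.\<close>

lemma sqrt_sum_mult:
 assumes h: "sqrt_sum Y d B h" and W: "rational_fun W" "C >= 0" "laurent (2 * e) (C^2) (%A. W A^2 * R A)"
  and Y': "!!A. generic A ==> Y' A=Y A * R A"
 shows "sqrt_sum Y' (d+e) (B*C) (%A. W A * h A)"
 using h
proof (induction rule: sqrt_sum.induct)
 case (sqrt_sum_single h B)
 have "laurent (2 * d+2 * e) (B^2*C^2) (%A. (h A^2*Y A)*(W A^2 * R A))"
  by (intro laurent_mult sqrt_sum_single W)
 also have "?this \<longleftrightarrow> laurent (2 * d+2 * e) (B^2*C^2) (%A. (W A * h A)^2*Y' A)"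
  by (rule laurent_cong) (simp add: Y' power_mult_distrib)
 finally show ?case
  using sqrt_sum_single W by (intro sqrt_sum.sqrt_sum_single rational_fun_mult) (auto simp: power_mult_distrib)
next
 case (sqrt_sum_add B f C' g h)
 show ?case unfolding distrib_right
  by (rule sqrt_sum.sqrt_sum_add[OF sqrt_sum_add.IH]) (simp add: sqrt_sum_add algebra_simps)
qed

text \<open>With trivial normalization every single term is a rational function whose square is a
  Laurent polynomial, hence is one itself.\<close>

lemma sqrt_sum_laurent:
 assumes "sqrt_sum Y d B h" "!!A. generic A ==> Y A=1"
 shows "laurent d B h"
 using assms(1)
proof (induction rule: sqrt_sum.induct)
 case (sqrt_sum_single h B)
 have "laurent (2 * d) (B^2) (%A. h A^2*Y A) \<longleftrightarrow> laurent (2 * d) (B^2) (%A. h A^2)"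
  by (rule laurent_cong) (simp add: assms(2))
 with sqrt_sum_single.hyps(3) show ?case
  by (intro laurent_sqrt_rational[OF sqrt_sum_single.hyps(1,2)]) blast
next
 case (sqrt_sum_add B f C g h)
 have "laurent d (B+C) h \<longleftrightarrow> laurent d (B+C) (%A. f A+g A)"
  by (rule laurent_cong) (rule sqrt_sum_add.hyps)
 with laurent_add[OF sqrt_sum_add.IH] show ?case by blast
qed

section \<open>Degrees and bounds of Gaussian binomials and quantum multinomials\<close>

lemma laurent_gauss: "laurent (4 * b * b) (2^b) (%A. gauss A b k)"
proof -
 have "laurent (4 * b * b) (\<Sum>ep\<in>words b. 1) (%A. \<Sum>ep\<in>words b. if cnt ep=k then A^(4 * invs ep) else 0)"
 proof (rule laurent_sum)
  fix ep assume "ep \<in> words b"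
  hence "4 * invs ep <= 4 * b * b" using invs_le[of ep] by simp
  hence "laurent (4 * b * b) 1 (%A. A^(4 * invs ep))"
   by (intro laurent_mono[OF laurent_power]) auto
  thus "laurent (4 * b * b) 1 (%A. if cnt ep=k then A^(4 * invs ep) else 0)"
   by (cases "cnt ep=k") (auto intro: laurent_0)
 qed simp
 thus ?thesis by (simp add: gauss_if card_words)
qed

lemma laurent_fun_gauss: "laurent_fun (%A. gauss A b k)"
 using laurent_gauss by (auto simp: laurent_fun_def)

text \<open>6 = 2 + 4: the monomial that relates it to \<open>gauss\<close>, and the degree of
  \<open>gauss\<close>.\<close>

lemma laurent_qbinomial:
 assumes "k+l <= s"
 shows "laurent (6 * s * s) (2^s) (%A. qfact A (k+l)/(qfact A k * qfact A l))"
proof -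
 have "2 * k * l <= 2*(s * s)" using mult_le_mono[of k s l s] assms by simp
 moreover have "4*(k+l)*(k+l) <= 4*(s * s)"
  using mult_le_mono[OF assms assms] unfolding mult.assoc by (rule mult_le_mono2)
 ultimately have d: "2 * k * l+4*(k+l)*(k+l) <= 6 * s * s" by simp
 have "laurent (2 * k * l+4*(k+l)*(k+l)) (1*2^(k+l)) (%A. inverse A^(2 * k * l) * gauss A (k+l) k)"
  by (intro laurent_mult laurent_inverse_power laurent_gauss)
 also have "?this \<longleftrightarrow> laurent (2 * k * l+4*(k+l)*(k+l)) (1*2^(k+l))
   (%A. qfact A (k+l)/(qfact A k * qfact A l))"
  by (rule laurent_cong) (simp add: gauss_eq power_inverse)
 finally show ?thesis by (rule laurent_mono) (use d assms in \<open>auto intro: power_increasing\<close>)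
qed

lemma laurent_qmultinomial:
 assumes "finite H" "sum p H <= s"
 shows "laurent (card H*(6 * s * s)) (2^(card H * s)) (%A. qfact A (sum p H)/(\<Prod>h\<in>H. qfact A (p h)))"
 using assms
proof (induction rule: finite_induct)
 case empty
 thus ?case using laurent_1 by simp
next
 case (insert x H)
 have "laurent (6 * s * s + card H*(6 * s * s)) (2^s*2^(card H * s))
  (%A. qfact A (p x+sum p H)/(qfact A (p x) * qfact A (sum p H))*(qfact A (sum p H)/(\<Prod>h\<in>H. qfact A (p h))))"
  using insert by (intro laurent_mult laurent_qbinomial) auto
 also have "?this \<longleftrightarrow> laurent (6 * s * s + card H*(6 * s * s)) (2^s*2^(card H * s))
  (%A. qfact A (sum p (insert x H))/(\<Prod>h\<in>insert x H. qfact A (p h)))"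
  by (rule laurent_cong) (use insert qfact_nz in simp)
 finally show ?case using insert by (simp add: power_add)
qed

section \<open>Coefficients of cabled crossings\<close>

lemma pass_Suc: "pass p (Suc b)=pass p b@[(b, p)]"
 by (simp add: pass_def)

lemma run_pass_Suc:
 assumes p: "p \<in> {Pos, Neg}" and "length ga=b"
 shows "run A (pass p b) v (ga@u#[u'])=run A (pass p b) (%\<mu>. v (\<mu>@[u'])) (ga@[u])"
 using run_local_0[OF valid_pass[OF p], of "ga@[u]" b A v "[u']"] assms by simp

text \<open>A closed form for one strand passing \<open>b\<close> strands in which the vector is
  symmetric. For the estimates its point is that at most three monomials occur, whatever
  \<open>b\<close> is.\<close>

lemma run_pass_Pos:
 assumes A: "generic A" and "!!x ga. length ga=b ==> v (x#ga)=A^(2 * invs ga) * y x (cnt ga)"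
  and "length ga=b"
 shows "run A (pass Pos b) v (ga@[False]) =
   A^(2 * invs ga)*(A^b * inverse A^(2 * cnt ga) * y False (cnt ga)) \<and>
  run A (pass Pos b) v (ga@[True])=A^(2 * invs ga) *
   (A^(2 * cnt ga) * inverse A^b * y True (cnt ga) +
    (A^(2*(b - cnt ga))-inverse A^(2*(b - cnt ga))) *
     (A^b * inverse A^(2+2 * cnt ga) * y False (Suc (cnt ga))))"
 using assms(2,3)
proof (induction b arbitrary: v y ga)
 case 0
 thus ?case using "0.prems"(1)[of "[]" False] "0.prems"(1)[of "[]" True] by (simp add: pass_def)
next
 case (Suc b)
 note v = Suc.prems(1)
 obtain dl z where g: "ga=dl@[z]" "length dl=b"
  using Suc.prems(2) by (cases ga rule: rev_cases) auto
 define B where "B=inverse A"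
 have nz: "A ~= 0" and AB: "A*B=1" using A by (auto simp: B_def)
 define k where "k=cnt dl"
 obtain m where b: "b=k+m" using cnt_le[of dl] g le_iff_add by (auto simp: k_def)
 define y' where "y' u x j=(if u then A^(2*(b-j)) * y x (Suc j) else y x j)" for u x j
 define E where "E=A^(2 * invs dl)"
 define K K' X X' where "K=A^k" "K' = B^k" "X=A^m" "X' = B^m"
 have KX: "K*K' = 1" "X*X' = 1" using AB by (simp_all add: K_K'_X_X'_def flip: power_mult_distrib)
 have pw: "A^(2 * k)=K^2" "B^(2 * k)=K'^2" "A^(2 * m)=X^2" "B^(2 * m)=X'^2"
  "A^b=K*X" "B^b=K'*X'" "B^(2+2 * k)=B^2*K'^2"
  by (simp_all only: K_K'_X_X'_def b power_add) (simp_all add: mult.commute flip: power_mult)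
 have IH: "run A (pass Pos b) v (dl@False#[u])=E*(K*X*K'^2 * y' u False k) \<and>
  run A (pass Pos b) v (dl@True#[u])=E*(K^2*(K'*X') * y' u True k +
   (X^2-X'^2)*(K*X*(B^2*K'^2) * y' u False (Suc k)))" for u
 proof -
  have "v (x#et@[u])=A^(2 * invs et) * y' u x (cnt et)" if "length et=b" for x et
   using v[of "et@[u]" x] that by (simp add: y'_def invs_append power_add)
  thus ?thesis
   using Suc.IH[of "%\<mu>. v (\<mu>@[u])" "y' u" dl] g(2) k_def[symmetric] b
   unfolding run_pass_Suc[OF _ g(2), of Pos, simplified] pw[symmetric] E_def B_def
   by (simp add: power2_eq_square)
 qed
 have y': "y' True x k=X^2 * y x (Suc k)" "y' False x j=y x j" for x j
  by (simp_all add: y'_def b pw)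
 \<comment> \<open>For \<open>m = 0\<close> the exponent in \<open>y'\<close> is truncated, but then
   \<open>X = X' = 1\<close> and the first factor vanishes.\<close>
 have y'': "(X^2-X'^2)*(c * y' True x (Suc k))=(X^2-X'^2)*(c*(X^2*B^2 * y x (Suc (Suc k))))" for c x
 proof (cases m)
  case (Suc n)
  have "X^2*B^2=(A*B)^2*A^(2 * n)"
   unfolding pw(3)[symmetric] Suc by (simp add: power_mult_distrib power2_eq_square)
  thus ?thesis using AB by (simp add: y'_def b Suc)
 qed (simp add: K_K'_X_X'_def)
 note c = crossing_values[OF g(2) nz, of "run A (pass Pos b) v", folded B_def]
 have r: "run A (pass Pos (Suc b)) v (ga@[x])=elem_op A b Pos (run A (pass Pos b) v) (dl@z#[x])" for x
  by (simp add: pass_Suc run_append g)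
 show ?case
 proof (cases z)
  case True
  have e: "A^(2 * invs ga)=E*X^2" "cnt ga=Suc k" "Suc b-Suc k=m"
   using True g by (simp_all add: invs_append k_def[symmetric] b E_def power_add pw)
  have pw': "A^Suc b=A*(K*X)" "B^Suc b=B*(K'*X')" "A^(2*Suc k)=A^2*K^2"
   "B^(2*Suc k)=B^2*K'^2" "B^(2+2*Suc k)=B^4*K'^2"
   by (simp_all only: power_Suc mult_Suc_right power_add pw) (simp flip: power_add mult.assoc)
  have "run A (pass Pos (Suc b)) v (ga@[False])=E*X^2*(A*(K*X)*(B^2*K'^2) * y False (Suc k))"
   unfolding r using True AB IH[of True] by (simp add: c y') algebra
  moreover have "run A (pass Pos (Suc b)) v (ga@[True])=E*X^2 *
   (A^2*K^2*(B*(K'*X')) * y True (Suc k) +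
    (X^2-X'^2)*(A*(K*X)*(B^4*K'^2) * y False (Suc (Suc k))))"
   unfolding r using True AB IH[of True] by (simp add: c y' y'') algebra
  ultimately show ?thesis
   unfolding e B_def[symmetric] pw pw' by simp
 next
  case False
  have e: "A^(2 * invs ga)=E" "cnt ga=k" "Suc b-k=Suc m"
   using False g by (simp_all add: invs_append k_def[symmetric] b E_def)
  have pw': "A^Suc b=A*(K*X)" "B^Suc b=B*(K'*X')" "A^(2*Suc m)=A^2*X^2"
   "B^(2*Suc m)=B^2*X'^2"
   by (simp_all only: power_Suc mult_Suc_right power_add pw)
  have "run A (pass Pos (Suc b)) v (ga@[False])=E*(A*(K*X)*K'^2 * y False k)"
   unfolding r using False IH[of False] by (simp add: c y')
  moreover have "run A (pass Pos (Suc b)) v (ga@[True])=E *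
   (K^2*(B*(K'*X')) * y True k +
    (A^2*X^2-B^2*X'^2)*(A*(K*X)*(B^2*K'^2) * y False (Suc k)))"
   unfolding r using False AB KX IH[of False] IH[of True] by (simp add: c y' y'') algebra
  ultimately show ?thesis
   unfolding e B_def[symmetric] pw pw' by simp
 qed
qed

lemma run_pass_Neg:
 assumes A: "generic A" and "!!x ga. length ga=b ==> v (x#ga)=A^(2 * invs ga) * y x (cnt ga)"
  and "length ga=b"
 shows "run A (pass Neg b) v (ga@[True]) =
   A^(2 * invs ga)*(A^b * inverse A^(2 * cnt ga) * y True (cnt ga)) \<and>
  run A (pass Neg b) v (ga@[False])=A^(2 * invs ga) *
   (A^(2 * cnt ga) * inverse A^b * y False (cnt ga) -
    (A^(2 * cnt ga)-inverse A^(2 * cnt ga)) *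
     (A^(2 * cnt ga) * inverse A^b * y True (cnt ga-1)))"
 using assms(2,3)
proof (induction b arbitrary: v y ga)
 case 0
 thus ?case using "0.prems"(1)[of "[]" False] "0.prems"(1)[of "[]" True] by (simp add: pass_def)
next
 case (Suc b)
 note v = Suc.prems(1)
 obtain dl z where g: "ga=dl@[z]" "length dl=b"
  using Suc.prems(2) by (cases ga rule: rev_cases) auto
 define B where "B=inverse A"
 have nz: "A ~= 0" and AB: "A*B=1" using A by (auto simp: B_def)
 define k where "k=cnt dl"
 obtain m where b: "b=k+m" using cnt_le[of dl] g le_iff_add by (auto simp: k_def)
 define y' where "y' u x j=(if u then A^(2*(b-j)) * y x (Suc j) else y x j)" for u x j
 define E where "E=A^(2 * invs dl)"
 define K K' X X' where "K=A^k" "K' = B^k" "X=A^m" "X' = B^m"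
 have KX: "K*K' = 1" "X*X' = 1" using AB by (simp_all add: K_K'_X_X'_def flip: power_mult_distrib)
 have pw: "A^(2 * k)=K^2" "B^(2 * k)=K'^2" "A^(2 * m)=X^2" "B^(2 * m)=X'^2"
  "A^b=K*X" "B^b=K'*X'"
  by (simp_all add: K_K'_X_X'_def b power_add mult.commute flip: power_mult)
 have IH: "run A (pass Neg b) v (dl@True#[u])=E*(K*X*K'^2 * y' u True k) \<and>
  run A (pass Neg b) v (dl@False#[u])=E*(K^2*(K'*X') * y' u False k -
   (K^2-K'^2)*(K^2*(K'*X') * y' u True (k-1)))" for u
 proof -
  have "v (x#et@[u])=A^(2 * invs et) * y' u x (cnt et)" if "length et=b" for x et
   using v[of "et@[u]" x] that by (simp add: y'_def invs_append power_add)
  thus ?thesis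
   using Suc.IH[of "%\<mu>. v (\<mu>@[u])" "y' u" dl] g(2) k_def[symmetric] b
   unfolding run_pass_Suc[OF _ g(2), of Neg, simplified] pw[symmetric] E_def B_def by simp
 qed
 have y': "y' True x k=X^2 * y x (Suc k)" "y' False x j=y x j" for x j
  by (simp_all add: y'_def b pw)
 have y'': "(K^2-K'^2)*(c * y' True x (k-Suc 0))=(K^2-K'^2)*(c*(A^2*X^2 * y x k))" for c x
 proof (cases k)
  case (Suc n)
  thus ?thesis using b pw(3)[symmetric] by (simp add: y'_def power2_eq_square)
 qed (simp add: K_K'_X_X'_def)
 note c = crossing_values[OF g(2) nz, of "run A (pass Neg b) v", folded B_def]
 have r: "run A (pass Neg (Suc b)) v (ga@[x])=elem_op A b Neg (run A (pass Neg b) v) (dl@z#[x])" for x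
  by (simp add: pass_Suc run_append g)
 show ?case
 proof (cases z)
  case True
  have e: "A^(2 * invs ga)=E*X^2" "cnt ga=Suc k"
   using True g by (simp_all add: invs_append k_def[symmetric] b E_def power_add pw)
  have pw': "A^Suc b=A*(K*X)" "B^Suc b=B*(K'*X')" "A^(2*Suc k)=A^2*K^2"
   "B^(2*Suc k)=B^2*K'^2"
   by (simp_all only: power_Suc mult_Suc_right power_add pw)
  have "run A (pass Neg (Suc b)) v (ga@[True])=E*X^2*(A*(K*X)*(B^2*K'^2) * y True (Suc k))"
   unfolding r using True AB IH[of True] by (simp add: c y') algebra
  moreover have "run A (pass Neg (Suc b)) v (ga@[False])=E*X^2 *
   (A^2*K^2*(B*(K'*X')) * y False (Suc k) -
    (A^2*K^2-B^2*K'^2)*(A^2*K^2*(B*(K'*X')) * y True k))"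
  proof -
   have 1: "K*X*K'^2=X*K'" using KX by algebra
   have 2: "K^2*(K'*X')*X^2=K*X" using KX by algebra
   have 3: "(K^2-K'^2)*K=K^3-K'" using KX by algebra
   have 4: "B^2*K'^2*(A*K)=B*K'" using KX AB by algebra
   have 5: "A^2*B=A" using AB by algebra
   have "run A (pass Neg (Suc b)) v (ga@[False])=(B-A^3)*(E*(K*X*K'^2 * y True k)) +
    A*(E*(K^2*(K'*X')*(X^2 * y False (Suc k)) -
     (K^2-K'^2)*(K^2*(K'*X')*(A^2*X^2 * y True k))))"
    unfolding r using True IH[of True] IH[of False] by (simp add: c y' y'')
   also have "\<dots>=E*((B-A^3)*(K*X*K'^2) * y True k +
    A*(K^2*(K'*X')*X^2) * y False (Suc k) -
    A^3*((K^2-K'^2)*(K^2*(K'*X')*X^2)) * y True k)"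
    by (simp add: algebra_simps power2_eq_square power3_eq_cube)
   also have "\<dots>=E*((B-A^3)*(X*K') * y True k+A*(K*X) * y False (Suc k) -
    A^3*(((K^2-K'^2)*K)*X) * y True k)"
    unfolding 1 2 by (simp add: mult.assoc)
   also have "\<dots>=E*(A*(K*X) * y False (Suc k)-(A^2*K^2*(A*K)-B*K')*X * y True k)"
    unfolding 3 by (simp add: algebra_simps power2_eq_square power3_eq_cube)
   also have "\<dots>=E*((A^2*B)*(K^2*(K'*X')*X^2) * y False (Suc k) -
    (A^2*K^2-B^2*K'^2)*((A^2*B)*(K^2*(K'*X')*X^2)) * y True k)"
    unfolding 2 5 4[symmetric] by (simp add: algebra_simps)
   finally show ?thesis by (simp add: algebra_simps)
  qed
  ultimately show ?thesis
   unfolding e B_def[symmetric] pw pw' by simp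
 next
  case False
  have e: "A^(2 * invs ga)=E" "cnt ga=k"
   using False g by (simp_all add: invs_append k_def[symmetric] b E_def)
  have pw': "A^Suc b=A*(K*X)" "B^Suc b=B*(K'*X')"
   by (simp_all add: pw[symmetric])
  have "run A (pass Neg (Suc b)) v (ga@[True])=E*(A*(K*X)*K'^2 * y True k)"
   unfolding r using False IH[of False] by (simp add: c y')
  moreover have "run A (pass Neg (Suc b)) v (ga@[False])=E *
   (K^2*(B*(K'*X')) * y False k-(K^2-K'^2)*(K^2*(B*(K'*X')) * y True (k-1)))"
   unfolding r using False IH[of False] by (simp add: c y') (simp add: algebra_simps)
  ultimately show ?thesis
   unfolding e B_def[symmetric] pw pw' by simp
 qed
qed

text \<open>On the unit circle the at most three monomials of \<open>run_pass_Pos\<close> and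
  \<open>run_pass_Neg\<close> have modulus 1.\<close>

lemma run_pass_bound:
 assumes A: "generic A" "norm A=1" and p: "p \<in> {Pos, Neg}"
  and v: "!!x ga. length ga=b ==> v (x#ga)=A^(2 * invs ga) * y x (cnt ga)"
  and y: "!!x k. norm (y x k) <= M"
 obtains y' where "!!x ga. length ga=b ==> run A (pass p b) v (ga@[x])=A^(2 * invs ga) * y' x (cnt ga)"
  "!!x k. norm (y' x k) <= 3*M"
proof -
 let ?B = "inverse A"
 have n: "norm (A^i)=1" "norm (?B^i)=1" for i using A by (simp_all add: norm_power norm_inverse)
 have M: "M >= 0" using y[of True 0] norm_ge_zero order_trans by blast
 have n1: "norm (A^i * ?B^j * y x k) <= M" for i j x k
  using y by (simp add: norm_mult n)
 have n2: "norm ((A^i - ?B^i)*(A^i' * ?B^j * y x k)) <= 2*M" for i i' j x k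
 proof -
  have "norm (A^i - ?B^i) <= 2" using norm_triangle_ineq4[of "A^i" "?B^i"] n by simp
  thus ?thesis unfolding norm_mult[of "A^i - ?B^i"] using n1 by (intro mult_mono) auto
 qed
 from p consider "p=Pos" | "p=Neg" by auto
 thus ?thesis
 proof cases
  case 1
  define y' where "y' x k=(if x then A^(2 * k) * ?B^b * y True k +
    (A^(2*(b-k)) - ?B^(2*(b-k)))*(A^b * ?B^(2+2 * k) * y False (Suc k))
   else A^b * ?B^(2 * k) * y False k)" for x k
  show ?thesis
  proof
   show "run A (pass p b) v (ga@[x])=A^(2 * invs ga) * y' x (cnt ga)" if "length ga=b" for x ga
    using run_pass_Pos[of A b v y ga, OF A(1) v that] by (cases x) (simp_all add: y'_def 1)
   show "norm (y' x k) <= 3*M" for x k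
    using norm_triangle_mono[OF n1[of "2 * k" b True k] n2[of "2*(b-k)" b "2+2 * k" False "Suc k"]]
     n1[of b "2 * k" False k] M by (auto simp: y'_def)
  qed
 next
  case 2
  define y' where "y' x k=(if x then A^b * ?B^(2 * k) * y True k
   else A^(2 * k) * ?B^b * y False k -
    (A^(2 * k) - ?B^(2 * k))*(A^(2 * k) * ?B^b * y True (k-1)))" for x k
  show ?thesis
  proof
   show "run A (pass p b) v (ga@[x])=A^(2 * invs ga) * y' x (cnt ga)" if "length ga=b" for x ga
    using run_pass_Neg[of A b v y ga, OF A(1) v that] by (cases x) (simp_all add: y'_def 2)
   show "norm (y' x k) <= 3*M" for x k
    using order_trans[OF norm_triangle_ineq4 add_mono[OF n1[of "2 * k" b False k] n2[of "2 * k" "2 * k" b True "k-1"]]]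
     n1[of b "2 * k" True k] M by (auto simp: y'_def)
  qed
 qed
qed

text \<open>Symmetry is required in the right block only. The strands of the left block pass one
  after another at the cost of a factor 3 each, so the bound is exponential in \<open>a\<close>
  although there are a b crossings.\<close>

lemma run_cross_bound:
 assumes A: "generic A" "norm A=1" and p: "p \<in> {Pos, Neg}"
  and "!!ga1 ga2. length ga1=a ==> length ga2=b ==> v (ga1@ga2)=A^(2 * invs ga2) * y ga1 (cnt ga2)"
  and "!!ga1 k. norm (y ga1 k) <= M"
 obtains y' where
  "!!ga1 ga2. length ga1=a ==> length ga2=b ==>
   run A (cross p a b) v (ga2@ga1)=A^(2 * invs ga2) * y' ga1 (cnt ga2)"
  "!!ga1 k. norm (y' ga1 k) <= 3^a*M"
proof -
 have "\<exists>y'. (\<forall>ga1 ga2. length ga1=a --> length ga2=b -->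
   run A (cross p a b) v (ga2@ga1)=A^(2 * invs ga2) * y' ga1 (cnt ga2)) \<and>
  (\<forall>ga1 k. norm (y' ga1 k) <= 3^a*M)"
  using assms(4,5)
 proof (induction a arbitrary: v y M)
  case 0
  thus ?case by (intro exI[of _ "%_. y []"]) auto
 next
  case (Suc a)
  have M: "M >= 0" using Suc.prems(2)[of "[]" 0] norm_ge_zero order_trans by blast
  have "\<exists>z. (\<forall>x ga. length ga=b --> run A (pass p b) (%\<mu>. v (al@\<mu>)) (ga@[x])=A^(2 * invs ga) * z x (cnt ga)) \<and>
    (\<forall>x k. norm (z x k) <= 3*M)" if "length al=a" for al
  proof -
   have "v (al@x#ga)=A^(2 * invs ga) * y (al@[x]) (cnt ga)" if "length ga=b" for x ga
    using Suc.prems(1)[of "al@[x]" ga] that \<open>length al = a\<close> by simp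
   from run_pass_bound[OF A p this Suc.prems(2)] show ?thesis by metis
  qed
  then obtain z where z: "!!al x ga. length al=a ==> length ga=b ==>
    run A (pass p b) (%\<mu>. v (al@\<mu>)) (ga@[x])=A^(2 * invs ga) * z al x (cnt ga)"
   "!!al x k. length al=a ==> norm (z al x k) <= 3*M"
   by metis
  \<comment> \<open>The value 0 on words of other lengths makes the bound hold for all arguments, as
    the induction hypothesis demands.\<close>
  define Y where "Y x al k=(if length al=a then z al x k else 0)" for x al k
  define w where "w=run A (shift a (pass p b)) v"
  have w: "w (al@ga@[x])=A^(2 * invs ga)*Y x al (cnt ga)" if "length al=a" "length ga=b" for al ga x
   using run_local[OF valid_pass[OF p], of al a "ga@[x]" b A v "[]"] that z(1)[OF that]
   by (simp add: w_def Y_def)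
  have "\<exists>y'. (\<forall>ga1 ga2. length ga1=a --> length ga2=b -->
   run A (cross p a b) (%\<mu>. w (\<mu>@[x])) (ga2@ga1)=A^(2 * invs ga2) * y' ga1 (cnt ga2)) \<and>
   (\<forall>ga1 k. norm (y' ga1 k) <= 3^a*(3*M))" for x
   by (rule Suc.IH[of _ "Y x"]) (use w z(2) M in \<open>auto simp: Y_def\<close>)
  then obtain y' where y': "!!x ga1 ga2. length ga1=a ==> length ga2=b ==>
    run A (cross p a b) (%\<mu>. w (\<mu>@[x])) (ga2@ga1)=A^(2 * invs ga2) * y' x ga1 (cnt ga2)"
   "!!x ga1 k. norm (y' x ga1 k) <= 3^a*(3*M)" by metis
  show ?case
  proof (intro exI conjI allI impI)
   fix ga1 ga2 :: "bool list" assume l: "length ga1=Suc a" "length ga2=b"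
   then obtain ga x where g: "ga1=ga@[x]" "length ga=a" by (cases ga1 rule: rev_cases) auto
   have "run A (cross p (Suc a) b) v (ga2@ga1)=run A (cross p a b) (%\<mu>. w (\<mu>@[x])) (ga2@ga)"
    using run_local_0[OF valid_cross[OF p], of "ga2@ga" a b A w "[x]"] l g
    by (simp add: cross_Suc run_append w_def)
   thus "run A (cross p (Suc a) b) v (ga2@ga1) =
    A^(2 * invs ga2)*(%ga1. y' (last ga1) (butlast ga1)) ga1 (cnt ga2)"
    using y'(1)[OF g(2) l(2)] g by simp
  next
   show "norm ((%ga1. y' (last ga1) (butlast ga1)) ga1 k) <= 3^Suc a*M" for ga1 k
    using y'(2)[of "last ga1" "butlast ga1" k] by (simp add: mult_ac)
  qed
 qed
 thus ?thesis using that by blast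
qed

text \<open>A word without inversions: a symmetric vector takes its coefficient as its value
  there.\<close>

definition sorted_word :: "nat => nat => bool list" where
 "sorted_word b k=replicate k True@replicate (b-k) False"

lemma cnt_replicate [simp]: "cnt (replicate n x)=(if x then n else 0)"
 by (induction n) auto

lemma invs_replicate [simp]: "invs (replicate n x)=0"
 by (induction n) auto

lemma sorted_word [simp]:
 "cnt (sorted_word b k)=k" "invs (sorted_word b k)=0" "k <= b ==> length (sorted_word b k)=b"
 by (auto simp: sorted_word_def invs_append)

definition sym_vec2 :: "complex => nat => nat => nat => vec" where
 "sym_vec2 A a k l ep=A^(2 * invs (take a ep)+2 * invs (drop a ep)) *
   (if cnt (take a ep)=k & cnt (drop a ep)=l then 1 else 0)"

text \<open>The coefficient of \<open>l'\<close>, \<open>k'\<close> (in this order from left to right) in the image of the product of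
 the symmetric vectors \<open>k\<close> of \<open>a\<close> strands and \<open>l\<close> of \<open>b\<close> strands.\<close>

definition cross_coeff :: "complex => elem => nat => nat => nat => nat => nat => nat => complex" where
 "cross_coeff A p a b k l l' k' = run A (cross p a b) (sym_vec2 A a k l) (sorted_word b l'@sorted_word a k')"

text \<open>The product of symmetric vectors is fixed by two symmetrizers, and these slide through
  the crossing. So the image is symmetric in both blocks and is determined by its values on sorted
  words.\<close>

lemma run_cross_sym_vec2:
 assumes A: "generic A" and p: "p \<in> {Pos, Neg}" and len: "length ga1=a" "length ga2=b"
 shows "run A (cross p a b) (sym_vec2 A a k l) (ga2@ga1) =
  A^(2 * invs ga2+2 * invs ga1) * cross_coeff A p a b k l (cnt ga2) (cnt ga1)"
proof -
 let ?N = "a+b"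
 define u where "u ep=(if length ep = ?N then sym_vec2 A a k l ep else 0)" for ep
 have su: "supp ?N u" by (simp add: supp_def u_def)
 have V: "valid ?N (cross p a b) ?N" by (rule valid_cross[OF p])
 define w where "w=run A (cross p a b) u"
 have w: "run A (cross p a b) (sym_vec2 A a k l) ep=w ep" if "length ep = ?N" for ep
  unfolding w_def by (rule run_cong[OF V that]) (simp add: u_def)
 have sw: "supp ?N w" unfolding w_def by (rule supp_run[OF su V])
 have fix1: "sym_op A 0 a u=u"
 proof (rule supp_eqI[of ?N])
  fix ep :: "bool list" assume "length ep = ?N"
  then obtain ga et where e: "ep=[]@ga@et" "length ga=a" "length et=b"
   by (metis append_Nil append_take_drop_id length_append add_left_cancel split_len le_add1)
  have "sym_op A 0 a u ep=(\<Sum>bt\<in>words a. sym_kernel A a ga bt*(A^(2 * invs bt) *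
    (A^(2 * invs et)*(if cnt bt=k & cnt et=l then 1 else 0))))"
   unfolding e(1) by (subst sym_op_app) (use e in \<open>auto simp: u_def sym_vec2_def power_add mult.assoc intro!: sum.cong\<close>)
  also have "\<dots>=u ep"
   using sym_kernel_fixes[OF A e(2), of "%i. A^(2 * invs et)*(if i=k & cnt et=l then 1 else 0)"] e
   by (simp add: u_def sym_vec2_def power_add mult.assoc)
  finally show "sym_op A 0 a u ep=u ep" .
 qed (use su in \<open>auto intro!: supp_sym_op\<close>)
 have fix2: "sym_op A a b u=u"
 proof (rule supp_eqI[of ?N])
  fix ep :: "bool list" assume "length ep = ?N"
  then obtain et ga where e: "ep=et@ga@[]" "length ga=b" "length et=a"
   by (metis append_Nil2 append_take_drop_id length_append add_left_cancel split_len le_add1)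
  have "sym_op A a b u ep=(\<Sum>bt\<in>words b. sym_kernel A b ga bt*(A^(2 * invs bt) *
    (A^(2 * invs et)*(if cnt et=k & cnt bt=l then 1 else 0))))"
   unfolding e(1) by (subst sym_op_app) (use e in \<open>auto simp: u_def sym_vec2_def power_add mult_ac intro!: sum.cong\<close>)
  also have "\<dots>=u ep"
   using sym_kernel_fixes[OF A e(2), of "%i. A^(2 * invs et)*(if cnt et=k & i=l then 1 else 0)"] e
   by (simp add: u_def sym_vec2_def power_add mult_ac)
  finally show "sym_op A a b u ep=u ep" .
 qed (use su in \<open>auto intro!: supp_sym_op\<close>)
 have w1: "sym_op A b a w=w"
  using cross_sym_op_left[OF A p su, of 0 a b] fix1 by (simp add: w_def)
 have w2: "sym_op A 0 b w=w"
  using cross_sym_op_right[OF A p su, of 0 a b] fix2 by (simp add: w_def)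
 have s1: "w (et@ga)=A^(2 * invs ga) * w (et@sorted_word a (cnt ga))"
  if "length et=b" "length ga=a" for et ga
 proof -
  have "w (et@ga@[])=(\<Sum>bt\<in>words a. sym_kernel A a ga bt * w (et@bt@[]))"
   by (subst w1[symmetric]) (rule sym_op_app[OF that])
  also have "\<dots>=A^(2 * invs ga)*(\<Sum>bt\<in>words a. sym_kernel A a (sorted_word a (cnt ga)) bt * w (et@bt@[]))"
   unfolding sum_distrib_left by (intro sum.cong refl) (auto simp: sym_kernel_def power_add)
  also have "(\<Sum>bt\<in>words a. sym_kernel A a (sorted_word a (cnt ga)) bt * w (et@bt@[]))=w (et@sorted_word a (cnt ga)@[])"
   by (subst (2) w1[symmetric], rule sym_op_app[OF that(1), symmetric]) (use cnt_le[of ga] that in auto)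
  finally show ?thesis by simp
 qed
 have s2: "w (ga@et)=A^(2 * invs ga) * w (sorted_word b (cnt ga)@et)"
  if "length ga=b" for et ga
 proof -
  have "w ([]@ga@et)=(\<Sum>bt\<in>words b. sym_kernel A b ga bt * w ([]@bt@et))"
   by (subst w2[symmetric]) (rule sym_op_app[OF _ that], simp)
  also have "\<dots>=A^(2 * invs ga)*(\<Sum>bt\<in>words b. sym_kernel A b (sorted_word b (cnt ga)) bt * w ([]@bt@et))"
   unfolding sum_distrib_left by (intro sum.cong refl) (auto simp: sym_kernel_def power_add)
  also have "(\<Sum>bt\<in>words b. sym_kernel A b (sorted_word b (cnt ga)) bt * w ([]@bt@et))=w ([]@sorted_word b (cnt ga)@et)"
   by (subst (2) w2[symmetric], rule sym_op_app[symmetric]) (use cnt_le[of ga] that in auto)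
  finally show ?thesis by simp
 qed
 have l: "length (sorted_word a (cnt ga1))=a" "length (sorted_word b (cnt ga2))=b"
  using cnt_le[of ga1] cnt_le[of ga2] len by auto
 have "w (ga2@ga1)=A^(2 * invs ga1)*(A^(2 * invs ga2) * w (sorted_word b (cnt ga2)@sorted_word a (cnt ga1)))"
  using s1[OF len(2,1)] s2[OF len(2)] by simp
 thus ?thesis
  unfolding cross_coeff_def using w l len by (simp add: power_add mult_ac)
qed

lemma run_cross_symmetric:
 assumes A: "generic A" and p: "p \<in> {Pos, Neg}"
  and v: "!!ga1 ga2. length ga1=a ==> length ga2=b ==>
   v (al@ga1@ga2@et)=A^(2 * invs ga1+2 * invs ga2) * x (cnt ga1) (cnt ga2)"
  and len: "length al=q" "length ga1=a" "length ga2=b"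
 shows "run A (shift q (cross p a b)) v (al@ga2@ga1@et)=A^(2 * invs ga2+2 * invs ga1) *
  (\<Sum>k\<le>a. \<Sum>l\<le>b. cross_coeff A p a b k l (cnt ga2) (cnt ga1) * x k l)"
proof -
 have V: "valid (a+b) (cross p a b) (a+b)" by (rule valid_cross[OF p])
 have "run A (shift q (cross p a b)) v (al@ga2@ga1@et) =
  run A (cross p a b) (%\<mu>. v (al@\<mu>@et)) (ga2@ga1)"
  using run_local[OF V len(1), of "ga2@ga1" A v et] len by simp
 also have "\<dots>=run A (cross p a b) (%\<mu>. \<Sum>(k, l)\<in>{..a} \<times> {..b}. x k l * sym_vec2 A a k l \<mu>) (ga2@ga1)"
 proof (rule run_cong[OF V])
  fix \<mu> :: "bool list" assume "length \<mu>=a+b"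
  then obtain dl1 dl2 where m: "\<mu>=dl1@dl2" "length dl1=a" "length dl2=b"
   by (metis length_append add_left_cancel split_len le_add1)
  have "(\<Sum>(k, l)\<in>{..a} \<times> {..b}. x k l * sym_vec2 A a k l \<mu>) =
   (\<Sum>z\<in>{..a} \<times> {..b}. if z=(cnt dl1, cnt dl2) then A^(2 * invs dl1+2 * invs dl2) * x (fst z) (snd z) else 0)"
   by (intro sum.cong refl) (auto simp: sym_vec2_def m split: if_splits)
  also have "\<dots>=A^(2 * invs dl1+2 * invs dl2) * x (cnt dl1) (cnt dl2)"
   using cnt_le[of dl1] cnt_le[of dl2] m by simp
  finally show "v (al@\<mu>@et)=(\<Sum>(k, l)\<in>{..a} \<times> {..b}. x k l * sym_vec2 A a k l \<mu>)"
   using v[OF m(2,3)] m by simp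
 qed (use len in simp)
 also have "\<dots>=(\<Sum>z\<in>{..a} \<times> {..b}. x (fst z) (snd z) * run A (cross p a b) (sym_vec2 A a (fst z) (snd z)) (ga2@ga1))"
  unfolding case_prod_unfold by (rule run_sum)
 also have "\<dots>=A^(2 * invs ga2+2 * invs ga1) *
   (\<Sum>z\<in>{..a} \<times> {..b}. cross_coeff A p a b (fst z) (snd z) (cnt ga2) (cnt ga1) * x (fst z) (snd z))"
  unfolding run_cross_sym_vec2[OF A p len(2,3)] sum_distrib_left by (intro sum.cong refl) simp
 finally show ?thesis by (simp add: sum.cartesian_product case_prod_unfold)
qed

text \<open>Both sides are the pairing of the image of one product of symmetric vectors with another one;
 cf. \<open>run_rev_cross\<close>.\<close>

lemma cross_coeff_transpose:
 assumes A: "generic A" and p: "p \<in> {Pos, Neg}" and "k <= a" "l <= b" "k' <= a" "l' <= b"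
 shows "cross_coeff A p a b k l l' k'*(gauss A b l' * gauss A a k') =
  cross_coeff A p b a l' k' k l*(gauss A a k * gauss A b l)"
proof -
 have nz: "A ~= 0" using A by simp
 have gen: "pair (a+b) (sym_vec2 A b l' k') (run A (cross p a b) (sym_vec2 A a k l)) =
  cross_coeff A p a b k l l' k'*(gauss A b l' * gauss A a k')" for a b k l k' l'
 proof -
  have "pair (b+a) (sym_vec2 A b l' k') (run A (cross p a b) (sym_vec2 A a k l)) =
   (\<Sum>ga2\<in>words b. \<Sum>ga1\<in>words a. (if cnt ga2=l' then A^(4 * invs ga2) else 0) *
    ((if cnt ga1=k' then A^(4 * invs ga1) else 0) * cross_coeff A p a b k l l' k'))"
   unfolding pair_def sum_words_add
  proof (intro sum.cong refl)
   fix ga2 ga1 assume "ga2 \<in> words b" "ga1 \<in> words a"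
   moreover have "A^(4 * i)=A^(2 * i)*A^(2 * i)" for i by (simp flip: power_add)
   ultimately show "sym_vec2 A b l' k' (ga2@ga1) * run A (cross p a b) (sym_vec2 A a k l) (ga2@ga1) =
    (if cnt ga2=l' then A^(4 * invs ga2) else 0) *
    ((if cnt ga1=k' then A^(4 * invs ga1) else 0) * cross_coeff A p a b k l l' k')"
    by (simp add: run_cross_sym_vec2[OF A p] sym_vec2_def power_add mult_ac)
  qed
  also have "\<dots>=gauss A b l'*(gauss A a k' * cross_coeff A p a b k l l' k')"
   unfolding gauss_if by (simp only: sum_distrib_right[symmetric] sum_distrib_left[symmetric])
  finally show ?thesis by (simp add: mult_ac add.commute)
 qed
 have "pair (a+b) (sym_vec2 A b l' k') (run A (cross p a b) (sym_vec2 A a k l)) =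
  pair (a+b) (run A (rev (cross p a b)) (sym_vec2 A b l' k')) (sym_vec2 A a k l)"
  by (rule pair_run[OF nz]) (use p set_cross in blast)
 also have "\<dots>=pair (b+a) (sym_vec2 A a k l) (run A (cross p b a) (sym_vec2 A b l' k'))"
  by (simp add: run_rev_cross[OF p] pair_def mult.commute add.commute)
 finally show ?thesis unfolding gen .
qed

lemma laurent_mono_ex: "\<exists>B. laurent d B h ==> d <= d' ==> \<exists>B. laurent d' B h"
 using laurent_mono by blast

text \<open>5 = 2 + 2 + 1: cup, cap and the coefficient of the smoothing. The bound on the unit
  circle is left open, since multiplying such bounds over all crossings would be useless.\<close>

lemma laurent_ekernel: "\<exists>B. laurent 5 B (%A. ekernel A p ga bt)"
proof -
 have cup: "\<exists>B. laurent 2 B (%A. cupw A a b)" for a b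
 proof (cases "a=b")
  case True
  thus ?thesis using laurent_0[of 0 2] by (auto simp: cupw_def)
 next
  case False
  thus ?thesis
   using laurent_uminus[OF laurent_power[of 2]] laurent_mono[OF laurent_1, of 2 1]
   by (cases a) (auto simp: cupw_def)
 qed
 have cap: "\<exists>B. laurent 2 B (%A. capw A a b)" for a b
 proof (cases "a=b")
  case True
  thus ?thesis using laurent_0[of 0 2] by (auto simp: capw_def)
 next
  case False
  thus ?thesis
   using laurent_uminus[OF laurent_inverse_power[of 2]] laurent_mono[OF laurent_1, of 2 1]
   by (cases a) (auto simp: capw_def)
 qed
 have cc: "\<exists>B. laurent 4 B (%A. cupw A a b * capw A c d)" for a b c d
 proof -
  obtain B C where "laurent 2 B (%A. cupw A a b)" "laurent 2 C (%A. capw A c d)" using cup cap by blast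
  from laurent_mult[OF this] show ?thesis by auto
 qed
 have A: "laurent 1 1 (%A. A)" "laurent 1 1 (%A. inverse A)"
  using laurent_power[of 1] laurent_inverse_power[of 1] by simp_all
 have cr: "\<exists>B. laurent 5 B (%A. A*(cupw A a b * capw A c d))"
  "\<exists>B. laurent 5 B (%A. inverse A*(cupw A a b * capw A c d))" for a b c d
 proof -
  obtain B where B: "laurent 4 B (%A. cupw A a b * capw A c d)" using cc by blast
  from laurent_mult[OF A(1) B] laurent_mult[OF A(2) B]
  show "\<exists>B. laurent 5 B (%A. A*(cupw A a b * capw A c d))"
   "\<exists>B. laurent 5 B (%A. inverse A*(cupw A a b * capw A c d))" by auto
 qed
 have di: "\<exists>B. laurent 5 B (%A. if ga=bt then A else 0)" "\<exists>B. laurent 5 B (%A. if ga=bt then inverse A else 0)"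
  using laurent_0[of 0 5] laurent_mono[OF A(1), of 5 1] laurent_mono[OF A(2), of 5 1]
  by (cases "ga=bt"; auto)+
 show ?thesis
 proof (cases p)
  case Cup
  have "\<exists>B. laurent 5 B (%A. cupw A (ga!0) (ga!1))" by (rule laurent_mono_ex[OF cup]) simp
  thus ?thesis by (simp add: Cup)
 next
  case Cap
  have "\<exists>B. laurent 5 B (%A. capw A (bt!0) (bt!1))" by (rule laurent_mono_ex[OF cap]) simp
  thus ?thesis by (simp add: Cap)
 next
  case Pos
  obtain B C where "laurent 5 B (%A. if ga=bt then A else 0)"
   "laurent 5 C (%A. inverse A*(cupw A (ga!0) (ga!1) * capw A (bt!0) (bt!1)))"
   using di(1) cr(2) by blast
  from laurent_add[OF this] show ?thesis by (auto simp: Pos)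
 next
  case Neg
  obtain B C where "laurent 5 B (%A. if ga=bt then inverse A else 0)"
   "laurent 5 C (%A. A*(cupw A (ga!0) (ga!1) * capw A (bt!0) (bt!1)))"
   using di(2) cr(1) by blast
  from laurent_add[OF this(2,1)] show ?thesis by (auto simp: Neg)
 qed
qed

lemma laurent_run:
 "(!!ep. \<exists>B. laurent d B (%A. v A ep)) ==> \<exists>B. laurent (d+5 * length D) B (%A. run A D (v A) ep)"
proof (induction D arbitrary: d v)
 case (Cons x D)
 obtain k p where x: "x=(k, p)" by (cases x)
 have "\<exists>B. laurent (d+5) B (%A. elem_op A k p (v A) ep)" for ep
 proof (cases "k+n_out p <= length ep")
  case True
  have "\<exists>B. laurent (d+5) B (%A. ekernel A p (take (n_out p) (drop k ep)) bt *
    v A (take k ep@bt@drop (k+n_out p) ep))" for bt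
  proof -
   obtain B C where "laurent 5 B (%A. ekernel A p (take (n_out p) (drop k ep)) bt)"
    "laurent d C (%A. v A (take k ep@bt@drop (k+n_out p) ep))"
    using laurent_ekernel Cons.prems by blast
   from laurent_mult[OF this] show ?thesis by (auto simp: add.commute)
  qed
  then obtain B where "!!bt. laurent (d+5) (B bt) (%A. ekernel A p (take (n_out p) (drop k ep)) bt *
    v A (take k ep@bt@drop (k+n_out p) ep))" by metis
  from laurent_sum[OF finite_words this, of "%bt. bt" "n_in p"] show ?thesis
   using True by (auto simp: elem_op_def op_def)
 next
  case False
  thus ?thesis using laurent_0[of 0 "d+5"] by (auto simp: elem_op_short)
 qed
 from Cons.IH[OF this] show ?case by (simp add: x add.assoc)
qed simp

lemma length_cross: "length (cross p a b)=a * b"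
 by (induction a) (simp_all add: cross_Suc shift_def pass_def)

text \<open>9 = 4 + 5: the exponents in \<open>sym_vec2\<close>, and degree 5 for each of the at
  most m^2 crossings. The bound comes from \<open>run_cross_bound\<close> and not from this
  expansion.\<close>

lemma laurent_cross_coeff:
 assumes p: "p \<in> {Pos, Neg}" and "a <= m" "b <= m" "l' <= b" "k' <= a"
 shows "laurent (9 * m * m) (3^m) (%A. cross_coeff A p a b k l l' k')"
proof -
 define ep where "ep=sorted_word b l'@sorted_word a k'"
 define v where "v A ep=(if length ep=a+b then sym_vec2 A a k l ep else 0)" for A ep
 have ab: "a * b <= m * m" "a * a <= m * m" "b * b <= m * m"
  using assms by (auto intro: mult_le_mono)
 have "\<exists>B. laurent (4 * m * m) B (%A. v A ep)" for ep
 proof (cases "length ep=a+b & cnt (take a ep)=k & cnt (drop a ep)=l")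
  case True
  have "2 * invs (take a ep)+2 * invs (drop a ep) <= 4 * m * m"
   using invs_le[of "take a ep"] invs_le[of "drop a ep"] True ab by simp
  hence "laurent (4 * m * m) 1 (%A. A^(2 * invs (take a ep)+2 * invs (drop a ep)))"
   by (intro laurent_mono[OF laurent_power]) auto
  thus ?thesis using True by (auto simp: v_def sym_vec2_def)
 next
  case False
  hence "(%A. v A ep)=(%A. 0)" by (auto simp: v_def sym_vec2_def)
  thus ?thesis using laurent_0[of 0] by auto
 qed
 from laurent_run[of "4 * m * m" v "cross p a b" ep, OF this]
 have "\<exists>B. laurent (4 * m * m+5*(a * b)) B (%A. run A (cross p a b) (v A) ep)"
  by (simp add: length_cross)
 hence 1: "\<exists>B. laurent (9 * m * m) B (%A. run A (cross p a b) (v A) ep)"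
  by (rule laurent_mono_ex) (use ab in simp)
 have len: "length ep=a+b" using assms by (simp add: ep_def)
 have "run A (cross p a b) (v A) ep=cross_coeff A p a b k l l' k'" for A
  unfolding cross_coeff_def ep_def[symmetric]
  by (rule run_cong[OF valid_cross[OF p] len]) (simp add: v_def)
 with 1 have 2: "\<exists>B. laurent (9 * m * m) B (%A. cross_coeff A p a b k l l' k')" by simp
 have "norm (cross_coeff A p a b k l l' k') <= 3^m" if A: "generic A" "norm A=1" for A
 proof -
  define y where "y ga1 i=A^(2 * invs ga1)*(if cnt ga1=k & i=l then 1 else 0)" for ga1 i
  obtain y' where y': "!!ga1 ga2. length ga1=a ==> length ga2=b ==>
    run A (cross p a b) (sym_vec2 A a k l) (ga2@ga1)=A^(2 * invs ga2) * y' ga1 (cnt ga2)"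
   "!!ga1 i. norm (y' ga1 i) <= 3^a*1"
  proof (rule run_cross_bound[OF A p, of a b "sym_vec2 A a k l" y 1])
   show "norm (y ga1 i) <= 1" for ga1 i using A by (simp add: y_def norm_mult norm_power)
  qed (auto simp: sym_vec2_def y_def power_add mult_ac)
  have "cross_coeff A p a b k l l' k' = y' (sorted_word a k') l'"
   unfolding cross_coeff_def using y'(1)[of "sorted_word a k'" "sorted_word b l'"] assms by simp
  hence "norm (cross_coeff A p a b k l l' k') <= 3^a" using y'(2)[of "sorted_word a k'" l'] by simp
  also have "\<dots> <= 3^m" using assms by (intro power_increasing) auto
  finally show ?thesis .
 qed
 with 2 show ?thesis unfolding laurent_def by blast
qed

section \<open>Vertices\<close>

text \<open>A local projector whose legs are forgotten, so that arcs can be removed one at a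
  time.\<close>

definition matching :: "nat => (nat \<times> nat) set => bool" where
 "matching L S \<longleftrightarrow> (\<forall>(i, j) \<in> S. i<j & j<L) \<and>
   (\<forall>x<L. \<exists>!a. a \<in> S & (x=fst a \<or> x=snd a)) \<and>
   (\<forall>(i, j) \<in> S. \<forall>(k, l) \<in> S. \<not> (i<k & k<j & j<l))"

lemma matching_less: "matching L S ==> (i, j) \<in> S ==> i<j & j<L"
 by (auto simp: matching_def)

lemma matching_unique:
 assumes "matching L S" "a \<in> S" "b \<in> S" "x=fst a \<or> x=snd a" "x=fst b \<or> x=snd b"
 shows "a=b"
proof -
 have "x<L" using matching_less[OF assms(1), of "fst a" "snd a"] assms(2,4) by auto
 thus ?thesis using assms unfolding matching_def by metis
qed

lemma matching_ex:
 assumes "matching L S" "x<L"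
 obtains y where "(x, y) \<in> S" | y where "(y, x) \<in> S"
proof -
 have "\<exists>!a. a \<in> S & (x=fst a \<or> x=snd a)" using assms unfolding matching_def by simp
 then obtain a where "a \<in> S" "x=fst a \<or> x=snd a" by blast
 thus ?thesis using that by (cases a) auto
qed

lemma matching_noncrossing:
 "matching L S ==> (i, j) \<in> S ==> (k, l) \<in> S ==> i<k ==> k<j ==> j<l ==> False"
 unfolding matching_def by fast

lemma matching_finite: "matching L S ==> finite S"
 by (rule finite_subset[of _ "{..<L} \<times> {..<L}"]) (auto dest: matching_less)

definition arc_cups :: "(nat \<times> nat) set => link_diagram" where
 "arc_cups S=map (%i. (i, Cup)) (sorted_list_of_set (fst ` S))"

lemma sorted_list_of_set_snoc:
 fixes X :: "nat set"
 assumes "finite X" "!!x. x \<in> X ==> x<i"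
 shows "sorted_list_of_set (insert i X)=sorted_list_of_set X@[i]"
 by (rule sorted_distinct_set_unique) (use assms in \<open>auto simp: sorted_append less_imp_le simp del: sorted_list_of_set_insert_remove\<close>)

text \<open>The arc with the largest left end point joins neighbouring points \<open>i\<close>, \<open>i + 1\<close>; the others form
 a matching of the remaining points, which are renumbered by \<open>dl\<close>.\<close>

lemma arc_cups_run:
 assumes "matching L S"
 shows "valid 0 (arc_cups S) L & (\<forall>ep. length ep=L -->
  run A (arc_cups S) u ep=(\<Prod>(i, j)\<in>S. cupw A (ep!i) (ep!j)) * u [])"
 using assms
proof (induction L arbitrary: S rule: less_induct)
 case (less L)
 note M = less.prems
 show ?case
 proof (cases "S={}")
  case True
  have "L=0"
  proof (rule ccontr)
   assume "L ~= 0" thus False using matching_ex[OF M, of 0] True by auto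
  qed
  thus ?thesis using True by (simp add: arc_cups_def)
 next
  case False
  have fin: "finite S" by (rule matching_finite[OF M])
  define i where "i=Max (fst ` S)"
  have "i \<in> fst ` S" unfolding i_def using fin False by (intro Max_in) auto
  then obtain j where ij: "(i, j) \<in> S" by auto
  have max: "k <= i" if "(k, l) \<in> S" for k l
   unfolding i_def using that fin by (intro Max_ge) (auto intro: image_eqI[of _ _ "(k, l)"])
  \<comment> \<open>Otherwise \<open>i + 1\<close> lies under the arc. By maximality of
    \<open>i\<close> it is a right end point, of an arc that starts left of \<open>i\<close> and
    crosses the arc from \<open>i\<close> to \<open>j\<close>.\<close>
  have j: "j=Suc i"
  proof (rule ccontr)
   assume "j ~= Suc i"
   hence lt: "Suc i<j" "j<L" using matching_less[OF M ij] by auto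
   hence "Suc i<L" by simp
   then consider y where "(Suc i, y) \<in> S" | y where "(y, Suc i) \<in> S" by (rule matching_ex[OF M]) auto
   thus False
   proof cases
    case (1 y)
    thus False using max[of "Suc i" y] by simp
   next
    case (2 y)
    have "y ~= i" using matching_unique[OF M ij 2, of i] lt by auto
    moreover have "y<Suc i" using matching_less[OF M 2] by simp
    ultimately show False using matching_noncrossing[OF M 2 ij] lt by simp
   qed
  qed
  have iL: "Suc i<L" using matching_less[OF M ij] j by simp
  define dl where "dl x=(if x<i then x else x+2)" for x
  have dmono: "dl x<dl y \<longleftrightarrow> x<y" for x y by (auto simp: dl_def)
  have dinj: "dl x=dl y \<longleftrightarrow> x=y" for x y by (auto simp: dl_def)
  have dL: "dl x<L \<longleftrightarrow> x<L-2" for x using iL by (auto simp: dl_def)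
  have drange: "\<exists>x. y=dl x" if "y ~= i" "y ~= Suc i" for y
  proof (cases "y<i")
   case True thus ?thesis by (intro exI[of _ y]) (simp add: dl_def)
  next
   case False
   hence "y=dl (y-2)" using that by (auto simp: dl_def)
   thus ?thesis by blast
  qed
  have dne: "dl x ~= i" "dl x ~= Suc i" for x by (auto simp: dl_def)
  have ne: "a ~= i & a ~= Suc i & b ~= i & b ~= Suc i" if "(a, b) \<in> S" "(a, b) ~= (i, Suc i)" for a b
   using matching_unique[OF M that(1) ij, of i] matching_unique[OF M that(1) ij, of "Suc i"] that(2) j by auto
  define S' where "S' = {(a, b). (dl a, dl b) \<in> S}"
  have S: "S=insert (i, Suc i) ((%(a, b). (dl a, dl b)) ` S')"
  proof (intro equalityI subsetI)
   fix z assume z: "z \<in> S"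
   show "z \<in> insert (i, Suc i) ((%(a, b). (dl a, dl b)) ` S')"
   proof (cases "z=(i, Suc i)")
    case False
    obtain a b where ab: "z=(a, b)" by (cases z)
    then obtain a' b' where "a=dl a'" "b=dl b'" using ne[of a b] z False drange by metis
    thus ?thesis using z ab by (auto simp: S'_def)
   qed simp
  qed (use ij j in \<open>auto simp: S'_def\<close>)
  have nin: "(i, Suc i) \<notin> (%(a, b). (dl a, dl b)) ` S'" using dne by auto
  have inj: "inj_on (%(a, b). (dl a, dl b)) S'" by (auto simp: inj_on_def dinj)
  have M1: "a<b & b<L-2" if "(a, b) \<in> S'" for a b
   using that matching_less[OF M, of "dl a" "dl b"] by (auto simp: S'_def dmono dL)
  have M2: "\<exists>!z. z \<in> S' & (x=fst z \<or> x=snd z)" if "x<L-2" for x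
  proof -
   from that have "dl x<L" by (simp add: dL)
   then obtain a b where ab: "(a, b) \<in> S" "dl x=a \<or> dl x=b" by (rule matching_ex[OF M]) auto
   have "(a, b) ~= (i, Suc i)" using ab(2) dne[of x] by auto
   from ne[OF ab(1) this] obtain a' b' where d: "a=dl a'" "b=dl b'" using drange by metis
   show ?thesis
   proof (intro ex1I[of _ "(a', b')"] conjI)
    show "(a', b') \<in> S'" using ab d by (simp add: S'_def)
    show "x=fst (a', b') \<or> x=snd (a', b')" using ab d by (simp add: dinj)
    fix z assume "z \<in> S' & (x=fst z \<or> x=snd z)"
    hence "(dl (fst z), dl (snd z))=(a, b)"
     using ab by (intro matching_unique[OF M _ ab(1), of _ "dl x"]) (auto simp: S'_def)
    thus "z=(a', b')" using d by (auto simp: dinj prod_eq_iff)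
   qed
  qed
  have M3: "\<not> (k<k' & k' < l & l<l')" if "(k, l) \<in> S'" "(k', l') \<in> S'" for k l k' l'
   using that matching_noncrossing[OF M, of "dl k" "dl l" "dl k'" "dl l'"] by (auto simp: S'_def dmono)
  have M': "matching (L-2) S'"
   unfolding matching_def using M1 M2 M3 by blast
  have lt: "a<i" if "(a, b) \<in> S'" for a b
  proof -
   have "dl a <= i" using max[of "dl a" "dl b"] that by (simp add: S'_def)
   thus ?thesis by (auto simp: dl_def split: if_splits)
  qed
  have "fst ` S=insert i (fst ` S')"
   unfolding S by (force simp: image_iff dl_def dest: lt)
  moreover have "finite S'" by (rule matching_finite[OF M'])
  hence "sorted_list_of_set (insert i (fst ` S'))=sorted_list_of_set (fst ` S')@[i]"
   by (intro sorted_list_of_set_snoc) (auto dest: lt)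
  ultimately have cups: "arc_cups S=arc_cups S'@[(i, Cup)]"
   by (simp only: arc_cups_def map_append list.map)
  have IH: "valid 0 (arc_cups S') (L-2)" "!!ep. length ep=L-2 ==>
    run A (arc_cups S') u ep=(\<Prod>(i, j)\<in>S'. cupw A (ep!i) (ep!j)) * u []"
   using less.IH[OF _ M'] iL by auto
  have "valid 0 (arc_cups S) L"
   unfolding cups valid_append using IH(1) iL by (intro exI[of _ "L-2"]) auto
  moreover have "run A (arc_cups S) u ep=(\<Prod>(i, j)\<in>S. cupw A (ep!i) (ep!j)) * u []" if l: "length ep=L" for ep
  proof -
   define al where "al=take i ep"
   define et where "et=drop (i+2) ep"
   have e: "ep=al@ep!i#ep!Suc i#et" "length al=i" "length et=L-2-i"
    using split_at[of i ep] l iL by (auto simp: al_def et_def)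
   have nth: "(al@et)!x=ep!dl x" if "x<L-2" for x
   proof (cases "x<i")
    case True
    thus ?thesis using l iL by (simp add: nth_append dl_def al_def)
   next
    case False
    hence "et!(x-i)=ep!(i+2+(x-i))" using l iL that unfolding et_def by (intro nth_drop) simp
    thus ?thesis using False e(2) by (simp add: nth_append dl_def)
   qed
   have "run A (arc_cups S) u ep=elem_op A i Cup (run A (arc_cups S') u) ep"
    by (simp add: cups run_append)
   also have "\<dots>=cupw A (ep!i) (ep!Suc i) * run A (arc_cups S') u (al@et)"
    by (subst e(1)) (rule elem_op_Cup[OF e(2)])
   also have "run A (arc_cups S') u (al@et)=(\<Prod>(a, b)\<in>S'. cupw A (ep!dl a) (ep!dl b)) * u []"
   proof -
    have "length (al@et)=L-2" using e iL by simp
    moreover have "(\<Prod>(a, b)\<in>S'. cupw A ((al@et)!a) ((al@et)!b))=(\<Prod>(a, b)\<in>S'. cupw A (ep!dl a) (ep!dl b))"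
    proof (intro prod.cong refl, clarify)
     fix a b assume "(a, b) \<in> S'"
     hence "a<L-2" "b<L-2" using matching_less[OF M', of a b] by auto
     thus "cupw A ((al@et)!a) ((al@et)!b)=cupw A (ep!dl a) (ep!dl b)" by (simp only: nth)
    qed
    ultimately show ?thesis using IH(2) by simp
   qed
   also have "cupw A (ep!i) (ep!Suc i)*((\<Prod>(a, b)\<in>S'. cupw A (ep!dl a) (ep!dl b)) * u []) =
    (\<Prod>(i, j)\<in>S. cupw A (ep!i) (ep!j)) * u []"
    unfolding S using nin inj \<open>finite S'\<close> by (simp add: prod.reindex case_prod_unfold o_def)
   finally show ?thesis .
  qed
  ultimately show ?thesis by blast
 qed
qed

primrec cnts :: "nat list => bool list => nat list" where
 "cnts [] ep=[]"
| "cnts (b#bs) ep=cnt (take b ep) # cnts bs (drop b ep)"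

primrec block_invs :: "nat list => bool list => nat" where
 "block_invs [] ep=0"
| "block_invs (b#bs) ep=invs (take b ep)+block_invs bs (drop b ep)"

lemma cnts_append:
 "length al=sum_list bs ==> cnts (bs@bs') (al@bt)=cnts bs al @ cnts bs' bt"
 by (induction bs arbitrary: al) auto

lemma block_invs_append:
 "length al=sum_list bs ==> block_invs (bs@bs') (al@bt)=block_invs bs al+block_invs bs' bt"
 by (induction bs arbitrary: al) auto

lemma length_cnts [simp]: "length (cnts bs ep)=length bs"
 by (induction bs arbitrary: ep) auto

definition gausses :: "complex => nat list => nat list => complex" where
 "gausses A bs ks=prod_list (map2 (gauss A) bs ks)"

lemma gausses_simps [simp]: "gausses A [] []=1" "gausses A (b#bs) (k#ks)=gauss A b k * gausses A bs ks"
 by (simp_all add: gausses_def)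

lemma gausses_append: "length bs=length ks ==> gausses A (bs@bs') (ks@ks')=gausses A bs ks * gausses A bs' ks'"
 by (simp add: gausses_def)

lemma gausses_nz:
 assumes "generic A" shows "list_all2 (\<le>) ks bs ==> gausses A bs ks ~= 0"
 by (induction ks bs rule: list_all2_induct) (use assms in \<open>auto simp: gauss_nz\<close>)

fun sym_ops :: "complex => nat => nat list => vec => vec" where
 "sym_ops A q [] v=v"
| "sym_ops A q (b#bs) v=sym_ops A (q+b) bs (sym_op A q b v)"

lemma sym_ops_app:
 assumes "length al=q" "length ga=sum_list bs"
 shows "sym_ops A q bs v (al@ga@et)=A^(2 * block_invs bs ga)/gausses A bs (cnts bs ga) *
  (\<Sum>bt\<in>words (sum_list bs). (if cnts bs bt=cnts bs ga then A^(2 * block_invs bs bt) else 0) * v (al@bt@et))"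
 using assms
proof (induction bs arbitrary: q v al ga)
 case (Cons b bs)
 obtain ga1 ga2 where g: "ga=ga1@ga2" "length ga1=b" using split_len[of b ga] Cons.prems by auto
 hence g2: "length ga2=sum_list bs" using Cons.prems by simp
 have 1: "sym_op A q b v (al@ga1@bt2@et)=(\<Sum>bt\<in>words b. sym_kernel A b ga1 bt * v (al@bt@bt2@et))" for bt2
  by (rule sym_op_app[OF Cons.prems(1) g(2)])
 let ?c = "%bt2. if cnts bs bt2=cnts bs ga2 then A^(2 * block_invs bs bt2) else 0"
 let ?p = "A^(2 * block_invs bs ga2)/gausses A bs (cnts bs ga2)"
 have "sym_ops A q (b#bs) v (al@ga@et)=sym_ops A (q+b) bs (sym_op A q b v) ((al@ga1)@ga2@et)"
  by (simp add: g)
 also have "\<dots> = ?p*(\<Sum>bt2\<in>words (sum_list bs). ?c bt2 * sym_op A q b v ((al@ga1)@bt2@et))"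
  by (rule Cons.IH) (use Cons.prems g g2 in auto)
 also have "\<dots>=(\<Sum>bt2\<in>words (sum_list bs). \<Sum>bt\<in>words b. ?p * ?c bt2*(sym_kernel A b ga1 bt * v (al@bt@bt2@et)))"
  by (simp add: 1 sum_distrib_left mult.assoc)
 also have "\<dots>=(\<Sum>bt\<in>words b. \<Sum>bt2\<in>words (sum_list bs). ?p * ?c bt2*(sym_kernel A b ga1 bt * v (al@bt@bt2@et)))"
  by (rule sum.swap)
 also have "\<dots>=A^(2 * block_invs (b#bs) ga)/gausses A (b#bs) (cnts (b#bs) ga) *
  (\<Sum>bt\<in>words (sum_list (b#bs)). (if cnts (b#bs) bt=cnts (b#bs) ga then A^(2 * block_invs (b#bs) bt) else 0) * v (al@bt@et))"
  unfolding sum_list.Cons sum_words_add sum_distrib_left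
  by (intro sum.cong refl) (use g in \<open>auto simp: sym_kernel_def power_add distrib_left\<close>)
 finally show ?case .
next
 case Nil
 thus ?case by simp
qed

text \<open>For the word that is \<open>True\<close> exactly on \<open>T\<close>: the inversions
  with \<open>False\<close> at a point of \<open>S\<close> and \<open>True\<close> at a point of
  \<open>S'\<close>. Two sets are needed to treat pairs of bundles.\<close>

definition inversions :: "nat set => nat set => nat set => nat" where
 "inversions S S' T=card {(x, y). x \<in> S-T & y \<in> S' \<inter> T & x<y}"

lemma cnt_card: "cnt ga=card {x. x<length ga & ga!x}"
proof (induction ga)
 case (Cons a ga)
 have "{x. x<length (a#ga) & (a#ga)!x}=(if a then {0} else {}) \<union> Suc ` {x. x<length ga & ga!x}"
  by (auto simp: less_Suc_eq_0_disj)
 thus ?case using Cons by (auto simp: card_insert_if card_image)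
qed simp

lemma invs_card: "invs ga=card {(x, y). x<y & y<length ga & \<not> ga!x & ga!y}"
proof (induction ga)
 case (Cons a ga)
 let ?I = "%ga. {(x, y). x<y & y<length ga & \<not> ga!x & ga!y}"
 let ?J = "if a then {} else (%y. (0 :: nat, Suc y)) ` {x. x<length ga & ga!x}"
 have fin: "finite (?I ga)" by (rule finite_subset[of _ "{..<length ga} \<times> {..<length ga}"]) auto
 have "?I (a#ga) = ?J \<union> (%(x, y). (Suc x, Suc y)) ` ?I ga"
 proof -
  have "(x, y) \<in> ?I (a#ga) \<longleftrightarrow> (x, y) \<in> ?J \<union> (%(x, y). (Suc x, Suc y)) ` ?I ga" for x y
   by (cases x; cases y) auto
  thus ?thesis by auto
 qed
 moreover have "card (?J \<union> (%(x, y). (Suc x, Suc y)) ` ?I ga)=card ?J + card ((%(x, y). (Suc x, Suc y)) ` ?I ga)"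
  by (rule card_Un_disjoint) (use fin in auto)
 moreover have "card ((%(x, y). (Suc x, Suc y)) ` ?I ga)=invs ga"
  unfolding Cons by (rule card_image) (auto simp: inj_on_def)
 moreover have "card ?J=(if a then 0 else cnt ga)"
  by (auto simp: cnt_card intro!: card_image inj_onI)
 ultimately show ?case by simp
qed simp

lemma sum_list_take_Suc: "g<length cs ==> sum_list (take (Suc g) cs)=sum_list (take g cs) + cs!g"
 by (simp add: take_Suc_conv_app_nth)

lemma sum_list_take_mono: "g <= h ==> sum_list (take g cs) <= sum_list (take h (cs :: nat list))"
 by (metis append_take_drop_id le_add1 min.absorb1 sum_list_append take_take)

lemma cnts_nth: "g<length bs ==> cnts bs ep!g=cnt (take (bs!g) (drop (sum_list (take g bs)) ep))"
 by (induction bs arbitrary: g ep) (auto simp: nth_Cons less_Suc_eq_0_disj add.commute split: nat.splits)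

lemma block_invs_sum:
 "block_invs bs ep=(\<Sum>g<length bs. invs (take (bs!g) (drop (sum_list (take g bs)) ep)))"
 by (induction bs arbitrary: ep) (simp_all add: sum.lessThan_Suc_shift add.commute del: sum.lessThan_Suc)

text \<open>The Pascal recursion, according to whether the least element of \<open>S\<close> belongs
  to \<open>Y\<close>; if not, it forms an inversion with each element of \<open>Y\<close>.\<close>

lemma gauss_subsets:
 "finite S ==> gauss A (card S) j=(\<Sum>Y\<in>{Y. Y \<subseteq> S & card Y=j}. A^(4 * inversions S S Y))"
proof (induction "card S" arbitrary: S j)
 case 0
 hence "S={}" by simp
 thus ?case
 proof (cases j)
  case 0
  have "{Y. Y \<subseteq> S & card Y=j}={{}}" using \<open>S = {}\<close> 0 by auto
  thus ?thesis using \<open>S = {}\<close> 0 by (simp add: inversions_def)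
 next
  case (Suc n)
  hence "{Y. Y \<subseteq> S & card Y=j}={}" using \<open>S = {}\<close> by auto
  thus ?thesis using \<open>S = {}\<close> Suc by (simp only: gauss_gt card.empty zero_less_Suc sum.empty)
 qed
next
 case (Suc n)
 have fin: "finite S" by fact
 define s where "s=Min S"
 have s: "s \<in> S" unfolding s_def using Suc.hyps(2) fin by (intro Min_in) auto
 define S' where "S' = S-{s}"
 have S: "S=insert s S'" "s \<notin> S'" "finite S'" using s fin by (auto simp: S'_def)
 have lt: "s<x" if "x \<in> S'" for x
  using that fin by (auto simp: S'_def s_def intro: le_neq_trans[OF Min_le])
 have n: "n=card S'" using Suc.hyps(2) S by simp
 have nlt: "\<not> x<s" if "x \<in> S" for x using lt[of x] that S by auto
 have inv_in: "inversions S S (insert s Y)=inversions S' S' Y" if "Y \<subseteq> S'" for Y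
  unfolding inversions_def using that S lt by (intro arg_cong[where f = card]) (auto dest: lt)
 have inv_out: "inversions S S Y=card Y+inversions S' S' Y" if "Y \<subseteq> S'" for Y
 proof -
  have "{(x, y). x \<in> S-Y & y \<in> S \<inter> Y & x<y}=Pair s ` Y \<union> {(x, y). x \<in> S'-Y & y \<in> S' \<inter> Y & x<y}"
   using that S lt by auto
  moreover have "card (Pair s ` Y \<union> {(x, y). x \<in> S'-Y & y \<in> S' \<inter> Y & x<y}) =
   card (Pair s ` Y) + card {(x, y). x \<in> S'-Y & y \<in> S' \<inter> Y & x<y}"
  proof (rule card_Un_disjoint)
   show "finite {(x, y). x \<in> S'-Y & y \<in> S' \<inter> Y & x<y}"
    by (rule finite_subset[of _ "S' \<times> S'"]) (use S in auto)
   show "finite (Pair s ` Y)" using that S finite_subset by blast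
  qed (use S in auto)
  ultimately show ?thesis by (simp add: inversions_def card_image inj_on_def)
 qed
 have cd: "card (insert s Y)=Suc (card Y)" if "Y \<subseteq> S'" for Y
  using that S finite_subset[OF that S(3)] by (subst card_insert_disjoint) auto
 show ?case
 proof (cases j)
  case 0
  have "{Y. Y \<subseteq> S & card Y=j}={{}}" using fin 0 finite_subset by fastforce
  thus ?thesis using 0 by (simp add: inversions_def)
 next
  case (Suc i)
  let ?P = "%S j. {Y. Y \<subseteq> S & card Y=j}"
  have e: "?P S (Suc i)=insert s ` ?P S' i \<union> ?P S' (Suc i)"
  proof (intro equalityI subsetI)
   fix Y assume Y: "Y \<in> ?P S (Suc i)"
   show "Y \<in> insert s ` ?P S' i \<union> ?P S' (Suc i)"
   proof (cases "s \<in> Y")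
    case True
    hence "Y=insert s (Y-{s})" "Y-{s} \<subseteq> S'" using Y S by auto
    moreover have "card (Y-{s})=i" using True Y by simp
    ultimately show ?thesis by blast
   next
    case False
    thus ?thesis using Y S by auto
   qed
  next
   fix Y assume "Y \<in> insert s ` ?P S' i \<union> ?P S' (Suc i)"
   thus "Y \<in> ?P S (Suc i)" using S cd by auto
  qed
  have "(\<Sum>Y\<in>?P S (Suc i). A^(4 * inversions S S Y)) =
   (\<Sum>Y\<in>insert s ` ?P S' i. A^(4 * inversions S S Y))+(\<Sum>Y\<in>?P S' (Suc i). A^(4 * inversions S S Y))"
   unfolding e using S by (intro sum.union_disjoint) auto
  also have "(\<Sum>Y\<in>insert s ` ?P S' i. A^(4 * inversions S S Y))=(\<Sum>Y\<in>?P S' i. A^(4 * inversions S' S' Y))"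
  proof (subst sum.reindex)
   show "inj_on (insert s) (?P S' i)"
    using S(2) by (intro inj_onI) (metis (no_types, lifting) Diff_insert_absorb mem_Collect_eq subsetD)
  qed (use inv_in in \<open>auto intro!: sum.cong\<close>)
  also have "\<dots>=gauss A n i" using Suc.hyps(1)[OF n S(3)] n by simp
  also have "(\<Sum>Y\<in>?P S' (Suc i). A^(4 * inversions S S Y))=A^(4*Suc i)*(\<Sum>Y\<in>?P S' (Suc i). A^(4 * inversions S' S' Y))"
   unfolding sum_distrib_left using inv_out by (intro sum.cong refl) (auto simp: power_add distrib_left)
  also have "(\<Sum>Y\<in>?P S' (Suc i). A^(4 * inversions S' S' Y))=gauss A n (Suc i)"
   using Suc.hyps(1)[OF n S(3)] n by simp
  finally show ?thesis
   unfolding Suc by (subst \<open>Suc n = card S\<close>[symmetric]) (simp only: gauss_Suc)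
 qed
qed

section \<open>Bundles of parallel arcs in a local projector\<close>

locale local_proj =
 fixes p :: projector
 assumes local_projector: "local_projector p"
begin

definition "deg=length (legs p)"
definition "npts=sum_list (legs p)"
definition "start h=sum_list (take h (legs p))"
definition "leg_of x=(LEAST h. x<start (Suc h))"
definition "partner x=(THE y. (x, y) \<in> arcs p \<or> (y, x) \<in> arcs p)"

lemma leg_points_eq: "leg_points p h={start h..<start (Suc h)}"
 by (simp add: leg_points_def start_def)

lemma start_mono: "g <= h ==> start g <= start h"
 unfolding start_def by (rule sum_list_take_mono)

lemma start_Suc: "h<deg ==> start (Suc h)=start h+legs p!h"
 by (simp add: start_def deg_def sum_list_take_Suc)

lemma start_deg: "start deg=npts"
 by (simp add: start_def deg_def npts_def)

lemma start_le: "start h <= npts"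
 by (metis append_take_drop_id le_add1 npts_def start_def sum_list_append)

lemma leg_of_iff:
 assumes "x<npts"
 shows "leg_of x=h & h<deg \<longleftrightarrow> x \<in> leg_points p h & h<deg"
proof -
 have deg0: "deg > 0"
  using assms start_deg by (cases deg) (auto simp: start_def)
 have ex: "x<start (Suc (deg-1))" using assms deg0 start_deg by simp
 have 1: "x<start (Suc (leg_of x))" unfolding leg_of_def using ex by (rule LeastI)
 have 2: "start (leg_of x) <= x"
 proof (cases "leg_of x")
  case (Suc h)
  hence "\<not> x<start (Suc h)" unfolding leg_of_def by (metis lessI not_less_Least)
  thus ?thesis using Suc by simp
 qed (simp add: start_def)
 show ?thesis
 proof
  assume "leg_of x=h & h<deg"
  thus "x \<in> leg_points p h & h<deg" using 1 2 by (auto simp: leg_points_eq)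
 next
  assume h: "x \<in> leg_points p h & h<deg"
  have "\<not> leg_of x<h" using start_mono[of "Suc (leg_of x)" h] 1 h by (auto simp: leg_points_eq)
  moreover have "\<not> h<leg_of x" using start_mono[of "Suc h" "leg_of x"] 2 h by (auto simp: leg_points_eq)
  ultimately show "leg_of x=h & h<deg" using h by auto
 qed
qed

lemma leg_of_less: "x<npts ==> leg_of x<deg"
proof -
 assume x: "x<npts"
 hence deg0: "deg > 0"
  using start_deg by (cases deg) (auto simp: start_def)
 hence "x<start (Suc (deg-1))" using x start_deg by simp
 hence "leg_of x <= deg-1" unfolding leg_of_def by (rule Least_le)
 thus ?thesis using deg0 by simp
qed

lemma leg_of_eq: "x<npts ==> h<deg ==> leg_of x=h \<longleftrightarrow> x \<in> leg_points p h"
 using leg_of_iff by blast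

lemma leg_of_in: "x<npts ==> x \<in> leg_points p (leg_of x)"
 using leg_of_eq[OF _ leg_of_less] by blast

lemma leg_points_less: "x \<in> leg_points p h ==> x<npts"
 using start_le[of "Suc h"] by (auto simp: leg_points_eq)

lemma leg_of_mono:
 assumes "x<npts" "y<npts" "x<y"
 shows "leg_of x <= leg_of y"
proof -
 have "x \<in> leg_points p (leg_of x)" "y \<in> leg_points p (leg_of y)"
  using leg_of_in assms by auto
 thus ?thesis
  using start_mono[of "Suc (leg_of y)" "leg_of x"] assms(3) by (fastforce simp: leg_points_eq not_le)
qed

lemma matching: "matching npts (arcs p)"
 using local_projector by (simp add: matching_def local_projector_def npts_def)

lemma no_uturn: "(i, j) \<in> arcs p ==> leg_of i ~= leg_of j"
proof
 assume ij: "(i, j) \<in> arcs p" "leg_of i=leg_of j"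
 have l: "i<npts" "j<npts" using matching_less[OF matching ij(1)] by auto
 hence "i \<in> leg_points p (leg_of i)" "j \<in> leg_points p (leg_of i)" "leg_of i<deg"
  using leg_of_in[OF l(1)] leg_of_in[OF l(2)] leg_of_less[OF l(1)] ij(2) by auto
 thus False using local_projector ij(1) unfolding local_projector_def deg_def by fast
qed

lemma partner_arc: "(i, j) \<in> arcs p ==> partner i=j" "(i, j) \<in> arcs p ==> partner j=i"
proof -
 assume ij: "(i, j) \<in> arcs p"
 have "i<j" using matching_less[OF matching ij] by simp
 note u = matching_unique[OF matching _ ij]
 show "partner i=j" unfolding partner_def
 proof (rule the_equality)
  fix y assume "(i, y) \<in> arcs p \<or> (y, i) \<in> arcs p"
  thus "y=j" using u[of "(i, y)" i] u[of "(y, i)" i] \<open>i < j\<close> by auto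
 qed (use ij in simp)
 show "partner j=i" unfolding partner_def
 proof (rule the_equality)
  fix y assume "(j, y) \<in> arcs p \<or> (y, j) \<in> arcs p"
  thus "y=i" using u[of "(j, y)" j] u[of "(y, j)" j] \<open>i < j\<close> by auto
 qed (use ij in simp)
qed

lemma arc_partner:
 assumes "x<npts"
 shows "x<partner x & (x, partner x) \<in> arcs p \<or> partner x<x & (partner x, x) \<in> arcs p"
 using assms
proof (rule matching_ex[OF matching])
 fix y assume "(x, y) \<in> arcs p"
 thus ?thesis using partner_arc(1)[of x y] matching_less[OF matching, of x y] by simp
next
 fix y assume "(y, x) \<in> arcs p"
 thus ?thesis using partner_arc(2)[of y x] matching_less[OF matching, of y x] by simp
qed

lemma partner_less: "x<npts ==> partner x<npts"
 using arc_partner[of x] matching_less[OF matching] by (metis less_trans)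

lemma partner_partner: "x<npts ==> partner (partner x)=x"
 using arc_partner[of x] partner_arc by metis

lemma leg_of_partner: "x<npts ==> leg_of (partner x) ~= leg_of x"
 using arc_partner[of x] no_uturn by metis

lemma partner_less_iff:
 assumes "x<npts"
 shows "partner x<x \<longleftrightarrow> leg_of (partner x)<leg_of x"
proof -
 have "partner x<npts" "leg_of (partner x) ~= leg_of x" "partner x ~= x"
  using assms partner_less leg_of_partner arc_partner[of x] by auto
 thus ?thesis
  using leg_of_mono[of "partner x" x] leg_of_mono[of x "partner x"] assms
  by (cases "partner x" x rule: linorder_cases) auto
qed

text \<open>The place of the other end in the cyclic order read from \<open>x\<close> on: ends left
  of \<open>x\<close> come after one full turn.\<close>

definition "key x=(if partner x<x then partner x+npts else partner x)"

text \<open>Along a leg, the other end points are met in clockwise order.\<close>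

lemma key_decreasing:
 assumes "u<v" "v<npts" "leg_of u=leg_of v"
 shows "key v<key u"
proof -
 have l: "u<npts" "v<npts" using assms by auto
 have ne: "partner u ~= partner v" using partner_partner[OF l(1)] partner_partner[OF l(2)] assms(1) by auto
 \<comment> \<open>An arc from \<open>u\<close> or \<open>v\<close> to a point between them would be
   a U-turn, because legs are intervals.\<close>
 have lo: "partner w<u \<or> v<partner w" if "w=u \<or> w=v" for w
 proof (rule ccontr)
  assume "\<not> (partner w<u \<or> v<partner w)"
  hence b: "u <= partner w" "partner w <= v" by auto
  have w: "w<npts" using that l by auto
  have "leg_of u <= leg_of (partner w)" "leg_of (partner w) <= leg_of v"
   using b leg_of_mono[OF l(1) partner_less[OF w]] leg_of_mono[OF partner_less[OF w] l(2)]
   by (auto simp: le_less)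
  thus False using leg_of_partner[OF w] that assms(3) by auto
 qed
 note nc = matching_noncrossing[OF matching]
 consider "partner u<u" "partner v<v" | "\<not> partner u<u" "\<not> partner v<v"
  | "\<not> partner u<u" "partner v<v" | "partner u<u" "\<not> partner v<v" by blast
 thus ?thesis
 proof cases
  case 1
  hence a: "(partner u, u) \<in> arcs p" "(partner v, v) \<in> arcs p" using arc_partner l by (metis less_asym)+
  have "partner v<u" using lo[of v] 1 by auto
  hence "\<not> partner u<partner v" using nc[OF a(1,2)] assms(1) by auto
  thus ?thesis using 1 ne by (simp add: key_def)
 next
  case 2
  hence a: "(u, partner u) \<in> arcs p" "(v, partner v) \<in> arcs p" using arc_partner l by metis+
  have "v<partner u" using lo[of u] 2 assms(1) by auto
  hence "\<not> partner u<partner v" using nc[OF a(1,2)] assms(1) by auto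
  thus ?thesis using 2 ne by (simp add: key_def)
 next
  case 3
  hence a: "(u, partner u) \<in> arcs p" "(partner v, v) \<in> arcs p" using arc_partner l by (metis less_asym)+
  have "v<partner u" using lo[of u] 3 assms(1) by auto
  moreover have "partner v<u" using lo[of v] 3 by auto
  ultimately show ?thesis using nc[OF a(2,1)] assms(1) by auto
 next
  case 4
  thus ?thesis using partner_less[OF l(2)] by (simp add: key_def)
 qed
qed

lemma key_less_iff:
 "u<npts ==> v<npts ==> leg_of u=leg_of v ==> key v<key u \<longleftrightarrow> u<v"
 using key_decreasing[of u v] key_decreasing[of v u] by (metis less_asym less_irrefl linorder_neqE_nat)

definition "fib g h={x. x<npts & leg_of x=g & leg_of (partner x)=h}"

lemma fib_finite [simp]: "finite (fib g h)"
 by (simp add: fib_def)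

lemma fib_same: "fib g g={}"
 using leg_of_partner by (auto simp: fib_def)

lemma leg_points_fib: "g<deg ==> leg_points p g=(\<Union>h<deg. fib g h)"
proof (intro equalityI subsetI)
 fix x assume g: "g<deg" and "x \<in> leg_points p g"
 hence "x<npts" "leg_of x=g" using leg_points_less leg_of_eq by auto
 thus "x \<in> (\<Union>h<deg. fib g h)" using leg_of_less[OF partner_less] by (auto simp: fib_def)
next
 fix x assume "g<deg" and "x \<in> (\<Union>h<deg. fib g h)"
 thus "x \<in> leg_points p g" using leg_of_eq by (auto simp: fib_def)
qed

lemma partner_fib: "bij_betw partner (fib g h) (fib h g)"
 by (rule bij_betw_byWitness[where f' = partner]) (auto simp: fib_def partner_partner partner_less)

lemma card_fib_commute: "card (fib g h)=card (fib h g)"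
 using partner_fib by (rule bij_betw_same_card)

text \<open>The order of the bundles along leg \<open>g\<close>: destinations are compared in the
  cyclic order starting at \<open>g\<close>, in analogy with \<open>key\<close>.\<close>

definition "before g h h' \<longleftrightarrow> (if h' < g then h'+deg else h')<(if h<g then h+deg else h)"

text \<open>\<open>key\<close> decreases along a leg, and for points of different bundles the keys
  are ordered like the destinations. Hence bundles do not interleave.\<close>

lemma fib_before:
 assumes x: "x \<in> fib g h" and y: "y \<in> fib g h'" and ne: "h ~= h'"
 shows "x<y \<longleftrightarrow> before g h h'"
proof -
 have l: "x<npts" "y<npts" "leg_of x=leg_of y" using x y by (auto simp: fib_def)
 have le: "h<deg" "h' < deg" using x y leg_of_less partner_less by (auto simp: fib_def)
 have px: "partner x<x \<longleftrightarrow> h<g" and py: "partner y<y \<longleftrightarrow> h' < g"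
  using partner_less_iff x y by (auto simp: fib_def)
 have o: "partner y<partner x \<longleftrightarrow> h' < h"
 proof -
  have "leg_of (partner x)=h" "leg_of (partner y)=h'" using x y by (auto simp: fib_def)
  thus ?thesis
   using leg_of_mono[of "partner x" "partner y"] leg_of_mono[of "partner y" "partner x"] ne
    partner_less[OF l(1)] partner_less[OF l(2)] by (metis le_neq_implies_less less_asym linorder_neqE_nat)
 qed
 have "x<y \<longleftrightarrow> key y<key x" using key_less_iff[OF l] by simp
 also have "\<dots> \<longleftrightarrow> before g h h'"
  using o px py le partner_less[OF l(1)] partner_less[OF l(2)] by (auto simp: key_def before_def)
 finally show ?thesis .
qed

lemma inversions_fib:
 assumes "h ~= h'"
 shows "inversions (fib g h) (fib g h') T =
  (if before g h h' then card (fib g h-T) * card (fib g h' \<inter> T) else 0)"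
proof -
 have "{(x, y). x \<in> fib g h-T & y \<in> fib g h' \<inter> T & x<y} =
  (if before g h h' then (fib g h-T) \<times> (fib g h' \<inter> T) else {})"
  using fib_before[OF _ _ assms] by auto
 thus ?thesis by (simp add: inversions_def card_cartesian_product)
qed

lemma inversions_leg:
 assumes "g<deg"
 shows "inversions (leg_points p g) (leg_points p g) T=(\<Sum>h<deg. \<Sum>h'<deg. inversions (fib g h) (fib g h') T)"
proof -
 let ?I = "%S S'. {(x, y). x \<in> S-T & y \<in> S' \<inter> T & x<y}"
 have fin: "finite (?I (fib g h) (fib g h'))" for h h'
  by (rule finite_subset[of _ "fib g h \<times> fib g h'"]) auto
 have "?I (leg_points p g) (leg_points p g)=(\<Union>z\<in>{..<deg} \<times> {..<deg}. ?I (fib g (fst z)) (fib g (snd z)))"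
  unfolding leg_points_fib[OF assms] by fastforce
 moreover have "card \<dots>=(\<Sum>z\<in>{..<deg} \<times> {..<deg}. card (?I (fib g (fst z)) (fib g (snd z))))"
 proof (rule card_UN_disjoint)
  show "\<forall>i\<in>{..<deg} \<times> {..<deg}. \<forall>j\<in>{..<deg} \<times> {..<deg}. i ~= j -->
    ?I (fib g (fst i)) (fib g (snd i)) \<inter> ?I (fib g (fst j)) (fib g (snd j))={}"
   by (auto simp: fib_def)
 qed (use fin in auto)
 ultimately show ?thesis
  by (simp add: inversions_def sum.cartesian_product case_prod_unfold)
qed

text \<open>Within a bundle \<open>partner\<close> reverses the order and exchanges \<open>T\<close>
  with its complement, and these two effects cancel on inverted pairs.\<close>

lemma inversions_partner:
 assumes T: "!!x. x<npts ==> x \<in> T \<longleftrightarrow> partner x \<notin> T"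
 shows "inversions (fib h g) (fib h g) T=inversions (fib g h) (fib g h) T"
proof -
 have rev: "partner y<partner x" if "x \<in> fib g h" "y \<in> fib g h" "x<y" for g h x y
 proof -
  have l: "x<npts" "y<npts" "leg_of x=leg_of y" using that by (auto simp: fib_def)
  have "partner x<x \<longleftrightarrow> h<g" "partner y<y \<longleftrightarrow> h<g"
   using partner_less_iff that by (auto simp: fib_def)
  thus ?thesis using key_decreasing[OF that(3) l(2,3)] by (auto simp: key_def split: if_splits)
 qed
 have f: "partner x \<in> fib h g" if "x \<in> fib g h" for x g h
  using that by (auto simp: fib_def partner_partner partner_less)
 have n: "x<npts" if "x \<in> fib g h" for x g h using that by (simp add: fib_def)
 let ?I = "%S. {(x, y). x \<in> S-T & y \<in> S \<inter> T & x<y}"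
 let ?f = "%z. (partner (snd z), partner (fst z))"
 have img: "?f z \<in> ?I (fib h g)" if "z \<in> ?I (fib g h)" for z g h
 proof -
  from that obtain x y where z: "z=(x, y)" "x \<in> fib g h" "x \<notin> T" "y \<in> fib g h" "y \<in> T" "x<y"
   by blast
  have "partner x \<in> T" "partner y \<notin> T" using T[of x] T[of y] n z by auto
  thus ?thesis using z f rev[of x g h y] by auto
 qed
 have ff: "?f (?f z)=z" if "z \<in> ?I (fib g h)" for z g h
  using that n partner_partner by (cases z) auto
 have "bij_betw ?f (?I (fib h g)) (?I (fib g h))"
 proof (rule bij_betw_byWitness[where f' = ?f])
  show "\<forall>z\<in>?I (fib h g). ?f (?f z)=z" "\<forall>z\<in>?I (fib g h). ?f (?f z)=z"
   using ff by blast+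
  show "?f ` ?I (fib h g) \<subseteq> ?I (fib g h)" "?f ` ?I (fib g h) \<subseteq> ?I (fib h g)"
   using img by blast+
 qed
 thus ?thesis unfolding inversions_def by (rule bij_betw_same_card)
qed

end

lemma sum_PiE_Pow:
 fixes f :: "'a set => 'b::comm_monoid_add"
 assumes "disjoint_family_on F C"
 shows "(\<Sum>Y\<in>Pow (\<Union>c\<in>C. F c). f Y)=(\<Sum>g\<in>(\<Pi>\<^sub>E c\<in>C. Pow (F c)). f (\<Union>c\<in>C. g c))"
proof (rule sum.reindex_bij_betw[symmetric])
 show "bij_betw (%g. \<Union>c\<in>C. g c) (\<Pi>\<^sub>E c\<in>C. Pow (F c)) (Pow (\<Union>c\<in>C. F c))"
 proof (rule bij_betw_byWitness[where f' = "%Y. \<lambda>c\<in>C. Y \<inter> F c"])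
  show "\<forall>g\<in>\<Pi>\<^sub>E c\<in>C. Pow (F c). (\<lambda>c\<in>C. (\<Union>c\<in>C. g c) \<inter> F c)=g"
  proof (intro ballI ext)
   fix g c assume g: "g \<in> (\<Pi>\<^sub>E c\<in>C. Pow (F c))"
   show "(\<lambda>c\<in>C. (\<Union>c\<in>C. g c) \<inter> F c) c=g c"
   proof (cases "c \<in> C")
    case True
    have "x \<in> g c" if "x \<in> g c'" "x \<in> F c" "c' \<in> C" for x c'
    proof -
     have "x \<in> F c'" using g that by auto
     hence "c' = c" using assms that True unfolding disjoint_family_on_def by blast
     thus ?thesis using that by simp
    qed
    moreover have "g c \<subseteq> F c" using g True by auto
    ultimately show ?thesis using True by auto
   qed (use g in auto)
  qed
  show "\<forall>Y\<in>Pow (\<Union>c\<in>C. F c). (\<Union>c\<in>C. (\<lambda>c\<in>C. Y \<inter> F c) c)=Y" by auto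
 qed auto
qed

lemma inversions_Int: "inversions S S (Y \<inter> S)=inversions S S Y"
 unfolding inversions_def by (intro arg_cong[where f = card]) auto

section \<open>The sum over the states of a vertex\<close>

context local_proj
begin

definition "classes={(g, h). g<h & h<deg}"
definition "arcno g h=card (fib g h)"
definition "classfib c=fib (fst c) (snd c)"
definition "classmult c=arcno (fst c) (snd c)"
definition "lefts={x. x<npts & x<partner x}"

lemma finite_classes [simp]: "finite classes"
 by (rule finite_subset[of _ "{..<deg} \<times> {..<deg}"]) (auto simp: classes_def)

lemma arcno_commute: "arcno g h=arcno h g"
 by (simp add: arcno_def card_fib_commute)

lemma fib_lefts: "x \<in> fib g h ==> x \<in> lefts \<longleftrightarrow> g<h"
 using partner_less_iff[of x] leg_of_partner[of x] arc_partner[of x] by (auto simp: fib_def lefts_def)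

lemma lefts_eq: "lefts=(\<Union>c\<in>classes. classfib c)"
proof (intro equalityI subsetI)
 fix x assume x: "x \<in> lefts"
 hence f: "x \<in> fib (leg_of x) (leg_of (partner x))" by (simp add: fib_def lefts_def)
 hence "leg_of x<leg_of (partner x)" using fib_lefts x by blast
 moreover have "leg_of (partner x)<deg" using x partner_less leg_of_less by (simp add: lefts_def)
 ultimately show "x \<in> (\<Union>c\<in>classes. classfib c)" using f by (force simp: classes_def classfib_def)
next
 fix x assume "x \<in> (\<Union>c\<in>classes. classfib c)"
 thus "x \<in> lefts" using fib_lefts by (auto simp: classes_def classfib_def)
qed

lemma disjoint_classfib: "disjoint_family_on classfib classes"
 by (auto simp: disjoint_family_on_def classfib_def fib_def classes_def)

lemma fst_arcs: "bij_betw fst (arcs p) lefts"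
proof (rule bij_betw_byWitness[where f' = "%x. (x, partner x)"])
 show "\<forall>a\<in>arcs p. (fst a, partner (fst a))=a" using partner_arc by auto
 show "(%x. (x, partner x)) ` lefts \<subseteq> arcs p" using arc_partner by (fastforce simp: lefts_def)
 show "fst ` arcs p \<subseteq> lefts" using partner_arc(1) matching_less[OF matching] by (fastforce simp: lefts_def)
qed auto

text \<open>States of nonzero weight are determined by the set \<open>Y\<close> of left end points
  with letter \<open>True\<close>; the right end of each arc has the opposite letter.\<close>

definition "ext Y={x. x<npts & (if x<partner x then x \<in> Y else partner x \<notin> Y)}"
definition "word_of T=map (%x. x \<in> T) [0..<npts]"
definition "arc_weight A bt=(\<Prod>(i, j)\<in>arcs p. cupw A (bt!i) (bt!j))"

lemma length_word_of [simp]: "length (word_of T)=npts"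
 by (simp add: word_of_def)

lemma word_of_nth: "x<npts ==> word_of T!x \<longleftrightarrow> x \<in> T"
 by (simp add: word_of_def)

lemma ext_partner: "x<npts ==> x \<in> ext Y \<longleftrightarrow> partner x \<notin> ext Y"
 using partner_less[of x] partner_partner[of x] arc_partner[of x] by (auto simp: ext_def)

text \<open>A word that is not of the form \<open>word_of (ext Y)\<close> has equal letters at the
  ends of some arc, whose \<open>cupw\<close> is then 0.\<close>

lemma sum_words_ext:
 fixes F :: "bool list => complex"
 assumes F: "!!bt. length bt=npts ==> arc_weight A bt=0 ==> F bt=0"
 shows "(\<Sum>bt\<in>words npts. F bt)=(\<Sum>Y\<in>Pow lefts. F (word_of (ext Y)))"
proof -
 have inj: "inj_on (%Y. word_of (ext Y)) (Pow lefts)"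
 proof (rule inj_onI)
  fix Y Y' assume *: "Y \<in> Pow lefts" "Y' \<in> Pow lefts" "word_of (ext Y)=word_of (ext Y')"
  have "x \<in> Y \<longleftrightarrow> x \<in> Y'" if "x \<in> lefts" for x
  proof -
   have "x \<in> ext Y \<longleftrightarrow> x \<in> ext Y'"
    using word_of_nth[of x "ext Y"] word_of_nth[of x "ext Y'"] * that by (simp add: lefts_def)
   thus ?thesis using that by (simp add: ext_def lefts_def)
  qed
  thus "Y=Y'" using * by blast
 qed
 have "(\<Sum>bt\<in>words npts. F bt)=(\<Sum>bt\<in>(%Y. word_of (ext Y)) ` Pow lefts. F bt)"
 proof (rule sum.mono_neutral_right)
  show "\<forall>bt\<in>words npts-(%Y. word_of (ext Y)) ` Pow lefts. F bt=0"
  proof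
   fix bt assume b: "bt \<in> words npts-(%Y. word_of (ext Y)) ` Pow lefts"
   define Y where "Y={x \<in> lefts. bt!x}"
   have "\<exists>(i, j)\<in>arcs p. bt!i=bt!j"
   proof (rule ccontr)
    assume "\<not> ?thesis"
    hence ne: "bt!i ~= bt!j" if "(i, j) \<in> arcs p" for i j using that by auto
    have "bt!x=(x \<in> ext Y)" if "x<npts" for x
     using arc_partner[OF that] ne[of x "partner x"] ne[of "partner x" x] that partner_less[OF that] partner_partner[OF that]
     by (auto simp: ext_def Y_def lefts_def)
    hence "bt=word_of (ext Y)"
     using b by (intro nth_equalityI) (auto simp: word_of_nth)
    thus False using b by (auto simp: Y_def)
   qed
   hence "arc_weight A bt=0"
    unfolding arc_weight_def using matching_finite[OF matching] by (auto simp: cupw_def case_prod_unfold)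
   thus "F bt=0" using F b by simp
  qed
 qed auto
 also have "\<dots>=(\<Sum>Y\<in>Pow lefts. F (word_of (ext Y)))" using inj by (simp add: sum.reindex)
 finally show ?thesis .
qed

lemma arc_weight_ext:
 assumes "Y \<subseteq> lefts"
 shows "arc_weight A (word_of (ext Y))=(- (A^2)) ^ card Y"
proof -
 have fin: "finite lefts" by (simp add: lefts_def)
 have "arc_weight A (word_of (ext Y))=(\<Prod>a\<in>arcs p. if fst a \<in> Y then-(A^2) else 1)"
  unfolding arc_weight_def
 proof (intro prod.cong refl)
  fix a assume a: "a \<in> arcs p"
  obtain i j where ij: "a=(i, j)" by (cases a)
  hence l: "i<j" "j<npts" "partner i=j" "partner j=i"
   using a matching_less[OF matching] partner_arc by auto
  thus "(case a of (i, j) => cupw A (word_of (ext Y)!i) (word_of (ext Y)!j)) =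
    (if fst a \<in> Y then-(A^2) else 1)"
   by (simp add: ij word_of_nth ext_def cupw_def)
 qed
 also have "\<dots>=(\<Prod>x\<in>lefts. if x \<in> Y then-(A^2) else 1)"
  by (rule prod.reindex_bij_betw[OF fst_arcs])
 also have "\<dots>=(\<Prod>x\<in>lefts \<inter> Y. - (A^2))"
  using fin by (rule prod.inter_restrict[symmetric])
 also have "lefts \<inter> Y=Y" using assms by auto
 finally show ?thesis by simp
qed

text \<open>The number of letters \<open>True\<close> at the ends on leg \<open>g\<close> of the
  bundle to leg \<open>h\<close>. The parameter \<open>j\<close> counts them at left ends; at right
  ends the letters are opposite, hence the complement.\<close>

definition "pluses j g h=(if g<h then j (g, h) else arcno h g-j (h, g))"
definition "pluscount j g=(\<Sum>h\<in>{..<deg}-{g}. pluses j g h)"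
text \<open>The inversions between different bundles at a common leg. Since bundles do not
  interleave, they depend only on the counts.\<close>

definition "cross_invs j=(\<Sum>g<deg. \<Sum>h<deg. \<Sum>h'\<in>{..<deg}-{h}.
 if before g h h' then (arcno g h-pluses j g h) * pluses j g h' else 0)"
definition "class_counts Y=(\<lambda>c\<in>classes. card (Y \<inter> classfib c))"

lemma card_fib_ext:
 assumes "g ~= h" "g<deg" "h<deg"
 shows "card (fib g h \<inter> ext Y)=pluses (class_counts Y) g h"
proof (cases "g<h")
 case True
 have "fib g h \<inter> ext Y=Y \<inter> fib g h" using fib_lefts[of _ g h] True by (auto simp: ext_def lefts_def fib_def)
 thus ?thesis using True assms by (simp add: pluses_def class_counts_def classes_def classfib_def)
next
 case False
 hence lt: "h<g" using assms by simp
 have mem: "x \<in> fib h g & x \<notin> ext Y \<longleftrightarrow> x \<in> fib h g-Y" for x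
  using fib_lefts[of x h g] lt by (auto simp: ext_def lefts_def fib_def)
 have "bij_betw partner (fib g h \<inter> ext Y) (fib h g-Y)"
 proof (rule bij_betw_byWitness[where f' = partner])
  have p: "partner x \<in> fib h g" if "x \<in> fib g h" for x g h
   using that by (auto simp: fib_def partner_partner partner_less)
  have n: "x<npts" if "x \<in> fib g h" for x g h using that by (simp add: fib_def)
  show "partner ` (fib g h \<inter> ext Y) \<subseteq> fib h g-Y"
  proof clarify
   fix x assume x: "x \<in> fib g h" "x \<in> ext Y"
   hence "partner x \<notin> ext Y" using ext_partner[OF n] by blast
   with p[OF x(1)] mem show "partner x \<in> fib h g-Y" by blast
  qed
  show "partner ` (fib h g-Y) \<subseteq> fib g h \<inter> ext Y"
  proof (rule image_subsetI)
   fix x assume "x \<in> fib h g-Y"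
   hence x: "x \<in> fib h g" "x \<notin> ext Y" using mem by blast+
   hence "partner x \<in> ext Y" using ext_partner[OF n] by blast
   with p[OF x(1)] show "partner x \<in> fib g h \<inter> ext Y" by blast
  qed
 qed (auto simp: fib_def partner_partner)
 hence "card (fib g h \<inter> ext Y)=card (fib h g-Y)" by (rule bij_betw_same_card)
 also have "\<dots>=arcno h g - card (Y \<inter> fib h g)"
  by (simp add: arcno_def card_Diff_subset_Int Int_commute)
 finally show ?thesis using lt assms by (simp add: pluses_def class_counts_def classes_def classfib_def)
qed

lemma take_drop_word:
 assumes "g<deg"
 shows "take (legs p!g) (drop (sum_list (take g (legs p))) (word_of T))=map (%x. x \<in> T) [start g..<start (Suc g)]"
proof -
 have "start (Suc g) <= npts" by (rule start_le)
 moreover have "start (Suc g)=start g+legs p!g" by (rule start_Suc[OF assms])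
 ultimately show ?thesis by (simp add: word_of_def drop_map take_map start_def)
qed

lemma cnt_interval: "cnt (map (%x. x \<in> T) [a..<b])=card ({a..<b} \<inter> T)"
proof -
 have "bij_betw (%x. x+a) {x. x<b-a & map (%x. x \<in> T) [a..<b]!x} ({a..<b} \<inter> T)"
  by (rule bij_betw_byWitness[where f' = "%x. x-a"]) (auto simp: add.commute)
 thus ?thesis using bij_betw_same_card by (fastforce simp: cnt_card)
qed

lemma invs_interval: "invs (map (%x. x \<in> T) [a..<b])=inversions {a..<b} {a..<b} T"
proof -
 let ?g = "map (%x. x \<in> T) [a..<b]"
 have "bij_betw (%(x, y). (x+a, y+a)) {(x, y). x<y & y<b-a & \<not> ?g!x & ?g!y}
   {(x, y). x \<in> {a..<b}-T & y \<in> {a..<b} \<inter> T & x<y}"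
  by (rule bij_betw_byWitness[where f' = "%(x, y). (x-a, y-a)"]) (auto simp: add.commute)
 thus ?thesis using bij_betw_same_card by (fastforce simp: invs_card inversions_def)
qed

lemma cnts_ext: "cnts (legs p) (word_of (ext Y))=map (pluscount (class_counts Y)) [0..<deg]"
proof (rule nth_equalityI)
 fix g assume "g<length (cnts (legs p) (word_of (ext Y)))"
 hence g: "g<deg" by (simp add: deg_def)
 have "cnts (legs p) (word_of (ext Y))!g=card (leg_points p g \<inter> ext Y)"
  using cnts_nth[of g "legs p"] g take_drop_word[OF g] by (simp add: cnt_interval leg_points_eq flip: deg_def)
 also have "leg_points p g \<inter> ext Y=(\<Union>h<deg. fib g h \<inter> ext Y)"
  using leg_points_fib[OF g] by blast
 also have "card \<dots>=(\<Sum>h<deg. card (fib g h \<inter> ext Y))"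
  by (rule card_UN_disjoint) (auto simp: fib_def)
 also have "\<dots>=pluscount (class_counts Y) g"
  unfolding pluscount_def
 proof (rule sum.mono_neutral_cong_right)
  show "\<forall>i\<in>{..<deg}-({..<deg}-{g}). card (fib g i \<inter> ext Y)=0" by (auto simp: fib_same)
 qed (use g card_fib_ext in auto)
 finally show "cnts (legs p) (word_of (ext Y))!g=map (pluscount (class_counts Y)) [0..<deg]!g"
  using g by simp
qed (simp add: deg_def)

lemma sum_offdiag:
 fixes f :: "nat => nat => 'a::comm_monoid_add"
 shows "(\<Sum>g<deg. \<Sum>h\<in>{..<deg}-{g}. f g h)=(\<Sum>c\<in>classes. f (fst c) (snd c)+f (snd c) (fst c))"
proof -
 have "(\<Sum>g<deg. \<Sum>h\<in>{..<deg}-{g}. f g h)=(\<Sum>z\<in>(SIGMA g:{..<deg}. {..<deg}-{g}). f (fst z) (snd z))"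
  by (simp add: sum.Sigma case_prod_unfold)
 also have "(SIGMA g:{..<deg}. {..<deg}-{g})=classes \<union> prod.swap ` classes"
  by (auto simp: classes_def image_iff)
 also have "(\<Sum>z\<in>classes \<union> prod.swap ` classes. f (fst z) (snd z)) =
   (\<Sum>z\<in>classes. f (fst z) (snd z))+(\<Sum>z\<in>prod.swap ` classes. f (fst z) (snd z))"
  by (rule sum.union_disjoint) (simp_all, auto simp: classes_def)
 also have "(\<Sum>z\<in>prod.swap ` classes. f (fst z) (snd z))=(\<Sum>c\<in>classes. f (snd c) (fst c))"
  by (subst sum.reindex) (auto simp: inj_on_def)
 finally show ?thesis by (simp add: sum.distrib)
qed

lemma prod_offdiag:
 fixes f :: "nat => nat => 'a::comm_monoid_mult"
 shows "(\<Prod>g<deg. \<Prod>h\<in>{..<deg}-{g}. f g h)=(\<Prod>c\<in>classes. f (fst c) (snd c) * f (snd c) (fst c))"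
proof -
 have "(\<Prod>g<deg. \<Prod>h\<in>{..<deg}-{g}. f g h)=(\<Prod>z\<in>(SIGMA g:{..<deg}. {..<deg}-{g}). f (fst z) (snd z))"
  by (simp add: prod.Sigma case_prod_unfold)
 also have "(SIGMA g:{..<deg}. {..<deg}-{g})=classes \<union> prod.swap ` classes"
  by (auto simp: classes_def image_iff)
 also have "(\<Prod>z\<in>classes \<union> prod.swap ` classes. f (fst z) (snd z)) =
   (\<Prod>z\<in>classes. f (fst z) (snd z))*(\<Prod>z\<in>prod.swap ` classes. f (fst z) (snd z))"
  by (rule prod.union_disjoint) (simp_all, auto simp: classes_def)
 also have "(\<Prod>z\<in>prod.swap ` classes. f (fst z) (snd z))=(\<Prod>c\<in>classes. f (snd c) (fst c))"
  by (subst prod.reindex) (auto simp: inj_on_def)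
 finally show ?thesis by (simp add: prod.distrib)
qed

text \<open>Inversions inside a bundle are seen equally at both of its legs, whence the factor 2. It
  turns the weight \<open>A^(2 * block_invs)\<close> into the power of A^4 that occurs in
  \<open>gauss\<close>.\<close>

lemma block_invs_ext:
 "block_invs (legs p) (word_of (ext Y)) =
   cross_invs (class_counts Y)+2*(\<Sum>c\<in>classes. inversions (classfib c) (classfib c) Y)"
proof -
 let ?T = "ext Y"
 let ?d = "%g h. inversions (fib g h) (fib g h) ?T"
 have "block_invs (legs p) (word_of ?T)=(\<Sum>g<deg. inversions (leg_points p g) (leg_points p g) ?T)"
  unfolding block_invs_sum deg_def[symmetric]
  by (intro sum.cong refl) (simp add: take_drop_word invs_interval leg_points_eq)
 also have "\<dots>=(\<Sum>g<deg. \<Sum>h<deg. \<Sum>h'<deg. inversions (fib g h) (fib g h') ?T)"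
  by (intro sum.cong refl) (simp add: inversions_leg)
 also have "\<dots>=(\<Sum>g<deg. \<Sum>h<deg. (\<Sum>h'\<in>{..<deg}-{h}. inversions (fib g h) (fib g h') ?T) + ?d g h)"
 proof -
  have "(\<Sum>h'<deg. f h')=(\<Sum>h'\<in>{..<deg}-{h}. f h')+f h" if "h \<in> {..<deg}" for f :: "nat => nat" and h
   using that by (subst sum.remove[of _ h]) auto
  thus ?thesis by (intro sum.cong refl)
 qed
 also have "\<dots>=(\<Sum>g<deg. \<Sum>h<deg. \<Sum>h'\<in>{..<deg}-{h}. inversions (fib g h) (fib g h') ?T) +
   (\<Sum>g<deg. \<Sum>h<deg. ?d g h)"
  by (simp add: sum.distrib)
 also have "(\<Sum>g<deg. \<Sum>h<deg. \<Sum>h'\<in>{..<deg}-{h}. inversions (fib g h) (fib g h') ?T)=cross_invs (class_counts Y)"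
  unfolding cross_invs_def
 proof (intro sum.cong refl)
  fix g h h' assume *: "g \<in> {..<deg}" "h \<in> {..<deg}" "h' \<in> {..<deg}-{h}"
  have "card (fib g h - ?T) * card (fib g h' \<inter> ?T) =
    (arcno g h-pluses (class_counts Y) g h) * pluses (class_counts Y) g h'"
  proof (cases "g=h \<or> g=h'")
   case True
   moreover have "arcno g g=0" by (simp add: arcno_def fib_same)
   moreover have "pluses (class_counts Y) g g=0" by (simp add: pluses_def arcno_def fib_same)
   ultimately show ?thesis by (auto simp: fib_same)
  next
   case False
   hence "card (fib g h \<inter> ?T)=pluses (class_counts Y) g h" "card (fib g h' \<inter> ?T)=pluses (class_counts Y) g h'"
    using * card_fib_ext by auto
   thus ?thesis by (simp add: arcno_def card_Diff_subset_Int)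
  qed
  thus "inversions (fib g h) (fib g h') ?T =
   (if before g h h' then (arcno g h-pluses (class_counts Y) g h) * pluses (class_counts Y) g h' else 0)"
   using inversions_fib[of h h' g ?T] * by auto
 qed
 also have "(\<Sum>g<deg. \<Sum>h<deg. ?d g h)=(\<Sum>g<deg. \<Sum>h\<in>{..<deg}-{g}. ?d g h)"
  by (intro sum.cong refl sum.mono_neutral_right) (auto simp: fib_same inversions_def)
 also have "\<dots>=(\<Sum>c\<in>classes. ?d (fst c) (snd c) + ?d (snd c) (fst c))" by (rule sum_offdiag)
 also have "\<dots>=(\<Sum>c\<in>classes. 2 * inversions (classfib c) (classfib c) Y)"
 proof (intro sum.cong refl)
  fix c assume c: "c \<in> classes"
  have "?d (snd c) (fst c) = ?d (fst c) (snd c)" by (rule inversions_partner[OF ext_partner])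
  moreover have "inversions (classfib c) (classfib c) ?T=inversions (classfib c) (classfib c) Y"
  proof -
   have "?T \<inter> classfib c=Y \<inter> classfib c"
    using c fib_lefts by (auto simp: classfib_def classes_def ext_def lefts_def fib_def)
   thus ?thesis by (metis inversions_Int)
  qed
  ultimately show "?d (fst c) (snd c) + ?d (snd c) (fst c)=2 * inversions (classfib c) (classfib c) Y"
   by (simp add: classfib_def)
 qed
 finally show ?thesis by (simp add: sum_distrib_left)
qed

definition "vmono A j=A^(2 * cross_invs j)*(- (A^2))^(\<Sum>c\<in>classes. j c)"

lemma card_Y:
 assumes "Y \<subseteq> lefts"
 shows "card Y=(\<Sum>c\<in>classes. class_counts Y c)"
proof -
 have "Y=(\<Union>c\<in>classes. Y \<inter> classfib c)" using assms lefts_eq by blast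
 also have "card \<dots>=(\<Sum>c\<in>classes. card (Y \<inter> classfib c))"
  by (rule card_UN_disjoint) (auto simp: classfib_def fib_def)
 finally show ?thesis by (simp add: class_counts_def)
qed

text \<open>States are grouped by the number \<open>j c\<close> of \<open>True\<close> left ends in
  each bundle \<open>c\<close>. What is not determined by these numbers factors over the bundles,
  and each factor is a sum over subsets as in \<open>gauss_subsets\<close>.\<close>

lemma vertex_sum:
 "(\<Sum>bt\<in>words npts. (if cnts (legs p) bt=ks then A^(2 * block_invs (legs p) bt) else 0) * arc_weight A bt) =
  (\<Sum>j\<in>(\<Pi>\<^sub>E c\<in>classes. {..classmult c}). if map (pluscount j) [0..<deg]=ks
   then vmono A j*(\<Prod>c\<in>classes. gauss A (classmult c) (j c)) else 0)"
proof -
 define G where "G j=(if map (pluscount j) [0..<deg]=ks then vmono A j else 0)" for j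
 define w where "w c Y=A^(4 * inversions (classfib c) (classfib c) Y)" for c Y
 let ?P = "\<Pi>\<^sub>E c\<in>classes. Pow (classfib c)"
 let ?J = "\<Pi>\<^sub>E c\<in>classes. {..classmult c}"
 have fin: "finite (classfib c)" for c by (simp add: classfib_def)
 have "(\<Sum>bt\<in>words npts. (if cnts (legs p) bt=ks then A^(2 * block_invs (legs p) bt) else 0) * arc_weight A bt) =
  (\<Sum>Y\<in>Pow lefts. (if cnts (legs p) (word_of (ext Y))=ks then A^(2 * block_invs (legs p) (word_of (ext Y))) else 0) *
   arc_weight A (word_of (ext Y)))"
  by (rule sum_words_ext) auto
 also have "\<dots>=(\<Sum>Y\<in>Pow lefts. G (class_counts Y)*(\<Prod>c\<in>classes. w c Y))"
 proof (intro sum.cong refl)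
  fix Y assume Y: "Y \<in> Pow lefts"
  have "(\<Prod>c\<in>classes. w c Y)=A^(4*(\<Sum>c\<in>classes. inversions (classfib c) (classfib c) Y))"
   by (simp add: w_def power_sum sum_distrib_left)
  thus "(if cnts (legs p) (word_of (ext Y))=ks then A^(2 * block_invs (legs p) (word_of (ext Y))) else 0) *
   arc_weight A (word_of (ext Y))=G (class_counts Y)*(\<Prod>c\<in>classes. w c Y)"
   using Y by (simp add: cnts_ext block_invs_ext G_def vmono_def arc_weight_ext card_Y power_add distrib_left)
 qed
 also have "\<dots>=(\<Sum>g\<in>?P. G (class_counts (\<Union>c\<in>classes. g c))*(\<Prod>c\<in>classes. w c (\<Union>c\<in>classes. g c)))"
  unfolding lefts_eq by (rule sum_PiE_Pow[OF disjoint_classfib])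
 also have "\<dots>=(\<Sum>g\<in>?P. G (\<lambda>c\<in>classes. card (g c))*(\<Prod>c\<in>classes. w c (g c)))"
 proof (intro sum.cong refl)
  fix g assume g: "g \<in> ?P"
  have e: "(\<Union>c\<in>classes. g c) \<inter> classfib c=g c" if "c \<in> classes" for c
  proof -
   have "g c' \<inter> classfib c \<subseteq> g c" if "c' \<in> classes" for c'
   proof (cases "c' = c")
    case False
    hence "classfib c' \<inter> classfib c={}"
     using disjoint_classfib \<open>c \<in> classes\<close> that by (auto simp: disjoint_family_on_def)
    moreover have "g c' \<subseteq> classfib c'" using g that by auto
    ultimately show ?thesis by blast
   qed simp
   moreover have "g c \<subseteq> classfib c" using g that by auto
   ultimately show ?thesis using that by blast
  qed
  have "class_counts (\<Union>c\<in>classes. g c)=(\<lambda>c\<in>classes. card (g c))"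
   unfolding class_counts_def using e by (intro restrict_ext) simp
  moreover have "w c (\<Union>c\<in>classes. g c)=w c (g c)" if "c \<in> classes" for c
   unfolding w_def using e[OF that] by (metis inversions_Int)
  ultimately show "G (class_counts (\<Union>c\<in>classes. g c))*(\<Prod>c\<in>classes. w c (\<Union>c\<in>classes. g c)) =
   G (\<lambda>c\<in>classes. card (g c))*(\<Prod>c\<in>classes. w c (g c))" by simp
 qed
 also have "\<dots>=(\<Sum>j\<in>?J. \<Sum>g\<in>{g\<in>?P. (\<lambda>c\<in>classes. card (g c))=j}. G (\<lambda>c\<in>classes. card (g c))*(\<Prod>c\<in>classes. w c (g c)))"
 proof (rule sum.group[symmetric])
  show "(%g. \<lambda>c\<in>classes. card (g c)) ` ?P \<subseteq> ?J"
   using fin by (auto simp: PiE_iff classmult_def arcno_def classfib_def[symmetric] intro!: card_mono; blast)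
 qed (use fin in \<open>auto intro!: finite_PiE\<close>)
 also have "\<dots>=(\<Sum>j\<in>?J. G j*(\<Prod>c\<in>classes. gauss A (classmult c) (j c)))"
 proof (intro sum.cong refl)
  fix j assume j: "j \<in> ?J"
  have e: "{g\<in>?P. (\<lambda>c\<in>classes. card (g c))=j}=(\<Pi>\<^sub>E c\<in>classes. {Y. Y \<subseteq> classfib c & card Y=j c})"
  proof (intro equalityI subsetI)
   fix g assume "g \<in> (\<Pi>\<^sub>E c\<in>classes. {Y. Y \<subseteq> classfib c & card Y=j c})"
   moreover from this have "(\<lambda>c\<in>classes. card (g c))=j"
    using j by (intro ext) (auto simp: PiE_iff extensional_def)
   ultimately show "g \<in> {g\<in>?P. (\<lambda>c\<in>classes. card (g c))=j}" by (auto simp: PiE_iff)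
  next
   fix g assume "g \<in> {g\<in>?P. (\<lambda>c\<in>classes. card (g c))=j}"
   thus "g \<in> (\<Pi>\<^sub>E c\<in>classes. {Y. Y \<subseteq> classfib c & card Y=j c})"
    by (auto simp: PiE_iff)
  qed
  have "(\<Sum>g\<in>{g\<in>?P. (\<lambda>c\<in>classes. card (g c))=j}. G (\<lambda>c\<in>classes. card (g c))*(\<Prod>c\<in>classes. w c (g c))) =
   G j*(\<Sum>g\<in>{g\<in>?P. (\<lambda>c\<in>classes. card (g c))=j}. \<Prod>c\<in>classes. w c (g c))"
   unfolding sum_distrib_left by (intro sum.cong refl) auto
  also have "\<dots>=G j*(\<Prod>c\<in>classes. \<Sum>Y\<in>{Y. Y \<subseteq> classfib c & card Y=j c}. w c Y)"
   unfolding e using fin by (subst prod_sum_PiE) auto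
  also have "\<dots>=G j*(\<Prod>c\<in>classes. gauss A (classmult c) (j c))"
   unfolding w_def classmult_def arcno_def classfib_def[symmetric]
   using gauss_subsets[OF fin] by (intro arg_cong2[where f = "(*)"] prod.cong refl) (simp add: classfib_def)
  finally show "(\<Sum>g\<in>{g\<in>?P. (\<lambda>c\<in>classes. card (g c))=j}. G (\<lambda>c\<in>classes. card (g c))*(\<Prod>c\<in>classes. w c (g c))) =
   G j*(\<Prod>c\<in>classes. gauss A (classmult c) (j c))" .
 qed
 also have "\<dots>=(\<Sum>j\<in>?J. if map (pluscount j) [0..<deg]=ks
   then vmono A j*(\<Prod>c\<in>classes. gauss A (classmult c) (j c)) else 0)"
  by (intro sum.cong refl) (simp add: G_def)
 finally show ?thesis .
qed

end

section \<open>The normalized weight of a vertex\<close>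

context local_proj
begin

text \<open>The two denominators come from the symmetrizers on the legs and from the factorials of
  the standard evaluation at this vertex.\<close>

definition "vweight A j=vmono A j*(\<Prod>c\<in>classes. gauss A (classmult c) (j c)) /
 (gausses A (legs p) (map (pluscount j) [0..<deg]) * projector_fact A p)"

lemma arcs_between_eq:
 assumes "g<h" "h<deg"
 shows "arcs_between p g h=arcno g h"
proof -
 have "bij_betw fst {(i, j) \<in> arcs p. i \<in> leg_points p g & j \<in> leg_points p h} (fib g h)"
 proof (rule bij_betw_byWitness[where f' = "%x. (x, partner x)"])
  show "\<forall>a\<in>{(i, j) \<in> arcs p. i \<in> leg_points p g & j \<in> leg_points p h}. (fst a, partner (fst a))=a"
   using partner_arc(1) by auto
  show "fst ` {(i, j) \<in> arcs p. i \<in> leg_points p g & j \<in> leg_points p h} \<subseteq> fib g h"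
  proof clarify
   fix i j assume *: "(i, j) \<in> arcs p" "i \<in> leg_points p g" "j \<in> leg_points p h"
   hence "i<npts" "j<npts" by (auto dest: leg_points_less)
   thus "fst (i, j) \<in> fib g h" using * assms leg_of_eq partner_arc(1) by (simp add: fib_def)
  qed
  show "(%x. (x, partner x)) ` fib g h \<subseteq> {(i, j) \<in> arcs p. i \<in> leg_points p g & j \<in> leg_points p h}"
  proof clarify
   fix x assume x: "x \<in> fib g h"
   hence "x<npts" "x \<in> lefts" using fib_lefts assms by (auto simp: fib_def)
   thus "(x, partner x) \<in> arcs p & x \<in> leg_points p g & partner x \<in> leg_points p h"
    using x arc_partner[of x] leg_of_in[of x] leg_of_in[OF partner_less, of x]
    by (auto simp: fib_def lefts_def)
  qed
 qed auto
 thus ?thesis unfolding arcs_between_def arcno_def by (rule bij_betw_same_card)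
qed

lemma projector_fact_classes: "projector_fact A p=(\<Prod>c\<in>classes. qfact A (classmult c))"
proof -
 have "projector_fact A p=(\<Prod>z\<in>(SIGMA h:{..<deg}. {..<h}). qfact A (arcs_between p (snd z) (fst z)))"
  by (simp add: projector_fact_def deg_def prod.Sigma case_prod_unfold)
 also have "\<dots>=(\<Prod>c\<in>classes. qfact A (arcs_between p (fst c) (snd c)))"
  by (rule prod.reindex_bij_witness[of _ prod.swap prod.swap]) (auto simp: classes_def)
 also have "\<dots>=(\<Prod>c\<in>classes. qfact A (classmult c))"
  by (intro prod.cong refl) (auto simp: classes_def arcs_between_eq classmult_def)
 finally show ?thesis .
qed

lemma legs_eq:
 assumes "g<deg"
 shows "legs p!g=(\<Sum>h\<in>{..<deg}-{g}. arcno g h)"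
proof -
 have "legs p!g=card (leg_points p g)"
  using start_Suc[OF assms] by (simp add: leg_points_eq)
 also have "\<dots>=(\<Sum>h<deg. card (fib g h))"
  unfolding leg_points_fib[OF assms] by (rule card_UN_disjoint) (auto simp: fib_def)
 also have "\<dots>=(\<Sum>h\<in>{..<deg}-{g}. arcno g h)"
  unfolding arcno_def by (rule sum.mono_neutral_right) (auto simp: fib_same)
 finally show ?thesis .
qed

lemma arcno_le: "g<deg ==> h<deg ==> arcno g h <= legs p!g"
 by (cases "g=h") (auto simp: legs_eq arcno_def fib_same intro!: member_le_sum)

context
 fixes j
 assumes j: "j \<in> (\<Pi>\<^sub>E c\<in>classes. {..classmult c})"
begin

lemma pluses_add:
 assumes "g ~= h" "g<deg" "h<deg"
 shows "pluses j g h+pluses j h g=arcno g h"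
proof -
 have "j (a, b) <= arcno a b" if "a<b" "b<deg" for a b
  using PiE_mem[OF j, of "(a, b)"] that by (simp add: classes_def classmult_def)
 from this[of g h] this[of h g] assms show ?thesis
  by (cases "g<h") (auto simp: pluses_def arcno_commute)
qed

lemma pluscount_add:
 assumes "g<deg"
 shows "pluscount j g+(\<Sum>h\<in>{..<deg}-{g}. pluses j h g)=legs p!g"
 unfolding pluscount_def legs_eq[OF assms] sum.distrib[symmetric]
 using assms by (intro sum.cong refl pluses_add) auto

lemma pluscount_le: "g<deg ==> pluscount j g <= legs p!g"
 using pluscount_add by (metis le_add1)

lemma pluscounts_le: "list_all2 (\<le>) (map (pluscount j) [0..<deg]) (legs p)"
 using pluscount_le by (auto simp: list_all2_conv_all_nth deg_def)

lemma class_le: "c \<in> classes ==> j c <= classmult c"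
 using PiE_mem[OF j] by auto

lemma gausses_legs:
 "gausses A (legs p) (map (pluscount j) [0..<deg])=(\<Prod>g<deg. gauss A (legs p!g) (pluscount j g))"
proof -
 have "map2 (gauss A) (legs p) (map (pluscount j) [0..<deg])=map (%g. gauss A (legs p!g) (pluscount j g)) [0..<deg]"
  by (rule nth_equalityI) (auto simp: deg_def)
 thus ?thesis
  by (simp add: gausses_def prod.list_conv_set_nth atLeast0LessThan)
qed

lemma prod_list_legs: "prod_list (map f (legs p))=(\<Prod>g<deg. f (legs p!g))"
 for f :: "nat => complex"
 by (simp add: prod.list_conv_set_nth atLeast0LessThan deg_def)

definition "qmult1 A g=qfact A (pluscount j g)/(\<Prod>h\<in>{..<deg}-{g}. qfact A (pluses j g h))"
definition "qmult2 A g=qfact A (\<Sum>h\<in>{..<deg}-{g}. pluses j h g)/(\<Prod>h\<in>{..<deg}-{g}. qfact A (pluses j h g))"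
definition "minuscount g=(\<Sum>h\<in>{..<deg}-{g}. pluses j h g)"

text \<open>The Gaussian binomial of a bundle with m arcs, divided by its [m]!, is a monomial over
  [j]! [m - j]!, and squaring provides these two factorials once for each of the two legs it joins.
  On the other side, the binomials in the normalization together with those hidden in the factorials
  of the legs cancel the squared denominator and leave, at each leg, the factorials of the numbers
  of \<open>True\<close> and of \<open>False\<close> letters. Together these are two quantum
  multinomials per leg.\<close>

lemma vweight_square:
 assumes A: "generic A"
 shows "vweight A j^2*(gausses A (legs p) (map (pluscount j) [0..<deg]) * prod_list (map (qfact A) (legs p))) =
  A^(4 * cross_invs j+4*(\<Sum>c\<in>classes. j c)+4*(\<Sum>c\<in>classes. j c*(classmult c-j c))) *
  (inverse A^(\<Sum>g<deg. 2 * pluscount j g * minuscount g)*(\<Prod>g<deg. qmult1 A g * qmult2 A g))"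
proof -
 have nz: "qfact A n ~= 0" for n using qfact_nz[OF A] .
 define N where "N=(\<Prod>g<deg. gauss A (legs p!g) (pluscount j g))"
 define Q where "Q=(\<Prod>c\<in>classes. qfact A (j c) * qfact A (classmult c-j c))"
 define F where "F=projector_fact A p"
 define G where "G=(\<Prod>c\<in>classes. gauss A (classmult c) (j c))"
 have N0: "N ~= 0" unfolding N_def using gauss_nz[OF A] pluscount_le by auto
 have F0: "F ~= 0" unfolding F_def projector_fact_classes using nz by simp
 have Q0: "Q ~= 0" unfolding Q_def using nz by simp
 have G: "G*Q=A^(2*(\<Sum>c\<in>classes. j c*(classmult c-j c)))*F"
 proof -
  have "G*Q=(\<Prod>c\<in>classes. A^(2*(j c*(classmult c-j c))) * qfact A (classmult c))"
   unfolding G_def Q_def prod.distrib[symmetric]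
  proof (intro prod.cong refl)
   fix c assume "c \<in> classes"
   thus "gauss A (classmult c) (j c)*(qfact A (j c) * qfact A (classmult c-j c)) =
    A^(2*(j c*(classmult c-j c))) * qfact A (classmult c)"
    using gauss_qfact[OF A, of "j c" "classmult c-j c"] class_le[of c] by (simp add: mult_ac)
  qed
  thus ?thesis by (simp add: prod.distrib power_sum sum_distrib_left F_def projector_fact_classes)
 qed
 define K where "K=(\<Prod>g<deg. qfact A (pluscount j g) * qfact A (minuscount g))"
 define s where "s=(\<Sum>g<deg. 2 * pluscount j g * minuscount g)"
 have R: "N*K=A^s * prod_list (map (qfact A) (legs p))"
  unfolding N_def K_def s_def prod.distrib[symmetric] power_sum prod_list_legs
 proof (intro prod.cong refl)
  fix g assume "g \<in> {..<deg}"
  hence "legs p!g=pluscount j g+minuscount g" using pluscount_add by (simp add: minuscount_def)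
  thus "gauss A (legs p!g) (pluscount j g)*(qfact A (pluscount j g) * qfact A (minuscount g)) =
   A^(2 * pluscount j g * minuscount g) * qfact A (legs p!g)"
   using gauss_qfact[OF A, of "pluscount j g" "minuscount g"] by (simp add: mult_ac)
 qed
 \<comment> \<open>Regrouping by legs: at the second leg of a bundle the counts of
   \<open>True\<close> and \<open>False\<close> are exchanged, so the same two factorials appear
   again.\<close>
 have Q2: "Q^2=(\<Prod>g<deg. (\<Prod>h\<in>{..<deg}-{g}. qfact A (pluses j g h))*(\<Prod>h\<in>{..<deg}-{g}. qfact A (pluses j h g)))"
 proof -
  have "(\<Prod>g<deg. (\<Prod>h\<in>{..<deg}-{g}. qfact A (pluses j g h))*(\<Prod>h\<in>{..<deg}-{g}. qfact A (pluses j h g))) =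
   (\<Prod>c\<in>classes. (qfact A (pluses j (fst c) (snd c)) * qfact A (pluses j (snd c) (fst c)))^2)"
   unfolding prod.distrib[symmetric] prod_offdiag by (intro prod.cong refl) (simp add: power2_eq_square mult_ac)
  also have "\<dots>=Q^2"
   unfolding Q_def prod_power_distrib
   by (intro prod.cong refl) (auto simp: pluses_def classes_def classmult_def)
  finally show ?thesis ..
 qed
 have KQ: "K/Q^2=(\<Prod>g<deg. qmult1 A g * qmult2 A g)"
  unfolding Q2 K_def prod_dividef[symmetric]
  by (intro prod.cong refl) (simp add: qmult1_def qmult2_def minuscount_def)
 have L: "prod_list (map (qfact A) (legs p))=inverse A^s*(N*K)"
  using R A by (simp add: power_inverse)
 have mono: "vmono A j^2=A^(4 * cross_invs j+4*(\<Sum>c\<in>classes. j c))"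
 proof -
  have "((- (A^2))^n)^2=A^(4 * n)" for n
   by (simp flip: power_mult add: power_mult[of _ 2] mult.commute[of n])
  thus ?thesis by (simp add: vmono_def power_mult_distrib power_add flip: power_mult)
 qed
 have "vweight A j^2*(gausses A (legs p) (map (pluscount j) [0..<deg]) * prod_list (map (qfact A) (legs p))) =
  (vmono A j*G/(N*F))^2*(N*(inverse A^s*(N*K)))"
  unfolding vweight_def gausses_legs L G_def F_def N_def ..
 also have "\<dots>=vmono A j^2*(G/F)^2*(inverse A^s*K)"
  using N0 by (simp add: power2_eq_square field_simps)
 also have "G/F=A^(2*(\<Sum>c\<in>classes. j c*(classmult c-j c)))/Q"
  using G F0 Q0 by (simp add: field_simps)
 also have "vmono A j^2*(A^(2*(\<Sum>c\<in>classes. j c*(classmult c-j c)))/Q)^2*(inverse A^s*K) =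
  vmono A j^2*A^(4*(\<Sum>c\<in>classes. j c*(classmult c-j c)))*(inverse A^s*(K/Q^2))"
  by (simp add: power_divide flip: power_mult)
 finally show ?thesis unfolding mono KQ s_def by (simp only: power_add mult.assoc)
qed

lemma rational_vweight: "rational_fun (%A. vweight A j)"
 unfolding vweight_def
proof (intro rational_fun_divide rational_fun_laurent)
 have g: "laurent_fun (%A. A^n)" for n using laurent_power by (auto simp: laurent_fun_def)
 have u: "laurent_fun (%A. (- (A^2))^n)" for n
 proof (induction n)
  case (Suc n)
  have "laurent_fun (%A. - (A^2))"
   using laurent_uminus[OF laurent_power[of 2]] by (auto simp: laurent_fun_def)
  from laurent_fun_mult[OF this Suc] show ?case by simp
 qed (simp add: laurent_fun_1)
 show "laurent_fun (%A. vmono A j*(\<Prod>c\<in>classes. gauss A (classmult c) (j c)))"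
  unfolding vmono_def by (intro laurent_fun_mult laurent_fun_prod laurent_fun_gauss g u finite_classes)
 show "laurent_fun (%A. gausses A (legs p) (map (pluscount j) [0..<deg]) * projector_fact A p)"
  unfolding gausses_legs projector_fact_classes
  by (intro laurent_fun_mult laurent_fun_prod laurent_fun_gauss laurent_fun_qfact) auto
 show "gausses A (legs p) (map (pluscount j) [0..<deg]) * projector_fact A p ~= 0" if "generic A" for A
  using gausses_nz[OF that pluscounts_le] qfact_nz[OF that] by (simp add: projector_fact_classes)
qed

text \<open>26 = 12 + 2 + 12: three terms with coefficient 4 in the positive exponent, the negative
  exponent, and two multinomials per leg, each with fewer than \<open>deg\<close> binomial factors
  of degree at most 6 m^2. Each multinomial is bounded by 2^(deg m).\<close>

lemma laurent_vweight:
 assumes m: "!!c. c \<in> set (legs p) ==> c <= m"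
 shows "laurent (2*(13 * deg^3 * m\<^sup>2)) ((2^(deg\<^sup>2 * m))\<^sup>2)
  (%A. vweight A j^2*(gausses A (legs p) (map (pluscount j) [0..<deg]) * prod_list (map (qfact A) (legs p))))"
proof -
 have leg: "legs p!g <= m" if "g<deg" for g using m that by (simp add: deg_def)
 have an: "arcno g h <= m" if "g<deg" "h<deg" for g h using arcno_le[OF that] leg[OF that(1)] by simp
 have pl: "pluses j g h <= m" if "g<deg" "h<deg" for g h
 proof (cases "g=h")
  case True thus ?thesis by (simp add: pluses_def arcno_def fib_same)
 next
  case False thus ?thesis using pluses_add[OF False that] an[OF that] by simp
 qed
 have pc: "pluscount j g <= m" "minuscount g <= m" if "g<deg" for g
  using pluscount_add[OF that] leg[OF that] by (auto simp: minuscount_def)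
 have cm: "j c <= m" "classmult c-j c <= m" if "c \<in> classes" for c
  using class_le[OF that] an[of "fst c" "snd c"] that by (auto simp: classes_def classmult_def)
 have cc: "card classes <= deg\<^sup>2"
 proof -
  have "card classes <= card ({..<deg} \<times> {..<deg})" by (intro card_mono) (auto simp: classes_def)
  thus ?thesis by (simp add: power2_eq_square)
 qed
 let ?q = "%g. card ({..<deg}-{g})*(6 * m * m)"
 let ?Q = "%g. 2^(card ({..<deg}-{g}) * m) :: real"
 have qm: "laurent (?q g + ?q g) (?Q g * ?Q g) (%A. qmult1 A g * qmult2 A g)" if "g<deg" for g
  unfolding qmult1_def qmult2_def pluscount_def
  using pc[OF that] by (intro laurent_mult laurent_qmultinomial) (auto simp: pluscount_def minuscount_def)
 have "laurent (2 * deg*(6 * m * m)) (2^(2 * deg * m)) (%A. qmult1 A g * qmult2 A g)" if "g<deg" for g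
 proof (rule laurent_mono[OF qm[OF that]])
  have c: "card ({..<deg}-{g}) <= deg" by (metis card_Diff1_le card_lessThan finite_lessThan)
  show "?q g + ?q g <= 2 * deg*(6 * m * m)"
   using mult_le_mono1[OF c, of "6 * m * m"] by simp
  show "?Q g * ?Q g <= 2^(2 * deg * m)"
   unfolding power_add[symmetric] mult.assoc using mult_le_mono1[OF c, of m]
   by (intro power_increasing) linarith+
 qed
 hence "laurent (\<Sum>g<deg. 2 * deg*(6 * m * m)) (\<Prod>g<deg. 2^(2 * deg * m)) (%A. \<Prod>g<deg. qmult1 A g * qmult2 A g)"
  by (intro laurent_prod) auto
 hence q: "laurent (12 * deg\<^sup>2 * m\<^sup>2) ((2^(deg\<^sup>2 * m))\<^sup>2) (%A. \<Prod>g<deg. qmult1 A g * qmult2 A g)"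
 proof -
  have "(\<Prod>g<deg. 2^(2 * deg * m))=(2 :: real)^(2 * deg * m * deg)" by (simp flip: power_mult)
  also have "2 * deg * m * deg=deg\<^sup>2 * m*2" by (simp add: power2_eq_square)
  finally have "(\<Prod>g<deg. 2^(2 * deg * m))=((2 :: real)^(deg\<^sup>2 * m))\<^sup>2" by (simp only: power_mult)
  moreover have "(\<Sum>g<deg. 2 * deg*(6 * m * m))=12 * deg\<^sup>2 * m\<^sup>2"
   by (simp add: power2_eq_square)
  ultimately show ?thesis
   using \<open>laurent (\<Sum>g<deg. 2 * deg * (6 * m * m)) (\<Prod>g<deg. 2 ^ (2 * deg * m)) _\<close> by (simp only:)
 qed
 let ?s1 = "4 * cross_invs j+4*(\<Sum>c\<in>classes. j c)+4*(\<Sum>c\<in>classes. j c*(classmult c-j c))"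
 let ?s2 = "\<Sum>g<deg. 2 * pluscount j g * minuscount g"
 have 1: "cross_invs j <= deg^3 * m\<^sup>2"
 proof -
  have "cross_invs j <= (\<Sum>g<deg. \<Sum>h<deg. \<Sum>h'\<in>{..<deg}-{h}. m * m)"
   unfolding cross_invs_def
  proof (intro sum_mono)
   fix g h h' assume "g \<in> {..<deg}" "h \<in> {..<deg}" "h' \<in> {..<deg}-{h}"
   hence "(arcno g h-pluses j g h) * pluses j g h' <= m * m"
    using an[of g h] pl[of g h'] by (intro mult_le_mono) auto
   thus "(if before g h h' then (arcno g h-pluses j g h) * pluses j g h' else 0) <= m * m" by simp
  qed
  also have "\<dots> <= (\<Sum>g<deg. \<Sum>h<deg. \<Sum>h'<deg. m * m)"
   by (intro sum_mono sum_mono2) auto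
  also have "\<dots>=deg^3 * m\<^sup>2" by (simp add: power2_eq_square power3_eq_cube mult_ac)
  finally show ?thesis .
 qed
 have d: "deg\<^sup>2 <= deg^3" "deg <= deg^3" "m <= m\<^sup>2"
  by (cases deg; simp add: power2_eq_square power3_eq_cube)+
 have 2: "(\<Sum>c\<in>classes. j c) <= deg^3 * m\<^sup>2"
 proof -
  have "(\<Sum>c\<in>classes. j c) <= card classes * m" using sum_bounded_above[of classes j m] cm(1) by simp
  also have "\<dots> <= deg^3 * m\<^sup>2" using cc d by (intro mult_le_mono) auto
  finally show ?thesis .
 qed
 have 3: "(\<Sum>c\<in>classes. j c*(classmult c-j c)) <= deg^3 * m\<^sup>2"
 proof -
  have "(\<Sum>c\<in>classes. j c*(classmult c-j c)) <= card classes * m\<^sup>2"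
   using sum_bounded_above[of classes "%c. j c*(classmult c-j c)" "m\<^sup>2"] cm
   by (simp add: power2_eq_square mult_le_mono)
  also have "\<dots> <= deg^3 * m\<^sup>2" using cc d by (intro mult_le_mono) auto
  finally show ?thesis .
 qed
 have 4: "?s2 <= 2*(deg^3 * m\<^sup>2)"
 proof -
  have "2 * pluscount j g * minuscount g <= 2 * m\<^sup>2" if "g<deg" for g
   using mult_le_mono[OF pc[OF that]] by (simp add: power2_eq_square)
  hence "?s2 <= deg*(2 * m\<^sup>2)"
   using sum_bounded_above[of "{..<deg}" "%g. 2 * pluscount j g * minuscount g" "2 * m\<^sup>2"] by simp
  also have "\<dots> <= deg^3*(2 * m\<^sup>2)" using d by (intro mult_le_mono) auto
  finally show ?thesis by simp
 qed
 have 5: "12 * deg\<^sup>2 * m\<^sup>2 <= 12*(deg^3 * m\<^sup>2)" using d by simp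
 have "laurent (?s1+(?s2+12 * deg\<^sup>2 * m\<^sup>2)) (1*(1*(2^(deg\<^sup>2 * m))\<^sup>2))
  (%A. A ^ ?s1*(inverse A ^ ?s2*(\<Prod>g<deg. qmult1 A g * qmult2 A g)))"
  by (intro laurent_mult laurent_power laurent_inverse_power q)
 also have "?this \<longleftrightarrow> laurent (?s1+(?s2+12 * deg\<^sup>2 * m\<^sup>2)) (1*(1*(2^(deg\<^sup>2 * m))\<^sup>2))
  (%A. vweight A j^2*(gausses A (legs p) (map (pluscount j) [0..<deg]) * prod_list (map (qfact A) (legs p))))"
  by (rule laurent_cong) (simp only: vweight_square)
 finally show ?thesis
 proof (rule laurent_mono)
  show "?s1+(?s2+12 * deg\<^sup>2 * m\<^sup>2) <= 2*(13 * deg^3 * m\<^sup>2)"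
   using 1 2 3 4 5 by (simp only: mult.assoc)
 qed simp
qed

end

lemma card_PiE_classes:
 assumes m: "!!c. c \<in> set (legs p) ==> c <= m"
 shows "real (card (\<Pi>\<^sub>E c\<in>classes. {..classmult c})) <= 2^(deg\<^sup>2 * m)"
proof -
 have cc: "card classes <= deg\<^sup>2"
 proof -
  have "card classes <= card ({..<deg} \<times> {..<deg})" by (intro card_mono) (auto simp: classes_def)
  thus ?thesis by (simp add: power2_eq_square)
 qed
 have "card {..classmult c} <= 2^m" if "c \<in> classes" for c
 proof -
  have "classmult c <= legs p!fst c" using that arcno_le[of "fst c" "snd c"] by (auto simp: classes_def classmult_def)
  also have "\<dots> <= m" using that by (intro m) (auto simp: classes_def deg_def)
  finally have "classmult c <= m" .
  hence "Suc (classmult c) <= 2^m" using less_exp[of m] by (metis Suc_leI le_less_trans)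
  thus ?thesis by simp
 qed
 hence "(\<Prod>c\<in>classes. card {..classmult c}) <= (\<Prod>c\<in>classes. 2^m)"
  by (intro prod_mono) (simp del: card_atMost)
 also have "(\<Prod>c\<in>classes. card {..classmult c})=card (\<Pi>\<^sub>E c\<in>classes. {..classmult c})"
  by (rule card_PiE[symmetric]) simp
 finally have "card (\<Pi>\<^sub>E c\<in>classes. {..classmult c}) <= (\<Prod>c\<in>classes. 2^m)" .
 also have "\<dots>=2^(card classes * m)" by (simp add: power_mult mult.commute)
 also have "\<dots> <= 2^(deg\<^sup>2 * m)" using cc by (intro power_increasing) auto
 finally show ?thesis by (metis of_nat_le_iff of_nat_numeral of_nat_power)
qed

end

section \<open>Inserting symmetrizers\<close>

text \<open>Colors are attached to labels instead of edges; \<open>cap_color\<close> says that they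
  are constant along each edge.\<close>

locale colored_diagram =
 fixes D :: diagram and c :: "nat => nat" and P :: "nat => projector"
 assumes graph: "knotted_ribbon_graph D"
  and cap_color: "(x, y) \<in> cap_rel D ==> c x=c y"
  and proj: "v \<in> vertices D ==> local_projector (P v)"
  and legs: "v \<in> vertices D ==> legs (P v)=map c (half_edges D v)"
begin

definition "colors s=map c (level D s)"
definition "offset s i=sum_list (take i (colors s))"
definition "width s=sum_list (colors s)"

text \<open>The cabled piece at offset 0 and without the braids of the edges, which are treated
  separately.\<close>

definition "core s=(case D!s of (k, p) =>
 (case p of
   Elem Cup => cups (c (first_label D s))
  | Elem Cap => caps (c (level D s!k))
  | Elem Pos => cross Pos (c (level D s!k)) (c (level D s!(k+1)))
  | Elem Neg => cross Neg (c (level D s!k)) (c (level D s!(k+1)))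
  | Vertex d => arc_cups (arcs (P s))))"

definition "slice_base s=shift (offset s (fst (D!s))) (core s)"

definition "ins s=(case D!s of (k, p) => take (inputs p) (drop k (level D s)))"
definition "outs s=(case D!s of (k, p) =>
 (case p of
   Elem Cup => [first_label D s, first_label D s]
  | Elem Cap => []
  | Elem _ => [level D s!(k+1), level D s!k]
  | Vertex d => [first_label D s..<first_label D s+d]))"

lemma fits: "s<length D ==> D!s=(k, p) ==> k+inputs p <= length (level D s)"
 using graph by (auto simp: knotted_ribbon_graph_def)

lemma level_in:
 assumes "s<length D" "D!s=(k, p)"
 shows "level D s=take k (level D s)@ins s@drop (k+inputs p) (level D s)"
 unfolding ins_def using assms by simp (metis add.commute append_take_drop_id drop_drop)

lemma level_out:
 assumes "s<length D" "D!s=(k, p)"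
 shows "level D (Suc s)=take k (level D s) @ outs s@drop (k+inputs p) (level D s)"
proof (cases p)
 case (Elem e)
 thus ?thesis using assms
  by (cases e) (simp_all add: outs_def insert_at_def remove_two_def swap_two_def)
next
 case (Vertex d)
 thus ?thesis using assms by (simp add: outs_def insert_at_def)
qed

lemma length_ins: "s<length D ==> D!s=(k, p) ==> length (ins s)=inputs p"
 using fits[of s k p] by (simp add: ins_def)

lemma ins_two:
 assumes "s<length D" "D!s=(k, Elem e)" "e ~= Cup"
 shows "ins s=[level D s!k, level D s!(k+1)]"
proof -
 have i: "inputs (Elem e)=2" using assms(3) by (cases e) auto
 hence "k+2 <= length (level D s)" using fits[OF assms(1,2)] by simp
 hence "take 2 (drop k (level D s))=[level D s!k, level D s!(k+1)]"
  using split_at[of k "level D s"] by (simp add: numeral_2_eq_2 flip: Cons_nth_drop_Suc)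
 thus ?thesis using assms(2) i by (simp add: ins_def)
qed

lemma colors_in:
 assumes "s<length D" "D!s=(k, p)"
 shows "colors s=take k (colors s)@map c (ins s)@drop (k+inputs p) (colors s)"
 unfolding colors_def by (subst (1) level_in[OF assms]) (simp only: map_append take_map drop_map)

lemma colors_out:
 assumes "s<length D" "D!s=(k, p)"
 shows "colors (Suc s)=take k (colors s)@map c (outs s)@drop (k+inputs p) (colors s)"
 unfolding colors_def level_out[OF assms] by (simp only: map_append take_map drop_map)

lemma length_take_colors:
 "s<length D ==> D!s=(k, p) ==> length (take k (colors s))=k"
 using fits[of s k p] by (simp add: colors_def)

lemma vertex_legs:
 assumes "s<length D" "D!s=(k, Vertex d)"
 shows "local_projector (P s)" "legs (P s)=map c (outs s)"
proof -
 have v: "s \<in> vertices D" using assms by (auto simp: vertices_def)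
 thus "local_projector (P s)" by (rule proj)
 show "legs (P s)=map c (outs s)" using legs[OF v] assms by (simp add: outs_def half_edges_def)
qed

lemma cap_colors:
 assumes "s<length D" "D!s=(k, Elem Cap)"
 shows "c (level D s!k)=c (level D s!(k+1))"
 using assms by (intro cap_color) (auto simp: cap_rel_def)

lemma valid_core:
 assumes "s<length D" "D!s=(k, p)"
 shows "valid (sum_list (map c (ins s))) (core s) (sum_list (map c (outs s)))"
proof (cases p)
 case (Elem e)
 show ?thesis
 proof (cases e)
  case Cup
  thus ?thesis using assms Elem valid_cups by (simp add: ins_def core_def outs_def)
 next
  case Cap
  thus ?thesis using assms Elem valid_caps[of "c (level D s!k)"] ins_two[of s k e] cap_colors[of s k]
   by (simp add: core_def outs_def)
 next
  case Pos
  thus ?thesis using assms Elem valid_cross[of Pos] ins_two[of s k e]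
   by (simp add: core_def outs_def add.commute)
 next
  case Neg
  thus ?thesis using assms Elem valid_cross[of Neg] ins_two[of s k e]
   by (simp add: core_def outs_def add.commute)
 qed
next
 case (Vertex d)
 interpret local_proj "P s" using vertex_legs(1) assms Vertex by unfold_locales auto
 have "npts=sum_list (map c (outs s))" using vertex_legs(2) assms Vertex by (simp add: npts_def)
 thus ?thesis
  using assms Vertex arc_cups_run[OF matching] by (simp add: ins_def core_def)
qed

lemma width_split:
 assumes "s<length D" "D!s=(k, p)"
 shows "width s = offset s k+sum_list (map c (ins s))+sum_list (drop (k+inputs p) (colors s))"
  "width (Suc s) = offset s k+sum_list (map c (outs s))+sum_list (drop (k+inputs p) (colors s))"
 unfolding width_def offset_def by (subst colors_in[OF assms], simp) (subst colors_out[OF assms], simp)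

lemma valid_slice:
 assumes "s<length D"
 shows "valid (width s) (slice_base s) (width (Suc s))"
proof -
 obtain k p where kp: "D!s=(k, p)" by (cases "D!s")
 show ?thesis
  unfolding slice_base_def kp fst_conv
  by (rule valid_shift[OF valid_core[OF assms kp]]) (use width_split[OF assms kp] in auto)
qed

lemma offset_Suc: "i<length (colors s) ==> offset s (Suc i) = offset s i + colors s!i"
 by (simp add: offset_def sum_list_take_Suc)

lemma offset_mono: "i <= j ==> offset s i <= offset s j"
 unfolding offset_def by (rule sum_list_take_mono)

lemma offset_width: "offset s i <= width s"
 unfolding offset_def width_def by (metis append_take_drop_id le_add1 sum_list_append)

definition "sym_at A s i=sym_op A (offset s i) (colors s!i)"

lemma sym_at_fits: "i<length (colors s) ==> offset s i + colors s!i <= width s"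
 using offset_Suc[of i s] offset_width[of s "Suc i"] by simp

lemma supp_sym_at: "supp (width s) v ==> i<length (colors s) ==> supp (width s) (sym_at A s i v)"
 unfolding sym_at_def using sym_at_fits by (intro supp_sym_op)

lemma sym_at_idem:
 "generic A ==> supp (width s) v ==> i<length (colors s) ==> sym_at A s i (sym_at A s i v)=sym_at A s i v"
 unfolding sym_at_def using sym_at_fits by (intro sym_op_idem)

lemma sym_at_commute:
 assumes "i<length (colors s)" "j<length (colors s)"
 shows "sym_at A s i (sym_at A s j v)=sym_at A s j (sym_at A s i v)"
proof (cases "i=j")
 case False
 have "offset s i + colors s!i <= offset s j \<or> offset s j + colors s!j <= offset s i"
  using False offset_Suc[OF assms(1)] offset_Suc[OF assms(2)] offset_mono[of "Suc i" j s] offset_mono[of "Suc j" i s]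
  by (cases "i<j") auto
 thus ?thesis unfolding sym_at_def by (rule sym_op_commute)
qed simp

text \<open>The position at level \<open>s + 1\<close> of the strand at position \<open>i\<close> of level \<open>s\<close> (if it does not end there).\<close>

definition "thr s i=(case D!s of (k, p) =>
 if i<k then i
 else if i<k+inputs p then (if i=k then k+1 else k)
 else i-inputs p+length (outs s))"

definition "ends s i \<longleftrightarrow> (\<exists>k. D!s=(k, Elem Cap) & (i=k \<or> i=k+1))"

lemma thr_less:
 assumes "s<length D" "i<length (level D s)" "\<not> ends s i"
 shows "thr s i<length (level D (Suc s)) & level D (Suc s)!thr s i=level D s!i"
proof -
 obtain k p where kp: "D!s=(k, p)" by (cases "D!s")
 let ?w = "level D s"
 have fit: "k+inputs p <= length ?w" by (rule fits[OF assms(1) kp])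
 have out: "level D (Suc s)=take k ?w @ outs s@drop (k+inputs p) ?w"
  by (rule level_out[OF assms(1) kp])
 have lk: "length (take k ?w)=k" using fit by simp
 consider "i<k" | "k <= i" "i<k+inputs p" | "k+inputs p <= i" by linarith
 thus ?thesis
 proof cases
  case 1
  thus ?thesis using fit by (simp add: thr_def kp out nth_append del: level.simps)
 next
  case 2
  then obtain e where e: "p=Elem e" "e=Pos \<or> e=Neg"
   using assms(3) kp by (cases p rule: inputs.cases) (auto simp: ends_def)
  hence o: "outs s=[?w!(k+1), ?w!k]" by (auto simp: outs_def kp)
  have "i=k \<or> i=k+1" using 2 e by auto
  thus ?thesis unfolding thr_def kp out o using lk e by (auto simp: nth_append simp del: level.simps)
 next
  case 3
  then obtain r where r: "i=k+inputs p+r" using le_iff_add by blast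
  hence "thr s i=k+(length (outs s)+r)" by (simp add: thr_def kp)
  moreover have "r<length ?w-(k+inputs p)" using r assms(2) by simp
  ultimately show ?thesis unfolding out using fit lk by (simp add: nth_append r)
 qed
qed

lemma sum_take_append3:
 fixes as :: "nat list"
 shows "sum_list (take (length as+length xs+r) (as@xs@zs))=sum_list as+sum_list xs+sum_list (take r zs)"
 by (simp add: add.commute)

lemma offset_right:
 assumes "s<length D" "D!s=(k, p)"
 shows "offset s (k+inputs p+r) = offset s k+sum_list (map c (ins s))+sum_list (take r (drop (k+inputs p) (colors s)))"
  "offset (Suc s) (k+length (outs s)+r) = offset s k+sum_list (map c (outs s))+sum_list (take r (drop (k+inputs p) (colors s)))"
proof -
 note l = length_take_colors[OF assms]
 have "sum_list (take (length (take k (colors s))+length (map c (ins s))+r) (colors s)) =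
  sum_list (take k (colors s))+sum_list (map c (ins s))+sum_list (take r (drop (k+inputs p) (colors s)))"
  by (subst (2) colors_in[OF assms]) (rule sum_take_append3)
 thus "offset s (k+inputs p+r) = offset s k+sum_list (map c (ins s))+sum_list (take r (drop (k+inputs p) (colors s)))"
  using l length_ins[OF assms] by (simp add: offset_def)
 have "sum_list (take (length (take k (colors s))+length (map c (outs s))+r) (colors (Suc s))) =
  sum_list (take k (colors s))+sum_list (map c (outs s))+sum_list (take r (drop (k+inputs p) (colors s)))"
  unfolding colors_out[OF assms] by (rule sum_take_append3)
 thus "offset (Suc s) (k+length (outs s)+r) = offset s k+sum_list (map c (outs s))+sum_list (take r (drop (k+inputs p) (colors s)))"
  using l by (simp add: offset_def)
qed

lemma offset_left:
 assumes "s<length D" "D!s=(k, p)" "i <= k"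
 shows "offset (Suc s) i = offset s i"
proof -
 have "i <= length (take k (colors s))" using length_take_colors[OF assms(1,2)] assms(3) by simp
 thus ?thesis unfolding offset_def colors_out[OF assms(1,2)] using assms(3) by (simp add: min_def)
qed

lemma colors_thr:
 assumes "s<length D" "i<length (level D s)" "\<not> ends s i"
 shows "colors (Suc s)!thr s i=colors s!i"
 using thr_less[OF assms] assms(2) by (simp add: colors_def del: level.simps)

text \<open>A strand beside the piece commutes with it for reasons of position; for the two strands
  of a crossing this is \<open>cross_sym_op_left\<close> and
  \<open>cross_sym_op_right\<close>.\<close>

lemma slice_sym_at:
 assumes A: "generic A" and s: "s<length D" and i: "i<length (level D s)" and e: "\<not> ends s i"
  and v: "supp (width s) v"
 shows "run A (slice_base s) (sym_at A s i v)=sym_at A (Suc s) (thr s i) (run A (slice_base s) v)"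
proof -
 obtain k p where kp: "D!s=(k, p)" by (cases "D!s")
 note V = valid_core[OF s kp]
 note W = width_split[OF s kp]
 have ct: "colors (Suc s)!thr s i=colors s!i" by (rule colors_thr[OF s i e])
 have b: "slice_base s=shift (offset s k) (core s)" by (simp add: slice_base_def kp)
 have il: "i<length (colors s)" using i by (simp add: colors_def)
 consider "i<k" | "k <= i" "i<k+inputs p" | "k+inputs p <= i" by linarith
 thus ?thesis
 proof cases
  case 1
  have "offset s i + colors s!i <= offset s k"
   using offset_Suc[OF il] offset_mono[of "Suc i" k s] 1 by simp
  moreover have "thr s i=i" using 1 by (simp add: thr_def kp)
  ultimately show ?thesis
   using run_sym_op_left[OF V _ v, of "offset s i" "colors s!i" "offset s k"] ct W
    offset_left[OF s kp, of i] 1 unfolding b sym_at_def by simp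
 next
  case 2
  then obtain x where x: "p=Elem x" "x=Pos \<or> x=Neg"
   using e kp by (cases p rule: inputs.cases) (auto simp: ends_def)
  let ?a = "c (level D s!k)"
  let ?b = "c (level D s!(k+1))"
  have ins: "ins s=[level D s!k, level D s!(k+1)]" using ins_two[OF s, of k x] kp x by auto
  have outs: "outs s=[level D s!(k+1), level D s!k]" using x by (auto simp: outs_def kp)
  have co: "core s=cross x ?a ?b" using x by (auto simp: core_def kp)
  have x': "x \<in> {Pos, Neg}" using x by auto
  have fit: "offset s k + ?a + ?b <= width s" using W ins by simp
  have len: "k+1<length (colors s)" using fits[OF s kp] x by (auto simp: colors_def)
  have cols: "colors s!k = ?a" "colors s!Suc k = ?b" using len by (simp_all add: colors_def)
  have lc: "length (colors (Suc s))=length (colors s)"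
   using arg_cong[OF colors_out[OF s kp], of length] length_take_colors[OF s kp] outs fits[OF s kp] x
   by (auto simp: colors_def)
  have o1: "offset s (Suc k) = offset s k + ?a" using offset_Suc[of k s] len cols by simp
  have o2: "offset (Suc s) k = offset s k" using offset_left[OF s kp, of k] by simp
  have ck: "colors (Suc s)!k = ?b"
   using colors_out[OF s kp] length_take_colors[OF s kp] outs by (simp add: nth_append)
  have o3: "offset (Suc s) (Suc k) = offset s k + ?b"
   using offset_Suc[of k "Suc s"] len lc o2 ck by simp
  show ?thesis
  proof (cases "i=k")
   case True
   hence "thr s i=Suc k" using 2 by (simp add: thr_def kp)
   thus ?thesis
    using cross_sym_op_left[OF A x' v fit] ct True cols o3 unfolding b sym_at_def co by simp
  next
   case False
   hence "i=Suc k" using 2 x by auto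
   moreover from this have "thr s i=k" using 2 by (simp add: thr_def kp)
   ultimately show ?thesis
    using cross_sym_op_right[OF A x' v fit] ct cols o1 o2 unfolding b sym_at_def co by simp
  qed
 next
  case 3
  define r where "r=i-(k+inputs p)"
  have ir: "i=k+inputs p+r" using 3 by (simp add: r_def)
  have tr: "thr s i=k+length (outs s)+r" using 3 by (simp add: thr_def kp r_def)
  note o = offset_right[OF s kp, of r]
  have "offset s i + colors s!i <= width s" using sym_at_fits[OF il] .
  moreover have "offset s k+sum_list (map c (ins s)) <= offset s i" using o(1) ir by simp
  moreover have "offset s i-sum_list (map c (ins s))+sum_list (map c (outs s)) = offset (Suc s) (thr s i)"
   using o ir tr by simp
  ultimately show ?thesis
   using run_sym_op_right[OF V v, of "offset s k" "offset s i" "colors s!i"] ct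
   unfolding b sym_at_def by simp
 qed
qed

lemma slice_cap:
 assumes "s<length D" "D!s=(k, Elem Cap)" "supp (width s) v"
 shows "run A (slice_base s) (sym_at A s k v)=run A (slice_base s) (sym_at A s (k+1) v)"
proof -
 let ?a = "c (level D s!k)"
 have ins: "ins s=[level D s!k, level D s!(k+1)]" using ins_two[OF assms(1,2)] by simp
 have len: "k+1<length (colors s)" using fits[OF assms(1,2)] by (auto simp: colors_def)
 have cols: "colors s!k = ?a" "colors s!(k+1) = ?a"
  using len cap_colors[OF assms(1,2)] by (simp_all add: colors_def)
 have "offset s (k+1) = offset s k + ?a" using offset_Suc[of k s] len cols by simp
 moreover have "offset s k+2 * ?a <= width s"
  using width_split(1)[OF assms(1,2)] ins cap_colors[OF assms(1,2)] by simp
 ultimately show ?thesis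
  using sym_op_caps[OF assms(3), of "offset s k" ?a A] assms(2) cols
  by (simp add: slice_base_def core_def sym_at_def)
qed

lemma slice_cup:
 assumes "s<length D" "D!s=(k, Elem Cup)" "supp (width s) v"
 shows "sym_at A (Suc s) k (run A (slice_base s) v)=sym_at A (Suc s) (k+1) (run A (slice_base s) v)"
proof -
 let ?a = "c (first_label D s)"
 have outs: "outs s=[first_label D s, first_label D s]" using assms by (simp add: outs_def)
 have cols: "colors (Suc s)!k = ?a" "colors (Suc s)!(k+1) = ?a"
  using colors_out[OF assms(1,2)] length_take_colors[OF assms(1,2)] outs by (simp_all add: nth_append)
 have o: "offset (Suc s) k = offset s k" using offset_left[OF assms(1,2), of k] by simp
 have "offset (Suc s) (k+1) = offset (Suc s) k + ?a"
  using offset_Suc[of k "Suc s"] cols arg_cong[OF colors_out[OF assms(1,2)], of length]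
   length_take_colors[OF assms(1,2)] outs by simp
 thus ?thesis
  using sym_op_cups[OF assms(3) offset_width, of A k ?a] assms(2) cols o
  by (simp add: slice_base_def core_def sym_at_def)
qed

end

section \<open>Marking points by symmetrizers\<close>

context colored_diagram
begin

text \<open>The marked points form a set of pairs of level and position. Marking a point twice is
  thus the same as marking it once, in accordance with idempotence.\<close>

primrec syms :: "complex => (nat \<times> nat) set => nat => nat => vec => vec" where
 "syms A S s 0 v=v"
| "syms A S s (Suc n) v=(if (s, n) \<in> S then sym_at A s n (syms A S s n v) else syms A S s n v)"

lemma supp_syms: "supp (width s) v ==> n <= length (colors s) ==> supp (width s) (syms A S s n v)"
 by (induction n) (auto intro: supp_sym_at)

lemma syms_commute:
 "i<length (colors s) ==> n <= length (colors s) ==>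
  sym_at A s i (syms A S s n v)=syms A S s n (sym_at A s i v)"
 by (induction n) (simp_all add: sym_at_commute[of i])

lemma syms_absorb:
 assumes "generic A" "supp (width s) v" "n <= length (colors s)" "i<n" "(s, i) \<in> S"
 shows "sym_at A s i (syms A S s n v)=syms A S s n v"
 using assms(3,4)
proof (induction n)
 case (Suc n)
 have sv: "supp (width s) (syms A S s n v)" using Suc.prems assms(2) by (intro supp_syms) auto
 show ?case
 proof (cases "i=n")
  case True
  thus ?thesis using assms(1,5) Suc.prems sv by (simp add: sym_at_idem)
 next
  case False
  thus ?thesis using Suc sym_at_commute[of i s n] by simp
 qed
qed simp

lemma syms_cong: "(!!i. i<n ==> (s, i) \<in> S \<longleftrightarrow> (s, i) \<in> S') ==> syms A S s n v=syms A S' s n v"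
 by (induction n) auto

lemma syms_insert:
 assumes "generic A" "supp (width s) v" "n <= length (colors s)" "i<n"
 shows "syms A (insert (s, i) S) s n v=sym_at A s i (syms A S s n v)"
 using assms(3,4)
proof (induction n)
 case (Suc n)
 have sv: "supp (width s) (syms A S s n v)" using Suc.prems assms(2) by (intro supp_syms) auto
 show ?case
 proof (cases "i=n")
  case True
  have "syms A (insert (s, n) S) s n v=syms A S s n v" by (rule syms_cong) auto
  thus ?thesis using True sym_at_idem[OF assms(1) sv, of n] Suc.prems by simp
 next
  case False
  thus ?thesis using Suc sym_at_commute[of i s n] by simp
 qed
qed simp

definition "level_syms A S s v=syms A S s (length (colors s)) v"

primrec state :: "complex => (nat \<times> nat) set => nat => vec" where
 "state A S 0=unit_vec"
| "state A S (Suc s)=level_syms A S (Suc s) (run A (slice_base s) (state A S s))"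

definition "endstate A S=state A S (length D)"

lemma width_0: "width 0=0"
 by (simp add: width_def colors_def)

lemma supp_state: "s <= length D ==> supp (width s) (state A S s)"
proof (induction s)
 case 0
 thus ?case by (simp add: width_0)
next
 case (Suc s)
 thus ?case
  using supp_run[OF _ valid_slice[of s]] by (auto simp: level_syms_def intro!: supp_syms)
qed

lemma supp_slice: "s<length D ==> supp (width s) v ==> supp (width (Suc s)) (run A (slice_base s) v)"
 using supp_run valid_slice by blast

lemma state_cong:
 "(!!t i. t <= s ==> (t, i) \<in> S \<longleftrightarrow> (t, i) \<in> S') ==> state A S s=state A S' s"
proof (induction s)
 case (Suc s)
 hence "state A S s=state A S' s" by simp
 thus ?case
  using syms_cong[of "length (colors (Suc s))" "Suc s" S S'] Suc.prems by (simp add: level_syms_def)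
qed simp

lemma endstate_eqI:
 assumes "t0 <= length D" "state A S t0=state A S' t0" "!!t i. t > t0 ==> (t, i) \<in> S \<longleftrightarrow> (t, i) \<in> S'"
 shows "endstate A S=endstate A S'"
proof -
 have "t0 <= t ==> state A S t=state A S' t" for t
 proof (induction t)
  case (Suc t)
  show ?case
  proof (cases "t0=Suc t")
   case False
   hence "t0 <= t" using Suc.prems by simp
   thus ?thesis
    using Suc.IH syms_cong[of "length (colors (Suc t))" "Suc t" S S'] assms(3)[of "Suc t"]
    by (simp add: level_syms_def)
  qed (use assms(2) in simp)
 qed (use assms(2) in auto)
 thus ?thesis using assms(1) by (simp add: endstate_def)
qed

lemma level_pos: "i<length (level D s) ==> s > 0"
 by (cases s) auto

lemma state_absorb:
 assumes A: "generic A" and s: "s <= length D" and i: "i<length (level D s)" "(s, i) \<in> S"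
 shows "sym_at A s i (state A S s)=state A S s"
proof -
 obtain s0 where s0: "s=Suc s0" using level_pos[OF i(1)] by (cases s) auto
 have "supp (width s) (run A (slice_base s0) (state A S s0))"
  unfolding s0 using s s0 by (intro supp_slice supp_state) auto
 from syms_absorb[OF A this order_refl, of i S] show ?thesis
  using i s0 by (simp add: level_syms_def colors_def)
qed

lemma state_insert:
 assumes A: "generic A" and s: "s <= length D" and i: "i<length (level D s)"
 shows "state A (insert (s, i) S) s=sym_at A s i (state A S s)"
proof -
 obtain s0 where s0: "s=Suc s0" using level_pos[OF i(1)] by (cases s) auto
 have "state A (insert (s, i) S) s0=state A S s0" by (rule state_cong) (use s0 in auto)
 have "supp (width s) (run A (slice_base s0) (state A S s0))"
  unfolding s0 using s s0 by (intro supp_slice supp_state) auto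
 from syms_insert[OF A this order_refl, of i S] \<open>state A (insert (s, i) S) s0 = state A S s0\<close> show ?thesis
  using i s0 by (simp add: level_syms_def colors_def)
qed

text \<open>The new symmetrizer slides down through the slice and is absorbed by the one at
  \<open>(s, i)\<close>, which leaves the state below unchanged.\<close>

lemma endstate_through_up:
 assumes A: "generic A" and s: "s<length D" and i: "i<length (level D s)" "\<not> ends s i" "(s, i) \<in> S"
 shows "endstate A (insert (Suc s, thr s i) S)=endstate A S"
proof (rule endstate_eqI[of "Suc s"])
 let ?j = "thr s i"
 have j: "?j<length (level D (Suc s))" using thr_less[OF s i(1,2)] by simp
 have jc: "?j<length (colors (Suc s))" using j by (simp add: colors_def)
 have sp: "supp (width s) (state A S s)" using s by (intro supp_state) simp
 have "state A (insert (Suc s, ?j) S) (Suc s)=sym_at A (Suc s) ?j (state A S (Suc s))"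
  using s j by (intro state_insert[OF A]) auto
 also have "\<dots>=syms A S (Suc s) (length (colors (Suc s))) (sym_at A (Suc s) ?j (run A (slice_base s) (state A S s)))"
  unfolding state.simps level_syms_def by (rule syms_commute[OF jc order_refl])
 also have "sym_at A (Suc s) ?j (run A (slice_base s) (state A S s))=run A (slice_base s) (sym_at A s i (state A S s))"
  by (rule slice_sym_at[OF A s i(1,2) sp, symmetric])
 also have "sym_at A s i (state A S s)=state A S s"
  using s by (intro state_absorb[OF A _ i(1,3)]) simp
 finally show "state A (insert (Suc s, ?j) S) (Suc s)=state A S (Suc s)" by (simp add: level_syms_def)
qed (use s in auto)

lemma endstate_through_down:
 assumes A: "generic A" and s: "s<length D" and i: "i<length (level D s)" "\<not> ends s i" "(Suc s, thr s i) \<in> S"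
 shows "endstate A (insert (s, i) S)=endstate A S"
proof (rule endstate_eqI[of "Suc s"])
 let ?j = "thr s i"
 have j: "?j<length (level D (Suc s))" using thr_less[OF s i(1,2)] by simp
 have jc: "?j<length (colors (Suc s))" using j by (simp add: colors_def)
 have sp: "supp (width s) (state A S s)" using s by (intro supp_state) simp
 have "state A (insert (s, i) S) s=sym_at A s i (state A S s)"
  using s by (intro state_insert[OF A _ i(1)]) simp
 moreover have "syms A (insert (s, i) S) (Suc s) n v=syms A S (Suc s) n v" for n v
  by (rule syms_cong) auto
 ultimately have "state A (insert (s, i) S) (Suc s) =
   syms A S (Suc s) (length (colors (Suc s))) (run A (slice_base s) (sym_at A s i (state A S s)))"
  by (simp add: level_syms_def)
 also have "run A (slice_base s) (sym_at A s i (state A S s))=sym_at A (Suc s) ?j (run A (slice_base s) (state A S s))"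
  by (rule slice_sym_at[OF A s i(1,2) sp])
 also have "syms A S (Suc s) (length (colors (Suc s))) \<dots>=sym_at A (Suc s) ?j (state A S (Suc s))"
  unfolding state.simps level_syms_def by (rule syms_commute[OF jc order_refl, symmetric])
 also have "\<dots>=state A S (Suc s)"
  using s j by (intro state_absorb[OF A _ j i(3)]) simp
 finally show "state A (insert (s, i) S) (Suc s)=state A S (Suc s)" .
qed (use s in auto)

lemma endstate_cap:
 assumes A: "generic A" and s: "s<length D" "D!s=(k, Elem Cap)"
  and ij: "(i, j) \<in> {(k, k+1), (k+1, k)}" "(s, i) \<in> S"
 shows "endstate A (insert (s, j) S)=endstate A S"
proof (rule endstate_eqI[of "Suc s"])
 have len: "i<length (level D s)" "j<length (level D s)" using fits[OF s] ij(1) by auto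
 have sp: "supp (width s) (state A S s)" using s by (intro supp_state) simp
 have "state A (insert (s, j) S) s=sym_at A s j (state A S s)"
  using s by (intro state_insert[OF A _ len(2)]) simp
 moreover have "run A (slice_base s) (sym_at A s j (state A S s))=run A (slice_base s) (sym_at A s i (state A S s))"
  using slice_cap[OF s sp] ij(1) by auto
 moreover have "sym_at A s i (state A S s)=state A S s"
  using s by (intro state_absorb[OF A _ len(1) ij(2)]) simp
 moreover have "syms A (insert (s, j) S) (Suc s) n v=syms A S (Suc s) n v" for n v
  by (rule syms_cong) auto
 ultimately show "state A (insert (s, j) S) (Suc s)=state A S (Suc s)"
  by (simp add: level_syms_def)
qed (use s in auto)

lemma endstate_cup:
 assumes A: "generic A" and s: "s<length D" "D!s=(k, Elem Cup)"
  and ij: "(i, j) \<in> {(k, k+1), (k+1, k)}" "(Suc s, i) \<in> S"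
 shows "endstate A (insert (Suc s, j) S)=endstate A S"
proof (rule endstate_eqI[of "Suc s"])
 have "length (level D (Suc s))=length (level D s)+2"
  using arg_cong[OF level_out[OF s], of length] fits[OF s] s by (simp add: outs_def del: level.simps)
 hence len: "i<length (level D (Suc s))" "j<length (level D (Suc s))" using fits[OF s] ij(1) by auto
 hence lc: "i<length (colors (Suc s))" "j<length (colors (Suc s))" by (simp_all add: colors_def)
 have sp: "supp (width s) (state A S s)" using s by (intro supp_state) simp
 let ?r = "run A (slice_base s) (state A S s)"
 have "state A (insert (Suc s, j) S) (Suc s)=sym_at A (Suc s) j (state A S (Suc s))"
  using s by (intro state_insert[OF A _ len(2)]) simp
 also have "\<dots>=syms A S (Suc s) (length (colors (Suc s))) (sym_at A (Suc s) j ?r)"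
  unfolding state.simps level_syms_def by (rule syms_commute[OF lc(2) order_refl])
 also have "sym_at A (Suc s) j ?r=sym_at A (Suc s) i ?r"
  using slice_cup[OF s sp] ij(1) by auto
 also have "syms A S (Suc s) (length (colors (Suc s))) \<dots>=sym_at A (Suc s) i (state A S (Suc s))"
  unfolding state.simps level_syms_def by (rule syms_commute[OF lc(1) order_refl, symmetric])
 also have "\<dots>=state A S (Suc s)"
  using s by (intro state_absorb[OF A _ len(1) ij(2)]) simp
 finally show "state A (insert (Suc s, j) S) (Suc s)=state A S (Suc s)" .
qed (use s in auto)

section \<open>Points on the same edge\<close>

definition "adjacent =
 {((s, i), (Suc s, thr s i)) | s i. s<length D & i<length (level D s) & \<not> ends s i} \<union>
 {((s, k), (s, k+1)) | s k. s<length D & D!s=(k, Elem Cap)} \<union>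
 {((Suc s, k), (Suc s, k+1)) | s k. s<length D & D!s=(k, Elem Cup)}"

definition "joined=(adjacent \<union> adjacent\<inverse>)\<^sup>*"

lemma endstate_adjacent:
 assumes A: "generic A" and "x \<in> S" "(x, y) \<in> adjacent \<union> adjacent\<inverse>"
 shows "endstate A (insert y S)=endstate A S"
proof -
 have f: "endstate A (insert b S)=endstate A S" if "(a, b) \<in> adjacent" "a \<in> S" for a b
  using that(1) unfolding adjacent_def
 proof (elim UnE CollectE exE conjE)
  fix s i assume *: "(a, b)=((s, i), Suc s, thr s i)" "s<length D" "i<length (level D s)" "\<not> ends s i"
  thus ?thesis using endstate_through_up[OF A *(2-4), of S] that(2) by simp
 next
  fix s k assume *: "(a, b)=((s, k), s, k+1)" "s<length D" "D!s=(k, Elem Cap)"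
  thus ?thesis using endstate_cap[OF A *(2,3), of k "k+1" S] that(2) by simp
 next
  fix s k assume *: "(a, b)=((Suc s, k), Suc s, k+1)" "s<length D" "D!s=(k, Elem Cup)"
  thus ?thesis using endstate_cup[OF A *(2,3), of k "k+1" S] that(2) by simp
 qed
 have g: "endstate A (insert a S)=endstate A S" if "(a, b) \<in> adjacent" "b \<in> S" for a b
  using that(1) unfolding adjacent_def
 proof (elim UnE CollectE exE conjE)
  fix s i assume *: "(a, b)=((s, i), Suc s, thr s i)" "s<length D" "i<length (level D s)" "\<not> ends s i"
  thus ?thesis using endstate_through_down[OF A *(2-4), of S] that(2) by simp
 next
  fix s k assume *: "(a, b)=((s, k), s, k+1)" "s<length D" "D!s=(k, Elem Cap)"
  thus ?thesis using endstate_cap[OF A *(2,3), of "k+1" k S] that(2) by simp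
 next
  fix s k assume *: "(a, b)=((Suc s, k), Suc s, k+1)" "s<length D" "D!s=(k, Elem Cup)"
  thus ?thesis using endstate_cup[OF A *(2,3), of "k+1" k S] that(2) by simp
 qed
 show ?thesis using assms(2,3) f g by blast
qed

text \<open>The intermediate point \<open>y\<close> is first marked and at the end unmarked again,
  by the induction hypothesis for the sets \<open>insert z S\<close> and \<open>S\<close>; in
  between \<open>z\<close> is its neighbour.\<close>

lemma endstate_joined:
 assumes A: "generic A" and "(x, y) \<in> joined" "x \<in> S"
 shows "endstate A (insert y S)=endstate A S"
 using assms(2,3) unfolding joined_def
proof (induction arbitrary: S rule: rtrancl_induct)
 case base
 thus ?case by (simp add: insert_absorb)
next
 case (step y z)
 have "endstate A (insert z S)=endstate A (insert y (insert z S))"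
  using step.IH[of "insert z S"] step.prems by simp
 also have "\<dots>=endstate A (insert z (insert y S))" by (simp add: insert_commute)
 also have "\<dots>=endstate A (insert y S)" by (rule endstate_adjacent[OF A _ step.hyps(2)]) simp
 also have "\<dots>=endstate A S" by (rule step.IH[OF step.prems])
 finally show ?case .
qed

lemma endstate_union:
 assumes A: "generic A" and "finite T" "!!y. y \<in> T ==> \<exists>x\<in>S. (x, y) \<in> joined"
 shows "endstate A (S \<union> T)=endstate A S"
 using assms(2,3)
proof (induction T rule: finite_induct)
 case (insert y T)
 obtain x where "x \<in> S" "(x, y) \<in> joined" using insert.prems by blast
 hence "endstate A (insert y (S \<union> T))=endstate A (S \<union> T)" by (intro endstate_joined[OF A]) auto
 thus ?case using insert by simp
qed simp

lemma endstate_eq: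
 assumes "generic A" "finite S" "finite T"
  "!!y. y \<in> T ==> \<exists>x\<in>S. (x, y) \<in> joined" "!!x. x \<in> S ==> \<exists>y\<in>T. (y, x) \<in> joined"
 shows "endstate A S=endstate A T"
 using endstate_union[of A T S] endstate_union[of A S T] assms by (simp add: Un_commute)

lemma joined_sym: "(x, y) \<in> joined ==> (y, x) \<in> joined"
 unfolding joined_def by (metis converse_Un converse_converse rtrancl_converseD rtrancl_converseI sup_commute)

lemma joined_refl: "(x, x) \<in> joined"
 by (simp add: joined_def)

lemma joined_trans: "(x, y) \<in> joined ==> (y, z) \<in> joined ==> (x, z) \<in> joined"
 unfolding joined_def by (rule rtrancl_trans)

lemma adjacent_joined: "(x, y) \<in> adjacent ==> (x, y) \<in> joined"
 unfolding joined_def by auto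

text \<open>Each label with the point where it begins. The two legs of a cup share one label, and
  the left leg is taken, in accordance with \<open>births\<close> being 1 there.\<close>

definition "start_points =
 {(first_label D s+j, (Suc s, fst (D!s)+j)) | s j. s<length D & j<births (snd (D!s))}"

lemma first_label_Suc: "first_label D (Suc s)=first_label D s+births (snd (D!s))"
 by (simp add: first_label_def)

lemma first_label_mono: "s <= t ==> first_label D s <= first_label D t"
 by (induction rule: inc_induct) (auto simp: first_label_Suc)

lemma start_point_unique:
 assumes "(x, pt) \<in> start_points" "(x, pt') \<in> start_points"
 shows "pt=pt'"
proof -
 obtain s j s' j' where *: "x=first_label D s+j" "pt=(Suc s, fst (D!s)+j)" "j<births (snd (D!s))"
  "x=first_label D s'+j'" "pt' = (Suc s', fst (D!s')+j')" "j' < births (snd (D!s'))"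
  using assms unfolding start_points_def by blast
 have "\<not> s<s'" using first_label_mono[of "Suc s" s'] * by (auto simp: first_label_Suc)
 moreover have "\<not> s' < s" using first_label_mono[of "Suc s'" s] * by (auto simp: first_label_Suc)
 ultimately have "s=s'" by simp
 thus ?thesis using * by simp
qed

lemma start_point_ex: "x<first_label D s ==> s <= length D ==> \<exists>pt. (x, pt) \<in> start_points"
proof (induction s)
 case 0
 thus ?case by (simp add: first_label_def)
next
 case (Suc s)
 show ?case
 proof (cases "x<first_label D s")
  case False
  hence "x=first_label D s+(x-first_label D s)" "x-first_label D s<births (snd (D!s))" "s<length D"
   using Suc.prems by (auto simp: first_label_Suc)
  thus ?thesis unfolding start_points_def by blast
 qed (use Suc in auto)
qed

lemma level_Suc_cases:
 assumes s: "s<length D" "D!s=(k, p)" and i: "i<length (level D (Suc s))"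
 obtains i' where "i' < length (level D s)" "\<not> ends s i'" "thr s i' = i"
  | j where "j<births p" "i=k+j" "level D (Suc s)!i=first_label D s+j"
  | "p=Elem Cup" "i=k+1" "level D (Suc s)!i=first_label D s"
proof -
 let ?w = "level D s"
 have out: "level D (Suc s)=take k ?w @ outs s@drop (k+inputs p) ?w" by (rule level_out[OF s])
 have fit: "k+inputs p <= length ?w" by (rule fits[OF s])
 hence lk: "length (take k ?w)=k" by simp
 have len: "length (level D (Suc s))=k+length (outs s)+(length ?w-(k+inputs p))"
  unfolding out using fit by simp
 consider "i<k" | "k <= i" "i<k+length (outs s)" | "k+length (outs s) <= i" by linarith
 thus ?thesis
 proof cases
  case 1
  hence "i<length ?w" "\<not> ends s i" "thr s i=i" using fit s by (auto simp: ends_def thr_def)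
  thus ?thesis by (rule that(1))
 next
  case 3
  then obtain r where r: "i=k+length (outs s)+r" using le_iff_add by blast
  have "thr s (k+inputs p+r)=i" using s r by (simp add: thr_def)
  moreover have "k+inputs p+r<length ?w" using r i len by simp
  moreover have "\<not> ends s (k+inputs p+r)" using s by (auto simp: ends_def)
  ultimately show ?thesis using that(1) by blast
 next
  case 2
  then obtain j where j: "i=k+j" "j<length (outs s)" by (metis add_less_cancel_left le_iff_add)
  have nth: "level D (Suc s)!i = outs s!j"
   unfolding out using j lk by (simp add: nth_append)
  show ?thesis
  proof (cases p)
   case (Vertex d)
   hence "outs s=[first_label D s..<first_label D s+d]" using s by (simp add: outs_def)
   thus ?thesis using that(2)[of j] j nth Vertex by simp
  next
   case (Elem e)
   show ?thesis
   proof (cases e)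
    case Cup
    hence o: "outs s=[first_label D s, first_label D s]" using s Elem by (simp add: outs_def)
    hence "j=0 \<or> j=1" using j by auto
    thus ?thesis
    proof
     assume "j=0" thus ?thesis using that(2)[of 0] j nth o Elem Cup by simp
    next
     assume "j=1" thus ?thesis using that(3) j nth o Elem Cup by simp
    qed
   next
    case Cap
    thus ?thesis using j s Elem by (simp add: outs_def)
   next
    case Pos
    hence "j=0 \<or> j=1" using j s Elem by (auto simp: outs_def)
    thus ?thesis
    proof
     assume "j=0"
     thus ?thesis using that(1)[of "k+1"] fit s Elem Pos j by (simp add: thr_def ends_def)
    next
     assume "j=1"
     thus ?thesis using that(1)[of k] fit s Elem Pos j by (simp add: thr_def ends_def)
    qed
   next
    case Neg
    hence "j=0 \<or> j=1" using j s Elem by (auto simp: outs_def)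
    thus ?thesis
    proof
     assume "j=0"
     thus ?thesis using that(1)[of "k+1"] fit s Elem Neg j by (simp add: thr_def ends_def)
    next
     assume "j=1"
     thus ?thesis using that(1)[of k] fit s Elem Neg j by (simp add: thr_def ends_def)
    qed
   qed
  qed
 qed
qed

text \<open>Following a strand downwards leads to the slice where its label was born, possibly to
  the right leg of a cup, which is adjacent to the left one.\<close>

lemma joined_start:
 "s <= length D ==> i<length (level D s) ==>
  \<exists>pt. (level D s!i, pt) \<in> start_points & ((s, i), pt) \<in> joined"
proof (induction s arbitrary: i)
 case 0
 thus ?case by simp
next
 case (Suc s)
 obtain k p where kp: "D!s=(k, p)" by (cases "D!s")
 have s: "s<length D" using Suc.prems by simp
 from level_Suc_cases[OF s kp Suc.prems(2)] show ?case
 proof cases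
  case (1 i')
  from Suc.IH[OF _ 1(1)] s obtain pt where pt: "(level D s!i', pt) \<in> start_points" "((s, i'), pt) \<in> joined" by auto
  have "((s, i'), (Suc s, i)) \<in> adjacent" unfolding adjacent_def using 1 s by blast
  hence "((Suc s, i), pt) \<in> joined" using joined_trans[OF joined_sym[OF adjacent_joined] pt(2)] by blast
  moreover have "level D (Suc s)!i=level D s!i'" using thr_less[OF s 1(1,2)] 1(3) by simp
  ultimately show ?thesis using pt(1) by metis
 next
  case (2 j)
  hence "(level D (Suc s)!i, (Suc s, i)) \<in> start_points"
   unfolding start_points_def using s kp by auto
  thus ?thesis by (auto simp: joined_def)
 next
  case 3
  have "(first_label D s+0, (Suc s, k+0)) \<in> start_points"
   unfolding start_points_def using s kp 3(1) by fastforce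
  moreover have "((Suc s, k), (Suc s, i)) \<in> adjacent" unfolding adjacent_def using 3 s kp by auto
  ultimately show ?thesis unfolding 3(3) using joined_sym[OF adjacent_joined] by (metis add_0_right)
 qed
qed

lemma joined_cap_rel:
 assumes "(x, y) \<in> (cap_rel D \<union> (cap_rel D)\<inverse>)\<^sup>*" "(x, px) \<in> start_points"
 shows "\<exists>py. (y, py) \<in> start_points & (px, py) \<in> joined"
 using assms(1)
proof (induction rule: rtrancl_induct)
 case base
 thus ?case using assms(2) joined_refl by blast
next
 case (step y z)
 then obtain py where py: "(y, py) \<in> start_points" "(px, py) \<in> joined" by blast
 have cap: "\<exists>pa pb. (a, pa) \<in> start_points & (b, pb) \<in> start_points & (pa, pb) \<in> joined" if "(a, b) \<in> cap_rel D" for a b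
 proof -
  from that obtain s k where sk: "s<length D" "D!s=(k, Elem Cap)" "a=level D s!k" "b=level D s!(k+1)"
   unfolding cap_rel_def by blast
  have len: "k<length (level D s)" "k+1<length (level D s)" using fits[OF sk(1,2)] by auto
  obtain pa pb where "(a, pa) \<in> start_points" "((s, k), pa) \<in> joined" "(b, pb) \<in> start_points" "((s, k+1), pb) \<in> joined"
   using joined_start[of s k] joined_start[of s "k+1"] len sk by auto
  moreover have "((s, k), (s, k+1)) \<in> adjacent" unfolding adjacent_def using sk by auto
  ultimately show ?thesis using joined_trans joined_sym adjacent_joined by metis
 qed
 have "\<exists>pz. (z, pz) \<in> start_points & (py, pz) \<in> joined"
  using step.hyps(2)
 proof
  assume "(y, z) \<in> cap_rel D"
  from cap[OF this] show ?thesis using start_point_unique py(1) by metis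
 next
  assume "(y, z) \<in> (cap_rel D)\<inverse>"
  hence "(z, y) \<in> cap_rel D" by simp
  from cap[OF this] show ?thesis using start_point_unique py(1) joined_sym by metis
 qed
 thus ?case using py(2) joined_trans by blast
qed

lemma edge_at_refl: "x \<in> edge_at D x"
 by (simp add: edge_at_def)

lemma edge_at_eq: "y \<in> edge_at D x ==> edge_at D y=edge_at D x"
proof -
 let ?R = "(cap_rel D \<union> (cap_rel D)\<inverse>)\<^sup>*"
 assume "y \<in> edge_at D x"
 hence xy: "(x, y) \<in> ?R" by (simp add: edge_at_def)
 have "sym ?R" by (rule sym_rtrancl) (auto simp: sym_def)
 hence yx: "(y, x) \<in> ?R" using xy by (auto dest: symD)
 show ?thesis unfolding edge_at_def using rtrancl_trans[OF xy] rtrancl_trans[OF yx] by blast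
qed

lemma start_point_label: "(x, pt) \<in> start_points ==> x \<in> labels D"
proof -
 assume "(x, pt) \<in> start_points"
 then obtain s j where "x=first_label D s+j" "s<length D" "j<births (snd (D!s))"
  unfolding start_points_def by blast
 thus ?thesis using first_label_mono[of "Suc s" "length D"] by (simp add: labels_def first_label_Suc)
qed

lemma label_start_point: "x \<in> labels D ==> \<exists>pt. (x, pt) \<in> start_points"
 using start_point_ex[of x "length D"] by (simp add: labels_def)

lemma edge_at_labels: "x \<in> labels D ==> edge_at D x \<subseteq> labels D"
 using label_start_point joined_cap_rel start_point_label unfolding edge_at_def by blast

lemma Min_edge:
 assumes "x \<in> labels D"
 shows "Min (edge_at D x) \<in> edge_at D x" "Min (edge_at D (Min (edge_at D x)))=Min (edge_at D x)"
proof -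
 have "finite (edge_at D x)" using edge_at_labels[OF assms] by (rule finite_subset) (simp add: labels_def)
 thus 1: "Min (edge_at D x) \<in> edge_at D x" using edge_at_refl by (intro Min_in) auto
 show "Min (edge_at D (Min (edge_at D x)))=Min (edge_at D x)" using edge_at_eq[OF 1] by simp
qed

definition "min_points={pt. \<exists>x. (x, pt) \<in> start_points & x=Min (edge_at D x)}"

lemma finite_start_points: "finite (snd ` start_points)"
proof -
 have "snd ` start_points \<subseteq> (\<Union>s<length D. \<Union>j<births (snd (D!s)). {(Suc s, fst (D!s)+j)})"
  unfolding start_points_def by force
 thus ?thesis by (rule finite_subset) auto
qed

text \<open>The evaluation provides one symmetrizer per edge, at its least label. The estimates need
  one wherever a strand starts, so that the state is symmetric in every strand at every
  level.\<close>

lemma endstate_min_points: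
 assumes "generic A"
 shows "endstate A min_points=endstate A (snd ` start_points)"
proof (rule endstate_eq[OF assms])
 show "finite (snd ` start_points)" by (rule finite_start_points)
 show "finite min_points"
  by (rule finite_subset[OF _ finite_start_points]) (force simp: min_points_def)
 show "\<exists>y\<in>snd ` start_points. (y, x) \<in> joined" if "x \<in> min_points" for x
 proof -
  from that obtain l where "(l, x) \<in> start_points" unfolding min_points_def by blast
  hence "x \<in> snd ` start_points" by force
  thus ?thesis using joined_refl by blast
 qed
 show "\<exists>x\<in>min_points. (x, y) \<in> joined" if "y \<in> snd ` start_points" for y
 proof -
  from that obtain l where l: "(l, y) \<in> start_points" by auto
  note m = Min_edge[OF start_point_label[OF l]]
  have "(l, Min (edge_at D l)) \<in> (cap_rel D \<union> (cap_rel D)\<inverse>)\<^sup>*" using m(1) by (simp add: edge_at_def)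
  from joined_cap_rel[OF this l] obtain pt where pt: "(Min (edge_at D l), pt) \<in> start_points" "(y, pt) \<in> joined" by blast
  have "pt \<in> min_points" unfolding min_points_def using pt(1) m(2) by force
  thus ?thesis using pt(2) joined_sym by blast
 qed
qed

end

section \<open>The state sum\<close>

lemma sym_ops_snoc: "sym_ops A q (bs@[b]) v=sym_op A (q+sum_list bs) b (sym_ops A q bs v)"
 by (induction bs arbitrary: q v) (simp_all add: add.assoc)

context colored_diagram
begin

lemma start_points_level:
 assumes "s<length D" "D!s=(k, p)"
 shows "(Suc s, i) \<in> snd ` start_points \<longleftrightarrow> k <= i & i<k+births p"
proof
 assume "(Suc s, i) \<in> snd ` start_points"
 thus "k <= i & i<k+births p" using assms by (auto simp: start_points_def)
next
 assume "k <= i & i<k+births p"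
 then obtain j where "i=k+j" "j<births p" by (metis add_less_cancel_left le_iff_add)
 hence "(first_label D s+j, (Suc s, i)) \<in> start_points"
  unfolding start_points_def using assms by auto
 thus "(Suc s, i) \<in> snd ` start_points" by force
qed

lemma births_outs: "s<length D ==> D!s=(k, p) ==> births p <= length (outs s)"
 by (cases p rule: births.cases) (auto simp: outs_def)

lemma offset_out:
 assumes "s<length D" "D!s=(k, p)" "j <= length (outs s)"
 shows "offset (Suc s) (k+j) = offset s k+sum_list (map c (take j (outs s)))"
proof -
 have "take (k+j) (colors (Suc s))=take k (colors s)@map c (take j (outs s))"
  unfolding colors_out[OF assms(1,2)] using length_take_colors[OF assms(1,2)] assms(3)
  by (simp add: take_map)
 thus ?thesis by (simp add: offset_def)
qed

lemma colors_out_nth: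
 assumes "s<length D" "D!s=(k, p)" "j<length (outs s)"
 shows "colors (Suc s)!(k+j)=c (outs s!j)"
 unfolding colors_out[OF assms(1,2)] using length_take_colors[OF assms(1,2)] assms(3)
 by (simp add: nth_append)

lemma level_syms_start:
 assumes s: "s<length D" "D!s=(k, p)"
 shows "level_syms A (snd ` start_points) (Suc s) v=sym_ops A (offset s k) (map c (take (births p) (outs s))) v"
proof -
 let ?S = "snd ` start_points"
 note mem = start_points_level[OF s]
 have 1: "n <= k ==> syms A ?S (Suc s) n v=v" for n
  by (induction n) (auto simp: mem)
 have 2: "j <= births p ==> syms A ?S (Suc s) (k+j) v=sym_ops A (offset s k) (map c (take j (outs s))) v" for j
 proof (induction j)
  case 0
  thus ?case by (simp add: 1)
 next
  case (Suc j)
  have j: "j<length (outs s)" using Suc.prems births_outs[OF s] by simp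
  have "take (Suc j) (outs s)=take j (outs s)@[outs s!j]" using j by (rule take_Suc_conv_app_nth)
  thus ?case
   using Suc mem[of "k+j"] offset_out[OF s, of j] colors_out_nth[OF s j] j
   by (simp add: sym_ops_snoc sym_at_def)
 qed
 have 3: "syms A ?S (Suc s) (k+births p+r) v=sym_ops A (offset s k) (map c (take (births p) (outs s))) v" for r
  by (induction r) (use 2[of "births p"] mem in auto)
 have "length (colors (Suc s)) >= k+births p"
  unfolding colors_out[OF s] using length_take_colors[OF s] births_outs[OF s] by simp
 then obtain r where "length (colors (Suc s))=k+births p+r" using le_iff_add by blast
 thus ?thesis by (simp add: level_syms_def 3)
qed

section \<open>Growth of the state from slice to slice\<close>

definition "vfact s A=(if s \<in> vertices D then projector_fact A (P s) else 1)"
definition "legfact s A=(if s \<in> vertices D then prod_list (map (qfact A) (legs (P s))) else 1)"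
definition "vfacts s A=(\<Prod>t<s. vfact t A)"
definition "legfacts s A=(\<Prod>t<s. legfact t A)"
text \<open>The normalization of a squared coefficient: the pairing of the symmetric vector with
  counts \<open>ka\<close> with itself, and a factorial for each half-edge of the vertices already
  passed.\<close>

definition "weight s ka A=gausses A (colors s) ka * legfacts s A"

abbreviation "starts \<equiv> snd ` start_points"

text \<open>The first clause is symmetry in every strand. The second bounds the coefficients only
  after division by the projector factorials passed so far and in the normalization
  \<open>weight\<close>.\<close>

definition "bounded_state s d B \<longleftrightarrow> (\<exists>x.
  (\<forall>A ep. generic A --> length ep=width s -->
   state A starts s ep=x (cnts (colors s) ep) A*A^(2 * block_invs (colors s) ep)) \<and>
  (\<forall>ka. list_all2 (\<le>) ka (colors s) --> sqrt_sum (weight s ka) d B (%A. x ka A/vfacts s A)))"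

text \<open>The common part of all slices. The set \<open>I ka\<close> indexes the terms that
  contribute to the outgoing counts \<open>ka\<close>, \<open>jt\<close> gives their incoming counts
  and \<open>W\<close> their coefficients. In \<open>lau\<close> a coefficient is squared and
  multiplied by the quotient of the weights above and below the slice; with at most \<open>n\<close>
  terms the bound grows by \<open>n * C\<close>.\<close>

lemma evolve:
 assumes s: "s<length D" "D!s=(k, p)"
  and st: "bounded_state s d B" and B: "B >= 0" and C: "C >= 0"
  and I: "!!ka. list_all2 (\<le>) ka (map c (outs s)) ==> finite (I ka) & real (card (I ka)) <= n"
  and jt: "!!ka i. list_all2 (\<le>) ka (map c (outs s)) ==> i \<in> I ka ==> list_all2 (\<le>) (jt ka i) (map c (ins s))"
  and rat: "!!ka i. list_all2 (\<le>) ka (map c (outs s)) ==> i \<in> I ka ==> rational_fun (%A. W ka i A/vfact s A)"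
  and lau: "!!ka i. list_all2 (\<le>) ka (map c (outs s)) ==> i \<in> I ka ==> laurent (2 * e) (C^2)
   (%A. (W ka i A/vfact s A)^2 *
    (gausses A (map c (outs s)) ka * legfact s A/gausses A (map c (ins s)) (jt ka i)))"
  and val: "!!A al ga et v z. generic A ==> length al = offset s k ==> length ga=sum_list (map c (outs s)) ==>
   (!!bt. length bt=sum_list (map c (ins s)) ==>
    v (al@bt@et)=z (cnts (map c (ins s)) bt)*A^(2 * block_invs (map c (ins s)) bt)) ==>
   sym_ops A (offset s k) (map c (take (births p) (outs s))) (run A (slice_base s) v) (al@ga@et) =
   A^(2 * block_invs (map c (outs s)) ga) *
    (\<Sum>i\<in>I (cnts (map c (outs s)) ga). W (cnts (map c (outs s)) ga) i A * z (jt (cnts (map c (outs s)) ga) i))"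
 shows "bounded_state (Suc s) (d+e) (n*(B*C))"
proof -
 obtain x where x: "!!A ep. generic A ==> length ep=width s ==>
   state A starts s ep=x (cnts (colors s) ep) A*A^(2 * block_invs (colors s) ep)"
  and xs: "!!ka. list_all2 (\<le>) ka (colors s) ==> sqrt_sum (weight s ka) d B (%A. x ka A/vfacts s A)"
  using st unfolding bounded_state_def by blast
 define b1 b2 o' i' where "b1=take k (colors s)" "b2=drop (k+inputs p) (colors s)"
  "o' = map c (outs s)" "i' = map c (ins s)"
 note defs = this
 have ci: "colors s=b1@i'@b2" using colors_in[OF s] by (simp add: defs)
 have co: "colors (Suc s)=b1 @ o'@b2" using colors_out[OF s] by (simp add: defs)
 have l1: "length b1=k" using length_take_colors[OF s] by (simp add: defs)
 have s1: "sum_list b1 = offset s k" by (simp add: defs offset_def)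
 have wi: "width s=sum_list b1+sum_list i'+sum_list b2" by (simp add: width_def ci)
 have wo: "width (Suc s)=sum_list b1+sum_list o'+sum_list b2" by (simp add: width_def co)
 define x' where "x' ka A=(let kao=take (length o') (drop k ka) in
  \<Sum>i\<in>I kao. W kao i A * x (take k ka@jt kao i@drop (k+length o') ka) A)" for ka A
 have x'_app: "x' (ka1@kao@ka2) A=(\<Sum>i\<in>I kao. W kao i A * x (ka1@jt kao i@ka2) A)"
  if "length ka1=k" "length kao=length o'" for ka1 kao ka2 A
  using that by (simp add: x'_def Let_def)
 show ?thesis
  unfolding bounded_state_def
 proof (intro exI[of _ x'] conjI allI impI)
  fix A ep assume A: "generic A" and le: "length (ep :: bool list)=width (Suc s)"
  hence "sum_list b1+sum_list o' <= length ep" by (simp add: wo)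
  then obtain al ga et where e: "ep=al@ga@et" "length al=sum_list b1" "length ga=sum_list o'"
   by (rule split3)
  have ceta: "length et=sum_list b2" using le e by (simp add: wo)
  define z where "z ka=x (cnts b1 al@ka @ cnts b2 et) A*(A^(2 * block_invs b1 al)*A^(2 * block_invs b2 et))" for ka
  have cn: "cnts (colors (Suc s)) ep=cnts b1 al @ cnts o' ga @ cnts b2 et"
   "block_invs (colors (Suc s)) ep=block_invs b1 al+(block_invs o' ga+block_invs b2 et)"
   unfolding co e(1) using e by (simp_all add: cnts_append block_invs_append)
  have "state A starts (Suc s) ep =
   sym_ops A (offset s k) (map c (take (births p) (outs s))) (run A (slice_base s) (state A starts s)) (al@ga@et)"
   using level_syms_start[OF s] by (simp add: e(1))
  also have "\<dots>=A^(2 * block_invs o' ga)*(\<Sum>i\<in>I (cnts o' ga). W (cnts o' ga) i A * z (jt (cnts o' ga) i))"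
   unfolding defs(3)
  proof (rule val[OF A])
   fix bt :: "bool list" assume b: "length bt=sum_list (map c (ins s))"
   have "cnts (colors s) (al@bt@et)=cnts b1 al @ cnts i' bt @ cnts b2 et"
    "block_invs (colors s) (al@bt@et)=block_invs b1 al+(block_invs i' bt+block_invs b2 et)"
    unfolding ci using e b defs(4) by (simp_all add: cnts_append block_invs_append)
   moreover have "length (al@bt@et)=width s" using b e ceta wi defs(4) by simp
   ultimately show "state A starts s (al@bt@et) =
     z (cnts (map c (ins s)) bt)*A^(2 * block_invs (map c (ins s)) bt)"
    using x[OF A, of "al@bt@et"] by (simp add: z_def power_add defs(4) mult_ac distrib_left)
  qed (use e s1 defs(3) in auto)
  also have "\<dots>=x' (cnts (colors (Suc s)) ep) A*A^(2 * block_invs (colors (Suc s)) ep)"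
   unfolding cn using l1 by (subst x'_app) (auto simp: z_def sum_distrib_left sum_distrib_right power_add distrib_left mult_ac)
  finally show "state A starts (Suc s) ep=x' (cnts (colors (Suc s)) ep) A*A^(2 * block_invs (colors (Suc s)) ep)" .
 next
  fix ka assume "list_all2 (\<le>) ka (colors (Suc s))"
  then obtain ka1 kar where k1: "ka=ka1@kar" "list_all2 (\<le>) ka1 b1" "list_all2 (\<le>) kar (o'@b2)"
   unfolding co list_all2_append2 by blast
  then obtain kao ka2 where k2: "kar=kao@ka2" "list_all2 (\<le>) kao o'" "list_all2 (\<le>) ka2 b2"
   unfolding list_all2_append2 by blast
  have k: "ka=ka1@kao@ka2" using k1 k2 by simp
  note len = list_all2_lengthD[OF k1(2)] list_all2_lengthD[OF k2(2)] list_all2_lengthD[OF k2(3)]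
  have io: "list_all2 (\<le>) kao (map c (outs s))" using k2(2) by (simp add: defs)
  have "sqrt_sum (weight (Suc s) ka) (d+e) (B*C) (%A. (W kao i A/vfact s A)*(x (ka1@jt kao i@ka2) A/vfacts s A))"
   if i: "i \<in> I kao" for i
  proof (rule sqrt_sum_mult[OF xs rat[OF io i] C lau[OF io i]])
   have ii: "list_all2 (\<le>) (jt kao i) i'" using jt[OF io i] by (simp add: defs)
   show "list_all2 (\<le>) (ka1@jt kao i@ka2) (colors s)"
    unfolding ci using k1(2) k2(3) ii by (intro list_all2_appendI)
   fix A assume A: "generic A"
   note li = list_all2_lengthD[OF ii]
   have "gausses A (colors (Suc s)) ka=gausses A b1 ka1*(gausses A o' kao * gausses A b2 ka2)"
    "gausses A (colors s) (ka1@jt kao i@ka2)=gausses A b1 ka1*(gausses A i' (jt kao i) * gausses A b2 ka2)"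
    unfolding k co ci using len li by (simp_all add: gausses_append)
   moreover have "gausses A i' (jt kao i) ~= 0" by (rule gausses_nz[OF A ii])
   ultimately show "weight (Suc s) ka A=weight s (ka1@jt kao i@ka2) A *
     (gausses A (map c (outs s)) kao * legfact s A/gausses A (map c (ins s)) (jt kao i))"
    by (simp add: weight_def legfacts_def defs(3,4) mult_ac)
  qed
  hence "sqrt_sum (weight (Suc s) ka) (d+e) (\<Sum>i\<in>I kao. B*C)
    (%A. \<Sum>i\<in>I kao. (W kao i A/vfact s A)*(x (ka1@jt kao i@ka2) A/vfacts s A))"
   using I[OF io] by (intro sqrt_sum_sum) auto
  hence "sqrt_sum (weight (Suc s) ka) (d+e) (n*(B*C))
    (%A. \<Sum>i\<in>I kao. (W kao i A/vfact s A)*(x (ka1@jt kao i@ka2) A/vfacts s A))"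
   by (rule sqrt_sum_mono2) (use I[OF io] B C in \<open>auto intro!: mult_right_mono\<close>)
  thus "sqrt_sum (weight (Suc s) ka) (d+e) (n*(B*C)) (%A. x' ka A/vfacts (Suc s) A)"
  proof (rule sqrt_sum_cong)
   fix A
   show "x' ka A/vfacts (Suc s) A =
    (\<Sum>i\<in>I kao. (W kao i A/vfact s A)*(x (ka1@jt kao i@ka2) A/vfacts s A))"
    unfolding k using len l1 by (subst x'_app) (auto simp: vfacts_def sum_divide_distrib mult_ac)
  qed
 qed
qed

lemma level_labels: "s <= length D ==> set (level D s) \<subseteq> {..<first_label D s}"
proof (induction s)
 case (Suc s)
 obtain k p where kp: "D!s=(k, p)" by (cases "D!s")
 have s: "s<length D" using Suc by simp
 have IH: "set (level D s) \<subseteq> {..<first_label D (Suc s)}" using Suc by (auto simp: first_label_Suc)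
 have fit: "k+inputs p <= length (level D s)" by (rule fits[OF s kp])
 have "set (outs s) \<subseteq> {..<first_label D (Suc s)}"
 proof (cases p)
  case (Vertex d)
  thus ?thesis by (auto simp: outs_def kp first_label_Suc)
 next
  case (Elem e)
  have nth: "level D s!i<first_label D (Suc s)" if "i<length (level D s)" for i
   using IH nth_mem[OF that] by auto
  show ?thesis
   using fit nth[of k] nth[of "k+1"] by (cases e) (auto simp: outs_def kp Elem first_label_Suc)
 qed
 thus ?case
  unfolding level_out[OF s kp] using IH by (auto dest!: in_set_takeD in_set_dropD)
qed simp

lemma outs_labels:
 assumes "s<length D"
 shows "set (outs s) \<subseteq> labels D" "set (ins s) \<subseteq> labels D"
proof -
 obtain k p where kp: "D!s=(k, p)" by (cases "D!s")
 have "set (level D (Suc s)) \<subseteq> labels D" "set (level D s) \<subseteq> labels D"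
  using level_labels[of "Suc s"] level_labels[of s] assms first_label_mono[of "Suc s" "length D"]
   first_label_mono[of s "length D"] by (auto simp: labels_def simp del: level.simps)
 thus "set (outs s) \<subseteq> labels D" "set (ins s) \<subseteq> labels D"
  unfolding level_out[OF assms kp] using level_in[OF assms kp] by (simp, metis Un_subset_iff set_append)
qed

end

lemma laurent_funI: "laurent d B f ==> laurent_fun f"
 unfolding laurent_fun_def by blast

lemma laurent_monomial:
 "laurent (2 * k) 1 (%A. (- (A^2))^k)" "laurent (2 * k) 1 (%A. (- (inverse A^2))^k)"
proof -
 have *: "laurent d B f ==> laurent d B (%A. (-1)^k * f A)" for d B f
  by (cases "even k") (auto intro: laurent_uminus)
 have e: "(- (A^2))^k=(-1)^k*A^(2 * k)" for A :: complex
  by (metis mult_minus1 power_mult power_mult_distrib)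
 show "laurent (2 * k) 1 (%A. (- (A^2))^k)" "laurent (2 * k) 1 (%A. (- (inverse A^2))^k)"
  unfolding e by (intro * laurent_power laurent_inverse_power)+
qed

lemma card_le_2power: "b <= m ==> real (b+1) <= 2^m"
proof -
 assume "b <= m"
 have "b+1 <= 2^b" using less_exp[of b] by (simp del: less_exp add: Suc_leI)
 also have "\<dots> <= 2^m" using \<open>b <= m\<close> by simp
 finally show ?thesis by (metis of_nat_le_iff of_nat_numeral of_nat_power)
qed

context colored_diagram
begin

lemma bounded_state_mono:
 assumes "bounded_state s d B" "d <= d'" "B <= B'"
 shows "bounded_state s d' B'"
 using assms unfolding bounded_state_def by (metis sqrt_sum_mono2)

text \<open>There is a single term, and only for complementary counts on the two legs. By
  \<open>gauss_flip\<close> the legs have equal Gaussian binomials, which cancel the squared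
  denominator of the symmetrizer, so the normalized square is a monomial.\<close>

lemma evolve_cup:
 assumes s: "s<length D" "D!s=(k, Elem Cup)" and m: "!!x. x \<in> labels D ==> c x <= m"
  and st: "bounded_state s d B" and B: "B >= 0"
 shows "bounded_state (Suc s) (d+2 * m) B"
proof -
 define b where "b=c (first_label D s)"
 have o: "map c (outs s)=[b, b]" and tk: "map c (take (births (Elem Cup)) (outs s))=[b]"
  using s by (simp_all add: outs_def b_def)
 have i: "ins s=[]" using s by (simp add: ins_def)
 have bm: "b <= m" using m outs_labels[OF s(1)] s by (auto simp: outs_def b_def)
 have nv: "vfact s A=1" "legfact s A=1" for A using s by (auto simp: vfact_def legfact_def vertices_def)
 have "bounded_state (Suc s) (d+2 * m) (1*(B*1))"
 proof (rule evolve[OF s st B, where I = "%ka. if ka!0+ka!1=b then {0::nat} else {}"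
    and W = "%ka i A. (- (A^2))^(ka!0)/gauss A b (ka!0)" and jt = "%ka i. []"])
  fix ka :: "nat list" and u :: nat
  assume ka: "list_all2 (\<le>) ka (map c (outs s))"
  hence kb: "ka!0 <= b" and k2: "ka=[ka!0, ka!1]"
   by (auto simp: o list_all2_Cons2)
  show "rational_fun (%A. (- (A^2))^(ka!0)/gauss A b (ka!0)/vfact s A)"
   unfolding nv div_by_1
   by (intro rational_fun_divide rational_fun_laurent laurent_funI[OF laurent_monomial(1)] laurent_fun_gauss gauss_nz kb)
  assume "u \<in> (if ka!0+ka!1=b then {0::nat} else {})"
  hence k1: "ka!1=b-ka!0" by (auto split: if_splits)
  have "laurent (2*(2 * m)) (1^2) (%A. A^(4 * ka!0))"
   by (rule laurent_mono[OF laurent_power]) (use kb bm in auto)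
  also have "?this \<longleftrightarrow> laurent (2*(2 * m)) (1^2) (%A. ((- (A^2))^(ka!0)/gauss A b (ka!0)/vfact s A)^2 *
    (gausses A (map c (outs s)) ka * legfact s A/gausses A (map c (ins s)) []))"
  proof (rule laurent_cong)
   fix A assume A: "generic A"
   note nz = gauss_nz[OF A kb]
   have g: "gausses A (map c (outs s)) ka=gauss A b (ka!0)^2"
    using gauss_flip[OF kb, of A] by (subst k2) (simp add: o k1[unfolded One_nat_def] power2_eq_square)
   have "((- (A^2))^(ka!0))^2=A^(4 * ka!0)"
    by (simp add: power_mult[symmetric] mult.commute[of _ 2] power_mult[of "- (A^2)" 2])
   thus "A^(4 * ka!0)=((- (A^2))^(ka!0)/gauss A b (ka!0)/vfact s A)^2 *
    (gausses A (map c (outs s)) ka * legfact s A/gausses A (map c (ins s)) [])"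
    using nz by (simp add: g nv i power_divide)
  qed
  finally show "laurent (2*(2 * m)) (1^2) (%A. ((- (A^2))^(ka!0)/gauss A b (ka!0)/vfact s A)^2 *
    (gausses A (map c (outs s)) ka * legfact s A/gausses A (map c (ins s)) []))" .
 next
  fix A v z and al ga et :: "bool list"
  assume A: "generic A" and l: "length al = offset s k" "length ga=sum_list (map c (outs s))"
   and v: "!!bt. length bt=sum_list (map c (ins s)) ==>
    v (al@bt@et)=z (cnts (map c (ins s)) bt)*A^(2 * block_invs (map c (ins s)) bt)"
  have "b+b <= length ga" using l o by simp
  then obtain ga1 ga2 dl where g: "ga=ga1@ga2@dl" "length ga1=b" "length ga2=b" by (rule split3)
  hence "dl=[]" using l o by simp
  hence g': "ga=ga1@ga2" using g by simp
  have ce: "cnts [b, b] ga=[cnt ga1, cnt ga2]" using g(2,3) by (simp add: g')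
  have S: "(\<Sum>i\<in>(if Q then {0::nat} else {}). u)=(if Q then u else 0)" for Q and u :: complex by simp
  have v0: "v (al@et)=z []" using v[of "[]"] by (simp add: i)
  have R: "run A (slice_base s) v (al@bt@ga2@et) =
   (if ga2=flip bt then (- (A^2)) ^ cnt bt * z [] else 0)" if "length bt=b" for bt
   using run_cups[OF l(1) that g(3), of A v et] s v0 by (simp add: slice_base_def core_def b_def)
  have "sym_ops A (offset s k) [b] (run A (slice_base s) v) (al@ga1@(ga2@et)) =
   A^(2 * invs ga1)/gauss A b (cnt ga1)*(\<Sum>bt\<in>words b. (if cnt bt=cnt ga1 then A^(2 * invs bt) else 0) *
    (if ga2=flip bt then (- (A^2)) ^ cnt bt * z [] else 0))"
   (is "?L = ?R")
  proof -
   have "?L=A^(2 * invs ga1)/gauss A b (cnt ga1)*(\<Sum>bt\<in>words b. (if cnts [b] bt=cnts [b] ga1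
     then A^(2 * block_invs [b] bt) else 0) * run A (slice_base s) v (al@bt@ga2@et))"
    using sym_ops_app[OF l(1), of ga1 "[b]" A "run A (slice_base s) v" "ga2@et"] g(2) by simp
   also have "(\<Sum>bt\<in>words b. (if cnts [b] bt=cnts [b] ga1
     then A^(2 * block_invs [b] bt) else 0) * run A (slice_base s) v (al@bt@ga2@et)) =
    (\<Sum>bt\<in>words b. (if cnt bt=cnt ga1 then A^(2 * invs bt) else 0) *
     (if ga2=flip bt then (- (A^2)) ^ cnt bt * z [] else 0))"
   proof (intro sum.cong refl arg_cong2[where f = "(*)"])
    fix bt assume "bt \<in> words b"
    hence b: "length bt=b" by (simp add: words_def)
    show "(if cnts [b] bt=cnts [b] ga1 then A^(2 * block_invs [b] bt) else 0) =
     (if cnt bt=cnt ga1 then A^(2 * invs bt) else 0)"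
     using g(2) b by simp
    show "run A (slice_base s) v (al@bt@ga2@et)=(if ga2=flip bt then (- (A^2)) ^ cnt bt * z [] else 0)"
     by (rule R[OF b])
   qed
   finally show ?thesis .
  qed
  also have "(\<Sum>bt\<in>words b. (if cnt bt=cnt ga1 then A^(2 * invs bt) else 0) *
    (if ga2=flip bt then (- (A^2)) ^ cnt bt * z [] else 0)) =
   (\<Sum>bt\<in>{flip ga2}. (if cnt bt=cnt ga1 then A^(2 * invs bt) else 0)*((- (A^2)) ^ cnt bt * z []))"
  proof (rule sum.mono_neutral_cong_right)
   have fl: "ga2=flip bt \<longleftrightarrow> bt=flip ga2" for bt by (metis flip_flip)
   show "finite (words b)" by simp
   show "{flip ga2} \<subseteq> words b" using g(3) by (simp add: words_def)
   show "\<forall>bt\<in>words b-{flip ga2}. (if cnt bt=cnt ga1 then A^(2 * invs bt) else 0) *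
    (if ga2=flip bt then (- (A^2)) ^ cnt bt * z [] else 0)=0"
    unfolding fl by simp
  qed simp
  also have "A^(2 * invs ga1)/gauss A b (cnt ga1)*\<dots>=A^(2 * block_invs [b, b] ga) *
   (if cnt ga1 + cnt ga2=b then (- (A^2)) ^ cnt ga1/gauss A b (cnt ga1) * z [] else 0)"
   using g cnt_le[of ga2] by (auto simp: g' cnt_flip invs_flip distrib_left power_add)
  finally have fin: "sym_ops A (offset s k) [b] (run A (slice_base s) v) (al@ga@et)=A^(2 * block_invs [b, b] ga) *
   (if cnt ga1 + cnt ga2=b then (- (A^2)) ^ cnt ga1/gauss A b (cnt ga1) * z [] else 0)"
   unfolding g' append_assoc .
  show "sym_ops A (offset s k) (map c (take (births (Elem Cup)) (outs s))) (run A (slice_base s) v) (al@ga@et) =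
   A^(2 * block_invs (map c (outs s)) ga) *
    (\<Sum>i\<in>(if cnts (map c (outs s)) ga!0 + cnts (map c (outs s)) ga!1=b then {0::nat} else {}).
     (- (A^2))^(cnts (map c (outs s)) ga!0)/gauss A b (cnts (map c (outs s)) ga!0) * z [])"
   unfolding tk o ce nth_Cons_0 One_nat_def nth_Cons_Suc S
   by (rule fin)
 qed (auto simp: i)
 thus ?thesis by simp
qed

text \<open>Dual to the cup, but with one term for each count on the left strand; their number is at
  most 2^m.\<close>

lemma evolve_cap:
 assumes s: "s<length D" "D!s=(k, Elem Cap)" and m: "!!x. x \<in> labels D ==> c x <= m"
  and st: "bounded_state s d B" and B: "B >= 0"
 shows "bounded_state (Suc s) (d+2 * m) (2^m*B)"
proof -
 define b where "b=c (level D s!k)"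
 have o: "outs s=[]" using s by (simp add: outs_def)
 have i: "map c (ins s)=[b, b]" using ins_two[OF s] cap_colors[OF s] by (simp add: b_def)
 have bm: "b <= m" using m outs_labels(2)[OF s(1)] ins_two[OF s] by (auto simp: b_def)
 have nv: "vfact s A=1" "legfact s A=1" for A using s by (auto simp: vfact_def legfact_def vertices_def)
 have "bounded_state (Suc s) (d+2 * m) (2^m*(B*1))"
 proof (rule evolve[OF s st B, where I = "%ka. {..b}"
    and W = "%ka j A. (- (inverse A^2))^(b-j) * gauss A b j" and jt = "%ka j. [j, b-j]"])
  fix ka :: "nat list" and j
  assume ka: "list_all2 (\<le>) ka (map c (outs s))" and j: "j \<in> {..b}"
  hence jb: "j <= b" and k0: "ka=[]" by (auto simp: o)
  show "rational_fun (%A. (- (inverse A^2))^(b-j) * gauss A b j/vfact s A)"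
   unfolding nv div_by_1
   by (intro rational_fun_mult rational_fun_laurent laurent_funI[OF laurent_monomial(2)] laurent_fun_gauss)
  show "list_all2 (\<le>) [j, b-j] (map c (ins s))" using jb by (simp add: i)
  have "laurent (2*(2 * m)) (1^2) (%A. inverse A^(4*(b-j)))"
   by (rule laurent_mono[OF laurent_inverse_power]) (use bm in auto)
  also have "?this \<longleftrightarrow> laurent (2*(2 * m)) (1^2) (%A. ((- (inverse A^2))^(b-j) * gauss A b j/vfact s A)^2 *
    (gausses A (map c (outs s)) ka * legfact s A/gausses A (map c (ins s)) [j, b-j]))"
  proof (rule laurent_cong)
   fix A assume A: "generic A"
   note nz = gauss_nz[OF A jb]
   have g: "gausses A (map c (ins s)) [j, b-j]=gauss A b j^2"
    using gauss_flip[OF jb, of A] by (simp add: i power2_eq_square)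
   have "((- (inverse A^2))^(b-j))^2=inverse A^(4*(b-j))"
    by (simp add: power_mult[symmetric] mult.commute[of _ 2] power_mult[of "- (inverse A^2)" 2])
   thus "inverse A^(4*(b-j))=((- (inverse A^2))^(b-j) * gauss A b j/vfact s A)^2 *
    (gausses A (map c (outs s)) ka * legfact s A/gausses A (map c (ins s)) [j, b-j])"
    unfolding g power_divide power_mult_distrib using nz by (simp add: nv o k0 del: power_inverse)
  qed
  finally show "laurent (2*(2 * m)) (1^2) (%A. ((- (inverse A^2))^(b-j) * gauss A b j/vfact s A)^2 *
    (gausses A (map c (outs s)) ka * legfact s A/gausses A (map c (ins s)) [j, b-j]))" .
 next
  show "finite {..b} & real (card {..b}) <= 2^m" using card_le_2power[OF bm] by simp
 next
  fix A v z and al ga et :: "bool list"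
  assume A: "generic A" and l: "length al = offset s k" "length ga=sum_list (map c (outs s))"
   and v: "!!bt. length bt=sum_list (map c (ins s)) ==>
    v (al@bt@et)=z (cnts (map c (ins s)) bt)*A^(2 * block_invs (map c (ins s)) bt)"
  have g: "ga=[]" using l o by simp
  have v': "v (al@bt@flip bt@et)=z [cnt bt, b - cnt bt]*A^(4 * invs bt)" if "length bt=b" for bt
   using v[of "bt@flip bt"] that by (simp add: i length_flip cnt_flip invs_flip flip: mult_2)
  have "run A (slice_base s) v (al@et) =
   (\<Sum>bt\<in>words b. (- (inverse A^2))^(b - cnt bt)*(z [cnt bt, b - cnt bt]*A^(4 * invs bt)))"
   using run_caps[OF l(1), of A b v et] s v' by (simp add: slice_base_def core_def b_def words_def)
  also have "\<dots>=(\<Sum>j\<le>b. \<Sum>bt\<in>{bt\<in>words b. cnt bt=j}. (- (inverse A^2))^(b-j)*(z [j, b-j]*A^(4 * invs bt)))"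
   unfolding sum_words_cnt by (intro sum.cong) auto
  also have "\<dots>=(\<Sum>j\<le>b. (- (inverse A^2))^(b-j) * gauss A b j * z [j, b-j])"
   by (simp add: gauss_def sum_distrib_left sum_distrib_right mult_ac)
  finally show "sym_ops A (offset s k) (map c (take (births (Elem Cap)) (outs s))) (run A (slice_base s) v) (al@ga@et) =
   A^(2 * block_invs (map c (outs s)) ga) *
    (\<Sum>j\<in>{..b}. (- (inverse A^2))^(b-j) * gauss A b j * z [j, b-j])"
   by (simp add: g o)
 qed auto
 thus ?thesis by simp
qed

text \<open>By \<open>cross_coeff_transpose\<close> the normalized square of a coefficient is its
  product with the transposed coefficient, and both satisfy \<open>laurent_cross_coeff\<close>. 12 =
  4 * 3: the number of terms and the bound for each.\<close>

lemma evolve_crossing: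
 assumes s: "s<length D" "D!s=(k, Elem p)" and p: "p \<in> {Pos, Neg}" and m: "!!x. x \<in> labels D ==> c x <= m"
  and st: "bounded_state s d B" and B: "B >= 0"
 shows "bounded_state (Suc s) (d+9 * m * m) (12^m*B)"
proof -
 define a b where "a=c (level D s!k)" "b=c (level D s!(k+1))"
 have pp: "p ~= Cup" using p by auto
 have o: "map c (outs s)=[b, a]" using s p by (auto simp: outs_def a_b_def)
 have i: "map c (ins s)=[a, b]" using ins_two[OF s pp] by (simp add: a_b_def)
 have core: "core s=cross p a b" using s p by (auto simp: core_def a_b_def)
 have bi: "births (Elem p)=0" using p by auto
 have am: "a <= m" "b <= m" using m outs_labels(2)[OF s(1)] ins_two[OF s pp] by (auto simp: a_b_def)
 have nv: "vfact s A=1" "legfact s A=1" for A using s by (auto simp: vfact_def legfact_def vertices_def)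
 have "bounded_state (Suc s) (d+9 * m * m) (4^m*(B*3^m))"
 proof (rule evolve[OF s st B, where I = "%ka. {..a} \<times> {..b}"
    and W = "%ka j A. cross_coeff A p a b (fst j) (snd j) (ka!0) (ka!1)" and jt = "%ka j. [fst j, snd j]"])
  fix ka :: "nat list" and j :: "nat \<times> nat"
  assume ka: "list_all2 (\<le>) ka (map c (outs s))" and j: "j \<in> {..a} \<times> {..b}"
  hence jb: "fst j <= a" "snd j <= b" by auto
  have kb: "ka!0 <= b" "ka!1 <= a" and k2: "ka=[ka!0, ka!1]"
   using ka by (auto simp: o list_all2_Cons2)
  have L: "laurent (9 * m * m) (3^m) (%A. cross_coeff A p a b (fst j) (snd j) (ka!0) (ka!1))"
   by (rule laurent_cross_coeff[OF p am kb])
  have L': "laurent (9 * m * m) (3^m) (%A. cross_coeff A p b a (ka!0) (ka!1) (fst j) (snd j))"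
   by (rule laurent_cross_coeff[OF p am(2,1) jb])
  show "rational_fun (%A. cross_coeff A p a b (fst j) (snd j) (ka!0) (ka!1)/vfact s A)"
   unfolding nv div_by_1 by (intro rational_fun_laurent laurent_funI[OF L])
  show "list_all2 (\<le>) [fst j, snd j] (map c (ins s))" using jb by (simp add: i)
  have "laurent (2*(9 * m * m)) ((3^m)^2) (%A. cross_coeff A p a b (fst j) (snd j) (ka!0) (ka!1) *
   cross_coeff A p b a (ka!0) (ka!1) (fst j) (snd j))"
   using laurent_mult[OF L L'] by (simp add: power2_eq_square mult_2)
  also have "?this \<longleftrightarrow> laurent (2*(9 * m * m)) ((3^m)^2)
    (%A. (cross_coeff A p a b (fst j) (snd j) (ka!0) (ka!1)/vfact s A)^2 *
    (gausses A (map c (outs s)) ka * legfact s A/gausses A (map c (ins s)) [fst j, snd j]))"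
  proof (rule laurent_cong)
   fix A assume A: "generic A"
   note nz = gauss_nz[OF A jb(1)] gauss_nz[OF A jb(2)]
   have g: "gausses A (map c (ins s)) [fst j, snd j]=gauss A a (fst j) * gauss A b (snd j)"
    "gausses A (map c (outs s)) ka=gauss A b (ka!0) * gauss A a (ka!1)"
    by (simp add: i, subst k2, simp add: o)
   show "cross_coeff A p a b (fst j) (snd j) (ka!0) (ka!1) *
    cross_coeff A p b a (ka!0) (ka!1) (fst j) (snd j) =
    (cross_coeff A p a b (fst j) (snd j) (ka!0) (ka!1)/vfact s A)^2 *
    (gausses A (map c (outs s)) ka * legfact s A/gausses A (map c (ins s)) [fst j, snd j])"
    using nz cross_coeff_transpose[OF A p jb kb(2,1)] by (simp add: g nv power2_eq_square field_simps)
  qed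
  finally show "laurent (2*(9 * m * m)) ((3^m)^2)
    (%A. (cross_coeff A p a b (fst j) (snd j) (ka!0) (ka!1)/vfact s A)^2 *
    (gausses A (map c (outs s)) ka * legfact s A/gausses A (map c (ins s)) [fst j, snd j]))" .
 next
  have "real (a+1) * real (b+1) <= 2^m*2^m"
   by (intro mult_mono card_le_2power am) auto
  also have "\<dots>=4^m" by (simp add: power_mult_distrib[symmetric])
  finally show "finite ({..a} \<times> {..b}) & real (card ({..a} \<times> {..b})) <= 4^m"
   by (simp add: algebra_simps)
 next
  fix A v z and al ga et :: "bool list"
  assume A: "generic A" and l: "length al = offset s k" "length ga=sum_list (map c (outs s))"
   and v: "!!bt. length bt=sum_list (map c (ins s)) ==>
    v (al@bt@et)=z (cnts (map c (ins s)) bt)*A^(2 * block_invs (map c (ins s)) bt)"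
  have "b+a <= length ga" using l o by simp
  then obtain ga2 ga1 dl where g: "ga=ga2@ga1@dl" "length ga2=b" "length ga1=a" by (rule split3)
  hence "dl=[]" using l o by simp
  hence g': "ga=ga2@ga1" using g by simp
  have v': "v (al@bt1@bt2@et)=A^(2 * invs bt1+2 * invs bt2) * z [cnt bt1, cnt bt2]"
   if "length bt1=a" "length bt2=b" for bt1 bt2
   using v[of "bt1@bt2"] that by (simp add: i distrib_left)
  have "run A (slice_base s) v (al@ga@et)=A^(2 * invs ga2+2 * invs ga1) *
   (\<Sum>k\<le>a. \<Sum>l\<le>b. cross_coeff A p a b k l (cnt ga2) (cnt ga1) * z [k, l])"
   unfolding slice_base_def core s(2) fst_conv g' append_assoc
   by (rule run_cross_symmetric[OF A p v' l(1) g(3,2)])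
  moreover have "block_invs [b, a] ga=invs ga2+invs ga1" "cnts [b, a] ga=[cnt ga2, cnt ga1]"
   using g(2,3) by (simp_all add: g')
  ultimately show "sym_ops A (offset s k) (map c (take (births (Elem p)) (outs s))) (run A (slice_base s) v) (al@ga@et) =
   A^(2 * block_invs (map c (outs s)) ga) *
    (\<Sum>j\<in>{..a} \<times> {..b}. cross_coeff A p a b (fst j) (snd j) (cnts (map c (outs s)) ga!0) (cnts (map c (outs s)) ga!1) * z [fst j, snd j])"
   unfolding o bi by (simp add: distrib_left sum.cartesian_product case_prod_unfold)
 qed auto
 moreover have "(4::real)^m*(B*3^m)=12^m*B" by (simp flip: power_mult_distrib)
 ultimately show ?thesis by simp
qed

text \<open>4 = 2 * 2: the number of choices of \<open>j\<close> is bounded by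
  \<open>card_PiE_classes\<close>, the size of a term by \<open>laurent_vweight\<close>.\<close>

lemma evolve_vertex:
 assumes s: "s<length D" "D!s=(k, Vertex n)" and m: "!!x. x \<in> labels D ==> c x <= m"
  and st: "bounded_state s d B" and B: "B >= 0"
 shows "bounded_state (Suc s) (d+13 * n^3 * m\<^sup>2) (4^(n\<^sup>2 * m)*B)"
proof -
 have lp: "local_projector (P s)" "legs (P s)=map c (outs s)" using vertex_legs[OF s] by simp_all
 interpret local_proj "P s" by (unfold_locales) (rule lp)
 have i: "ins s=[]" using s by (simp add: ins_def)
 have o: "take n (outs s) = outs s" and dg: "deg=n" using s lp by (simp_all add: outs_def deg_def)
 have sv: "s \<in> vertices D" using s by (auto simp: vertices_def)
 have nv: "vfact s A=projector_fact A (P s)" "legfact s A=prod_list (map (qfact A) (legs (P s)))" for A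
  using sv by (simp_all add: vfact_def legfact_def)
 have cm: "x \<in> set (legs (P s)) ==> x <= m" for x using m outs_labels(1)[OF s(1)] lp(2) by auto
 define I where "I ka={j \<in> \<Pi>\<^sub>E c\<in>classes. {..classmult c}. map (pluscount j) [0..<deg]=ka}" for ka
 define W where "W ka j A=vmono A j*(\<Prod>c\<in>classes. gauss A (classmult c) (j c))/gausses A (legs (P s)) ka" for ka j A
 have finPi: "finite (\<Pi>\<^sub>E c\<in>classes. {..classmult c})" by (rule finite_PiE) auto
 have W: "W ka j A/vfact s A=vweight A j" if "j \<in> I ka" for ka j A
  using that by (auto simp: W_def I_def vweight_def nv)
 have "bounded_state (Suc s) (d+13 * n^3 * m\<^sup>2) (2^(n\<^sup>2 * m)*(B*2^(n\<^sup>2 * m)))"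
 proof (rule evolve[OF s st B, where I = I and W = W and jt = "%ka j. []"])
  fix ka :: "nat list"
  have "card (I ka) <= card (\<Pi>\<^sub>E c\<in>classes. {..classmult c})"
   by (intro card_mono finPi) (auto simp: I_def)
  thus "finite (I ka) & real (card (I ka)) <= 2^(n\<^sup>2 * m)"
   using card_PiE_classes[OF cm] finPi unfolding dg I_def by fastforce
  fix j assume j: "j \<in> I ka"
  hence jP: "j \<in> (\<Pi>\<^sub>E c\<in>classes. {..classmult c})" and k: "map (pluscount j) [0..<deg]=ka" by (auto simp: I_def)
  show "rational_fun (%A. W ka j A/vfact s A)" unfolding W[OF j] by (rule rational_vweight[OF jP])
  show "laurent (2*(13 * n^3 * m\<^sup>2)) ((2^(n\<^sup>2 * m))\<^sup>2) (%A. (W ka j A/vfact s A)^2 *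
    (gausses A (map c (outs s)) ka * legfact s A/gausses A (map c (ins s)) []))"
   using laurent_vweight[OF jP cm] unfolding W[OF j] by (simp add: i nv k[unfolded dg] lp(2) dg)
 next
  fix A v z and al ga et :: "bool list"
  assume A: "generic A" and l: "length al = offset s k" "length ga=sum_list (map c (outs s))"
   and v: "!!bt. length bt=sum_list (map c (ins s)) ==>
    v (al@bt@et)=z (cnts (map c (ins s)) bt)*A^(2 * block_invs (map c (ins s)) bt)"
  have v0: "v (al@et)=z []" using v[of "[]"] by (simp add: i)
  have np: "npts=sum_list (map c (outs s))" by (simp add: npts_def lp(2))
  have va: "valid 0 (arc_cups (arcs (P s))) npts" using arc_cups_run[OF matching] by blast
  have R: "run A (slice_base s) v (al@bt@et)=arc_weight A bt * z []" if "length bt=npts" for bt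
   using run_local[OF va l(1) that, of A v et] arc_cups_run[OF matching, of A] that s v0
   by (simp add: slice_base_def core_def arc_weight_def)
  have "sym_ops A (offset s k) (map c (outs s)) (run A (slice_base s) v) (al@ga@et) =
   A^(2 * block_invs (legs (P s)) ga)/gausses A (legs (P s)) (cnts (legs (P s)) ga) *
   (\<Sum>bt\<in>words npts. (if cnts (legs (P s)) bt=cnts (legs (P s)) ga then A^(2 * block_invs (legs (P s)) bt) else 0)*(arc_weight A bt * z []))"
   unfolding sym_ops_app[OF l] lp(2) np
   by (intro arg_cong2[where f = "(*)"] sum.cong refl) (auto simp: words_def R np)
  also have "\<dots>=A^(2 * block_invs (legs (P s)) ga)/gausses A (legs (P s)) (cnts (legs (P s)) ga) *
   ((\<Sum>bt\<in>words npts. (if cnts (legs (P s)) bt=cnts (legs (P s)) ga then A^(2 * block_invs (legs (P s)) bt) else 0) * arc_weight A bt) * z [])"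
   by (simp add: sum_distrib_right mult.assoc)
  also have "\<dots>=A^(2 * block_invs (legs (P s)) ga)*(\<Sum>j\<in>I (cnts (legs (P s)) ga). W (cnts (legs (P s)) ga) j A * z [])"
   unfolding vertex_sum sum.inter_filter[OF finPi, symmetric] I_def[symmetric]
   by (simp add: W_def sum_distrib_left sum_distrib_right sum_divide_distrib mult_ac)
  finally show "sym_ops A (offset s k) (map c (take (births (Vertex n)) (outs s))) (run A (slice_base s) v) (al@ga@et) =
   A^(2 * block_invs (map c (outs s)) ga) *
    (\<Sum>j\<in>I (cnts (map c (outs s)) ga). W (cnts (map c (outs s)) ga) j A * z [])"
   by (simp add: o lp(2))
 qed (auto simp: i)
 moreover have "(2::real)^(n\<^sup>2 * m)*(B*2^(n\<^sup>2 * m))=4^(n\<^sup>2 * m)*B"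
  by (simp flip: power_mult_distrib)
 ultimately show ?thesis by simp
qed

text \<open>9 suffices for cups, caps and crossings, and 13 comes from \<open>evolve_vertex\<close>,
  where \<open>births\<close> is the valency.\<close>

definition "slice_degree s=9+13 * births (snd (D!s))^3"
definition "slice_bound s=(12*4^(births (snd (D!s)))\<^sup>2 :: real)"

lemma evolve_slice:
 assumes s: "s<length D" and m: "!!x. x \<in> labels D ==> c x <= m"
  and st: "bounded_state s d B" and B: "B >= 0"
 shows "bounded_state (Suc s) (d+slice_degree s * m\<^sup>2) (slice_bound s^m*B)"
proof -
 obtain k p where kp: "D!s=(k, p)" by (cases "D!s")
 have m2: "m <= m\<^sup>2" by (simp add: power2_eq_square)
 have e1: "(1::real) <= 12^m" "(2::real)^m <= 12^m" by (auto intro: power_mono)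
 show ?thesis
 proof (cases p)
  case (Vertex n)
  have "(4::real)^(n\<^sup>2 * m) <= slice_bound s^m"
   by (simp add: slice_bound_def kp Vertex power_mult power_mono)
  thus ?thesis
   using bounded_state_mono[OF evolve_vertex[OF s kp[unfolded Vertex] m st B]] B
   by (simp add: slice_degree_def kp Vertex mult_right_mono)
 next
  case (Elem e)
  have be: "slice_bound s^m >= 12^m"
   by (auto simp: slice_bound_def intro!: power_mono)
  have de: "9 * m\<^sup>2 <= slice_degree s * m\<^sup>2" by (simp add: slice_degree_def)
  have de2: "2 * m <= slice_degree s * m\<^sup>2" using de m2 by linarith
  have le: "x <= 12^m ==> x * B <= slice_bound s^m*B" for x
   using be B by (intro mult_right_mono) auto
  show ?thesis
  proof (cases e)
   case Cup
   show ?thesis using bounded_state_mono[OF evolve_cup[OF s kp[unfolded Elem Cup] m st B]] le[of 1] e1(1) de2 by auto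
  next
   case Cap
   show ?thesis using bounded_state_mono[OF evolve_cap[OF s kp[unfolded Elem Cap] m st B]] le[of "2^m"] e1(2) de2 by auto
  next
   case Pos
   show ?thesis using bounded_state_mono[OF evolve_crossing[OF s kp[unfolded Elem Pos] _ m st B]] le[of "12^m"] de
    by (simp add: power2_eq_square)
  next
   case Neg
   show ?thesis using bounded_state_mono[OF evolve_crossing[OF s kp[unfolded Elem Neg] _ m st B]] le[of "12^m"] de
    by (simp add: power2_eq_square)
  qed
 qed
qed

lemma bounded_states:
 assumes m: "!!x. x \<in> labels D ==> c x <= m"
 shows "s <= length D ==> bounded_state s ((\<Sum>t<s. slice_degree t) * m\<^sup>2) ((\<Prod>t<s. slice_bound t)^m)"
proof (induction s)
 case 0
 have "sqrt_sum (weight 0 []) 0 1 (%A. 1)"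
  by (rule sqrt_sum_single)
   (auto intro!: rational_fun_laurent laurent_funI[OF laurent_1] laurent_1
    simp: weight_def colors_def legfacts_def)
 thus ?case
  unfolding bounded_state_def
  by (intro exI[of _ "%ka A. 1"]) (auto simp: width_0 colors_def unit_vec_def vfacts_def)
next
 case (Suc s)
 have "(\<Prod>t<s. slice_bound t)^m >= 0" by (intro zero_le_power prod_nonneg) (auto simp: slice_bound_def)
 from evolve_slice[OF _ m Suc.IH this] Suc.prems show ?case
  by (simp add: algebra_simps power_mult_distrib)
qed

lemma sqrt_sum_endstate:
 assumes m: "!!x. x \<in> labels D ==> c x <= m"
 shows "sqrt_sum (legfacts (length D)) ((\<Sum>t<length D. slice_degree t) * m\<^sup>2)
  ((\<Prod>t<length D. slice_bound t)^m) (%A. endstate A starts []/vfacts (length D) A)"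
proof -
 have c0: "colors (length D)=[]" "width (length D)=0"
  using graph by (auto simp: knotted_ribbon_graph_def colors_def width_def)
 obtain x where x: "!!A. generic A ==> state A starts (length D) []=x [] A"
  and xs: "sqrt_sum (weight (length D) []) ((\<Sum>t<length D. slice_degree t) * m\<^sup>2)
   ((\<Prod>t<length D. slice_bound t)^m) (%A. x [] A/vfacts (length D) A)"
  using bounded_states[OF m order_refl] unfolding bounded_state_def c0 by force
 have "weight (length D) []=legfacts (length D)"
  by (auto simp: weight_def c0)
 from sqrt_sum_cong[OF xs[unfolded this]] x show ?thesis by (simp add: endstate_def)
qed

end

section \<open>Symmetrizers as sums of braids\<close>

text \<open>Diagrams with places for braids: \<open>Inl\<close> is a piece of a link diagram, and
  \<open>Inr (e, q)\<close> is the place, at offset \<open>q\<close>, for the braid of the edge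
  \<open>e\<close>.\<close>

type_synonym item = "link_diagram+(nat set \<times> nat)"

definition expand :: "(nat set => nat) => (nat set => nat => nat) => item => link_diagram" where
 "expand b sm x=(case x of Inl d => d | Inr (e, q) => shift q (negs (perm_braid (b e) (sm e))))"

definition perform :: "complex => (nat set => nat) => item => vec => vec" where
 "perform A b x v=(case x of Inl d => run A d v | Inr (e, q) => sym_op A q (b e) v)"

definition braided :: "item list => nat set set" where
 "braided L={e. \<exists>q. Inr (e, q) \<in> set L}"

text \<open>Every edge has at most one place, so that the permutations of different edges can be
  summed independently.\<close>

inductive layout :: "(nat set => nat) => item list => nat => bool" for b where
 layout_Nil: "layout b [] 0"
| layout_link: "layout b L n ==> valid n d m ==> layout b (L@[Inl d]) m"
| layout_braid: "layout b L n ==> q+b e <= n ==> e \<notin> braided L ==> layout b (L@[Inr (e, q)]) n"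

lemma braided_append [simp]: "braided (L@L')=braided L \<union> braided L'"
 and braided_Nil [simp]: "braided []={}"
 and braided_Inl [simp]: "braided (Inl d#L)=braided L"
 and braided_Inr [simp]: "braided (Inr (e, q)#L)=insert e (braided L)"
 by (auto simp: braided_def)

lemma finite_braided: "finite (braided L)"
 by (rule finite_subset[of _ "(%x. case x of Inl d => {} | Inr (e, q) => e) ` set L"])
  (force simp: braided_def image_iff split: sum.splits)+

lemma valid_shift_braid: "q+b <= n ==> valid n (shift q (negs (perm_braid b sm))) n"
 unfolding perm_braid_code by (rule valid_shift[OF valid_code_word]) auto

definition braid_coeff :: "complex => nat => (nat => nat) => complex" where
 "braid_coeff A b \<pi>=A^(b*(b-1))*A powi (- 3 * int (perm_length b \<pi>))"

lemma layout_valid: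
 "layout b L n ==> valid 0 (concat (map (expand b sm) L)) n"
 by (induction rule: layout.induct) (auto simp: expand_def valid_append intro!: valid_shift_braid)

lemma layout_supp: "layout b L n ==> supp n (fold (perform A b) L unit_vec)"
 by (induction rule: layout.induct) (auto simp: perform_def intro!: supp_sym_op elim: supp_run)

lemma op_scale: "op k m n K (%ep. a * v ep) ep=a * op k m n K v ep"
 using op_sum[of k m n K "%_. a" "%_. v" "{0::nat}" ep] by simp

text \<open>Induction on the layout: summing over the permutation of the edge placed last turns its
  braids into [b]! times the projector, by \<open>sym_op_perms\<close>; the other sums pass through
  by linearity.\<close>

lemma sum_braids:
 assumes A: "generic A" and L: "layout b L n"
 shows "(\<Sum>sm\<in>(\<Pi>\<^sub>E e\<in>braided L. {\<pi>. \<pi> permutes {..<b e}}). (\<Prod>e\<in>braided L. braid_coeff A (b e) (sm e)) *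
   run A (concat (map (expand b sm) L)) unit_vec ep) =
  (\<Prod>e\<in>braided L. qfact A (b e)) * fold (perform A b) L unit_vec ep"
 using L
proof (induction arbitrary: ep rule: layout.induct)
 case layout_Nil
 thus ?case by simp
next
 case (layout_link L n d m)
 have "(%ep. \<Sum>sm\<in>(\<Pi>\<^sub>E e\<in>braided L. {\<pi>. \<pi> permutes {..<b e}}). (\<Prod>e\<in>braided L. braid_coeff A (b e) (sm e)) *
   run A (concat (map (expand b sm) L)) unit_vec ep) =
  (%ep. (\<Prod>e\<in>braided L. qfact A (b e)) * fold (perform A b) L unit_vec ep)"
  using layout_link.IH by (rule ext)
 from arg_cong[OF this, of "%v. run A d v ep"] show ?case
  by (simp add: run_sum run_scale run_append expand_def[of _ _ "Inl _"] perform_def[of _ _ "Inl _"])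
next
 case (layout_braid L n q e)
 let ?T = "%e. {\<pi>. \<pi> permutes {..<b e}}"
 let ?P = "Pi\<^sub>E (braided L) ?T"
 let ?X = "%ta. run A (concat (map (expand b ta) L)) unit_vec"
 let ?C = "%ta. \<Prod>e\<in>braided L. braid_coeff A (b e) (ta e)"
 let ?Q = "\<Prod>e\<in>braided L. qfact A (b e)"
 let ?L = "L@[Inr (e, q)]"
 have E: "braided ?L=insert e (braided L)" by simp
 have lay: "layout b ?L n" by (rule layout.layout_braid[OF layout_braid.hyps])
 show ?case
 proof (cases "length ep=n")
  case False
  have "run A (concat (map (expand b sm) ?L)) unit_vec ep=0" for sm
   using supp_run[OF supp_unit layout_valid[OF lay]] False by (rule suppD)
  moreover have "fold (perform A b) ?L unit_vec ep=0"
   using layout_supp[OF lay] False by (rule suppD)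
  ultimately show ?thesis by simp
 next
  case True
  have X: "expand b (ta(e := \<pi>)) x=expand b ta x" if "x \<in> set L" for ta \<pi> x
   using that layout_braid.hyps(3) by (auto simp: expand_def braided_def split: sum.splits)
  have C: "(\<Prod>e'\<in>insert e (braided L). braid_coeff A (b e') ((ta(e := \<pi>)) e'))=braid_coeff A (b e) \<pi> * ?C ta" for ta \<pi>
   using layout_braid.hyps(3) finite_braided[of L] by (auto intro!: prod.cong)
  have R: "run A (concat (map (expand b (ta(e := \<pi>))) ?L)) unit_vec ep =
   run A (shift q (negs (perm_braid (b e) \<pi>))) (?X ta) ep" for ta \<pi>
   using X by (simp add: run_append expand_def[of _ _ "Inr _"] cong: map_cong)
  have "(\<Sum>sm\<in>Pi\<^sub>E (insert e (braided L)) ?T. (\<Prod>e\<in>insert e (braided L). braid_coeff A (b e) (sm e)) *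
    run A (concat (map (expand b sm) ?L)) unit_vec ep) =
   (\<Sum>(\<pi>, ta)\<in>?T e \<times> ?P. (braid_coeff A (b e) \<pi> * ?C ta) *
    run A (shift q (negs (perm_braid (b e) \<pi>))) (?X ta) ep)"
   unfolding PiE_insert_eq
   by (subst sum.reindex[OF inj_combinator[OF layout_braid.hyps(3), of ?T]]) (simp only: o_def case_prod_unfold C R)
  also have "\<dots>=(\<Sum>ta\<in>?P. \<Sum>\<pi>\<in>?T e. (braid_coeff A (b e) \<pi> * ?C ta) *
    run A (shift q (negs (perm_braid (b e) \<pi>))) (?X ta) ep)"
   unfolding sum.cartesian_product[symmetric] by (rule sum.swap)
  also have "\<dots>=(\<Sum>ta\<in>?P. ?C ta*(\<Sum>\<pi>\<in>?T e. braid_coeff A (b e) \<pi> *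
    run A (shift q (negs (perm_braid (b e) \<pi>))) (?X ta) ep))"
   by (simp add: sum_distrib_left mult_ac)
  also have "\<dots>=(\<Sum>ta\<in>?P. ?C ta*(qfact A (b e) * sym_op A q (b e) (?X ta) ep))"
   using sym_op_perms[OF A, of q "b e" ep] layout_braid.hyps(2) True by (simp add: braid_coeff_def)
  also have "\<dots>=qfact A (b e)*(\<Sum>ta\<in>?P. ?C ta * sym_op A q (b e) (?X ta) ep)"
   by (simp add: sum_distrib_left mult_ac)
  also have "(\<Sum>ta\<in>?P. ?C ta * sym_op A q (b e) (?X ta) ep) =
   sym_op A q (b e) (%ep. \<Sum>ta\<in>?P. ?C ta * ?X ta ep) ep"
   unfolding sym_op_def by (rule op_sum[symmetric])
  also have "(%ep. \<Sum>ta\<in>?P. ?C ta * ?X ta ep)=(%ep. ?Q * fold (perform A b) L unit_vec ep)"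
   using layout_braid.IH by (rule ext)
  also have "qfact A (b e) * sym_op A q (b e) \<dots> ep =
   (\<Prod>e\<in>insert e (braided L). qfact A (b e)) * fold (perform A b) ?L unit_vec ep"
   using layout_braid.hyps(3) finite_braided[of L] by (simp add: sym_op_def op_scale perform_def)
  finally show ?thesis unfolding E .
 qed
qed

lemma concat_map_concat: "concat (map f (concat xss))=concat (map (%xs. concat (map f xs)) xss)"
 by (induction xss) auto

section \<open>The cabled diagram as a layout\<close>

locale spin_network = colored_diagram D "label_color D ga" "snd ga" for D :: diagram and ga :: coloring
begin

abbreviation "b \<equiv> fst ga"

definition new_edges :: "nat => nat => item list" where
 "new_edges s j=(let x=first_label D s+j in
   if x=Min (edge_at D x) then [Inr (edge_at D x, offset (Suc s) (fst (D!s)+j))] else [])"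
definition items :: "nat => item list" where
 "items s=Inl (slice_base s) # concat (map (new_edges s) [0..<births (snd (D!s))])"
definition "all_items s=concat (map items [0..<s])"

lemma edge_braid_new_edges:
 assumes "x=first_label D s+j" "q = offset (Suc s) (fst (D!s)+j)"
 shows "edge_braid D ga sm x q=concat (map (expand b sm) (new_edges s j))"
 unfolding edge_braid_def new_edges_def Let_def assms
 by (simp add: expand_def shift_def negs_def label_color_def o_def)

lemma cable_slice_items:
 assumes s: "s<length D"
 shows "cable_slice D ga sm s=concat (map (expand b sm) (items s))"
proof -
 obtain k p where kp: "D!s=(k, p)" by (cases "D!s")
 have q: "sum_list (map (label_color D ga) (take k (level D s))) = offset s k"
  by (simp add: offset_def colors_def take_map)
 have base: "expand b sm (Inl (slice_base s))=shift (offset s k) (core s)"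
  by (simp add: expand_def slice_base_def kp)
 show ?thesis
 proof (cases p)
  case (Vertex d)
  have "edge_braid D ga sm (first_label D s+j) (offset s k+(\<Sum>i<j. label_color D ga (first_label D s+i))) =
   concat (map (expand b sm) (new_edges s j))" if "j<d" for j
  proof (rule edge_braid_new_edges[OF refl])
   have o: "outs s=map (%i. first_label D s+i) [0..<d]"
    by (rule nth_equalityI) (simp_all add: outs_def kp Vertex)
   have "take j (outs s)=map (%i. first_label D s+i) [0..<j]" unfolding o using that by (simp add: take_map)
   hence "sum_list (map (label_color D ga) (take j (outs s)))=(\<Sum>i<j. label_color D ga (first_label D s+i))"
    by (simp add: o_def interv_sum_list_conv_sum_set_nat atLeast0LessThan)
   thus "offset s k+(\<Sum>i<j. label_color D ga (first_label D s+i)) = offset (Suc s) (fst (D!s)+j)"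
    using offset_out[OF s kp, of j] that o by (simp add: kp)
  qed
  hence "map (%j. edge_braid D ga sm (first_label D s+j) (offset s k+(\<Sum>i<j. label_color D ga (first_label D s+i)))) [0..<d] =
   map (%j. concat (map (expand b sm) (new_edges s j))) [0..<d]" by simp
  thus ?thesis
   unfolding cable_slice_def items_def list.map concat.simps base
   by (simp add: kp Vertex q Let_def projector_cups_def arc_cups_def shift_def core_def o_def concat_map_concat del: map_eq_conv)
 next
  case (Elem e)
  show ?thesis
  proof (cases e)
   case Cup
   have "offset (Suc s) (k+0) = offset s k" using offset_out[OF s kp, of 0] by simp
   thus ?thesis
    unfolding cable_slice_def items_def list.map concat.simps base
    using edge_braid_new_edges[of "first_label D s" s 0 "offset s k" sm]
    by (simp add: kp Elem Cup q Let_def core_def cups_def shift_def o_def)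
  next
   case Cap
   thus ?thesis
    unfolding cable_slice_def items_def list.map concat.simps base
    by (simp add: kp Elem q Let_def core_def caps_def shift_def o_def)
  next
   case Pos
   thus ?thesis
    unfolding cable_slice_def items_def list.map concat.simps base
    by (simp add: kp Elem q Let_def core_def cable_crossing_cross)
  next
   case Neg
   thus ?thesis
    unfolding cable_slice_def items_def list.map concat.simps base
    by (simp add: kp Elem q Let_def core_def cable_crossing_cross)
  qed
 qed
qed

lemma cable_items: "cable D ga sm=concat (map (expand b sm) (all_items (length D)))"
proof -
 have "s <= length D ==> concat (map (cable_slice D ga sm) [0..<s])=concat (map (expand b sm) (all_items s))" for s
  by (induction s) (simp_all add: all_items_def cable_slice_items)
 thus ?thesis by (simp add: cable_def)
qed

text \<open>The edges whose braid has been placed once the labels below \<open>n\<close> have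
  started.\<close>

definition "min_edges n=edge_at D ` {x. x<n & x=Min (edge_at D x)}"

lemma min_edges_Suc:
 "min_edges (Suc n)=(if n=Min (edge_at D n) then insert (edge_at D n) (min_edges n) else min_edges n)"
 by (auto simp: min_edges_def less_Suc_eq)

lemma min_edges_fresh: "n=Min (edge_at D n) ==> edge_at D n \<notin> min_edges n"
 by (auto simp: min_edges_def)

lemma outs_birth: "s<length D ==> D!s=(k, p) ==> j<births p ==> outs s!j=first_label D s+j"
 by (cases p rule: births.cases) (auto simp: outs_def)

lemma layout_new_edges:
 assumes s: "s<length D" "D!s=(k, p)"
  and lay: "layout b (all_items s) (width s)" "braided (all_items s)=min_edges (first_label D s)"
 shows "j <= births p ==>
  layout b (all_items s@Inl (slice_base s) # concat (map (new_edges s) [0..<j])) (width (Suc s)) \<and>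
  braided (all_items s@Inl (slice_base s) # concat (map (new_edges s) [0..<j]))=min_edges (first_label D s+j)"
proof (induction j)
 case 0
 thus ?case using layout_link[OF lay(1) valid_slice[OF s(1)]] lay(2) by simp
next
 case (Suc j)
 let ?x = "first_label D s+j"
 let ?L = "all_items s@Inl (slice_base s) # concat (map (new_edges s) [0..<j])"
 have IH: "layout b ?L (width (Suc s))" "braided ?L=min_edges ?x" using Suc by simp_all
 have j: "j<births p" "j<length (outs s)" using Suc.prems births_outs[OF s] by auto
 have "k+j<length (colors (Suc s))"
  unfolding colors_out[OF s] using length_take_colors[OF s] j by simp
 from sym_at_fits[OF this] have fit: "offset (Suc s) (k+j)+b (edge_at D ?x) <= width (Suc s)"
  using colors_out_nth[OF s j(2)] outs_birth[OF s j(1)] by (simp add: label_color_def)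
 show ?case
 proof (cases "?x=Min (edge_at D ?x)")
  case True
  hence "edge_at D ?x \<notin> braided ?L" using min_edges_fresh IH(2) by simp
  note lb = layout_braid[OF IH(1) fit this]
  have eq: "all_items s@Inl (slice_base s) # concat (map (new_edges s) [0..<Suc j]) =
   ?L@[Inr (edge_at D ?x, offset (Suc s) (k+j))]"
   using True by (simp add: new_edges_def Let_def s)
  have B: "braided (L@[Inr (e, q)])=insert e (braided L)" for L e q by simp
  show ?thesis unfolding eq B IH(2) add_Suc_right min_edges_Suc using True lb by auto
 next
  case False
  hence eq: "all_items s@Inl (slice_base s) # concat (map (new_edges s) [0..<Suc j]) = ?L"
   by (simp add: new_edges_def Let_def s)
  show ?thesis unfolding eq add_Suc_right min_edges_Suc using False IH by auto
 qed
qed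

lemma layout_all_items:
 "s <= length D ==> layout b (all_items s) (width s) & braided (all_items s)=min_edges (first_label D s)"
proof (induction s)
 case 0
 thus ?case by (simp add: all_items_def width_0 layout_Nil min_edges_def first_label_def)
next
 case (Suc s)
 obtain k p where kp: "D!s=(k, p)" by (cases "D!s")
 have s: "s<length D" using Suc.prems by simp
 from layout_new_edges[OF s kp _ _ order_refl] Suc s show ?case
  by (simp add: all_items_def items_def first_label_Suc kp)
qed

lemma edges_min_edges: "edges D=min_edges (first_label D (length D))"
proof
 show "edges D \<subseteq> min_edges (first_label D (length D))"
 proof
  fix e assume "e \<in> edges D"
  then obtain x where x: "x \<in> labels D" "e=edge_at D x" by (auto simp: edges_def)
  have "e=edge_at D (Min (edge_at D x))" using edge_at_eq[OF Min_edge(1)[OF x(1)]] x(2) by simp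
  moreover have "Min (edge_at D x) \<in> labels D" using Min_edge(1)[OF x(1)] edge_at_labels[OF x(1)] by blast
  ultimately show "e \<in> min_edges (first_label D (length D))"
   using Min_edge(2)[OF x(1)] by (auto simp: min_edges_def labels_def)
 qed
qed (auto simp: min_edges_def edges_def labels_def)

lemma mem_min_points:
 assumes s: "s<length D" "D!s=(k, p)"
 shows "j<births p ==> (Suc s, k+j) \<in> min_points \<longleftrightarrow> first_label D s+j=Min (edge_at D (first_label D s+j))"
  "\<not> (k <= i & i<k+births p) ==> (Suc s, i) \<notin> min_points"
proof -
 assume "\<not> (k <= i & i<k+births p)"
 hence "(Suc s, i) \<notin> starts" using start_points_level[OF s] by blast
 moreover have "pt \<in> starts" if "pt \<in> min_points" for pt using that unfolding min_points_def by force
 ultimately show "(Suc s, i) \<notin> min_points" by blast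
next
 assume j: "j<births p"
 have "(x, (Suc s, k+j)) \<in> start_points \<longleftrightarrow> x=first_label D s+j" for x
  using s j by (auto simp: start_points_def)
 thus "(Suc s, k+j) \<in> min_points \<longleftrightarrow> first_label D s+j=Min (edge_at D (first_label D s+j))"
  by (simp add: min_points_def)
qed

lemma level_syms_min:
 assumes s: "s<length D" "D!s=(k, p)"
 shows "level_syms A min_points (Suc s) v=fold (perform A b) (concat (map (new_edges s) [0..<births p])) v"
proof -
 note mem = mem_min_points[OF s]
 have 1: "n <= k ==> syms A min_points (Suc s) n v=v" for n
  by (induction n) (auto simp: mem(2))
 have 2: "j <= births p ==> syms A min_points (Suc s) (k+j) v=fold (perform A b) (concat (map (new_edges s) [0..<j])) v" for j
 proof (induction j)
  case 0
  thus ?case by (simp add: 1)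
 next
  case (Suc j)
  have j: "j<births p" "j<length (outs s)" using Suc.prems births_outs[OF s] by auto
  let ?x = "first_label D s+j"
  have col: "colors (Suc s)!(k+j)=b (edge_at D ?x)"
   using colors_out_nth[OF s j(2)] outs_birth[OF s j(1)] by (simp add: label_color_def)
  have IH: "syms A min_points (Suc s) (k+j) v=fold (perform A b) (concat (map (new_edges s) [0..<j])) v"
   using Suc by simp
  show ?case
  proof (cases "?x=Min (edge_at D ?x)")
   case True
   hence "new_edges s j=[Inr (edge_at D ?x, offset (Suc s) (k+j))]"
    by (simp add: new_edges_def Let_def s)
   thus ?thesis
    using True mem(1)[OF j(1)] IH col by (simp add: sym_at_def perform_def[of _ _ "Inr _"])
  next
   case False
   hence "new_edges s j=[]" by (simp add: new_edges_def Let_def)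
   thus ?thesis using False mem(1)[OF j(1)] IH by simp
  qed
 qed
 have 3: "syms A min_points (Suc s) (k+births p+r) v=fold (perform A b) (concat (map (new_edges s) [0..<births p])) v" for r
  by (induction r) (use 2[of "births p"] mem(2) in auto)
 have "length (colors (Suc s)) >= k+births p"
  unfolding colors_out[OF s] using length_take_colors[OF s] births_outs[OF s] by simp
 then obtain r where "length (colors (Suc s))=k+births p+r" using le_iff_add by blast
 thus ?thesis by (simp add: level_syms_def 3)
qed

lemma state_min_points: "s <= length D ==> state A min_points s=fold (perform A b) (all_items s) unit_vec"
proof (induction s)
 case (Suc s)
 obtain k p where kp: "D!s=(k, p)" by (cases "D!s")
 have s: "s<length D" using Suc.prems by simp
 show ?case
  using Suc level_syms_min[OF s kp] by (simp add: all_items_def items_def kp perform_def[of _ _ "Inl _"])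
qed (simp add: all_items_def)

text \<open>\<open>sum_braids\<close> turns the sum over permutations into symmetrizers at the least
  labels, and \<open>endstate_min_points\<close> then spreads them to all strand starts.\<close>

lemma penrose_endstate:
 assumes A: "generic A" and adm: "admissible D ga"
 shows "penrose_eval D ga A=(\<Prod>e\<in>edges D. qfact A (b e)) * endstate A starts []"
proof -
 have lay: "layout b (all_items (length D)) 0" and br: "braided (all_items (length D))=edges D"
  using layout_all_items[OF order_refl] graph edges_min_edges
  by (auto simp: width_def colors_def knotted_ribbon_graph_def)
 have "penrose_eval D ga A=(\<Sum>sm\<in>(\<Pi>\<^sub>E e\<in>edges D. {\<pi>. \<pi> permutes {..<b e}}). (\<Prod>e\<in>edges D. braid_coeff A (b e) (sm e)) *
   run A (concat (map (expand b sm) (all_items (length D)))) unit_vec [])"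
  unfolding penrose_eval_def edge_perms_def cable_items using adm bracket_run[OF A layout_valid[OF lay]]
  by (simp add: braid_coeff_def)
 also have "\<dots>=(\<Prod>e\<in>edges D. qfact A (b e)) * endstate A min_points []"
  using sum_braids[OF A lay] by (simp add: br endstate_def state_min_points)
 finally show ?thesis by (simp add: endstate_min_points[OF A])
qed

end

section \<open>The two ends of an edge\<close>

lemma length_filter_disj:
 "(!!x. \<not> (P x & Q x)) ==> length (filter (%x. P x \<or> Q x) xs)=length (filter P xs)+length (filter Q xs)"
 by (induction xs) auto

lemma length_filter_upt: "length (filter (%x. x=r) [a..<b])=(if a <= r & r<b then 1 else 0)"
 by (induction b) auto

context spin_network
begin

definition "half_edge_set s=(\<Union>v\<in>{v \<in> vertices D. v<s}. set (half_edges D v))"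

text \<open>Free ends of the part of the diagram below level \<open>s\<close>: half-edges at its
  vertices and strands open at the top.\<close>

definition "ends_in s Q=card {x \<in> half_edge_set s. Q x}+length (filter Q (level D s))"

lemma half_edges_range: "set (half_edges D v)={first_label D v..<first_label D (Suc v)}"
 by (simp add: half_edges_def first_label_Suc)

lemma half_edge_set_less: "half_edge_set s \<subseteq> {..<first_label D s}"
proof
 fix x assume "x \<in> half_edge_set s"
 then obtain v where "v<s" "x \<in> set (half_edges D v)" by (auto simp: half_edge_set_def)
 thus "x \<in> {..<first_label D s}" using first_label_mono[of "Suc v" s] by (auto simp: half_edges_range)
qed

lemma finite_half_edge_set [simp]: "finite (half_edge_set s)"
 by (rule finite_subset[OF half_edge_set_less]) simp

lemma half_edge_set_Suc:
 "half_edge_set (Suc s)=half_edge_set s \<union> (if s \<in> vertices D then {first_label D s..<first_label D (Suc s)} else {})"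
 by (auto simp: half_edge_set_def half_edges_range less_Suc_eq)

text \<open>A new label brings two ends, either the two legs of a cup or a half-edge with the strand
  leaving it. Crossings only permute the open strands.\<close>

lemma birth_count:
 assumes s: "s<length D" "D!s=(k, p)" and p: "p ~= Elem Cap"
  and rh: "!!x. x >= first_label D s ==> rh x=x" "!!x. x<first_label D s ==> rh x<first_label D s"
 shows "ends_in (Suc s) (%x. rh x=r) =
  (if first_label D s <= r & r<first_label D (Suc s) then 2 else ends_in s (%x. rh x=r))"
proof -
 let ?m = "first_label D s"
 have m': "first_label D (Suc s) = ?m+births p" by (simp add: first_label_Suc s)
 have lv: "x \<in> set (level D s) ==> rh x < ?m" for x using level_labels[of s] s rh(2) by auto
 have zero: "filter (%x. rh x=r) (level D s)=[]" "{x \<in> half_edge_set s. rh x=r}={}" if "r >= ?m"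
 proof -
  have "rh x ~= r" if "x \<in> set (level D s)" for x using lv[OF that] \<open>r >= ?m\<close> by simp
  thus "filter (%x. rh x=r) (level D s)=[]" by (auto simp: filter_empty_conv)
  have "rh x ~= r" if "x \<in> half_edge_set s" for x
  proof -
   have "rh x < ?m" using rh(2) half_edge_set_less[of s] that by blast
   thus ?thesis using \<open>r >= ?m\<close> by simp
  qed
  thus "{x \<in> half_edge_set s. rh x=r}={}" by auto
 qed
 have io: "length (filter Q (level D (Suc s)))+length (filter Q (ins s))=length (filter Q (level D s))+length (filter Q (outs s))" for Q
  using arg_cong[OF level_out[OF s], of "%l. length (filter Q l)"] arg_cong[OF level_in[OF s], of "%l. length (filter Q l)"]
  by (simp del: level.simps)
 show ?thesis
 proof (cases p rule: births.cases)
  case 1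
  have o: "outs s=[?m, ?m]" "ins s=[]" using s 1 by (simp_all add: outs_def ins_def)
  have "s \<notin> vertices D" using s 1 by (auto simp: vertices_def)
  hence H: "half_edge_set (Suc s)=half_edge_set s" by (simp add: half_edge_set_Suc)
  show ?thesis
   using io[of "%x. rh x=r"] zero rh(1)[of ?m] by (auto simp: ends_in_def o H m' 1 simp del: level.simps)
 next
  case (2 d)
  have o: "outs s=[?m..<?m+d]" "ins s=[]" using s 2 by (simp_all add: outs_def ins_def)
  have "s \<in> vertices D" using s 2 by (auto simp: vertices_def)
  hence H: "half_edge_set (Suc s)=half_edge_set s \<union> {?m..<?m+d}" by (simp add: half_edge_set_Suc m' 2)
  have f: "length (filter (%x. rh x=r) (outs s))=(if ?m <= r & r < ?m+d then 1 else 0)"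
  proof -
   have "filter (%x. rh x=r) (outs s)=filter (%x. x=r) (outs s)"
    by (rule filter_cong) (auto simp: o rh(1))
   thus ?thesis by (simp add: o length_filter_upt)
  qed
  have c: "{x \<in> half_edge_set (Suc s). rh x=r}={x \<in> half_edge_set s. rh x=r} \<union> (if ?m <= r & r < ?m+d then {r} else {})"
   using rh(1) by (auto simp: H)
  show ?thesis
  proof (cases "?m <= r & r < ?m+d")
   case True
   have c1: "{x \<in> half_edge_set (Suc s). rh x=r}=insert r {x \<in> half_edge_set s. rh x=r}" unfolding c if_P[OF True] by simp
   have f1: "length (filter (%x. rh x=r) (outs s))=1" unfolding f if_P[OF True] by simp
   show ?thesis
    unfolding m' 2 births.simps if_P[OF True] ends_in_def c1
    using io[of "%x. rh x=r"] f1 zero[OF conjunct1[OF True]] by (simp add: o(2) del: level.simps)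
  next
   case False
   have c0: "{x \<in> half_edge_set (Suc s). rh x=r}={x \<in> half_edge_set s. rh x=r}" unfolding c if_not_P[OF False] by simp
   have f0: "length (filter (%x. rh x=r) (outs s))=0" unfolding f if_not_P[OF False] by simp
   show ?thesis
    unfolding m' 2 births.simps if_not_P[OF False] ends_in_def c0
    using io[of "%x. rh x=r"] f0 by (simp add: o(2) del: level.simps)
  qed
 next
  case ("3_1")
  thus ?thesis using p by simp
 next
  case ("3_2")
  have H: "half_edge_set (Suc s)=half_edge_set s" using s "3_2" by (auto simp: half_edge_set_Suc vertices_def)
  have pp: "D!s=(k, Elem Pos)" using s "3_2" by simp
  show ?thesis using io[of "%x. rh x=r"] ins_two[OF s(1) pp]
   by (cases "rh (level D s!k)=r"; cases "rh (level D s!(k+1))=r")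
    (simp_all add: ends_in_def H m' "3_2" outs_def pp del: level.simps)
 next
  case ("3_3")
  have H: "half_edge_set (Suc s)=half_edge_set s" using s "3_3" by (auto simp: half_edge_set_Suc vertices_def)
  have pp: "D!s=(k, Elem Neg)" using s "3_3" by simp
  show ?thesis using io[of "%x. rh x=r"] ins_two[OF s(1) pp]
   by (cases "rh (level D s!k)=r"; cases "rh (level D s!(k+1))=r")
    (simp_all add: ends_in_def H m' "3_3" outs_def pp del: level.simps)
 qed
qed

text \<open>\<open>rh\<close> gives each label an index of its component below level
  \<open>s\<close>. The last clause says that a component is an arc with two free ends or is
  closed.\<close>

definition "representatives s rh \<longleftrightarrow>
 (\<forall>x\<ge>first_label D s. rh x=x) & (\<forall>x<first_label D s. rh x<first_label D s) \<and>
 (\<forall>x<first_label D s. \<forall>y<first_label D s. rh x=rh y --> edge_at D x=edge_at D y) \<and>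
 (\<forall>t<s. \<forall>k. D!t=(k, Elem Cap) --> rh (level D t!k)=rh (level D t!(k+1))) \<and>
 (\<forall>r. ends_in s (%x. rh x=r) \<in> {0, 2})"

lemma representativesD:
 assumes "representatives s rh"
 shows "!!x. x >= first_label D s ==> rh x=x" "!!x. x<first_label D s ==> rh x<first_label D s"
  "!!x y. x<first_label D s ==> y<first_label D s ==> rh x=rh y ==> edge_at D x=edge_at D y"
  "!!t k. t<s ==> D!t=(k, Elem Cap) ==> rh (level D t!k)=rh (level D t!(k+1))"
  "!!r. ends_in s (%x. rh x=r) \<in> {0, 2}"
proof -
 note R = assms[unfolded representatives_def]
 note 2 = R[THEN conjunct2]
 note 3 = 2[THEN conjunct2]
 note 4 = 3[THEN conjunct2]
 show "rh x=x" if "x >= first_label D s" for x by (rule R[THEN conjunct1, rule_format, OF that])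
 show "rh x<first_label D s" if "x<first_label D s" for x by (rule 2[THEN conjunct1, rule_format, OF that])
 show "edge_at D x=edge_at D y" if "x<first_label D s" "y<first_label D s" "rh x=rh y" for x y
  by (rule 3[THEN conjunct1, rule_format, OF that])
 show "rh (level D t!k)=rh (level D t!(k+1))" if "t<s" "D!t=(k, Elem Cap)" for t k
  by (rule 4[THEN conjunct1, rule_format, OF that])
 show "ends_in s (%x. rh x=r) \<in> {0, 2}" for r by (rule 4[THEN conjunct2, THEN spec])
qed

text \<open>Only caps change components: a cap either closes one, whose two ends disappear, or joins
  two, each of which keeps its other end.\<close>

lemma edge_representatives: "s <= length D ==> \<exists>rh. representatives s rh"
proof (induction s)
 case 0
 have "ends_in 0 Q=0" for Q by (simp add: ends_in_def half_edge_set_def)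
 thus ?case unfolding representatives_def by (intro exI[of _ id]) (simp add: first_label_def)
next
 case (Suc s)
 let ?m = "first_label D s" and ?m' = "first_label D (Suc s)"
 have s: "s<length D" using Suc.prems by simp
 obtain k p where kp: "D!s=(k, p)" by (cases "D!s")
 obtain rh where "representatives s rh" using Suc.IH s by auto
 note r1 = representativesD(1)[OF this] and r2 = representativesD(2)[OF this] and r3 = representativesD(3)[OF this]
  and r4 = representativesD(4)[OF this] and r5 = representativesD(5)[OF this]
 have m': "?m' = ?m+births p" by (simp add: first_label_Suc kp)
 show ?case
 proof (cases "p=Elem Cap")
  case False
  show ?thesis
   unfolding representatives_def
  proof (intro exI[of _ rh] conjI allI impI)
   show "rh x=x" if "x >= ?m'" for x using that r1 m' by simp
   show "rh x < ?m'" if "x < ?m'" for x using that r1[of x] r2[of x] m' by (cases "x < ?m") auto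
   show "edge_at D x=edge_at D y" if "x < ?m'" "y < ?m'" "rh x=rh y" for x y
   proof (cases "x < ?m & y < ?m")
    case True
    thus ?thesis using r3 that(3) by blast
   next
    case False
    have "x=y"
    proof (cases "x < ?m")
     case True
     hence "rh x < ?m" "rh y=y" using False r2 r1[of y] by auto
     thus ?thesis using that(3) False True by simp
    next
     case xm: False
     hence "rh x=x" using r1[of x] by simp
     hence "\<not> rh y < ?m" using that(3) xm by simp
     hence "rh y=y" using r1[of y] r2[of y] by (cases "y < ?m") (blast, simp)
     thus ?thesis using \<open>rh x = x\<close> that(3) by simp
    qed
    thus ?thesis by simp
   qed
   show "rh (level D t!k)=rh (level D t!(k+1))" if "t<Suc s" "D!t=(k, Elem Cap)" for t k
    using that r4[of t k] False kp by (cases "t=s") auto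
   show "ends_in (Suc s) (%x. rh x=r) \<in> {0, 2}" for r
   proof -
    have "ends_in (Suc s) (%x. rh x=r)=(if ?m <= r & r < ?m' then 2 else ends_in s (%x. rh x=r))"
     by (rule birth_count[OF s kp False r1 r2])
    thus ?thesis using r5[of r] by simp
   qed
  qed
 next
  case True
  define a b where "a=level D s!k" "b=level D s!(k+1)"
  have cap: "D!s=(k, Elem Cap)" using kp True by simp
  have mm: "?m' = ?m" using m' True by simp
  have ins: "ins s=[a, b]" and outs: "outs s=[]"
   using ins_two[OF s cap] by (simp_all add: a_b_def outs_def cap)
  have ab: "a < ?m" "b < ?m"
  proof -
   have "a \<in> set (level D s)" "b \<in> set (level D s)" using fits[OF s cap] by (simp_all add: a_b_def)
   thus "a < ?m" "b < ?m" using level_labels[of s] s by auto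
  qed
  have eab: "edge_at D a=edge_at D b"
  proof -
   have "(a, b) \<in> cap_rel D" using cap s by (auto simp: cap_rel_def a_b_def)
   hence "b \<in> edge_at D a" by (auto simp: edge_at_def)
   thus ?thesis using edge_at_eq by metis
  qed
  define n where "n Q=card {x \<in> half_edge_set s. Q x}+length (filter Q (level D (Suc s)))" for Q
  have "half_edge_set (Suc s)=half_edge_set s" using cap by (auto simp: half_edge_set_Suc vertices_def)
  hence e': "ends_in (Suc s) Q=n Q" for Q by (simp add: ends_in_def n_def del: level.simps)
  have e: "ends_in s Q=n Q+(if Q a then 1 else 0)+(if Q b then 1 else 0)" for Q
   using arg_cong[OF level_out[OF s kp], of "%l. length (filter Q l)"] arg_cong[OF level_in[OF s kp], of "%l. length (filter Q l)"]
   by (simp add: ends_in_def n_def ins outs del: level.simps)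
  define rh' where "rh' x=(if rh x=rh a then rh b else rh x)" for x
  show ?thesis
   unfolding representatives_def mm
  proof (intro exI[of _ rh'] conjI allI impI)
   show "rh' x=x" if "x >= ?m" for x using that r1[of x] r2[OF ab(1)] by (simp add: rh'_def)
   show "rh' x < ?m" if "x < ?m" for x using r2[OF that] r2[OF ab(2)] by (simp add: rh'_def)
   show "edge_at D x=edge_at D y" if "x < ?m" "y < ?m" "rh' x=rh' y" for x y
    using that r3[of x y] r3[of x a] r3[of y a] r3[of x b] r3[of y b] ab eab
    by (auto simp: rh'_def split: if_splits)
   show "rh' (level D t!k')=rh' (level D t!(k'+1))" if "t<Suc s" "D!t=(k', Elem Cap)" for t k'
   proof (cases "t=s")
    case True
    thus ?thesis using that(2) cap by (auto simp: rh'_def a_b_def)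
   next
    case False
    hence "t<s" using that(1) by simp
    from r4[OF this that(2)] show ?thesis by (simp add: rh'_def)
   qed
   show "ends_in (Suc s) (%x. rh' x=r) \<in> {0, 2}" for r
   proof (cases "rh a=rh b")
    case True
    hence "rh' = rh" by (auto simp: rh'_def)
    thus ?thesis using r5[of r] True unfolding e' e by (auto split: if_splits)
   next
    case False
    \<comment> \<open>Of the two ends of this component exactly one is at the cap.\<close>
    have na: "n (%x. rh x=rh a)=1" using r5[of "rh a"] False unfolding e by auto
    have nb: "n (%x. rh x=rh b)=1" using r5[of "rh b"] False unfolding e by auto
    consider "r=rh a" | "r=rh b" | "r ~= rh a" "r ~= rh b" by blast
    thus ?thesis
    proof cases
     case 1
     hence "(%x. rh' x=r)=(%x. False)" using False by (auto simp: rh'_def)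
     thus ?thesis by (simp add: e' n_def del: level.simps)
    next
     case 2
     have q: "(%x. rh' x=r)=(%x. rh x=rh a \<or> rh x=rh b)" using 2 by (auto simp: rh'_def)
     have "{x \<in> half_edge_set s. rh x=rh a \<or> rh x=rh b} =
      {x \<in> half_edge_set s. rh x=rh a} \<union> {x \<in> half_edge_set s. rh x=rh b}" by auto
     hence "card {x \<in> half_edge_set s. rh x=rh a \<or> rh x=rh b} =
      card {x \<in> half_edge_set s. rh x=rh a} + card {x \<in> half_edge_set s. rh x=rh b}"
      using False by (simp add: card_Un_disjoint disjoint_iff)
     hence "n (%x. rh x=rh a \<or> rh x=rh b)=n (%x. rh x=rh a)+n (%x. rh x=rh b)"
      using length_filter_disj[of "%x. rh x=rh a" "%x. rh x=rh b" "level D (Suc s)"] False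
      by (simp add: n_def del: level.simps)
     thus ?thesis unfolding e' q by (simp add: na nb)
    next
     case 3
     hence "(%x. rh' x=r)=(%x. rh x=r)" by (auto simp: rh'_def)
     thus ?thesis using r5[of r] 3 unfolding e' e by (auto split: if_splits)
    qed
   qed
  qed
 qed
qed

abbreviation "all_half_edges \<equiv> half_edge_set (length D)"

lemma all_half_edges_labels: "all_half_edges \<subseteq> labels D"
 using half_edge_set_less[of "length D"] by (simp add: labels_def)

text \<open>No strand is open at the top, so the free ends of a component are half-edges, and a
  component without free ends is a knot.\<close>

lemma card_half_edges:
 assumes "e \<in> edges D"
 shows "card (all_half_edges \<inter> e)=(if e \<in> knots D then 0 else 2)"
proof -
 obtain x where x: "x \<in> labels D" "e=edge_at D x" using assms by (auto simp: edges_def)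
 obtain rh where "representatives (length D) rh" using edge_representatives by auto
 note r3 = representativesD(3)[OF this] and r4 = representativesD(4)[OF this] and r5 = representativesD(5)[OF this]
 have step: "rh y=rh z" if "(y, z) \<in> cap_rel D \<union> (cap_rel D)\<inverse>" for y z
  using that r4 by (auto simp: cap_rel_def)
 have "rh y=rh x" if "y \<in> edge_at D x" for y
  using that unfolding edge_at_def mem_Collect_eq by (induction rule: rtrancl_induct) (use step in auto)
 hence "all_half_edges \<inter> e={y \<in> all_half_edges. rh y=rh x}"
  using r3[of _ x] x(1) all_half_edges_labels edge_at_refl unfolding x(2) labels_def lessThan_iff by blast
 moreover have "ends_in (length D) (%y. rh y=rh x)=card {y \<in> all_half_edges. rh y=rh x}"
  using graph by (simp add: ends_in_def knotted_ribbon_graph_def)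
 ultimately have c: "card (all_half_edges \<inter> e) \<in> {0, 2}" using r5[of "rh x"] by simp
 have "e \<in> knots D \<longleftrightarrow> all_half_edges \<inter> e={}"
  using assms by (auto simp: knots_def half_edge_set_def vertices_def)
 thus ?thesis using c finite_half_edge_set[of "length D"] by auto
qed

lemma finite_edges: "finite (edges D)"
 by (simp add: edges_def labels_def)

lemma finite_vertices: "finite (vertices D)"
 by (simp add: vertices_def)

text \<open>The half-edges of all vertices are regrouped by edges, two to each edge by
  \<open>card_half_edges\<close>.\<close>

lemma legfacts_edges: "legfacts (length D) A=(\<Prod>e\<in>edges D-knots D. qfact A (b e))^2"
proof -
 have H: "all_half_edges=(\<Union>v\<in>vertices D. set (half_edges D v))" by (auto simp: half_edge_set_def vertices_def)
 have "legfacts (length D) A=(\<Prod>v\<in>vertices D. legfact v A)"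
  unfolding legfacts_def by (rule prod.mono_neutral_right) (auto simp: vertices_def legfact_def)
 also have "\<dots>=(\<Prod>v\<in>vertices D. \<Prod>x\<in>set (half_edges D v). qfact A (label_color D ga x))"
 proof (rule prod.cong[OF refl])
  fix v assume v: "v \<in> vertices D"
  have "distinct (half_edges D v)" by (simp add: half_edges_def)
  thus "legfact v A=(\<Prod>x\<in>set (half_edges D v). qfact A (label_color D ga x))"
   using v by (simp add: legfact_def legs[OF v] o_def prod.distinct_set_conv_list)
 qed
 also have "\<dots>=(\<Prod>x\<in>all_half_edges. qfact A (label_color D ga x))"
  unfolding H
 proof (rule prod.UNION_disjoint[symmetric])
  show "\<forall>v\<in>vertices D. \<forall>w\<in>vertices D. v ~= w --> set (half_edges D v) \<inter> set (half_edges D w)={}"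
  proof (intro ballI impI)
   fix v w :: nat assume "v ~= w"
   hence "Suc v <= w \<or> Suc w <= v" by auto
   thus "set (half_edges D v) \<inter> set (half_edges D w)={}"
    using first_label_mono[of "Suc v" w] first_label_mono[of "Suc w" v] by (auto simp: half_edges_range)
  qed
 qed (auto simp: finite_vertices)
 also have "all_half_edges=(\<Union>e\<in>edges D. all_half_edges \<inter> e)"
  using all_half_edges_labels edge_at_refl by (auto simp: edges_def)
 also have "(\<Prod>x\<in>\<dots>. qfact A (label_color D ga x))=(\<Prod>e\<in>edges D. \<Prod>x\<in>all_half_edges \<inter> e. qfact A (label_color D ga x))"
 proof (rule prod.UNION_disjoint)
  show "\<forall>e\<in>edges D. \<forall>e'\<in>edges D. e ~= e' --> (all_half_edges \<inter> e) \<inter> (all_half_edges \<inter> e')={}"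
   using edge_at_eq by (auto simp: edges_def) blast+
 qed (auto simp: finite_edges)
 also have "\<dots>=(\<Prod>e\<in>edges D. if e \<in> knots D then 1 else qfact A (b e)^2)"
 proof (rule prod.cong[OF refl])
  fix e assume e: "e \<in> edges D"
  have "label_color D ga x=b e" if "x \<in> e" for x
   using e that edge_at_eq by (auto simp: edges_def label_color_def)
  hence "(\<Prod>x\<in>all_half_edges \<inter> e. qfact A (label_color D ga x))=qfact A (b e) ^ card (all_half_edges \<inter> e)"
   by simp
  thus "(\<Prod>x\<in>all_half_edges \<inter> e. qfact A (label_color D ga x))=(if e \<in> knots D then 1 else qfact A (b e)^2)"
   using card_half_edges[OF e] by simp
 qed
 also have "\<dots>=(\<Prod>e\<in>edges D-knots D. qfact A (b e)^2)"
  by (rule prod.mono_neutral_cong_right) (auto simp: finite_edges)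
 finally show ?thesis by (simp add: prod_power_distrib)
qed

text \<open>The factors [b]! of the knots cancel against those in
  \<open>network_fact\<close>.\<close>

lemma standard_eval_endstate:
 assumes A: "generic A" and adm: "admissible D ga"
 shows "standard_eval D ga A=(\<Prod>e\<in>edges D-knots D. qfact A (b e))*(endstate A starts []/vfacts (length D) A)"
proof -
 have v: "vfacts (length D) A=(\<Prod>v\<in>vertices D. projector_fact A (snd ga v))"
  unfolding vfacts_def by (rule prod.mono_neutral_cong_right) (auto simp: vertices_def vfact_def)
 have sub: "knots D \<subseteq> edges D" by (auto simp: knots_def)
 have "(\<Prod>e\<in>edges D. qfact A (b e))=(\<Prod>e\<in>edges D-knots D. qfact A (b e))*(\<Prod>e\<in>knots D. qfact A (b e))"
  by (rule prod.subset_diff[OF sub finite_edges])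
 moreover have "(\<Prod>e\<in>knots D. qfact A (b e)) ~= 0"
  using qfact_nz[OF A] finite_subset[OF sub finite_edges] by simp
 ultimately show ?thesis
  unfolding standard_eval_def penrose_endstate[OF A adm] network_fact_def v by simp
qed

text \<open>The remaining product of factorials has square \<open>legfacts (length D)\<close>, so it
  cancels the final normalization without enlarging degree or bound, and
  \<open>sqrt_sum_laurent\<close> applies.\<close>

lemma laurent_standard_eval:
 assumes adm: "admissible D ga" and m: "!!x. x \<in> labels D ==> label_color D ga x <= m"
 shows "laurent ((\<Sum>t<length D. slice_degree t) * m\<^sup>2) ((\<Prod>t<length D. slice_bound t)^m) (standard_eval D ga)"
proof -
 let ?W = "%A. \<Prod>e\<in>edges D-knots D. qfact A (b e)"
 have nz: "?W A ~= 0" if "generic A" for A using qfact_nz[OF that] finite_edges by simp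
 have rat: "rational_fun ?W"
  by (intro rational_fun_laurent laurent_fun_prod laurent_fun_qfact) (simp add: finite_edges)
 have "laurent (2*0) (1^2) (%A. ?W A^2*(1/legfacts (length D) A)) \<longleftrightarrow> laurent (2*0) (1^2) (%A. 1)"
  by (rule laurent_cong) (use nz in \<open>simp add: legfacts_edges\<close>)
 hence lau: "laurent (2*0) (1^2) (%A. ?W A^2*(1/legfacts (length D) A))" using laurent_1 by simp
 have one: "1=legfacts (length D) A*(1/legfacts (length D) A)" if "generic A" for A
  using nz[OF that] by (simp add: legfacts_edges)
 have "sqrt_sum (%A. 1) ((\<Sum>t<length D. slice_degree t) * m\<^sup>2+0) ((\<Prod>t<length D. slice_bound t)^m*1)
  (%A. ?W A*(endstate A starts []/vfacts (length D) A))"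
  by (rule sqrt_sum_mult[OF sqrt_sum_endstate[OF m] rat _ lau one]) auto
 from sqrt_sum_laurent[OF this] have
  "laurent ((\<Sum>t<length D. slice_degree t) * m\<^sup>2) ((\<Prod>t<length D. slice_bound t)^m)
   (%A. ?W A*(endstate A starts []/vfacts (length D) A))" by simp
 also have "?this \<longleftrightarrow> ?thesis"
  by (rule laurent_cong) (simp add: standard_eval_endstate[OF _ adm])
 finally show ?thesis .
qed

end

section \<open>Exponents modulo 4\<close>

text \<open>Cups and caps join opposite letters, so all states have equally many of both. Without
  this the sign in \<open>sign_pair\<close> would depend on the word.\<close>

definition balanced :: "vec => bool" where
 "balanced v \<longleftrightarrow> (\<forall>ep. 2 * cnt ep ~= length ep --> v ep=0)"

text \<open>The effect of replacing \<open>A\<close> by \<i> A: a sign for each inversion, because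
  A^2 changes its sign, and a constant that does not depend on the word.\<close>

definition gauged :: "complex => vec => vec => bool" where
 "gauged th v v' \<longleftrightarrow> balanced v & (\<forall>ep. v' ep=th*(-1)^invs ep * v ep)"

lemma balancedD: "balanced v ==> 2 * cnt ep ~= length ep ==> v ep=0"
 by (simp add: balanced_def)

text \<open>The new pair forms \<open>cnt et + (k - cnt al)\<close> inversions with the other
  letters, which is \<open>k + n\<close> up to the even number \<open>2 * cnt al\<close>; in the
  order \<open>False\<close>, \<open>True\<close> it has one inversion of its own.\<close>

lemma sign_pair:
 assumes "length al=k" "cnt al + cnt et=n"
 shows "(-1)^invs (al@True#False#et)=(-1)^(k+n)*(-1 :: complex)^invs (al@et)"
  "(-1)^invs (al@False#True#et) = - ((-1)^(k+n)*(-1 :: complex)^invs (al@et))"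
proof -
 have "k+n=cnt et+(k - cnt al)+2 * cnt al" using cnt_le[of al] assms by simp
 hence "(-1 :: complex)^(k+n)=(-1)^(cnt et+(k - cnt al)+2 * cnt al)" by simp
 also have "\<dots>=(-1)^(cnt et+(k - cnt al))" by (simp add: power_add power_mult)
 finally have e: "(-1 :: complex)^(k+n)=(-1)^(cnt et+(k - cnt al))" .
 show "(-1)^invs (al@True#False#et)=(-1)^(k+n)*(-1 :: complex)^invs (al@et)"
  "(-1)^invs (al@False#True#et) = - ((-1)^(k+n)*(-1 :: complex)^invs (al@et))"
  unfolding e using assms(1) by (simp_all add: invs_append power_add distrib_left mult_ac)
qed

lemma inverse_i: "inverse (\<i>*A) = - \<i> * inverse A"
 by (simp add: inverse_mult_distrib)

lemma cupw_i: "cupw (\<i>*A) a b=(if a then-1 else 1) * cupw A a b"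
 by (simp add: cupw_def power_mult_distrib)

lemma pair_gauge:
 assumes g: "gauged th v v'" and v: "supp N v" and al: "length al=k"
 shows "v' (al@True#False#et)+inverse A^2 * v' (al@False#True#et) =
   th*(-1)^(k+(N-2) div 2)*(-1)^invs (al@et) *
   (v (al@True#False#et)-inverse A^2 * v (al@False#True#et))"
  "v (al@True#False#et)-inverse A^2 * v (al@False#True#et) ~= 0 ==>
   2*(cnt al + cnt et)=k+length et & k+length et+2=N"
proof -
 have b: "balanced v" and v': "v' ep=th*(-1)^invs ep * v ep" for ep using g by (auto simp: gauged_def)
 show 2: "2*(cnt al + cnt et)=k+length et & k+length et+2=N"
  if "v (al@True#False#et)-inverse A^2 * v (al@False#True#et) ~= 0"
 proof -
  have "v (al@True#False#et) ~= 0 \<or> v (al@False#True#et) ~= 0" using that by auto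
  thus ?thesis
   using balancedD[OF b, of "al@True#False#et"] balancedD[OF b, of "al@False#True#et"]
    suppD[OF v, of "al@True#False#et"] suppD[OF v, of "al@False#True#et"] al by auto
 qed
 show "v' (al@True#False#et)+inverse A^2 * v' (al@False#True#et) =
   th*(-1)^(k+(N-2) div 2)*(-1)^invs (al@et) *
   (v (al@True#False#et)-inverse A^2 * v (al@False#True#et))"
 proof (cases "2*(cnt al + cnt et)=k+length et & k+length et+2=N")
  case True
  hence "cnt al + cnt et=(N-2) div 2" by auto
  from sign_pair[OF al this] show ?thesis by (simp add: v' algebra_simps)
 next
  case False
  have "v (al@True#False#et)=0" "v (al@False#True#et)=0"
   using False balancedD[OF b, of "al@True#False#et"] balancedD[OF b, of "al@False#True#et"]
    suppD[OF v, of "al@True#False#et"] suppD[OF v, of "al@False#True#et"] al by auto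
  thus ?thesis by (simp add: v')
 qed
qed

lemma gauged_crossing:
 fixes v v' :: vec and A :: complex and et :: "bool list"
 assumes g: "gauged th v v'" and v: "supp N v" and al: "length al=k"
 defines "X \<equiv> v (al@True#False#et)-inverse A^2 * v (al@False#True#et)"
  and "X' \<equiv> v' (al@True#False#et)-inverse (\<i>*A)^2 * v' (al@False#True#et)"
 shows "cupw (\<i>*A) a b*X' = - th*(-1)^invs (al@a#b#et)*(cupw A a b*X)"
  "cupw A a b*X ~= 0 ==> 2 * cnt (al@a#b#et)=length (al@a#b#et)"
proof -
 note pg = pair_gauge[OF g v al, of et A]
 have X': "X' = th*(-1)^(k+(N-2) div 2)*(-1)^invs (al@et)*X"
  using pg(1) unfolding X_def X'_def inverse_i by (simp add: power_mult_distrib)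
 show "2 * cnt (al@a#b#et)=length (al@a#b#et)" if "cupw A a b*X ~= 0"
  using that pg(2) al by (auto simp: X_def cupw_def split: if_splits)
 show "cupw (\<i>*A) a b*X' = - th*(-1)^invs (al@a#b#et)*(cupw A a b*X)"
 proof (cases "X=0 \<or> a=b")
  case True
  thus ?thesis by (auto simp: X' cupw_def)
 next
  case False
  hence "cnt al + cnt et=(N-2) div 2" using pg(2) by (auto simp: X_def)
  note sg = sign_pair[OF al this]
  have ab: "(a=True & b=False) \<or> (a=False & b=True)" using False by auto
  thus ?thesis unfolding X' cupw_i by (elim disjE conjE) (simp_all only: sg, simp_all add: mult_ac)
 qed
qed

text \<open>Cups and caps contribute a sign, the crossings \<i> and - \<i>. For crossings both
  smoothings must pick up the same factor; the minus sign in \<open>gauged_crossing\<close> achieves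
  this. The new constant is independent of \<open>A\<close> and of the vectors.\<close>

lemma gauged_elem:
 assumes fit: "k+n_in p <= N"
 shows "\<exists>th'. \<forall>A v v'. generic A --> supp N v --> gauged th v v' --> gauged th' (elem_op A k p v) (elem_op (\<i>*A) k p v')"
proof (cases p)
 case Cup
 have "gauged (- th*(-1)^(k+N div 2)) (elem_op A k Cup v) (elem_op (\<i>*A) k Cup v')"
  if A: "generic A" and v: "supp N v" and g: "gauged th v v'" for A v v'
 proof -
  have b: "balanced v" and v': "v' ep=th*(-1)^invs ep * v ep" for ep using g by (auto simp: gauged_def)
  have "(elem_op A k Cup v ep ~= 0 --> 2 * cnt ep=length ep) \<and>
   elem_op (\<i>*A) k Cup v' ep=(- th*(-1)^(k+N div 2))*(-1)^invs ep * elem_op A k Cup v ep" for ep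
  proof (cases "k+2 <= length ep")
   case True
   then obtain al a b et where e: "ep=al@a#b#et" "length al=k"
    using split_at[of k ep] by (metis append_Cons append_Nil length_take min.absorb2 add_leD1)
   show ?thesis
   proof (cases "v (al@et)=0 \<or> a=b")
    case True
    thus ?thesis using e v' by (auto simp: elem_op_Cup cupw_def)
   next
    case False
    have l: "2 * cnt (al@et)=length (al@et)" "length (al@et)=N"
     using False balancedD[OF b] suppD[OF v] by blast+
    hence "cnt al + cnt et=N div 2" by simp
    note sg = sign_pair[OF e(2) this]
    have ab: "(a=True & b=False) \<or> (a=False & b=True)" using False by auto
    have sq: "((-1)^(k+N div 2))*((-1)^(k+N div 2))=(1::complex)" by (simp flip: power_mult_distrib)
    show ?thesis
     unfolding e(1) elem_op_Cup[OF e(2)] cupw_i v'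
     using ab l e(2) sq by (elim disjE conjE) (simp_all only: sg, auto simp: mult_ac power_add)
   qed
  next
   case False
   thus ?thesis using op_short[of ep k 2] by (simp add: elem_op_def)
  qed
  thus ?thesis unfolding gauged_def balanced_def by blast
 qed
 thus ?thesis using Cup by blast
next
 case Cap
 have "gauged (th*(-1)^(k+(N-2) div 2)) (elem_op A k Cap v) (elem_op (\<i>*A) k Cap v')"
  if A: "generic A" and v: "supp N v" and g: "gauged th v v'" for A v v'
 proof -
  have "(elem_op A k Cap v ep ~= 0 --> 2 * cnt ep=length ep) \<and>
   elem_op (\<i>*A) k Cap v' ep=(th*(-1)^(k+(N-2) div 2))*(-1)^invs ep * elem_op A k Cap v ep" for ep
  proof (cases "k <= length ep")
   case True
   then obtain al et where e: "ep=al@et" "length al=k" by (rule split_len)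
   show ?thesis
    unfolding e(1) elem_op_Cap[OF e(2)] inverse_i
    using pair_gauge[OF g v e(2), of et A] e(2) by (auto simp: power_mult_distrib)
  next
   case False
   thus ?thesis using op_short[of ep k 0] by (simp add: elem_op_def)
  qed
  thus ?thesis unfolding gauged_def balanced_def by blast
 qed
 thus ?thesis using Cap by blast
next
 case Pos
 have "gauged (\<i> * th) (elem_op A k Pos v) (elem_op (\<i>*A) k Pos v')"
  if A: "generic A" and v: "supp N v" and g: "gauged th v v'" for A v v'
 proof -
  have b: "balanced v" and v': "v' ep=th*(-1)^invs ep * v ep" for ep using g by (auto simp: gauged_def)
  have "(elem_op A k Pos v ep ~= 0 --> 2 * cnt ep=length ep) \<and>
   elem_op (\<i>*A) k Pos v' ep=(\<i> * th)*(-1)^invs ep * elem_op A k Pos v ep" for ep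
  proof (cases "k+2 <= length ep")
   case True
   then obtain al a b et where e: "ep=al@a#b#et" "length al=k"
    using split_at[of k ep] by (metis append_Cons append_Nil length_take min.absorb2 add_leD1)
   note gc = gauged_crossing[OF g v e(2), of A a b et]
   have "v (al@a#b#et) ~= 0 ==> 2 * cnt (al@a#b#et)=length (al@a#b#et)"
    using balancedD[OF b] by blast
   note bal = this
   let ?Z = "cupw A a b*(v (al@True#False#et)-inverse A^2 * v (al@False#True#et))"
   have "2 * cnt (al@a#b#et)=length (al@a#b#et)" if "A * v (al@a#b#et)+inverse A * ?Z ~= 0"
   proof -
    from that have "v (al@a#b#et) ~= 0 \<or> ?Z ~= 0" by (metis add_0 mult_zero_right)
    thus ?thesis using bal gc(2) by blast
   qed
   thus ?thesis
    unfolding e(1) elem_op_Pos[OF e(2)] unfolding gc(1) unfolding v' inverse_i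
    by (simp add: algebra_simps)
  next
   case False
   thus ?thesis using op_short[of ep k 2] by (simp add: elem_op_def)
  qed
  thus ?thesis unfolding gauged_def balanced_def by blast
 qed
 thus ?thesis using Pos by blast
next
 case Neg
 have "gauged (- \<i> * th) (elem_op A k Neg v) (elem_op (\<i>*A) k Neg v')"
  if A: "generic A" and v: "supp N v" and g: "gauged th v v'" for A v v'
 proof -
  have b: "balanced v" and v': "v' ep=th*(-1)^invs ep * v ep" for ep using g by (auto simp: gauged_def)
  have "(elem_op A k Neg v ep ~= 0 --> 2 * cnt ep=length ep) \<and>
   elem_op (\<i>*A) k Neg v' ep=(- \<i> * th)*(-1)^invs ep * elem_op A k Neg v ep" for ep
  proof (cases "k+2 <= length ep")
   case True
   then obtain al a b et where e: "ep=al@a#b#et" "length al=k"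
    using split_at[of k ep] by (metis append_Cons append_Nil length_take min.absorb2 add_leD1)
   note gc = gauged_crossing[OF g v e(2), of A a b et]
   have "v (al@a#b#et) ~= 0 ==> 2 * cnt (al@a#b#et)=length (al@a#b#et)"
    using balancedD[OF b] by blast
   note bal = this
   let ?Z = "cupw A a b*(v (al@True#False#et)-inverse A^2 * v (al@False#True#et))"
   have "2 * cnt (al@a#b#et)=length (al@a#b#et)" if "inverse A * v (al@a#b#et)+A * ?Z ~= 0"
   proof -
    from that have "v (al@a#b#et) ~= 0 \<or> ?Z ~= 0" by (metis add_0 mult_zero_right)
    thus ?thesis using bal gc(2) by blast
   qed
   thus ?thesis
    unfolding e(1) elem_op_Neg[OF e(2)] unfolding gc(1) unfolding v' inverse_i
    by (simp add: algebra_simps)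
  next
   case False
   thus ?thesis using op_short[of ep k 2] by (simp add: elem_op_def)
  qed
  thus ?thesis unfolding gauged_def balanced_def by blast
 qed
 thus ?thesis using Neg by blast
qed

lemma gauged_run:
 "valid N L M ==> \<exists>th'. \<forall>A v v'. generic A --> supp N v --> gauged th v v' --> gauged th' (run A L v) (run (\<i>*A) L v')"
proof (induction L arbitrary: N th)
 case Nil
 thus ?case by auto
next
 case (Cons x L)
 obtain k p where x: "x=(k, p)" by (cases x)
 have fit: "k+n_in p <= N" and val: "valid (N-n_in p+n_out p) L M" using Cons.prems by (auto simp: x)
 obtain th1 where 1: "!!A v v'. generic A ==> supp N v ==> gauged th v v' ==> gauged th1 (elem_op A k p v) (elem_op (\<i>*A) k p v')"
  using gauged_elem[OF fit, of th] by blast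
 obtain th2 where 2: "!!A v v'. generic A ==> supp (N-n_in p+n_out p) v ==> gauged th1 v v' ==> gauged th2 (run A L v) (run (\<i>*A) L v')"
  using Cons.IH[OF val, of th1] by blast
 have "gauged th2 (run A (x#L) v) (run (\<i>*A) (x#L) v')" if "generic A" "supp N v" "gauged th v v'" for A v v'
  unfolding x run.simps by (rule 2[OF that(1) supp_elem_op[OF that(2) fit refl] 1[OF that]])
 thus ?case by blast
qed

lemma gauss_i: "gauss (\<i>*A) b k=gauss A b k"
 by (simp add: gauss_def power_mult_distrib power_mult)

text \<open>Between words of equal count the kernel changes by the sign
  \<open>(-1)^(invs ga + invs bt)\<close>, and replacing \<open>bt\<close> by \<open>ga\<close>
  changes \<open>invs\<close> of the whole word by the same difference.\<close>

lemma gauged_sym_op: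
 assumes g: "gauged th v v'"
 shows "gauged th (sym_op A q b v) (sym_op (\<i>*A) q b v')"
proof -
 have bal: "balanced v" and v': "v' ep=th*(-1)^invs ep * v ep" for ep using g by (auto simp: gauged_def)
 have "(2 * cnt ep ~= length ep --> sym_op A q b v ep=0) \<and>
  sym_op (\<i>*A) q b v' ep=th*(-1)^invs ep * sym_op A q b v ep" for ep
 proof (cases "q+b <= length ep")
  case True
  then obtain al ga et where e: "ep=al@ga@et" "length al=q" "length ga=b" by (rule split3)
  have "sym_kernel (\<i>*A) b ga bt * v' (al@bt@et) =
   th*(-1)^invs (al@ga@et)*(sym_kernel A b ga bt * v (al@bt@et))" if "length bt=b" for bt
  proof (cases "cnt bt=cnt ga")
   case True
   have "invs (al@bt@et)+invs ga=invs (al@ga@et)+invs bt"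
    using True that e by (simp add: invs_append)
   hence "(-1 :: complex)^(invs (al@bt@et)+invs ga)*(-1)^invs bt =
    (-1)^(invs (al@ga@et)+invs bt)*(-1)^invs bt" by simp
   hence s: "(-1 :: complex)^invs ga*((-1)^invs bt*(-1)^invs (al@bt@et))=(-1)^invs (al@ga@et)"
    by (simp add: power_add mult_ac flip: power_mult_distrib)
   have i: "(\<i>*A)^(2 * x)=(-1)^x * A^(2 * x)" for x
    by (simp add: power_mult_distrib power_mult power_minus[of "A^2" x])
   show ?thesis
    unfolding s[symmetric] sym_kernel_def gauss_i v' power_add i using True by (simp add: mult_ac)
  qed (simp add: sym_kernel_def)
  hence "sym_op (\<i>*A) q b v' ep=th*(-1)^invs ep * sym_op A q b v ep"
   unfolding e(1) sym_op_app[OF e(2,3)] sum_distrib_left by (intro sum.cong) auto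
  moreover have "sym_op A q b v ep=0" if "2 * cnt ep ~= length ep"
   unfolding e(1) sym_op_app[OF e(2,3)]
  proof (rule sum.neutral, rule ballI)
   fix bt assume "bt \<in> words b"
   thus "sym_kernel A b ga bt * v (al@bt@et)=0"
    using that e balancedD[OF bal, of "al@bt@et"] by (cases "cnt bt=cnt ga") (auto simp: sym_kernel_def)
  qed
  ultimately show ?thesis by blast
 next
  case False
  thus ?thesis using op_short[of ep q b] by (simp add: sym_op_def)
 qed
 thus ?thesis unfolding gauged_def balanced_def by blast
qed

definition phase :: "(complex => complex) => bool" where
 "phase f \<longleftrightarrow> (\<exists>th. \<forall>A. generic A --> f (\<i>*A)=th * f A)"

lemma generic_i: "generic A ==> generic (\<i>*A)"
proof -
 assume A: "generic A"
 have "(\<i>*A)^m ~= 1" if "m > 0" for m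
 proof
  assume "(\<i>*A)^m=1"
  hence "((\<i>*A)^m)^4=1" by simp
  hence "(\<i>*A)^(4 * m)=1" by (simp add: mult.commute flip: power_mult)
  hence "A^(4 * m)=1" by (simp add: power_mult_distrib power_mult)
  thus False using generic_power_neq_1[OF A, of "4 * m"] that by simp
 qed
 thus ?thesis using A by (auto simp: generic_def root_of_unity_def)
qed

lemma phase_cong: "phase f ==> (!!A. generic A ==> g A=f A) ==> phase g"
 unfolding phase_def using generic_i by metis

lemma phase_mult: "phase f ==> phase g ==> phase (%A. f A * g A)"
proof -
 assume "phase f" "phase g"
 then obtain th th' where "!!A. generic A ==> f (\<i>*A)=th * f A" "!!A. generic A ==> g (\<i>*A)=th' * g A"
  unfolding phase_def by blast
 thus ?thesis unfolding phase_def by (intro exI[of _ "th * th'"]) (simp add: mult_ac)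
qed

lemma phase_divide: "phase f ==> phase g ==> phase (%A. f A/g A)"
proof -
 assume "phase f" "phase g"
 then obtain th th' where "!!A. generic A ==> f (\<i>*A)=th * f A" "!!A. generic A ==> g (\<i>*A)=th' * g A"
  unfolding phase_def by blast
 thus ?thesis unfolding phase_def by (intro exI[of _ "th/th'"]) simp
qed

lemma phase_1: "phase (%A. 1)"
 unfolding phase_def by (intro exI[of _ 1]) simp

lemma phase_prod: "(!!i. i \<in> I ==> phase (f i)) ==> phase (%A. \<Prod>i\<in>I. f i A)"
 by (induction I rule: infinite_finite_induct) (auto simp: phase_1 intro: phase_mult)

lemma phase_qint: "phase (%A. qint A n)"
proof -
 have "qint (\<i>*A) n = - ((-1)^n) * qint A n" for A
 proof -
  have "(\<i>*A)^2-inverse (\<i>*A)^2 = - (A^2-inverse A^2)"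
   unfolding inverse_i by (simp add: power_mult_distrib)
  moreover have "(\<i>*A)^(2 * n)-inverse (\<i>*A)^(2 * n)=(-1)^n*(A^(2 * n)-inverse A^(2 * n))"
   unfolding inverse_i power_mult
   by (simp add: power_mult_distrib right_diff_distrib power_minus[of "A^2" n] power_minus[of "inverse A^2" n] del: power_inverse)
  ultimately show ?thesis unfolding qint_alt by (metis (no_types) minus_divide_left minus_divide_right minus_mult_left times_divide_eq_right)
 qed
 thus ?thesis unfolding phase_def by blast
qed

lemma phase_qfact: "phase (%A. qfact A n)"
 unfolding qfact_def by (intro phase_prod phase_qint)

context spin_network
begin

lemma gauged_syms: "gauged th v v' ==> gauged th (syms A S s n v) (syms (\<i>*A) S s n v')"
 by (induction n) (auto simp: sym_at_def intro: gauged_sym_op)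

lemma gauged_state:
 "s <= length D ==> \<exists>th. \<forall>A. generic A --> gauged th (state A S s) (state (\<i>*A) S s)"
proof (induction s)
 case 0
 show ?case by (rule exI[of _ 1]) (auto simp: gauged_def balanced_def unit_vec_def)
next
 case (Suc s)
 then obtain th where 1: "!!A. generic A ==> gauged th (state A S s) (state (\<i>*A) S s)" by auto
 have s: "s<length D" using Suc.prems by simp
 obtain th' where 2: "!!A v v'. generic A ==> supp (width s) v ==> gauged th v v' ==>
   gauged th' (run A (slice_base s) v) (run (\<i>*A) (slice_base s) v')"
  using gauged_run[OF valid_slice[OF s], of th] by blast
 have "gauged th' (state A S (Suc s)) (state (\<i>*A) S (Suc s))" if "generic A" for A
  unfolding state.simps level_syms_def
  by (intro gauged_syms 2[OF that _ 1[OF that]] supp_state) (use s in simp)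
 thus ?case by blast
qed

lemma phase_standard_eval:
 assumes adm: "admissible D ga"
 shows "phase (standard_eval D ga)"
proof (rule phase_cong)
 have "phase (%A. endstate A starts [])"
  using gauged_state[OF order_refl, of starts] by (auto simp: phase_def gauged_def endstate_def)
 thus "phase (%A. (\<Prod>e\<in>edges D. qfact A (b e)) * endstate A starts []/network_fact D ga A)"
  unfolding network_fact_def projector_fact_def
  by (intro phase_divide phase_mult phase_prod phase_qfact)
 show "standard_eval D ga A=(\<Prod>e\<in>edges D. qfact A (b e)) * endstate A starts []/network_fact D ga A" if "generic A" for A
  using penrose_endstate[OF that adm] by (simp add: standard_eval_def)
qed

end

section \<open>Coefficients and derivatives\<close>

text \<open>A point of the unit circle for which not being a root of unity can be shown by
  arithmetic modulo 5.\<close>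

definition unit_point :: complex where
 "unit_point=Complex (3/5) (4/5)"

lemma norm_unit_point: "norm unit_point=1"
 by (simp add: unit_point_def cmod_def power_divide)

text \<open>3 + 4 \<i> is idempotent modulo 5, so none of its positive powers has imaginary part
  0.\<close>

lemma generic_unit_point: "generic unit_point"
proof -
 have "\<exists>a b :: int. Complex 3 4^Suc n=Complex (of_int a) (of_int b) & a mod 5=3 & b mod 5=4" for n
 proof (induction n)
  case 0
  show ?case by (rule exI[of _ 3], rule exI[of _ 4]) simp
 next
  case (Suc n)
  then obtain a b :: int where ab: "Complex 3 4^Suc n=Complex (of_int a) (of_int b)" "a mod 5=3" "b mod 5=4" by blast
  have "Complex 3 4^Suc (Suc n)=Complex (of_int (3 * a-4 * b)) (of_int (3 * b+4 * a))"
   unfolding power_Suc[of _ "Suc n"] ab(1) by (simp add: complex_eq_iff)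
  moreover have "(3 * a-4 * b) mod 5=3" "(3 * b+4 * a) mod 5=4" using ab(2,3) by presburger+
  ultimately show ?case by blast
 qed
 note key = this
 have "unit_point^m ~= 1" if "m > 0" for m
 proof
  assume 1: "unit_point^m=1"
  obtain n where n: "m=Suc n" using \<open>m > 0\<close> by (cases m) auto
  obtain a b :: int where ab: "Complex 3 4^m=Complex (of_int a) (of_int b)" "b mod 5=4" using key[of n] n by blast
  have "Complex 3 4=5 * unit_point" by (simp add: unit_point_def complex_eq_iff)
  hence "Complex 3 4^m=5^m" using 1 by (simp add: power_mult_distrib)
  also have "\<dots> = of_real (5^m)" by simp
  finally have "Im (Complex 3 4^m)=0" by (metis Im_complex_of_real)
  hence "b=0" using ab(1) by simp
  thus False using ab(2) by simp
 qed
 moreover have "unit_point ~= 0" using norm_unit_point by auto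
 ultimately show ?thesis by (auto simp: generic_def root_of_unity_def)
qed

lemma generic_times_root:
 assumes "generic A" "z^N=1" "N > 0"
 shows "generic (A * z)"
proof -
 have "(A * z)^m ~= 1" if "m > 0" for m
 proof
  assume "(A * z)^m=1"
  hence "((A * z)^m)^N=1" by simp
  hence "A^(m*N)*(z^N)^m=1" by (simp add: power_mult_distrib power_mult[symmetric] mult.commute)
  thus False using generic_power_neq_1[OF assms(1), of "m*N"] assms that by simp
 qed
 moreover have "z ~= 0" using assms by (auto simp: power_0_left)
 ultimately show ?thesis using assms(1) by (auto simp: generic_def root_of_unity_def)
qed

lemma ipoly_altdef: "degree p <= N ==> ipoly p A=(\<Sum>k\<le>N. of_int (coeff p k)*A^k)"
proof -
 assume N: "degree p <= N"
 have "degree (map_poly of_int p :: complex poly) <= N"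
  by (rule degree_le) (use N in \<open>simp add: coeff_map_poly coeff_eq_0\<close>)
 hence "ipoly p A=(\<Sum>k\<le>N. coeff (map_poly of_int p) k*A^k)"
  unfolding ipoly_def poly_altdef by (intro sum.mono_neutral_left) (auto simp: coeff_eq_0)
 thus ?thesis by (simp add: coeff_map_poly)
qed

text \<open>The coefficients are recovered by averaging over \<open>N\<close> points of the unit circle, none of which is a root of unity.\<close>

lemma laurent_coeff_bound:
 assumes deg: "degree p <= 2 * d" and h: "!!A. generic A ==> A^d * h A=ipoly p A"
  and B: "!!A. generic A ==> norm A=1 ==> norm (h A) <= B"
 shows "\<bar>real_of_int (coeff p n)\<bar> <= B"
proof -
 \<comment> \<open>Large enough that \<open>n\<close> and all exponents of \<open>p\<close> are at
   most \<open>N - 1\<close>, hence pairwise incongruent modulo \<open>N\<close>.\<close>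
 define N where "N=2 * d+n+1"
 define z where "z=exp (2 * of_real pi*\<i> / of_nat N)"
 have N: "N > 0" by (simp add: N_def)
 have zp: "z^j=exp (2 * of_real pi*\<i> * of_nat j / of_nat N)" for j
  unfolding z_def by (subst exp_of_nat_mult[symmetric]) (simp add: mult_ac)
 have z1: "z^j=1 \<longleftrightarrow> N dvd j" for j unfolding zp using complex_root_unity_eq_1[of N j] N by simp
 have nz: "norm z=1" by (simp add: z_def norm_exp_eq_Re)
 have z0: "z ~= 0" using nz by auto
 define A where "A j=unit_point * z^j" for j
 have "(z^j)^N=1" for j using z1[of "j*N"] by (simp add: power_mult)
 hence gA: "generic (A j)" for j unfolding A_def using generic_times_root[OF generic_unit_point _ N] by blast
 have nA: "norm (A j)=1" for j by (simp add: A_def norm_mult norm_power norm_unit_point nz)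
 have A0: "A j ~= 0" for j using generic_nz[OF gA] .
 have u0: "unit_point ~= 0" using generic_nz[OF generic_unit_point] .
 have orth: "(\<Sum>j<N. A j^k * inverse (A j)^n)=(if k=n then of_nat N else 0)" if k: "k <= N-1" for k
 proof (cases "k=n")
  case True
  thus ?thesis using A0 by (simp flip: power_mult_distrib)
 next
  case False
  define w where "w=z^k * inverse z^n"
  have w1: "w ~= 1"
  proof
   assume "w=1"
   hence e: "z^k=z^n" using z0 by (simp add: w_def power_inverse field_simps)
   have "N dvd (max k n-min k n)"
   proof -
    have "z^max k n=z^min k n" using e by (simp add: max_def min_def)
    hence "z^min k n * z^(max k n-min k n)=z^min k n" by (simp flip: power_add)
    thus ?thesis using z0 z1 by simp
   qed
   moreover have "max k n-min k n<N" "max k n-min k n > 0" using False k by (auto simp: N_def)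
   ultimately show False by (auto dest: dvd_imp_le)
  qed
  have "w^N=1"
  proof -
   have "z^N=1" using z1 by simp
   hence "(z^k)^N=1" "(inverse z^n)^N=1"
    by (simp_all add: power_mult[symmetric] mult.commute[of _ N] power_inverse) (simp_all add: power_mult)
   thus ?thesis by (simp add: w_def power_mult_distrib)
  qed
  hence "(\<Sum>j<N. w^j)=0" using w1 by (simp add: geometric_sum)
  moreover have "A j^k * inverse (A j)^n=(unit_point^k * inverse unit_point^n) * w^j" for j
   by (simp add: A_def w_def power_mult_distrib inverse_mult_distrib power_inverse mult_ac flip: power_mult)
  ultimately show ?thesis using False by (simp flip: sum_distrib_left)
 qed
 have "(\<Sum>j<N. ipoly p (A j) * inverse (A j)^n)=(\<Sum>k\<le>N-1. of_int (coeff p k)*(\<Sum>j<N. A j^k * inverse (A j)^n))"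
 proof -
  have dN: "degree p <= N-1" using deg by (simp add: N_def)
  have "(\<Sum>j<N. ipoly p (A j) * inverse (A j)^n) =
   (\<Sum>j<N. \<Sum>k\<le>N-1. of_int (coeff p k)*(A j^k * inverse (A j)^n))"
   unfolding ipoly_altdef[OF dN] sum_distrib_right mult.assoc ..
  also have "\<dots>=(\<Sum>k\<le>N-1. \<Sum>j<N. of_int (coeff p k)*(A j^k * inverse (A j)^n))"
   by (rule sum.swap)
  finally show ?thesis unfolding sum_distrib_left .
 qed
 also have "\<dots>=(\<Sum>k\<le>N-1. if k=n then of_int (coeff p k) * of_nat N else 0)"
  by (intro sum.cong refl) (simp add: orth)
 also have "\<dots> = of_int (coeff p n) * of_nat N" by (simp add: N_def)
 finally have e: "of_int (coeff p n) * of_nat N=(\<Sum>j<N. ipoly p (A j) * inverse (A j)^n)" ..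
 have "norm (of_int (coeff p n) * of_nat N :: complex) <= (\<Sum>j<N. B)"
  unfolding e
 proof (rule sum_norm_le)
  fix j
  have "norm (ipoly p (A j) * inverse (A j)^n)=norm (h (A j))"
   unfolding h[OF gA, symmetric] by (simp add: norm_mult norm_power norm_inverse nA)
  thus "norm (ipoly p (A j) * inverse (A j)^n) <= B" using B[OF gA nA] by simp
 qed
 thus ?thesis using N by (simp add: norm_mult mult.commute)
qed

section \<open>Exponents of \<open>A\<close> in one residue class modulo 4\<close>

lemma i_power_eq: "\<i>^n = \<i>^m ==> n mod 4=m mod 4"
proof -
 have r: "\<i>^n = \<i>^(n mod 4)" for n
 proof -
  have "\<i>^n = \<i>^(4*(n div 4)+n mod 4)" by simp
  also have "\<dots> = \<i>^(n mod 4)" unfolding power_add power_mult by simp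
  finally show ?thesis .
 qed
 have c: "a=b" if "a<4" "b<4" "\<i>^a = \<i>^b" for a b :: nat
 proof -
  have "a=0 \<or> a=1 \<or> a=2 \<or> a=3" "b=0 \<or> b=1 \<or> b=2 \<or> b=3" using that(1,2) by linarith+
  thus ?thesis using that(3) by (elim disjE) (simp_all add: power3_eq_cube complex_eq_iff)
 qed
 assume "\<i>^n = \<i>^m"
 hence "\<i>^(n mod 4) = \<i>^(m mod 4)" using r by metis
 thus ?thesis by (intro c) auto
qed

text \<open>The phase gives p(\<i> X) = \<open>\<i>^d * th\<close> p(X). Comparing coefficients,
  \<open>\<i>^n\<close> is the same number for all \<open>n\<close> with nonzero
  coefficient.\<close>

lemma phase_coeffs:
 assumes h: "!!A. generic A ==> A^d * h A=ipoly p A" and ph: "phase h"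
  and nz: "coeff p n ~= 0" "coeff p m ~= 0"
 shows "n mod 4=m mod 4"
proof -
 obtain th where th: "!!A. generic A ==> h (\<i>*A)=th * h A" using ph unfolding phase_def by blast
 define q :: "complex poly" where "q=map_poly of_int p"
 have eqp: "poly (pcompose q (monom \<i> (Suc 0))) A=poly (smult (\<i>^d * th) q) A" if "generic A" for A
 proof -
  have "poly (pcompose q (monom \<i> (Suc 0))) A=ipoly p (\<i>*A)" by (simp add: q_def ipoly_def poly_pcompose poly_monom)
  also have "\<dots>=(\<i>*A)^d*(th * h A)" using h[OF generic_i[OF that]] th[OF that] by simp
  also have "\<dots> = \<i>^d * th*(A^d * h A)" by (simp add: power_mult_distrib)
  finally show ?thesis using h[OF that] by (simp add: q_def ipoly_def)
 qed
 have "of_nat ` {2..} \<subseteq> {A. poly (pcompose q (monom \<i> (Suc 0))-smult (\<i>^d * th) q) A=0}"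
 proof (rule image_subsetI)
  fix n :: nat assume "n \<in> {2..}"
  hence "generic (of_nat n)" by (simp add: generic_of_nat)
  from eqp[OF this] show "of_nat n \<in> {A. poly (pcompose q (monom \<i> (Suc 0))-smult (\<i>^d * th) q) A=0}"
   by (simp only: mem_Collect_eq poly_diff right_minus_eq)
 qed
 moreover have "infinite (of_nat ` {2::nat..} :: complex set)" by (subst finite_image_iff) (auto simp: inj_on_def infinite_Ici)
 ultimately have "infinite {A. poly (pcompose q (monom \<i> (Suc 0))-smult (\<i>^d * th) q) A=0}" using finite_subset by blast
 hence "pcompose q (monom \<i> (Suc 0))-smult (\<i>^d * th) q=0" using poly_roots_finite by blast
 hence "pcompose q (monom \<i> (Suc 0))=smult (\<i>^d * th) q" by (simp only: right_minus_eq)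
 hence "coeff (pcompose q (monom \<i> (Suc 0))) k=coeff (smult (\<i>^d * th) q) k" for k by simp
 hence "\<i>^k * coeff q k = \<i>^d * th * coeff q k" for k by (simp add: coeff_pcompose_monom_linear)
 moreover have "coeff q n ~= 0" "coeff q m ~= 0" using nz by (simp_all add: q_def coeff_map_poly)
 ultimately have "\<i>^n = \<i>^d * th" "\<i>^m = \<i>^d * th" by (metis mult_right_cancel)+
 thus ?thesis using i_power_eq by metis
qed

text \<open>The exponents of \<open>A\<close> are the numbers n - d with \<open>coeff p n\<close>
  nonzero; \<open>phase_coeffs\<close> puts them into one class modulo 4, and \<open>Q\<close> is
  its residue. If \<open>p = 0\<close>, any residue serves.\<close>

lemma laurent_representation:
 assumes lau: "laurent d B h" and ph: "phase h"
 obtains Q f where "Q<4" "!!k. k \<in> Poly_Mapping.keys f ==> \<bar>k\<bar> <= int d"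
  "!!k. \<bar>real_of_int (Poly_Mapping.lookup f k)\<bar> <= B"
  "!!A. generic A ==> h A=A^Q * laurent_eval f (A^4)"
proof -
 obtain p where deg: "degree p <= 2 * d" and h: "!!A. generic A ==> A^d * h A=ipoly p A"
  and B: "!!A. generic A ==> norm A=1 ==> norm (h A) <= B" using lau unfolding laurent_def by blast
 note cb = laurent_coeff_bound[OF deg h B]
 obtain n0 where n0: "coeff p n ~= 0 ==> n mod 4=n0 mod 4" for n
  using phase_coeffs[OF h ph] by metis
 define Q where "Q=nat ((int n0-int d) mod 4)"
 have Q4: "Q<4" by (simp add: Q_def nat_less_iff)
 have Qi: "int Q=(int n0-int d) mod 4" by (simp add: Q_def)
 have dvd: "4 dvd (int n-int d-int Q)" if "coeff p n ~= 0" for n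
 proof -
  have "int n mod 4=int n0 mod 4" using n0[OF that] by (metis of_nat_mod of_nat_numeral)
  thus ?thesis unfolding Qi by presburger
 qed
 \<comment> \<open>The coefficient of \<open>A\<close> to the exponent 4 j + Q. The condition guards
   against the truncation by \<open>nat\<close>.\<close>
 define g where "g j=(if 0 <= 4 * j+int Q+int d then coeff p (nat (4 * j+int Q+int d)) else 0)" for j
 have gsupp: "\<bar>j\<bar> <= int d" if "g j ~= 0" for j
 proof -
  have *: "0 <= 4 * j+int Q+int d" "coeff p (nat (4 * j+int Q+int d)) ~= 0" using that by (auto simp: g_def split: if_splits)
  have "nat (4 * j+int Q+int d) <= 2 * d" using le_degree[OF *(2)] deg by simp
  thus ?thesis using *(1) Q4 by linarith
 qed
 have fin: "finite {j. g j ~= 0}" by (rule finite_subset[of _ "{- int d..int d}"]) (auto dest: gsupp simp: abs_le_iff)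
 define f where "f=Abs_poly_mapping g"
 have lf: "Poly_Mapping.lookup f=g" using fin by (simp add: f_def)
 have kf: "Poly_Mapping.keys f={j. g j ~= 0}" by (simp add: keys.rep_eq lf)
 show ?thesis
 proof (rule that[OF Q4])
  show "\<bar>k\<bar> <= int d" if "k \<in> Poly_Mapping.keys f" for k using that gsupp by (simp add: kf)
  have B0: "B >= 0" using cb[of 0] by (meson abs_ge_zero order_trans)
  show "\<bar>real_of_int (Poly_Mapping.lookup f k)\<bar> <= B" for k
  proof (cases "0 <= 4 * k+int Q+int d")
   case True
   show ?thesis unfolding lf g_def if_P[OF True] by (rule cb)
  next
   case False
   show ?thesis unfolding lf g_def if_not_P[OF False] using B0 by simp
  qed
  fix A assume A: "generic A"
  note A0 = generic_nz[OF A]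
  have t: "A^d*A^Q*(A^4) powi k=A^nat (4 * k+int Q+int d)" if "0 <= 4 * k+int Q+int d" for k
  proof -
   have "A^d*A^Q*(A^4) powi k=A powi int d*A powi int Q*A powi (4 * k)"
    by (simp add: power_int_mult)
   also have "\<dots>=A powi (int d+int Q+4 * k)" using A0 by (simp add: power_int_add)
   also have "\<dots>=A powi int (nat (4 * k+int Q+int d))" using that by (simp add: algebra_simps)
   finally show ?thesis by (simp only: power_int_of_nat)
  qed
  have "A^d * h A=(\<Sum>n\<le>2 * d. of_int (coeff p n)*A^n)" using h[OF A] ipoly_altdef[OF deg] by simp
  also have "\<dots>=(\<Sum>n\<in>{n. coeff p n ~= 0}. of_int (coeff p n)*A^n)"
   by (rule sum.mono_neutral_cong_right) (use deg in \<open>auto dest: le_degree\<close>)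
  also have "\<dots>=(\<Sum>k\<in>{j. g j ~= 0}. of_int (g k)*A^nat (4 * k+int Q+int d))"
  proof (rule sum.reindex_bij_witness[of _ "%k. nat (4 * k+int Q+int d)" "%n. (int n-int d-int Q) div 4"])
   fix n assume n: "n \<in> {n. coeff p n ~= 0}"
   hence "4*((int n-int d-int Q) div 4)=int n-int d-int Q" using dvd by auto
   hence e: "4*((int n-int d-int Q) div 4)+int Q+int d=int n" by linarith
   show "nat (4*((int n-int d-int Q) div 4)+int Q+int d)=n" unfolding e by simp
   show "(int n-int d-int Q) div 4 \<in> {j. g j ~= 0}" unfolding g_def mem_Collect_eq e using n by simp
   show "of_int (g ((int n-int d-int Q) div 4))*A^nat (4*((int n-int d-int Q) div 4)+int Q+int d) =
    of_int (coeff p n)*A^n" unfolding g_def e by simp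
  next
   fix k assume k: "k \<in> {j. g j ~= 0}"
   hence *: "0 <= 4 * k+int Q+int d" "coeff p (nat (4 * k+int Q+int d)) ~= 0" by (auto simp: g_def split: if_splits)
   show "(int (nat (4 * k+int Q+int d))-int d-int Q) div 4=k" using *(1) by simp
   show "nat (4 * k+int Q+int d) \<in> {n. coeff p n ~= 0}" using *(2) by simp
  qed
  also have "\<dots>=(\<Sum>k\<in>{j. g j ~= 0}. of_int (g k)*(A^d*A^Q*(A^4) powi k))"
  proof (rule sum.cong[OF refl])
   fix k assume "k \<in> {j. g j ~= 0}"
   hence "0 <= 4 * k+int Q+int d" by (auto simp: g_def split: if_splits)
   from t[OF this] show "of_int (g k)*A^nat (4 * k+int Q+int d) = of_int (g k)*(A^d*A^Q*(A^4) powi k)" by simp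
  qed
  also have "\<dots>=A^d*(A^Q * laurent_eval f (A^4))"
   by (simp add: laurent_eval_def kf lf sum_distrib_left mult_ac)
  finally show "h A=A^Q * laurent_eval f (A^4)" using A0 by simp
 qed
qed

lemma ipoly_sum: "ipoly (\<Sum>i\<in>I. p i) A=(\<Sum>i\<in>I. ipoly (p i) A)"
 by (induction I rule: infinite_finite_induct) auto

lemma ipoly_monom': "ipoly (monom a n) A = of_int a*A^n"
 using ipoly_smult[of a "monom 1 n" A] by (simp add: smult_monom)

text \<open>Makes the description in \<open>modified_eval\<close> unique. Different values of
  \<open>Q\<close> would occupy different classes of exponents modulo 4, so both Laurent polynomials
  would vanish.\<close>

lemma representation_unique:
 assumes Q: "Q1<4" "Q2<4"
  and eq: "!!A. generic A ==> A^Q1 * laurent_eval f1 (A^4)=A^Q2 * laurent_eval f2 (A^4)"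
 shows "f1=f2"
proof (rule poly_mapping_eqI)
 fix j
 \<comment> \<open>Multiplication by \<open>A^(4*M)\<close> makes all exponents nonnegative, also
   the one belonging to the index \<open>j\<close> under consideration.\<close>
 define M where "M=nat (\<Sum>k\<in>Poly_Mapping.keys f1 \<union> Poly_Mapping.keys f2 \<union> {j}. \<bar>k\<bar>)"
 have M: "k+int M >= 0" if "k \<in> Poly_Mapping.keys f1 \<union> Poly_Mapping.keys f2 \<union> {j}" for k
 proof -
  have "\<bar>k\<bar> <= (\<Sum>k\<in>Poly_Mapping.keys f1 \<union> Poly_Mapping.keys f2 \<union> {j}. \<bar>k\<bar>)"
   by (rule member_le_sum[OF that]) auto
  thus ?thesis by (simp add: M_def)
 qed
 define e where "e Q k=nat (4*(k+int M)+int Q)" for Q k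
 define R where "R Q f=(\<Sum>k\<in>Poly_Mapping.keys f. monom (Poly_Mapping.lookup f k) (e Q k))"
  for Q and f :: "int \<Rightarrow>\<^sub>0 int"
 have ev: "ipoly (R Q f) A=A^(4*M)*(A^Q * laurent_eval f (A^4))"
  if A: "generic A" and f: "Poly_Mapping.keys f \<subseteq> Poly_Mapping.keys f1 \<union> Poly_Mapping.keys f2" for A Q f
 proof -
  note A0 = generic_nz[OF A]
  have "A^e Q k=A^(4*M)*A^Q*(A^4) powi k" if "k \<in> Poly_Mapping.keys f" for k
  proof -
   have "0 <= k+int M" using M that f by blast
   hence "A^e Q k=A powi (4*(k+int M)+int Q)" by (simp add: e_def flip: power_int_of_nat)
   also have "\<dots>=A powi (4 * int M)*A powi int Q*A powi (4 * k)" using A0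
    by (simp add: power_int_add distrib_left)
   also have "A powi (4 * int M)=A^(4*M)" by (metis of_nat_mult of_nat_numeral power_int_of_nat)
   finally show ?thesis by (simp add: power_int_mult)
  qed
  thus ?thesis
   by (simp add: R_def ipoly_sum ipoly_monom' laurent_eval_def sum_distrib_left mult_ac)
 qed
 have "R Q1 f1=R Q2 f2" by (rule ipoly_eqI) (simp add: ev eq)
 hence co: "coeff (R Q1 f1) n=coeff (R Q2 f2) n" for n by simp
 have look: "coeff (R Q f) (e Q j)=Poly_Mapping.lookup f j"
  if f: "Poly_Mapping.keys f \<subseteq> Poly_Mapping.keys f1 \<union> Poly_Mapping.keys f2" for Q f
 proof -
  have "coeff (R Q f) (e Q j)=(\<Sum>k\<in>Poly_Mapping.keys f. if k=j then Poly_Mapping.lookup f k else 0)"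
   unfolding R_def coeff_sum coeff_monom
  proof (intro sum.cong refl if_cong)
   fix k assume "k \<in> Poly_Mapping.keys f"
   thus "(e Q k=e Q j)=(k=j)" using M[of k] M[of j] f by (auto simp: e_def)
  qed
  thus ?thesis by (simp add: in_keys_iff)
 qed
 have off: "coeff (R Q f) (e Q' j)=0"
  if f: "Poly_Mapping.keys f \<subseteq> Poly_Mapping.keys f1 \<union> Poly_Mapping.keys f2" and QQ: "Q ~= Q'" "Q<4" "Q' < 4" for Q Q' f
  unfolding R_def coeff_sum coeff_monom
 proof (rule sum.neutral, rule ballI)
  fix k assume "k \<in> Poly_Mapping.keys f"
  hence "k+int M >= 0" "j+int M >= 0" using M[of k] M[of j] f by auto
  have "e Q k ~= e Q' j"
  proof
   assume "e Q k=e Q' j"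
   hence "4*(k+int M)+int Q=4*(j+int M)+int Q'"
    using \<open>k + int M >= 0\<close> \<open>j + int M >= 0\<close> by (simp add: e_def eq_nat_nat_iff)
   hence "4*(k-j)=int Q'-int Q" by simp
   thus False using QQ by presburger
  qed
  thus "(if e Q k=e Q' j then Poly_Mapping.lookup f k else 0)=0" by simp
 qed
 show "Poly_Mapping.lookup f1 j=Poly_Mapping.lookup f2 j"
 proof (cases "Q1=Q2")
  case True
  thus ?thesis using look[of f1 Q1] look[of f2 Q2] co by auto
 next
  case False
  thus ?thesis using look[of f1 Q1] look[of f2 Q2] co off[of f2 Q2 Q1] off[of f1 Q1 Q2] Q by auto
 qed
qed

section \<open>Derivatives at roots of unity\<close>

lemma higher_deriv_laurent_eval:
 "q ~= 0 ==> (deriv ^^ r) (laurent_eval f) q =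
  (\<Sum>k\<in>Poly_Mapping.keys f. of_int (Poly_Mapping.lookup f k)*(\<Prod>i<r. of_int (k-int i)) * q powi (k-int r))"
proof (induction r arbitrary: q)
 case 0
 thus ?case by (simp add: laurent_eval_def)
next
 case (Suc r)
 let ?G = "%q. \<Sum>k\<in>Poly_Mapping.keys f. of_int (Poly_Mapping.lookup f k)*(\<Prod>i<r. of_int (k-int i)) * q powi (k-int r)"
 have "eventually (%x. x \<in>-{0}) (nhds q)" by (rule eventually_nhds_in_open) (use Suc.prems in auto)
 hence "eventually (%x. (deriv ^^ r) (laurent_eval f) x = ?G x) (nhds q)"
  by eventually_elim (use Suc.IH in auto)
 hence "deriv ((deriv ^^ r) (laurent_eval f)) q=deriv ?G q" by (rule deriv_cong_ev) simp
 also have "(?G has_field_derivative (\<Sum>k\<in>Poly_Mapping.keys f. of_int (Poly_Mapping.lookup f k) *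
   (\<Prod>i<r. of_int (k-int i))*(of_int (k-int r) * q powi (k-int r-1)))) (at q)"
 proof (rule DERIV_sum)
  fix k
  have "((%q. q powi (k-int r)) has_field_derivative of_int (k-int r) * q powi (k-int r-1)) (at q)"
   using DERIV_power_int[OF DERIV_ident, of "k-int r" q UNIV] Suc.prems by simp
  from DERIV_cmult[OF this] show "((%q. of_int (Poly_Mapping.lookup f k)*(\<Prod>i<r. of_int (k-int i)) * q powi (k-int r))
   has_field_derivative of_int (Poly_Mapping.lookup f k)*(\<Prod>i<r. of_int (k-int i)) *
   (of_int (k-int r) * q powi (k-int r-1))) (at q)" .
 qed
 from DERIV_imp_deriv[OF this] have "deriv ?G q=(\<Sum>k\<in>Poly_Mapping.keys f. of_int (Poly_Mapping.lookup f k) *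
   (\<Prod>i<r. of_int (k-int i))*(of_int (k-int r) * q powi (k-int r-1)))" .
 finally show ?case by (simp add: mult.assoc algebra_simps)
qed

lemma norm_root_of_unity: "root_of_unity \<zeta> ==> norm \<zeta>=1"
 unfolding root_of_unity_def by (metis norm_ge_zero norm_one norm_power power_eq_1_iff zero_less_iff_neq_zero not_gr_zero)

text \<open>The case \<open>k = 0\<close> is separate because \<open>L\<close> may be 0; then the
  factor for \<open>i = 0\<close> vanishes, unless the product is empty.\<close>

lemma falling_bound:
 assumes "\<bar>k\<bar> <= int L"
 shows "norm (\<Prod>i<r. of_int (k-int i) :: complex) <= (real L*(1+real r))^r"
proof (cases "k=0")
 case True
 show ?thesis
 proof (cases r)
  case (Suc r')
  have z: "(\<Prod>i<r. of_int (k-int i))=(0 :: complex)" using True Suc by (intro prod_zero) auto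
  show ?thesis unfolding z norm_zero by (intro zero_le_power mult_nonneg_nonneg) auto
 qed simp
next
 case False
 hence L: "L >= 1" using assms by linarith
 have "norm (\<Prod>i<r. of_int (k-int i) :: complex)=(\<Prod>i<r. norm (of_int (k-int i) :: complex))" by (rule prod_norm[symmetric])
 also have "\<dots> <= (\<Prod>i<r. real L*(1+real r))"
 proof (rule prod_mono, intro conjI)
  fix i assume "i \<in> {..<r}"
  have "norm (of_int (k-int i) :: complex)=real_of_int \<bar>k-int i\<bar>" by (simp only: norm_of_int)
  also have "\<dots> <= real L+real r"
  proof -
   have "\<bar>k-int i\<bar> <= int L+int r" using assms \<open>i \<in> {..<r}\<close> by auto
   hence "real_of_int \<bar>k-int i\<bar> <= real_of_int (int L+int r)" by (simp only: of_int_le_iff)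
   thus ?thesis by simp
  qed
  also have "\<dots> <= real L*(1+real r)"
   using L mult_right_mono[of 1 "real L" "real r"] by (simp add: distrib_left)
  finally show "norm (of_int (k-int i) :: complex) <= real L*(1+real r)" .
 qed simp
 also have "\<dots>=(real L*(1+real r))^r" by simp
 finally show ?thesis .
qed

text \<open>All powers of a root of unity have modulus 1, so only the at most 2 L + 1 coefficients
  and the factors produced by differentiation remain.\<close>

lemma higher_deriv_bound:
 assumes keys: "!!k. k \<in> Poly_Mapping.keys f ==> \<bar>k\<bar> <= int L"
  and B: "!!k. \<bar>real_of_int (Poly_Mapping.lookup f k)\<bar> <= B" and \<zeta>: "root_of_unity \<zeta>"
 shows "norm ((deriv ^^ r) (laurent_eval f) \<zeta>) <= (2 * real L+1)*(B*(real L*(1+real r))^r)"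
proof -
 have n1: "norm \<zeta>=1" by (rule norm_root_of_unity[OF \<zeta>])
 hence z: "\<zeta> ~= 0" by auto
 have B0: "B >= 0" using B[of 0] by (meson abs_ge_zero order_trans)
 let ?b = "B*(real L*(1+real r))^r"
 have b0: "?b >= 0" using B0 by simp
 have "norm ((deriv ^^ r) (laurent_eval f) \<zeta>) <= (\<Sum>k\<in>Poly_Mapping.keys f. ?b)"
  unfolding higher_deriv_laurent_eval[OF z]
 proof (rule sum_norm_le)
  fix k assume k: "k \<in> Poly_Mapping.keys f"
  have "norm (of_int (Poly_Mapping.lookup f k)*(\<Prod>i<r. of_int (k-int i))*\<zeta> powi (k-int r)) =
   \<bar>real_of_int (Poly_Mapping.lookup f k)\<bar> * norm (\<Prod>i<r. of_int (k-int i) :: complex)"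
   by (simp add: norm_mult norm_power_int n1)
  also have "\<dots> <= ?b" by (intro mult_mono B falling_bound keys k B0) auto
  finally show "norm (of_int (Poly_Mapping.lookup f k)*(\<Prod>i<r. of_int (k-int i))*\<zeta> powi (k-int r)) <= ?b" .
 qed
 also have "\<dots>=real (card (Poly_Mapping.keys f)) * ?b" by simp
 also have "\<dots> <= (2 * real L+1) * ?b"
 proof (rule mult_right_mono[OF _ b0])
  have "card (Poly_Mapping.keys f) <= card {- int L..int L}" by (rule card_mono) (use keys in force)+
  thus "real (card (Poly_Mapping.keys f)) <= 2 * real L+1" by simp
 qed
 finally show ?thesis .
qed

lemma modified_eval_bound:
 assumes lau: "laurent d B (standard_eval D ga)" and ph: "phase (standard_eval D ga)" and \<zeta>: "root_of_unity \<zeta>"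
 shows "norm ((deriv ^^ r) (laurent_eval (modified_eval D ga)) \<zeta>) <= (2 * real d+1)*(B*(real d*(1+real r))^r)"
proof -
 obtain Q f where f: "Q<4" "!!k. k \<in> Poly_Mapping.keys f ==> \<bar>k\<bar> <= int d"
  "!!k. \<bar>real_of_int (Poly_Mapping.lookup f k)\<bar> <= B"
  "!!A. generic A ==> standard_eval D ga A=A^Q * laurent_eval f (A^4)"
  using laurent_representation[OF lau ph] by blast
 have "modified_eval D ga=f"
  unfolding modified_eval_def
 proof (rule the_equality)
  show "\<exists>Q\<in>{0, 1, 2, 3}. \<forall>A. A ~= 0 & \<not> root_of_unity A --> standard_eval D ga A=A^Q * laurent_eval f (A^4)"
   using f(1,4) by (intro bexI[of _ Q]) (auto simp: generic_def)
  fix f' assume "\<exists>Q\<in>{0, 1, 2, 3}. \<forall>A. A ~= 0 & \<not> root_of_unity A --> standard_eval D ga A=A^Q * laurent_eval f' (A^4)"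
  then obtain Q' where Q': "Q' \<in> {0, 1, 2, 3}"
   "\<forall>A. A ~= 0 & \<not> root_of_unity A --> standard_eval D ga A=A^Q' * laurent_eval f' (A^4)" by blast
  have "Q' < 4" using Q'(1) by auto
  from representation_unique[OF this f(1), of f' f] show "f' = f" using Q'(2) f(4) by (simp add: generic_def)
 qed
 thus ?thesis using higher_deriv_bound[OF f(2,3) \<zeta>] by simp
qed

section \<open>Scaling a spin network\<close>

text \<open>The points are written as n i + t, the \<open>t\<close>-th copy of \<open>i\<close>, and
  are then ordered lexicographically. Copies of different arcs inherit their position from the arcs
  themselves; copies of one arc are nested because the copies of its right end are numbered
  backwards.\<close>

lemma local_projector_scale:
 assumes lp: "local_projector p"
 shows "local_projector (scale_projector n p)"
proof (cases "n=0")
 case True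
 hence a: "arcs (scale_projector n p)={}" by (simp add: scale_projector_def)
 have z: "sum_list (legs (scale_projector n p))=0" using True by (simp add: scale_projector_def sum_list_const_mult)
 show ?thesis unfolding local_projector_def a z by simp
next
 case False
 hence n: "n > 0" by simp
 let ?q = "scale_projector n p"
 let ?S = "sum_list (legs p)"
 have arc: "i<j" "j < ?S" if "(i, j) \<in> arcs p" for i j using lp that by (auto simp: local_projector_def)
 have un: "a=a'" if "a \<in> arcs p" "a' \<in> arcs p" "x=fst a \<or> x=snd a" "x=fst a' \<or> x=snd a'" for a a' x
 proof -
  have "x < ?S" using that arc[of "fst a" "snd a"] by auto
  hence "\<exists>!a. a \<in> arcs p & (x=fst a \<or> x=snd a)" using lp by (simp add: local_projector_def)
  thus ?thesis using that by blast
 qed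
 have qarcs: "arcs ?q={(n * i+t, n * j+(n-Suc t)) | i j t. (i, j) \<in> arcs p & t<n}"
  by (simp add: scale_projector_def)
 have total: "sum_list (legs ?q)=n * ?S" by (simp add: scale_projector_def sum_list_const_mult)
 have lpq: "leg_points ?q h={n * sum_list (take h (legs p))..<n * sum_list (take (Suc h) (legs p))}" for h
  by (simp add: leg_points_def scale_projector_def take_map sum_list_const_mult)
 have range: "n * i+t<n * j \<longleftrightarrow> i<j" "n * j <= n * i+t \<longleftrightarrow> j <= i" if "t<n" for i j t
 proof -
  have "i<j ==> n * i+t<n * j"
  proof -
   assume "i<j"
   hence "n*Suc i <= n * j" by (intro mult_le_mono2) simp
   thus ?thesis using that by simp
  qed
  moreover have "j <= i ==> n * j <= n * i+t" using mult_le_mono2[of j i n] by linarith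
  ultimately show "n * i+t<n * j \<longleftrightarrow> i<j" "n * j <= n * i+t \<longleftrightarrow> j <= i" by (metis not_le)+
 qed
 have lex: "n * i+t<n * k+u \<longleftrightarrow> i<k \<or> i=k & t<u" if "t<n" "u<n" for i k t u
  using range[OF that(1), of i k] range[OF that(2), of k i] by (cases i k rule: linorder_cases) auto
 have inj: "i=k & t=u" if "t<n" "u<n" "n * i+t=n * k+u" for i k t u
  using lex[OF that(1,2), of i k] lex[OF that(2,1), of k i] that(3) by (metis less_irrefl nat_neq_iff)
 have lg: "n * i+t \<in> leg_points ?q h \<longleftrightarrow> i \<in> leg_points p h" if "t<n" for i t h
  using range[OF that] by (simp add: lpq) (simp add: leg_points_def)
 have "i<j & j<sum_list (legs ?q)" if ij: "(i, j) \<in> arcs ?q" for i j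
 proof -
  obtain i' j' t where e: "i=n * i'+t" "j=n * j'+(n-Suc t)" "(i', j') \<in> arcs p" "t<n"
   using ij unfolding qarcs by blast
  have "n-Suc t<n" using e(4) by simp
  thus ?thesis using lex[OF e(4), of "n-Suc t" i' j'] range[of "n-Suc t" j' ?S] arc[OF e(3)]
   by (simp add: e(1,2) total)
 qed
 moreover have "\<exists>!a. a \<in> arcs ?q & (x=fst a \<or> x=snd a)" if x: "x<sum_list (legs ?q)" for x
 proof -
  define y t where "y=x div n" "t=x mod n"
  have xt: "x=n * y+t" "t<n" using n by (simp_all add: y_t_def)
  have "y < ?S" using x range(1)[OF xt(2), of y ?S] by (simp add: xt(1) total)
  hence "\<exists>!a. a \<in> arcs p & (y=fst a \<or> y=snd a)" using lp by (simp add: local_projector_def)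
  then obtain i j where ij: "(i, j) \<in> arcs p" "y=i \<or> y=j" by (metis prod.collapse)
  \<comment> \<open>The number of the copy of the arc through \<open>x\<close>; at a right end the
    copies are counted backwards.\<close>
  define u where "u=(if y=i then t else n-Suc t)"
  have u: "u<n" using xt(2) by (simp add: u_def)
  have mem: "(n * i+u, n * j+(n-Suc u)) \<in> arcs ?q" using ij(1) u unfolding qarcs by blast
  have hit: "x=n * i+u \<or> x=n * j+(n-Suc u)" using ij(2) xt by (auto simp: u_def)
  have only: "a=(n * i+u, n * j+(n-Suc u))" if a: "a \<in> arcs ?q" "x=fst a \<or> x=snd a" for a
  proof -
   obtain i' j' t' where e: "a=(n * i'+t', n * j'+(n-Suc t'))" "(i', j') \<in> arcs p" "t' < n"
    using a(1) unfolding qarcs by blast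
   have t'': "n-Suc t' < n" using e(3) by simp
   have c: "(y=i' & t=t') \<or> (y=j' & t=n-Suc t')"
    using a(2) inj[OF xt(2) e(3), of y i'] inj[OF xt(2) t'', of y j'] by (auto simp: e(1) xt(1))
   have "(i', j')=(i, j)" by (rule un[OF e(2) ij(1), of y]) (use c ij(2) in auto)
   hence "i' = i" "j' = j" by simp_all
   moreover have "t' = u"
    using c
   proof (elim disjE conjE)
    assume "y=i'" "t=t'"
    thus ?thesis using \<open>i' = i\<close> by (simp add: u_def)
   next
    assume *: "y=j'" "t=n-Suc t'"
    hence "y ~= i" using arc(1)[OF ij(1)] \<open>j' = j\<close> by simp
    hence "u=n-Suc t" by (simp add: u_def)
    thus ?thesis using *(2) e(3) by simp
   qed
   ultimately show ?thesis unfolding e(1) by (simp only:)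
  qed
  show ?thesis
  proof (rule ex1I[of _ "(n * i+u, n * j+(n-Suc u))"])
   show "(n * i+u, n * j+(n-Suc u)) \<in> arcs ?q & (x=fst (n * i+u, n * j+(n-Suc u)) \<or> x=snd (n * i+u, n * j+(n-Suc u)))"
    unfolding fst_conv snd_conv using mem hit by blast
   show "a=(n * i+u, n * j+(n-Suc u))" if "a \<in> arcs ?q & (x=fst a \<or> x=snd a)" for a
    using only that by blast
  qed
 qed
 moreover have "\<not> (i<k & k<j & j<l)" if ij: "(i, j) \<in> arcs ?q" and kl: "(k, l) \<in> arcs ?q" for i j k l
 proof
  assume less: "i<k & k<j & j<l"
  obtain i' j' t where e: "i=n * i'+t" "j=n * j'+(n-Suc t)" "(i', j') \<in> arcs p" "t<n"
   using ij unfolding qarcs by blast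
  obtain k' l' u where f: "k=n * k'+u" "l=n * l'+(n-Suc u)" "(k', l') \<in> arcs p" "u<n"
   using kl unfolding qarcs by blast
  have t': "n-Suc t<n" "n-Suc u<n" using e(4) f(4) by auto
  have 1: "i' < k' \<or> i' = k' & t<u" using less lex[OF e(4) f(4)] by (simp add: e f)
  have 2: "k' < j' \<or> k' = j' & u<n-Suc t" using less lex[OF f(4) t'(1)] by (simp add: e f)
  have 3: "j' < l' \<or> j' = l' & n-Suc t<n-Suc u" using less lex[OF t'] by (simp add: e f)
  have same: "(i', j') ~= (k', l')"
  proof
   assume "(i', j')=(k', l')"
   thus False using 1 3 e(4) f(4) by auto
  qed
  have "i' ~= k'" using un[OF e(3) f(3), of i'] same by (metis fst_conv)
  moreover have "k' ~= j'" using un[OF e(3) f(3), of k'] same by (metis fst_conv snd_conv)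
  moreover have "j' ~= l'" using un[OF e(3) f(3), of j'] same by (metis snd_conv)
  ultimately have "i' < k' & k' < j' & j' < l'" using 1 2 3 by blast
  moreover have "\<forall>(i, j) \<in> arcs p. \<forall>(k, l) \<in> arcs p. \<not> (i<k & k<j & j<l)"
   using lp by (simp add: local_projector_def)
  ultimately show False using e(3) f(3) by blast
 qed
 moreover have "\<not> (i \<in> leg_points ?q h & j \<in> leg_points ?q h)"
  if ij: "(i, j) \<in> arcs ?q" and h: "h<length (legs ?q)" for i j h
 proof -
  obtain i' j' t where e: "i=n * i'+t" "j=n * j'+(n-Suc t)" "(i', j') \<in> arcs p" "t<n"
   using ij unfolding qarcs by blast
  have "h<length (legs p)" using h by (simp add: scale_projector_def)
  hence "\<not> (i' \<in> leg_points p h & j' \<in> leg_points p h)" using lp e(3) by (auto simp: local_projector_def)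
  thus ?thesis using lg[OF e(4)] lg[of "n-Suc t"] e(4) by (simp add: e(1,2))
 qed
 ultimately show ?thesis unfolding local_projector_def by blast
qed

lemma spin_network_scale:
 "quantum_spin_network D ga ==> quantum_spin_network D (scale_coloring n ga)"
 by (auto simp: quantum_spin_network_def scale_coloring_def intro: local_projector_scale)
  (simp add: scale_projector_def)

lemma edge_at_cap: "(x, y) \<in> cap_rel D ==> edge_at D x=edge_at D y"
proof -
 let ?R = "(cap_rel D \<union> (cap_rel D)\<inverse>)\<^sup>*"
 assume "(x, y) \<in> cap_rel D"
 hence "(x, y) \<in> ?R" "(y, x) \<in> ?R" by auto
 thus ?thesis unfolding edge_at_def by (meson Collect_cong rtrancl_trans)
qed

lemma spin_network_locale:
 assumes "quantum_spin_network D ga" "admissible D ga"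
 shows "spin_network D ga"
 by unfold_locales
  (use assms edge_at_cap in \<open>auto simp: quantum_spin_network_def admissible_def label_color_def\<close>)

text \<open>Restated outside the locales: visibly independent of the coloring, so that the same
  constants serve for all multiples of it.\<close>

definition "eval_degree D=(\<Sum>s<length D. 9+13 * births (snd (D!s))^3)"
definition "eval_bound D=(\<Prod>s<length D. 12*4^(births (snd (D!s)))\<^sup>2 :: real)"

lemma eval_bound_ge_1: "eval_bound D >= 1"
proof -
 have "(12*4^n :: real) >= 1" for n using one_le_power[of "4::real" n] by linarith
 thus ?thesis unfolding eval_bound_def by (intro prod_ge_1)
qed

lemma laurent_phase_standard_eval:
 assumes qsn: "quantum_spin_network D ga" and m: "!!x. x \<in> labels D ==> label_color D ga x <= m"
 shows "laurent (eval_degree D * m\<^sup>2) (eval_bound D^m) (standard_eval D ga) & phase (standard_eval D ga)"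
proof (cases "admissible D ga")
 case True
 interpret spin_network D ga by (rule spin_network_locale[OF qsn True])
 show ?thesis
  using laurent_standard_eval[OF True m] phase_standard_eval[OF True]
  by (simp add: eval_degree_def eval_bound_def slice_degree_def slice_bound_def)
next
 case False
 hence "standard_eval D ga=(%A. 0)" by (simp add: fun_eq_iff standard_eval_def penrose_eval_def)
 moreover have "eval_bound D^m >= 0" using eval_bound_ge_1[of D] by simp
 ultimately show ?thesis by (auto simp: phase_def intro: laurent_0)
qed

text \<open>For the coloring multiplied by n, the degree is at most a constant times n^2 and the
  coefficients are at most exponential in n; differentiating \<open>r\<close> times adds only a
  power of n. No step depends on the root of unity, so one constant serves for all of them.\<close>

theorem theorem1p6:
 fixes \<Gamma> :: diagram and \<gamma> :: coloring and r :: nat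
 assumes "quantum_spin_network \<Gamma> \<gamma>"
 shows "\<exists>C::real. C > 0 \<and> (\<forall>\<zeta>::complex. root_of_unity \<zeta> \<longrightarrow>
  (\<forall>n::nat. norm ((deriv ^^ r) (laurent_eval (modified_eval \<Gamma> (scale_coloring n \<gamma>))) \<zeta>) \<le> C ^ n))"
proof -
 define M where "M = (\<Sum>x\<in>labels \<Gamma>. label_color \<Gamma> \<gamma> x)"
 have M: "label_color \<Gamma> \<gamma> x \<le> M" if "x \<in> labels \<Gamma>" for x
  unfolding M_def by (rule member_le_sum[OF that]) (auto simp: labels_def)
 define E where "E = real (eval_degree \<Gamma>) * real M ^ 2"
 define K where "K = eval_bound \<Gamma> ^ M"
 define a where "a = 2 * E + 1"
 define b where "b = E * (1 + real r) + 1"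
 \<comment> \<open>\<open>a\<close> accounts for the number of exponents, \<open>b\<close> for each
   differentiation and \<open>K\<close> for the coefficients. The factors 4 come from n^2 being at
   most 4^n.\<close>
 define C where "C = a * 4 * (K * (b * 4) ^ r)"
 have E0: "E \<ge> 0" by (simp add: E_def)
 have a1: "a \<ge> 1" and b1: "b \<ge> 1" using E0 by (simp_all add: a_def b_def)
 have K1: "K \<ge> 1" unfolding K_def by (rule one_le_power[OF eval_bound_ge_1])
 have "C > 0" using a1 b1 K1 by (simp add: C_def)
 moreover have "norm ((deriv ^^ r) (laurent_eval (modified_eval \<Gamma> (scale_coloring n \<gamma>))) \<zeta>) \<le> C ^ n"
  if \<zeta>: "root_of_unity \<zeta>" for \<zeta> n
 proof -
  let ?d = "eval_degree \<Gamma> * (n * M)\<^sup>2"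
  have "label_color \<Gamma> (scale_coloring n \<gamma>) x \<le> n * M" if "x \<in> labels \<Gamma>" for x
   using M[OF that] by (simp add: label_color_def scale_coloring_def)
  from laurent_phase_standard_eval[OF spin_network_scale[OF assms] this]
  have "norm ((deriv ^^ r) (laurent_eval (modified_eval \<Gamma> (scale_coloring n \<gamma>))) \<zeta>) \<le>
   (2 * real ?d + 1) * (eval_bound \<Gamma> ^ (n * M) * (real ?d * (1 + real r)) ^ r)"
   using modified_eval_bound[OF _ _ \<zeta>] by blast
  also have "real ?d = E * real n ^ 2" by (simp add: E_def power_mult_distrib)
  also have "eval_bound \<Gamma> ^ (n * M) = K ^ n" by (simp add: K_def mult.commute flip: power_mult)
  also have "(2 * (E * real n ^ 2) + 1) * (K ^ n * (E * real n ^ 2 * (1 + real r)) ^ r) \<le> C ^ n"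
  proof (cases "n = 0")
   case True
   thus ?thesis by (cases r) simp_all
  next
   case False
   hence n1: "real n \<ge> 1" by simp
   have "real n \<le> 2 ^ n" using less_exp[of n] by (metis less_imp_le of_nat_le_iff of_nat_numeral of_nat_power)
   hence "real n ^ 2 \<le> (2 ^ n) ^ 2" by (intro power_mono) auto
   also have "\<dots> = 4 ^ n" by (simp add: power2_eq_square flip: power_mult_distrib)
   finally have n4: "real n ^ 2 \<le> 4 ^ n" .
   have n2: "real n ^ 2 \<ge> 1" using n1 by simp
   have up: "x \<le> x ^ n" if "x \<ge> 1" for x :: real using self_le_power[OF that, of n] False by simp
   have "2 * (E * real n ^ 2) + 1 \<le> a * real n ^ 2" using n2 by (simp add: a_def algebra_simps)
   also have "\<dots> \<le> a ^ n * 4 ^ n" using up[OF a1] n4 a1 by (intro mult_mono) auto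
   finally have 1: "2 * (E * real n ^ 2) + 1 \<le> (a * 4) ^ n" by (simp add: power_mult_distrib)
   have "E * real n ^ 2 * (1 + real r) = E * (1 + real r) * real n ^ 2" by simp
   also have "\<dots> \<le> b * real n ^ 2" by (intro mult_right_mono) (simp_all add: b_def)
   also have "\<dots> \<le> b ^ n * 4 ^ n" using up[OF b1] n4 b1 by (intro mult_mono) auto
   finally have "E * real n ^ 2 * (1 + real r) \<le> (b * 4) ^ n" by (simp add: power_mult_distrib)
   hence "(E * real n ^ 2 * (1 + real r)) ^ r \<le> ((b * 4) ^ n) ^ r" using E0 by (intro power_mono) auto
   also have "\<dots> = ((b * 4) ^ r) ^ n" by (simp only: power_mult[symmetric] mult.commute)
   finally have 2: "K ^ n * (E * real n ^ 2 * (1 + real r)) ^ r \<le> (K * (b * 4) ^ r) ^ n"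
    using K1 by (simp add: power_mult_distrib mult_left_mono)
   have "(2 * (E * real n ^ 2) + 1) * (K ^ n * (E * real n ^ 2 * (1 + real r)) ^ r) \<le>
    (a * 4) ^ n * (K * (b * 4) ^ r) ^ n"
    using 1 2 E0 K1 a1 by (intro mult_mono) auto
   thus ?thesis by (simp add: C_def power_mult_distrib mult_ac)
  qed
  finally show ?thesis .
 qed
 ultimately show ?thesis by blast
qed

end
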